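(* Let $L\ge 1$, $B\ge 1$, $\alpha\ge 4$ and $C_0>0$. There are positive constants $c_1\le \tfrac12$, $c_2,\dots,c_8$ that depend only on $L,B,\alpha,C_0$ such that the following holds. Let $K\subset\mathbb{R}^n$ be a convex body, the unit ball of the norm $\|\cdot\|$, with $d^\ast(K)\ge C_0\log n$. Let $0<\varepsilon\le c_1$, $n\ge c_2$, $$m=\lceil c_3\,(d^\ast(K))^{\alpha}\rceil\qquad\text{and}\qquad d\in\mathbb{N},\quad d\le c_4\frac{\varepsilon^2}{\log(1/\varepsilon)}\,d^\ast(K).$$ Suppose that $X$ is an isotropic, rotation invariant random vector in $\mathbb{R}^d$ that satisfies $L_4-L_2$ norm equivalence with constant $L$ and for which, with probability at least $1-\eta$ (where $\eta\in[0,1]$), $\rho_{d,m}\le B(d/m)^{2/\alpha}$; and suppose that $Z$ is an isotropic, symmetric, $L$-subgaussian random vector in $\mathbb{R}^n$ that has iid coordinates. Then there is some $\Lambda\in[c_5\,\mathbb{E}\|G\|,\,c_6\,\mathbb{E}\|G\|]$ such that for any realization $(X_i)_{i=1}^m\in\Omega(\mathbb{X})$, with $\mathbb{P}_Z$-probability at least $1-2\exp(-c_7\varepsilon^2 d^\ast(K))$, $$\sup_{u\in S^{d-1}}\left|\frac{\|D\Gamma u\|}{\Lambda}-1\right|\le c_8\,\varepsilon .$$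
   Context: A convex body is a convex, compact, centrally-symmetric subset of $\mathbb{R}^n$ with nonempty interior. $K$ is the unit ball of the norm $\|\cdot\|$ on $\mathbb{R}^n$; $K^\circ=\{y\in\mathbb{R}^n:\langle x,y\rangle\le 1\ \text{for every }x\in K\}$; $G$ is the standard gaussian random vector in $\mathbb{R}^n$; the critical dimension is $d^\ast(K)=\left(\mathbb{E}\|G\|/\sup_{t\in K^\circ}\|t\|_2\right)^2$. A random vector is isotropic if it is centred and its covariance is the identity. A centred random vector $X$ in $\mathbb{R}^d$ satisfies $L_4-L_2$ norm equivalence with constant $L$ if $\|\langle X,u\rangle\|_{L_4}\le L\|\langle X,u\rangle\|_{L_2}$ for every $u\in\mathbb{R}^d$. A random vector $Z$ in $\mathbb{R}^n$ is $L$-subgaussian if $\|\langle Z,x\rangle\|_{L_p}\le L\sqrt p\,\|\langle Z,x\rangle\|_{L_2}$ for every $x\in\mathbb{R}^n$ and $p\ge2$. $X_1,\dots,X_m$ are independent copies of $X$, $Z_1,\dots,Z_m$ are independent copies of $Z$, and $(X_i)_{i=1}^m$ and $(Z_i)_{i=1}^m$ are independent. $\mathbb{P}_Z$ denotes probability with respect to $(Z_i)_{i=1}^m$ only, with $(X_i)_{i=1}^m$ fixed. Define $$\Gamma=\frac1{\sqrt m}\sum_{i=1}^m\langle X_i,\cdot\rangle e_i:\mathbb{R}^d\to\mathbb{R}^m,\qquad D=\sum_{i=1}^m\langle e_i,\cdot\rangle Z_i:\mathbb{R}^m\to\mathbb{R}^n,$$ $$\rho_{d,m}=\sup_{u\in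 S^{d-1}}\left|\frac1m\sum_{i=1}^m\langle X_i,u\rangle^2-1\right|,\qquad H_{s,m}=\sup_{u\in S^{d-1}}\ \sup_{I\subset\{1,\dots,m\},\,|I|\le s}\left(\frac1m\sum_{i\in I}\langle X_i,u\rangle^2\right)^{1/2}\quad(1\le s\le m).$$ The event $\Omega(\mathbb{X})$: for $u\in S^{d-1}$ let $\langle X_i,u\rangle^\sharp$ denote the $i$-th coordinate of the monotone non-decreasing rearrangement of the vector $(\langle X_j,u\rangle)_{j=1}^m$, let $F_{\langle X,u\rangle}^{-1}$ be the (right-)inverse distribution function of $\langle X,u\rangle$ and $\lambda_i^u=m\int_{(\frac{i-1}m,\frac im]}F^{-1}_{\langle X,u\rangle}(p)\,dp$. It is a known result that there are constants $\kappa_1,\kappa_2,\kappa_3>0$ depending only on $L,B,\alpha$ such that if $X$ is an isotropic, rotation invariant random vector in $\mathbb{R}^d$ that satisfies $L_4-L_2$ norm equivalence with constant $L\ge1$, and if with probability at least $1-\eta$, $\rho_{d,m}\le B(d/m)^{2/\alpha}$, where $B\ge1$ and $\alpha\ge4$ (and $\eta\in[0,1]$), then, if $m\ge\kappa_1 d$, with probability at least $1-\eta-\exp(-d)$ both $$\text{(i)}\quad \sup_{u\in S^{d-1}}\left(\frac1m\sum_{i=1}^m\left|\langle X_i,u\rangle^\sharp-\lambda_i^u\right|^2\right)^{1/2}\le\kappa_2\left(\frac dm\right)^{1/\alpha}\log\left(\frac md\right)$$ and $$\text{(ii)}\quad H_{s,m}\le\kappa_3\left(\left(\frac sm\right)^{1/4}+\left(\frac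 dm\right)^{1/\alpha}\log\left(\frac md\right)\right)\ \text{ for every }1\le s\le m$$ hold. Fix such $\kappa_2,\kappa_3$; $\Omega(\mathbb{X})$ is the event that (i), (ii) and $\rho_{d,m}\le B(d/m)^{2/\alpha}$ all hold. *)

theory Defs
  imports "HOL-Probability.Probability"
begin

(* Since the dimension has to vary under a quantifier, R^n is modelled by the extensional functions
   on {..<n}.  This is the carrier both of the product topology and of the product sigma-algebra PiM
   over {..<n}; coordinates are numbered from 0. *)

abbreviation Rn :: "nat \<Rightarrow> (nat \<Rightarrow> real) set" where
  "Rn n \<equiv> {..<n} \<rightarrow>\<^sub>E UNIV"

abbreviation Rn_topology :: "nat \<Rightarrow> (nat \<Rightarrow> real) topology" where
  "Rn_topology n \<equiv> product_topology (\<lambda>_. euclideanreal) {..<n}"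

abbreviation Rn_borel :: "nat \<Rightarrow> (nat \<Rightarrow> real) measure" where
  "Rn_borel n \<equiv> Pi\<^sub>M {..<n} (\<lambda>_. borel)"

definition vzero :: "nat \<Rightarrow> nat \<Rightarrow> real" where
  "vzero n = (\<lambda>i\<in>{..<n}. 0)"

definition vadd :: "nat \<Rightarrow> (nat \<Rightarrow> real) \<Rightarrow> (nat \<Rightarrow> real) \<Rightarrow> nat \<Rightarrow> real" where
  "vadd n x y = (\<lambda>i\<in>{..<n}. x i + y i)"

definition vscale :: "nat \<Rightarrow> real \<Rightarrow> (nat \<Rightarrow> real) \<Rightarrow> nat \<Rightarrow> real" where
  "vscale n a x = (\<lambda>i\<in>{..<n}. a * x i)"

definition vinner :: "nat \<Rightarrow> (nat \<Rightarrow> real) \<Rightarrow> (nat \<Rightarrow> real) \<Rightarrow> real" where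
  "vinner n x y = (\<Sum>i<n. x i * y i)"

abbreviation vnorm2 :: "nat \<Rightarrow> (nat \<Rightarrow> real) \<Rightarrow> real" where
  "vnorm2 n x \<equiv> L2_set x {..<n}"

definition unit_sphere :: "nat \<Rightarrow> (nat \<Rightarrow> real) set" where
  "unit_sphere d = {u \<in> Rn d. vnorm2 d u = 1}"

definition convex_body :: "nat \<Rightarrow> (nat \<Rightarrow> real) set \<Rightarrow> bool" where
  "convex_body n K \<longleftrightarrow>
     compactin (Rn_topology n) K \<and>
     Rn_topology n interior_of K \<noteq> {} \<and>
     (\<forall>x\<in>K. \<forall>y\<in>K. \<forall>t\<in>{0..1}. vadd n (vscale n (1 - t) x) (vscale n t y) \<in> K) \<and>
     (\<forall>x\<in>K. vscale n (- 1) x \<in> K)"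

definition is_norm :: "nat \<Rightarrow> ((nat \<Rightarrow> real) \<Rightarrow> real) \<Rightarrow> bool" where
  "is_norm n N \<longleftrightarrow>
     (\<forall>x\<in>Rn n. 0 \<le> N x \<and> (N x = 0 \<longleftrightarrow> x = vzero n)) \<and>
     (\<forall>x\<in>Rn n. \<forall>a. N (vscale n a x) = \<bar>a\<bar> * N x) \<and>
     (\<forall>x\<in>Rn n. \<forall>y\<in>Rn n. N (vadd n x y) \<le> N x + N y)"

definition unit_ball_of :: "nat \<Rightarrow> ((nat \<Rightarrow> real) \<Rightarrow> real) \<Rightarrow> (nat \<Rightarrow> real) set" where
  "unit_ball_of n N = {x \<in> Rn n. N x \<le> 1}"

definition polar_body :: "nat \<Rightarrow> (nat \<Rightarrow> real) set \<Rightarrow> (nat \<Rightarrow> real) set" where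
  "polar_body n K = {y \<in> Rn n. \<forall>x\<in>K. vinner n x y \<le> 1}"

definition gaussian_law :: "nat \<Rightarrow> (nat \<Rightarrow> real) measure" where
  "gaussian_law n = Pi\<^sub>M {..<n} (\<lambda>_. density lborel (\<lambda>x. ennreal (std_normal_density x)))"

definition gaussian_mean :: "nat \<Rightarrow> ((nat \<Rightarrow> real) \<Rightarrow> real) \<Rightarrow> real" where
  "gaussian_mean n N = (LINT g|gaussian_law n. N g)"

definition critical_dim :: "nat \<Rightarrow> (nat \<Rightarrow> real) set \<Rightarrow> ((nat \<Rightarrow> real) \<Rightarrow> real) \<Rightarrow> real" where
  "critical_dim n K N = (gaussian_mean n N / (SUP t\<in>polar_body n K. vnorm2 n t))\<^sup>2"

(* A random vector in R^n is represented by its law, a Borel probability measure on R^n.  This also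
   keeps constants that are quantified outside the random vectors independent of any sample space. *)

definition random_vector :: "nat \<Rightarrow> (nat \<Rightarrow> real) measure \<Rightarrow> bool" where
  "random_vector n \<mu> \<longleftrightarrow> prob_space \<mu> \<and> sets \<mu> = sets (Rn_borel n)"

(* The joint law of m independent copies; a realization x has the vectors x 0, ..., x (m - 1). *)

definition iid_copies :: "nat \<Rightarrow> (nat \<Rightarrow> real) measure \<Rightarrow> (nat \<Rightarrow> nat \<Rightarrow> real) measure" where
  "iid_copies m \<mu> = Pi\<^sub>M {..<m} (\<lambda>_. \<mu>)"

definition centred :: "nat \<Rightarrow> (nat \<Rightarrow> real) measure \<Rightarrow> bool" where
  "centred n \<mu> \<longleftrightarrow>
     (\<forall>i<n. integrable \<mu> (\<lambda>x. x i) \<and> (LINT x|\<mu>. x i) = 0)"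

definition isotropic :: "nat \<Rightarrow> (nat \<Rightarrow> real) measure \<Rightarrow> bool" where
  "isotropic n \<mu> \<longleftrightarrow>
     centred n \<mu> \<and>
     (\<forall>i<n. \<forall>j<n. integrable \<mu> (\<lambda>x. x i * x j) \<and>
        (LINT x|\<mu>. x i * x j) = (if i = j then 1 else 0))"

(* Invariance under the orthogonal group O(d). *)

definition orthogonal_mat :: "nat \<Rightarrow> (nat \<Rightarrow> nat \<Rightarrow> real) \<Rightarrow> bool" where
  "orthogonal_mat d Q \<longleftrightarrow>
     (\<forall>i<d. \<forall>j<d. (\<Sum>k<d. Q i k * Q j k) = (if i = j then 1 else 0))"

definition rotation_invariant :: "nat \<Rightarrow> (nat \<Rightarrow> real) measure \<Rightarrow> bool" where
  "rotation_invariant d \<mu> \<longleftrightarrow>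
     (\<forall>Q. orthogonal_mat d Q \<longrightarrow>
        distr \<mu> (Rn_borel d) (\<lambda>x. \<lambda>i\<in>{..<d}. \<Sum>k<d. Q i k * x k) = \<mu>)"

definition symmetric_vector :: "nat \<Rightarrow> (nat \<Rightarrow> real) measure \<Rightarrow> bool" where
  "symmetric_vector n \<nu> \<longleftrightarrow> distr \<nu> (Rn_borel n) (vscale n (- 1)) = \<nu>"

definition iid_coordinates :: "nat \<Rightarrow> (nat \<Rightarrow> real) measure \<Rightarrow> bool" where
  "iid_coordinates n \<nu> \<longleftrightarrow>
     prob_space.indep_vars \<nu> (\<lambda>_. borel) (\<lambda>i z. z i) {..<n} \<and>
     (\<forall>i<n. \<forall>j<n. distr \<nu> borel (\<lambda>z. z i) = distr \<nu> borel (\<lambda>z. z j))"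

(* The value is infinite when the p-th absolute moment is, so that moment comparisons
   are not satisfied through the convention that a divergent Bochner integral is 0. *)

definition Lp_norm :: "real \<Rightarrow> 'a measure \<Rightarrow> ('a \<Rightarrow> real) \<Rightarrow> ennreal" where
  "Lp_norm p M f =
     (if integrable M (\<lambda>x. \<bar>f x\<bar> powr p)
      then ennreal ((LINT x|M. \<bar>f x\<bar> powr p) powr (1 / p)) else \<infinity>)"

definition L4_L2_equiv :: "nat \<Rightarrow> real \<Rightarrow> (nat \<Rightarrow> real) measure \<Rightarrow> bool" where
  "L4_L2_equiv d L \<mu> \<longleftrightarrow>
     centred d \<mu> \<and>
     (\<forall>u\<in>Rn d. Lp_norm 4 \<mu> (\<lambda>x. vinner d x u) \<le> ennreal L * Lp_norm 2 \<mu> (\<lambda>x. vinner d x u))"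

definition subgaussian :: "nat \<Rightarrow> real \<Rightarrow> (nat \<Rightarrow> real) measure \<Rightarrow> bool" where
  "subgaussian n L \<nu> \<longleftrightarrow>
     (\<forall>x\<in>Rn n. \<forall>p\<ge>2. Lp_norm p \<nu> (\<lambda>z. vinner n z x)
        \<le> ennreal (L * sqrt p) * Lp_norm 2 \<nu> (\<lambda>z. vinner n z x))"

definition Gamma_op :: "nat \<Rightarrow> nat \<Rightarrow> (nat \<Rightarrow> nat \<Rightarrow> real) \<Rightarrow> (nat \<Rightarrow> real) \<Rightarrow> nat \<Rightarrow> real" where
  "Gamma_op d m x u = (\<lambda>i\<in>{..<m}. 1 / sqrt (real m) * vinner d (x i) u)"

definition D_op :: "nat \<Rightarrow> nat \<Rightarrow> (nat \<Rightarrow> nat \<Rightarrow> real) \<Rightarrow> (nat \<Rightarrow> real) \<Rightarrow> nat \<Rightarrow> real" where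
  "D_op m n z v = (\<lambda>j\<in>{..<n}. \<Sum>i<m. v i * z i j)"

definition rho :: "nat \<Rightarrow> nat \<Rightarrow> (nat \<Rightarrow> nat \<Rightarrow> real) \<Rightarrow> real" where
  "rho d m x = (SUP u\<in>unit_sphere d. \<bar>1 / real m * (\<Sum>i<m. (vinner d (x i) u)\<^sup>2) - 1\<bar>)"

definition H_sup :: "nat \<Rightarrow> nat \<Rightarrow> nat \<Rightarrow> (nat \<Rightarrow> nat \<Rightarrow> real) \<Rightarrow> real" where
  "H_sup d s m x =
     (SUP u\<in>unit_sphere d. SUP I\<in>{I. I \<subseteq> {..<m} \<and> card I \<le> s}.
        sqrt (1 / real m * (\<Sum>i\<in>I. (vinner d (x i) u)\<^sup>2)))"

definition rearrangement :: "nat \<Rightarrow> (nat \<Rightarrow> real) \<Rightarrow> nat \<Rightarrow> real" where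
  "rearrangement m v i = sort (map v [0..<m]) ! i"

(* Other versions of the inverse differ from this one at countably many p in (0,1) only. *)

definition quantile :: "real measure \<Rightarrow> real \<Rightarrow> real" where
  "quantile M p = Inf {t. p \<le> cdf M t}"

(* lambda with index i here is lambda with index i + 1 in the numbering from 1. *)

definition lambda_coeff :: "nat \<Rightarrow> nat \<Rightarrow> (nat \<Rightarrow> real) measure \<Rightarrow> (nat \<Rightarrow> real) \<Rightarrow> nat \<Rightarrow> real" where
  "lambda_coeff d m \<mu> u i =
     real m * (LINT p:{real i / real m <.. real (Suc i) / real m}|lborel.
        quantile (distr \<mu> borel (\<lambda>x. vinner d x u)) p)"

definition rearrangement_bound ::
  "real \<Rightarrow> real \<Rightarrow> nat \<Rightarrow> nat \<Rightarrow> (nat \<Rightarrow> real) measure \<Rightarrow> (nat \<Rightarrow> nat \<Rightarrow> real) \<Rightarrow> bool" where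
  "rearrangement_bound \<kappa>\<^sub>2 \<alpha> d m \<mu> x \<longleftrightarrow>
     (SUP u\<in>unit_sphere d. sqrt (1 / real m * (\<Sum>i<m.
        \<bar>rearrangement m (\<lambda>j. vinner d (x j) u) i - lambda_coeff d m \<mu> u i\<bar>\<^sup>2)))
     \<le> \<kappa>\<^sub>2 * (real d / real m) powr (1 / \<alpha>) * ln (real m / real d)"

definition H_bound ::
  "real \<Rightarrow> real \<Rightarrow> nat \<Rightarrow> nat \<Rightarrow> (nat \<Rightarrow> nat \<Rightarrow> real) \<Rightarrow> bool" where
  "H_bound \<kappa>\<^sub>3 \<alpha> d m x \<longleftrightarrow>
     (\<forall>s\<in>{1..m}. H_sup d s m x
        \<le> \<kappa>\<^sub>3 * ((real s / real m) powr (1 / 4)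
               + (real d / real m) powr (1 / \<alpha>) * ln (real m / real d)))"

definition rho_bound ::
  "real \<Rightarrow> real \<Rightarrow> nat \<Rightarrow> nat \<Rightarrow> (nat \<Rightarrow> nat \<Rightarrow> real) \<Rightarrow> bool" where
  "rho_bound B \<alpha> d m x \<longleftrightarrow> rho d m x \<le> B * (real d / real m) powr (2 / \<alpha>)"

definition rho_bound_whp ::
  "real \<Rightarrow> real \<Rightarrow> real \<Rightarrow> nat \<Rightarrow> nat \<Rightarrow> (nat \<Rightarrow> real) measure \<Rightarrow> bool" where
  "rho_bound_whp B \<alpha> \<eta> d m \<mu> \<longleftrightarrow>
     measure (iid_copies m \<mu>) {x \<in> space (iid_copies m \<mu>). rho_bound B \<alpha> d m x} \<ge> 1 - \<eta>"

(* Constants for which the known estimates on the rearranged coordinates and on H hold with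
   high probability; such constants are known to exist for all L, B >= 1 and alpha >= 4. *)

definition admissible_kappas ::
  "real \<Rightarrow> real \<Rightarrow> real \<Rightarrow> real \<Rightarrow> real \<Rightarrow> real \<Rightarrow> bool" where
  "admissible_kappas L B \<alpha> \<kappa>\<^sub>1 \<kappa>\<^sub>2 \<kappa>\<^sub>3 \<longleftrightarrow>
     0 < \<kappa>\<^sub>1 \<and> 0 < \<kappa>\<^sub>2 \<and> 0 < \<kappa>\<^sub>3 \<and>
     (\<forall>d m \<mu> \<eta>.
        1 \<le> d \<and> \<kappa>\<^sub>1 * real d \<le> real m \<and> 0 \<le> \<eta> \<and> \<eta> \<le> 1 \<and>
        random_vector d \<mu> \<and> isotropic d \<mu> \<and> rotation_invariant d \<mu> \<and> L4_L2_equiv d L \<mu> \<and>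
        rho_bound_whp B \<alpha> \<eta> d m \<mu>
        \<longrightarrow> measure (iid_copies m \<mu>)
              {x \<in> space (iid_copies m \<mu>).
                 rearrangement_bound \<kappa>\<^sub>2 \<alpha> d m \<mu> x \<and> H_bound \<kappa>\<^sub>3 \<alpha> d m x}
            \<ge> 1 - \<eta> - exp (- real d))"

definition Omega_event ::
  "real \<Rightarrow> real \<Rightarrow> real \<Rightarrow> real \<Rightarrow> nat \<Rightarrow> nat \<Rightarrow> (nat \<Rightarrow> real) measure \<Rightarrow> (nat \<Rightarrow> nat \<Rightarrow> real) set" where
  "Omega_event B \<alpha> \<kappa>\<^sub>2 \<kappa>\<^sub>3 d m \<mu> =
     {x \<in> space (iid_copies m \<mu>).
        rearrangement_bound \<kappa>\<^sub>2 \<alpha> d m \<mu> x \<and> H_bound \<kappa>\<^sub>3 \<alpha> d m x \<and> rho_bound B \<alpha> d m x}"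

end

theory Submission
  imports Defs
begin

text \<open>
  Write \<open>D\<close> for the critical dimension and \<open>R\<close> for the Euclidean radius of the polar body, so that the Gaussian mean
  is \<open>E = R sqrt D\<close>, and take \<open>\<Lambda> = E\<close>. For a fixed \<open>u\<close> the vector to be estimated is \<open>\<Sum>\<^sub>i a\<^sub>i Z\<^sub>i\<close> with
  \<open>a\<^sub>i = \<langle>X\<^sub>i, u\<rangle> / sqrt m\<close>. The coordinates of \<open>Z\<^sub>i\<close> are independent and symmetric, so one may multiply them by
  independent signs \<open>s\<^sub>i\<^sub>j\<close> and condition on \<open>|Z\<^sub>i\<^sub>j|\<close>. The norm is then a convex function of the signs with
  Lipschitz constant \<open>R max\<^sub>j (\<Sum>\<^sub>i a\<^sub>i\<^sup>2 Z\<^sub>i\<^sub>j\<^sup>2)\<^sup>1\<^sup>/\<^sup>2\<close>, which is close to \<open>R\<close>; by Maurey's inequality it concentrates about its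
  conditional mean at the scale \<open>R\<close>. The conditional mean is \<open>(1 \<plusminus> O(\<epsilon>)) E\<close>: signs with small coefficients are exchanged one
  by one for small increases of the variance of a Gaussian, because the two densities involved cross only once. The bounds
  on \<open>H\<close> and \<open>\<rho>\<close> say that the \<open>a\<^sub>i\<close> are small enough for this, and a net of the sphere finishes the proof.
\<close>

subsection \<open>Convex concentration for random signs\<close>

text \<open>The obstacle is that a norm is convex and Lipschitz but not smooth, so Taylor-type
  exchange arguments do not apply, and that there are \<open>m * n\<close> exchanges whose errors
  must add up to at most a small multiple of \<open>E\<close>. Upwards an exchange is free of error
  and costs only variance. Downwards each one leaves a Gaussian tail of order
  \<open>R * exp (- 3 * \<epsilon>^3 / (8 * \<beta>^2))\<close>, with \<beta> the largest
  coefficient, and this must beat \<open>m * n\<close>, which is exponential in \<open>D\<close>.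
  The coefficients used downwards therefore have to be far smaller than those tolerated upwards: the
  large \<open>a i\<close> are dropped and the squares of the entries of \<open>Z\<close> truncated,
  which a contraction principle permits. Every exchange also needs some Gaussian variance already
  present in its coordinate; upwards it is added for free by monotonicity in the variance, downwards
  it is removed again by subadditivity. Largeness of \<open>D\<close> comes from
  \<open>d \<ge> 1\<close>: the upper bound on \<open>d\<close> then forces
  \<open>\<epsilon>^2 * D\<close> above a prescribed constant.\<close>

fun ravg :: "'k list \<Rightarrow> (('k \<Rightarrow> real) \<Rightarrow> real) \<Rightarrow> ('k \<Rightarrow> real) \<Rightarrow> real" where
  "ravg [] f s = f s"
| "ravg (k # ks) f s = (ravg ks f (s(k := 1)) + ravg ks f (s(k := -1))) / 2"

text \<open>The points at which \<open>ravg\<close> evaluates its argument. \<open>ravg\<close> is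
  the expectation over independent uniform signs at the listed positions with the other coordinates
  frozen at the base point; its recursion is conditioning on the first listed sign.\<close>

definition signs_on :: "'k set \<Rightarrow> ('k \<Rightarrow> real) \<Rightarrow> ('k \<Rightarrow> real) \<Rightarrow> bool" where
  "signs_on A d s \<longleftrightarrow> (\<forall>k. k \<notin> A \<longrightarrow> s k = d k) \<and> (\<forall>k\<in>A. s k = 1 \<or> s k = -1)"

lemma ravg_mono:
  assumes "\<And>s. signs_on (set ks) d s \<Longrightarrow> f s \<le> g s"
  shows "ravg ks f d \<le> ravg ks g d"
  using assms
proof (induction ks arbitrary: d)
  case Nil
  show ?case using Nil[of d] by (simp add: signs_on_def)
next
  case (Cons k ks)
  have "ravg ks f (d(k := v)) \<le> ravg ks g (d(k := v))" if v: "v = 1 \<or> v = -1" for v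
  proof (rule Cons.IH)
    fix s assume "signs_on (set ks) (d(k := v)) s"
    then have "signs_on (set (k # ks)) d s"
      using v unfolding signs_on_def by (auto split: if_splits)
    then show "f s \<le> g s" by (rule Cons.prems)
  qed
  from this[of 1] this[of "-1"] show ?case by simp
qed

lemma ravg_cong:
  assumes "\<And>s. signs_on (set ks) d s \<Longrightarrow> f s = g s"
  shows "ravg ks f d = ravg ks g d"
  using assms by (intro antisym ravg_mono) auto

lemma ravg_const [simp]: "ravg ks (\<lambda>_. c) d = c"
  by (induction ks arbitrary: d) auto

lemma ravg_add: "ravg ks (\<lambda>s. f s + g s) d = ravg ks f d + ravg ks g d"
  by (induction ks arbitrary: d) (auto simp: field_simps)

lemma ravg_cmult: "ravg ks (\<lambda>s. c * f s) d = c * ravg ks f d"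
  by (induction ks arbitrary: d) (auto simp: field_simps)

text \<open>Lets the value at the opposite sign of \<open>k\<close> appear inside the average taken
  at the given sign, as the induction step for the convex property requires.\<close>

lemma ravg_fun_upd:
  assumes "k \<notin> set ks"
  shows "ravg ks (\<lambda>s. f (s(k := v))) d = ravg ks f (d(k := v))"
  using assms
  by (induction ks arbitrary: d) (auto simp: fun_upd_twist)

lemma ravg_pos: "(\<And>s. 0 < f s) \<Longrightarrow> 0 < ravg ks f d"
  by (induction ks arbitrary: d) (auto simp: add_pos_pos)

text \<open>Jensen's inequality, one two-point average at a time.\<close>

lemma exp_ravg_le: "exp (ravg ks f d) \<le> ravg ks (\<lambda>s. exp (f s)) d"
proof (induction ks arbitrary: d)
  case (Cons k ks)
  have "exp ((a + b) / 2) \<le> (exp a + exp b) / 2" for a b :: real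
    using convex_onD[OF exp_convex, of "1/2" a b] by (simp add: field_simps)
  then have "exp (ravg (k # ks) f d)
      \<le> (exp (ravg ks f (d(k := 1))) + exp (ravg ks f (d(k := -1)))) / 2" by simp
  also have "\<dots> \<le> ravg (k # ks) (\<lambda>s. exp (f s)) d"
    using Cons.IH[of "d(k := 1)"] Cons.IH[of "d(k := -1)"] by (simp del: fun_upd_apply)
  finally show ?case .
qed simp

section \<open>The two-point inequality behind the convex property\<close>

lemma exp_neg_le: 
  fixes x :: real assumes "0 \<le> x" shows "exp (- x) \<le> 1 - x + x\<^sup>2 / 2"
proof -
  have "exp (-x) \<le> 1 / (1 + x + x\<^sup>2/2)"
    using exp_lower_Taylor_quadratic[of x] assms
    by (simp add: exp_minus inverse_eq_divide frac_le add_pos_nonneg)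
  also have "\<dots> \<le> 1 - x + x\<^sup>2 / 2"
  proof -
    \<comment> \<open>The product is \<open>1 + x^4 / 4\<close>.\<close>
    have "1 \<le> (1 - x + x\<^sup>2 / 2) * (1 + x + x\<^sup>2/2)" 
      using zero_le_power[OF assms, of 4] by (simp add: algebra_simps power2_eq_square power4_eq_xxxx)
    moreover have "0 < 1 + x + x\<^sup>2/2" using assms by (simp add: add_pos_nonneg)
    ultimately show ?thesis by (simp add: divide_le_eq)
  qed
  finally show ?thesis .
qed

text \<open>The exponent is minimal at \<open>\<theta> = 2 * l\<close>, with value
  \<open>l - l^2\<close>; this is admissible for \<open>l \<le> 1/2\<close>, where Taylor bounds
  suffice. For larger \<open>l\<close> the endpoint \<open>\<theta> = 1\<close> leaves the constant
  exponent 1/4, and \<open>exp (- l) \<le> 2/3\<close> is enough.\<close>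

lemma two_point_inequality_aux:
  fixes l :: real
  assumes "0 \<le> l"
  shows "\<exists>\<theta>\<in>{0..1}. (1 + exp (\<theta>\<^sup>2 / 4 + (1 - \<theta>) * l)) * (1 + exp (- l)) \<le> 4"
proof (cases "l \<le> 1/2")
  case True
  have e1: "exp l \<le> 1 + l + l\<^sup>2" using exp_bound[of l] True assms by simp
  have e2: "exp (- l) \<le> 1 - l + l\<^sup>2 / 2" by (rule exp_neg_le[OF assms])
  have e3: "exp (- (l\<^sup>2)) \<le> 1 - l\<^sup>2 + l^4 / 2"
    using exp_neg_le[of "l\<^sup>2"] by simp
  have "(1 + exp ((2*l)\<^sup>2 / 4 + (1 - 2*l) * l)) * (1 + exp (- l)) 
      = 1 + exp (-l) + (1 + exp l) * exp (-(l\<^sup>2))"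
    by (simp add: algebra_simps power2_eq_square flip: exp_add)
  also have "\<dots> \<le> 1 + (1 - l + l\<^sup>2 / 2) + (1 + (1 + l + l\<^sup>2)) * (1 - l\<^sup>2 + l^4 / 2)"
    using e1 e2 e3 assms by (intro add_mono mult_mono) (auto intro: add_nonneg_nonneg)
  also have "\<dots> = 4 - l\<^sup>2/2 * (1 + 2 * l - l^3 - l^4)"
    by (simp add: field_simps power2_eq_square power3_eq_cube power4_eq_xxxx)
  also have "\<dots> \<le> 4"
  proof -
    have "l^3 \<le> 1" "l^4 \<le> l" using True assms power_le_one[of l 3] power_decreasing[of 1 4 l] by auto
    then have "0 \<le> 1 + 2 * l - l^3 - l^4" using assms by linarith
    then show ?thesis by simp
  qed
  finally show ?thesis using True assms by (intro bexI[of _ "2*l"]) auto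
next
  case False
  have a: "exp (-l) \<le> 2/3"
  proof -
    have "3/2 \<le> exp l" using exp_ge_add_one_self[of l] False by linarith
    then show ?thesis by (simp add: exp_minus inverse_eq_divide divide_le_eq)
  qed
  have b: "exp (1/4::real) \<le> 1.35" using exp_bound[of "1/4::real"] by (simp add: power2_eq_square)
  have "(1 + exp (1\<^sup>2 / 4 + (1 - 1) * l)) * (1 + exp (- l)) \<le> (1 + 1.35) * (1 + 2/3)"
    using a b by (intro mult_mono) (auto intro: add_nonneg_nonneg)
  also have "\<dots> \<le> 4" by simp
  finally show ?thesis by (intro bexI[of _ 1]) auto
qed

text \<open>By symmetry let \<open>c \<le> b\<close>. Then \<open>x\<close> is bounded with \<theta>
  = 0 (no move) and \<open>y\<close> with the optimal move; after cancelling, the product depends on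
  \<open>b - c\<close> alone. The 4 on the right cancels the two factors 1/2 of the sign
  averages.\<close>

lemma two_point_inequality:
  fixes x y b c :: real
  assumes x: "\<And>\<theta>. 0 \<le> \<theta> \<Longrightarrow> \<theta> \<le> 1 \<Longrightarrow> x \<le> exp (\<theta>\<^sup>2 / 4 - (1 - \<theta>) * b - \<theta> * c)"
    and y: "\<And>\<theta>. 0 \<le> \<theta> \<Longrightarrow> \<theta> \<le> 1 \<Longrightarrow> y \<le> exp (\<theta>\<^sup>2 / 4 - (1 - \<theta>) * c - \<theta> * b)"
  shows "(x + y) * (exp b + exp c) \<le> 4"
proof -
  have main: "(x + y) * (exp b + exp c) \<le> 4"
    if bc: "c \<le> b" and x: "x \<le> exp (- b)" 
      and y: "\<And>\<theta>. 0 \<le> \<theta> \<Longrightarrow> \<theta> \<le> 1 \<Longrightarrow> y \<le> exp (\<theta>\<^sup>2 / 4 - (1 - \<theta>) * c - \<theta> * b)" 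
    for b c x y :: real
  proof -
    define l where "l = b - c"
    obtain \<theta> where th: "0 \<le> \<theta>" "\<theta> \<le> 1" 
      "(1 + exp (\<theta>\<^sup>2 / 4 + (1 - \<theta>) * l)) * (1 + exp (- l)) \<le> 4"
      using two_point_inequality_aux[of l] bc by (auto simp: l_def)
    have "(x + y) * (exp b + exp c) \<le> (exp (-b) + exp (\<theta>\<^sup>2 / 4 - (1 - \<theta>) * c - \<theta> * b)) * (exp b + exp c)"
      using x y[OF th(1,2)] by (intro mult_right_mono add_mono) auto
    also have "\<dots> = (1 + exp (\<theta>\<^sup>2 / 4 + (1 - \<theta>) * l)) * (1 + exp (- l))"
      by (simp add: l_def algebra_simps flip: exp_add)
    finally show ?thesis using th by simp
  qed
  show ?thesis
  proof (cases "c \<le> b")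
    case True
    show ?thesis using x[of 0] by (intro main[OF True _ y]) auto
  next
    case False
    have "(y + x) * (exp c + exp b) \<le> 4" 
      using y[of 0] False by (intro main[OF _ _ x]) auto
    then show ?thesis by (simp add: add.commute)
  qed
qed

text \<open>Infimal convolution with a quadratic cost in the coordinates of \<open>A\<close>. The
  competitor \<open>y\<close> is real and may leave the cube, which is where convexity of
  \<open>f\<close> enters. The 16 is matched to the two-point inequality: moving a fraction
  \<open>t\<close> of the distance 2 between the signs costs
  \<open>(2 * t)^2 / 16 = t^2 / 4\<close>.\<close>

definition qinf :: "'k set \<Rightarrow> (('k \<Rightarrow> real) \<Rightarrow> real) \<Rightarrow> ('k \<Rightarrow> real) \<Rightarrow> real" where
  "qinf A f s = (INF y\<in>{y. \<forall>k. k \<notin> A \<longrightarrow> y k = s k}. f y + (\<Sum>k\<in>A. (s k - y k)\<^sup>2) / 16)"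

lemma qinf_lower:
  assumes "\<And>y. 0 \<le> f y" and "\<And>k. k \<notin> A \<Longrightarrow> y k = s k"
  shows "qinf A f s \<le> f y + (\<Sum>k\<in>A. (s k - y k)\<^sup>2) / 16"
  unfolding qinf_def using assms
  by (intro cINF_lower bdd_belowI[where m = 0]) (auto intro!: add_nonneg_nonneg sum_nonneg)

lemma qinf_approx:
  assumes "0 < e"
  obtains y where "\<And>k. k \<notin> A \<Longrightarrow> y k = s k" "f y + (\<Sum>k\<in>A. (s k - y k)\<^sup>2) / 16 < qinf A f s + e"
proof -
  have "\<exists>a\<in>(\<lambda>y. f y + (\<Sum>k\<in>A. (s k - y k)\<^sup>2) / 16) ` {y. \<forall>k. k \<notin> A \<longrightarrow> y k = s k}. a < qinf A f s + e"
    using assms by (intro cInf_lessD) (auto simp: qinf_def)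
  then show ?thesis using that by auto
qed

definition convex_fun :: "(('k \<Rightarrow> real) \<Rightarrow> real) \<Rightarrow> bool" where
  "convex_fun f \<longleftrightarrow> (\<forall>x y t. 0 \<le> t \<longrightarrow> t \<le> 1 \<longrightarrow>
     f (\<lambda>k. (1 - t) * x k + t * y k) \<le> (1 - t) * f x + t * f y)"

lemma square_convex_comb:
  fixes a b t :: real
  assumes "0 \<le> t" "t \<le> 1"
  shows "((1 - t) * a + t * b)\<^sup>2 \<le> (1 - t) * a\<^sup>2 + t * b\<^sup>2"
proof -
  have "(1 - t) * a\<^sup>2 + t * b\<^sup>2 - ((1 - t) * a + t * b)\<^sup>2 = t * (1 - t) * (a - b)\<^sup>2"
    by (simp add: algebra_simps power2_eq_square)
  also have "\<dots> \<ge> 0" using assms by simp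
  finally show ?thesis by simp
qed

text \<open>Near-minimisers for the two values of coordinate \<open>k\<close> are combined with
  weights \<open>1 - t\<close> and \<open>t\<close>. Coordinate \<open>k\<close> then moves by
  \<open>t * (v - s k)\<close> and pays \<open>t^2 / 4\<close>; everything else is handled by
  convexity of \<open>f\<close> and of the square.\<close>

lemma qinf_insert_le:
  assumes f: "\<And>y. 0 \<le> f y" "convex_fun f" and A: "finite A" "k \<notin> A"
    and t: "0 \<le> t" "t \<le> 1" and s: "(s k - v)\<^sup>2 = 4"
  shows "qinf (insert k A) f s \<le> (1 - t) * qinf A f s + t * qinf A f (s(k := v)) + t\<^sup>2 / 4"
proof (rule field_le_epsilon)
  fix e :: real assume e: "0 < e"
  obtain y1 where y1: "\<And>k. k \<notin> A \<Longrightarrow> y1 k = s k" 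
    "f y1 + (\<Sum>k\<in>A. (s k - y1 k)\<^sup>2) / 16 < qinf A f s + e" using qinf_approx[OF e] by metis
  obtain y0 where y0: "\<And>k'. k' \<notin> A \<Longrightarrow> y0 k' = (s(k := v)) k'" 
    "f y0 + (\<Sum>k'\<in>A. ((s(k := v)) k' - y0 k')\<^sup>2) / 16 < qinf A f (s(k := v)) + e" 
    using qinf_approx[OF e] by metis
  have sm: "(\<Sum>k'\<in>A. ((s(k := v)) k' - y0 k')\<^sup>2) = (\<Sum>k\<in>A. (s k - y0 k)\<^sup>2)"
    using A by (intro sum.cong) auto
  define y where "y = (\<lambda>k. (1 - t) * y1 k + t * y0 k)"
  have "qinf (insert k A) f s \<le> f y + (\<Sum>k\<in>insert k A. (s k - y k)\<^sup>2) / 16"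
  proof (rule qinf_lower[OF f(1)])
    fix k' assume "k' \<notin> insert k A"
    then show "y k' = s k'" using y1(1)[of k'] y0(1)[of k'] by (simp add: y_def algebra_simps)
  qed
  also have "\<dots> = f y + ((s k - y k)\<^sup>2 + (\<Sum>k\<in>A. (s k - y k)\<^sup>2)) / 16" using A by simp
  also have "s k - y k = t * (s k - v)"
    using y1(1)[of k] y0(1)[of k] A by (simp add: y_def algebra_simps)
  also have "(t * (s k - v))\<^sup>2 = t\<^sup>2 * 4" using s by (simp add: power_mult_distrib)
  also have "(\<Sum>k\<in>A. (s k - y k)\<^sup>2) \<le> (\<Sum>k\<in>A. (1 - t) * (s k - y1 k)\<^sup>2 + t * (s k - y0 k)\<^sup>2)"
  proof (rule sum_mono)
    fix k
    have "s k - y k = (1 - t) * (s k - y1 k) + t * (s k - y0 k)" by (simp add: y_def algebra_simps)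
    then show "(s k - y k)\<^sup>2 \<le> (1 - t) * (s k - y1 k)\<^sup>2 + t * (s k - y0 k)\<^sup>2"
      using square_convex_comb[OF t] by simp
  qed
  also have "\<dots> = (1 - t) * (\<Sum>k\<in>A. (s k - y1 k)\<^sup>2) + t * (\<Sum>k\<in>A. (s k - y0 k)\<^sup>2)"
    by (simp add: sum.distrib sum_distrib_left)
  also have "f y \<le> (1 - t) * f y1 + t * f y0"
    using f(2) t unfolding convex_fun_def y_def by blast
  finally have "qinf (insert k A) f s \<le> (1 - t) * (f y1 + (\<Sum>k\<in>A. (s k - y1 k)\<^sup>2) / 16)
      + t * (f y0 + (\<Sum>k\<in>A. (s k - y0 k)\<^sup>2) / 16) + t\<^sup>2 / 4"
    by (simp add: field_simps)
  also have "\<dots> \<le> (1 - t) * (qinf A f s + e) + t * (qinf A f (s(k := v)) + e) + t\<^sup>2 / 4"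
    using t less_imp_le[OF y1(2)] less_imp_le[OF y0(2)[unfolded sm]]
    by (intro add_right_mono add_mono[of "(1 - t) * _"] mult_left_mono) auto
  finally show "qinf (insert k A) f s \<le> (1 - t) * qinf A f s + t * qinf A f (s(k := v)) + t\<^sup>2 / 4 + e"
    by (simp add: algebra_simps)
qed

text \<open>This is Hoelder's inequality for exponents \<open>1 - t\<close> and \<open>t\<close>.
  The factors \<open>exp b\<close> and \<open>exp c\<close> normalise both averages to at most 1,
  after which convexity of the exponential gives it pointwise.\<close>

lemma ravg_exp_qinf_step:
  assumes f: "\<And>y. 0 \<le> f y" "convex_fun f" and ks: "k \<notin> set ks"
    and t: "0 \<le> t" "t \<le> 1" and v: "(u - v)\<^sup>2 = 4"
    and b: "ravg ks (\<lambda>s. exp (qinf (set ks) f s)) (d(k := u)) \<le> exp (- b)"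
    and c: "ravg ks (\<lambda>s. exp (qinf (set ks) f s)) (d(k := v)) \<le> exp (- c)"
  shows "ravg ks (\<lambda>s. exp (qinf (set (k # ks)) f s)) (d(k := u)) \<le> exp (t\<^sup>2 / 4 - (1 - t) * b - t * c)"
proof -
  let ?q = "qinf (set ks) f" and ?E = "exp (t\<^sup>2 / 4 - (1 - t) * b - t * c)"
  have "ravg ks (\<lambda>s. exp (qinf (set (k # ks)) f s)) (d(k := u))
      \<le> ravg ks (\<lambda>s. ?E * ((1 - t) * exp b * exp (?q s) + t * exp c * exp (?q (s(k := v))))) (d(k := u))"
  proof (rule ravg_mono)
    fix s assume "signs_on (set ks) (d(k := u)) s"
    then have "s k = u" using ks by (auto simp: signs_on_def)
    then have "qinf (set (k # ks)) f s \<le> (1 - t) * ?q s + t * ?q (s(k := v)) + t\<^sup>2 / 4"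
      using qinf_insert_le[OF f, of "set ks" k t s v] ks t v by simp
    then have "exp (qinf (set (k # ks)) f s) \<le> exp ((1 - t) * ?q s + t * ?q (s(k := v)) + t\<^sup>2 / 4)" by simp
    also have "\<dots> = ?E * exp ((1 - t) * (b + ?q s) + t * (c + ?q (s(k := v))))"
      by (simp add: algebra_simps flip: exp_add)
    also have "exp ((1 - t) * (b + ?q s) + t * (c + ?q (s(k := v))))
        \<le> (1 - t) * exp (b + ?q s) + t * exp (c + ?q (s(k := v)))"
      using convex_onD[OF exp_convex t, of "b + ?q s" "c + ?q (s(k := v))"] by simp
    finally show "exp (qinf (set (k # ks)) f s) \<le> ?E * ((1 - t) * exp b * exp (?q s) + t * exp c * exp (?q (s(k := v))))"
      by (simp add: exp_add mult.assoc)
  qed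
  also have "\<dots> = ?E * ((1 - t) * (exp b * ravg ks (\<lambda>s. exp (?q s)) (d(k := u)))
      + t * (exp c * ravg ks (\<lambda>s. exp (?q s)) (d(k := v))))"
    using ravg_fun_upd[OF ks, of "\<lambda>s. exp (?q s)" v "d(k := u)"]
    by (simp add: ravg_cmult ravg_add mult.assoc)
  also have "\<dots> \<le> ?E * ((1 - t) * (exp b * exp (-b)) + t * (exp c * exp (-c)))"
    using t b c by (intro mult_left_mono add_mono) auto
  also have "\<dots> = ?E" by (simp flip: exp_add)
  finally show ?thesis .
qed

text \<open>Maurey's convex property tau. Conditioning on the last sign turns the induction step into a two-point problem,
  in which the infimal convolution may move a fraction \<open>t\<close> of the way towards the other point.\<close>

lemma maurey_rademacher:
  assumes f: "\<And>y. 0 \<le> f y" "convex_fun f" and "distinct ks"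
  shows "ravg ks (\<lambda>s. exp (qinf (set ks) f s)) d * ravg ks (\<lambda>s. exp (- f s)) d \<le> 1"
  using assms(3)
proof (induction ks arbitrary: d)
  case Nil
  have "qinf {} f d \<le> f d" using qinf_lower[OF f(1), of "{}" d d] by simp
  then show ?case by (simp flip: exp_add)
next
  case (Cons k ks)
  let ?B = "\<lambda>v. ravg ks (\<lambda>s. exp (- f s)) (d(k := v))"
  let ?X = "\<lambda>v. ravg ks (\<lambda>s. exp (qinf (set (k # ks)) f s)) (d(k := v))"
  have B: "0 < ?B v" for v by (rule ravg_pos) simp
  have le: "ravg ks (\<lambda>s. exp (qinf (set ks) f s)) (d(k := v)) \<le> exp (- ln (?B v))" for v
    using Cons.IH[of "d(k := v)"] Cons.prems B[of v] 
    by (simp add: exp_minus[of "ln _"] inverse_eq_divide pos_le_divide_eq del: fun_upd_apply)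
  have "(?X 1 + ?X (-1)) * (exp (ln (?B 1)) + exp (ln (?B (-1)))) \<le> 4"
    using Cons.prems
    by (intro two_point_inequality ravg_exp_qinf_step[where u = 1 and v = "-1"]
        ravg_exp_qinf_step[where u = "-1" and v = 1] f le) auto
  then show ?case using B[of 1] B[of "-1"] by (simp add: exp_ln)
qed

text \<open>Moving by a distance \<open>r\<close> gains at most \<open>L * r\<close> and costs
  \<open>r^2 / 16\<close>; the difference is at most \<open>4 * L^2\<close>, by completing a
  square.\<close>

lemma qinf_ge_lipschitz:
  assumes "0 \<le> L" 
    and lip: "\<And>x y. (\<And>k. k \<notin> A \<Longrightarrow> x k = y k) \<Longrightarrow> f x - f y \<le> L * sqrt (\<Sum>k\<in>A. (x k - y k)\<^sup>2)"
  shows "f s - 4 * L\<^sup>2 \<le> qinf A f s"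
  unfolding qinf_def
proof (rule cINF_greatest)
  fix y assume y: "y \<in> {y. \<forall>k. k \<notin> A \<longrightarrow> y k = s k}"
  define r where "r = sqrt (\<Sum>k\<in>A. (s k - y k)\<^sup>2)"
  have r2: "r\<^sup>2 = (\<Sum>k\<in>A. (s k - y k)\<^sup>2)" by (simp add: r_def sum_nonneg)
  have "f s - f y \<le> L * r" using lip[of s y] y by (simp add: r_def)
  moreover have "0 \<le> (r / 4 - 2 * L)\<^sup>2" by simp
  then have "L * r \<le> 4 * L\<^sup>2 + r\<^sup>2 / 16" by (simp add: power2_eq_square algebra_simps)
  ultimately show "f s - 4 * L\<^sup>2 \<le> f y + (\<Sum>k\<in>A. (s k - y k)\<^sup>2) / 16" using r2 by linarith
qed auto

lemma ravg_exp_product: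
  assumes f: "\<And>y. 0 \<le> f y" "convex_fun f" and "distinct ks" and "0 \<le> L" 
    and lip: "\<And>x y. (\<And>k. k \<notin> set ks \<Longrightarrow> x k = y k) \<Longrightarrow> f x - f y \<le> L * sqrt (\<Sum>k\<in>set ks. (x k - y k)\<^sup>2)"
  shows "ravg ks (\<lambda>s. exp (f s)) d * ravg ks (\<lambda>s. exp (- f s)) d \<le> exp (4 * L\<^sup>2)"
proof -
  have "exp (- (4 * L\<^sup>2)) * ravg ks (\<lambda>s. exp (f s)) d = ravg ks (\<lambda>s. exp (f s - 4 * L\<^sup>2)) d"
    by (simp add: exp_diff exp_minus field_simps flip: ravg_cmult)
  also have "\<dots> \<le> ravg ks (\<lambda>s. exp (qinf (set ks) f s)) d"
    using qinf_ge_lipschitz[OF assms(4) lip] by (intro ravg_mono) auto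
  finally have "exp (- (4 * L\<^sup>2)) * ravg ks (\<lambda>s. exp (f s)) d * ravg ks (\<lambda>s. exp (- f s)) d 
     \<le> ravg ks (\<lambda>s. exp (qinf (set ks) f s)) d * ravg ks (\<lambda>s. exp (- f s)) d"
    by (intro mult_right_mono) (auto intro!: less_imp_le[OF ravg_pos])
  also have "\<dots> \<le> 1" using maurey_rademacher[OF f assms(3)] .
  finally show ?thesis by (simp add: exp_minus field_simps)
qed

text \<open>The bound on the product of the two exponential moments gives concentration about the
  mean: Jensen's inequality bounds either factor from below by its value at the mean, so the other
  factor is bounded from above, and both tails follow at once.\<close>

theorem ravg_concentration:
  assumes f: "\<And>y. 0 \<le> f y" "convex_fun f" and ks: "distinct ks" and L: "0 < L" 
    and lip: "\<And>x y. (\<And>k. k \<notin> set ks \<Longrightarrow> x k = y k) \<Longrightarrow> f x - f y \<le> L * sqrt (\<Sum>k\<in>set ks. (x k - y k)\<^sup>2)"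
    and r: "0 \<le> r"
  shows "ravg ks (\<lambda>s. of_bool (\<bar>f s - ravg ks f d\<bar> > r)) d \<le> 2 * exp (- r\<^sup>2 / (16 * L\<^sup>2))"
proof -
  \<comment> \<open>The minimiser of the final exponent
    \<open>4 * (l * L)^2 - l * r\<close>.\<close>
  define l where "l = r / (8 * L\<^sup>2)"
  define m where "m = ravg ks f d"
  have l0: "0 \<le> l" using r by (simp add: l_def)
  have prod: "ravg ks (\<lambda>s. exp (l * f s)) d * ravg ks (\<lambda>s. exp (- (l * f s))) d \<le> exp (4 * (l * L)\<^sup>2)"
  proof (rule ravg_exp_product[OF _ _ ks])
    show "convex_fun (\<lambda>s. l * f s)" using f(2) l0 unfolding convex_fun_def
    proof (intro allI impI, goal_cases)
      case (1 x y t)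
      then have "l * f (\<lambda>k. (1 - t) * x k + t * y k) \<le> l * ((1 - t) * f x + t * f y)"
        using l0 by (intro mult_left_mono) auto
      then show ?case by (simp add: algebra_simps)
    qed
    fix x y :: "'a \<Rightarrow> real" assume "\<And>k. k \<notin> set ks \<Longrightarrow> x k = y k"
    from mult_left_mono[OF lip[OF this] l0]
    show "l * f x - l * f y \<le> l * L * sqrt (\<Sum>k\<in>set ks. (x k - y k)\<^sup>2)" by (simp add: algebra_simps)
  qed (use f l0 L in auto)
  have j1: "exp (l * m) \<le> ravg ks (\<lambda>s. exp (l * f s)) d" 
    and j2: "exp (- (l * m)) \<le> ravg ks (\<lambda>s. exp (- (l * f s))) d"
    using exp_ravg_le[of ks "\<lambda>s. l * f s" d] exp_ravg_le[of ks "\<lambda>s. (- l) * f s" d]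
      ravg_cmult[of ks "- l" f d] ravg_cmult[of ks l f d]
    by (simp_all add: m_def)
  have uu: "ravg ks (\<lambda>s. exp (l * f s)) d \<le> exp (4 * (l * L)\<^sup>2 + l * m)"
  proof -
    have "ravg ks (\<lambda>s. exp (l * f s)) d * exp (- (l * m)) \<le> 
        ravg ks (\<lambda>s. exp (l * f s)) d * ravg ks (\<lambda>s. exp (- (l * f s))) d"
      by (intro mult_left_mono j2 less_imp_le[OF ravg_pos]) auto
    then have "ravg ks (\<lambda>s. exp (l * f s)) d * exp (- (l * m)) \<le> exp (4 * (l * L)\<^sup>2)" using prod by linarith
    then show ?thesis by (simp add: exp_add exp_minus field_simps)
  qed
  have ll: "ravg ks (\<lambda>s. exp (- (l * f s))) d \<le> exp (4 * (l * L)\<^sup>2 - l * m)"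
  proof -
    have "exp (l * m) * ravg ks (\<lambda>s. exp (- (l * f s))) d \<le> 
        ravg ks (\<lambda>s. exp (l * f s)) d * ravg ks (\<lambda>s. exp (- (l * f s))) d"
      by (intro mult_right_mono j1 less_imp_le[OF ravg_pos]) auto
    then have "exp (l * m) * ravg ks (\<lambda>s. exp (- (l * f s))) d \<le> exp (4 * (l * L)\<^sup>2)" using prod by linarith
    then show ?thesis by (simp add: exp_diff field_simps)
  qed
  have "ravg ks (\<lambda>s. of_bool (\<bar>f s - m\<bar> > r)) d 
    \<le> ravg ks (\<lambda>s. exp (- (l * (m + r))) * exp (l * f s) + exp (l * (m - r)) * exp (- (l * f s))) d"
  proof (rule ravg_mono)
    fix s
    have e: "exp (- (l * (m + r))) * exp (l * f s) = exp (l * (f s - m - r))"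
      "exp (l * (m - r)) * exp (- (l * f s)) = exp (l * (m - f s - r))"
      by (simp_all add: algebra_simps flip: exp_add)
    show "of_bool (\<bar>f s - m\<bar> > r) \<le> exp (- (l * (m + r))) * exp (l * f s) + exp (l * (m - r)) * exp (- (l * f s))"
    proof (cases "\<bar>f s - m\<bar> > r")
      case True
      then have "0 \<le> l * (f s - m - r) \<or> 0 \<le> l * (m - f s - r)" using l0 by (auto simp: abs_if split: if_splits)
      then have "1 \<le> exp (l * (f s - m - r)) \<or> 1 \<le> exp (l * (m - f s - r))" by simp
      then show ?thesis unfolding e using True
        by (smt (verit, best) exp_gt_zero of_bool_eq(2))
    qed (auto intro: add_nonneg_nonneg)
  qed
  also have "\<dots> = exp (- (l * (m + r))) * ravg ks (\<lambda>s. exp (l * f s)) d 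
      + exp (l * (m - r)) * ravg ks (\<lambda>s. exp (- (l * f s))) d"
    by (simp add: ravg_add ravg_cmult)
  also have "\<dots> \<le> exp (- (l * (m + r))) * exp (4 * (l * L)\<^sup>2 + l * m) 
      + exp (l * (m - r)) * exp (4 * (l * L)\<^sup>2 - l * m)"
    using uu ll by (intro add_mono mult_left_mono) auto
  also have "\<dots> = 2 * exp (4 * (l * L)\<^sup>2 - l * r)"
    by (simp add: algebra_simps flip: exp_add)
  also have "4 * (l * L)\<^sup>2 - l * r = - r\<^sup>2 / (16 * L\<^sup>2)"
    using L by (simp add: l_def power2_eq_square field_simps)
  finally show ?thesis by (simp add: m_def)
qed

subsection \<open>One-dimensional comparison of Gaussian mixtures\<close>

definition cvx_lip :: "real \<Rightarrow> (real \<Rightarrow> real) \<Rightarrow> bool" where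
  "cvx_lip c h \<longleftrightarrow> convex_on UNIV h \<and> (\<forall>x y. \<bar>h x - h y\<bar> \<le> c * \<bar>x - y\<bar>)"

lemma cvx_lip_measurable: "cvx_lip c h \<Longrightarrow> h \<in> borel_measurable borel"
  unfolding cvx_lip_def
  by (intro borel_measurable_continuous_onI convex_on_continuous) auto

lemma cvx_lip_integrable:
  assumes "cvx_lip c h" "0 < \<sigma>"
  shows "integrable lborel (\<lambda>x. h x * normal_density \<mu> \<sigma> x)"
proof (rule Bochner_Integration.integrable_bound)
  show "integrable lborel (\<lambda>x. \<bar>h \<mu>\<bar> * normal_density \<mu> \<sigma> x + \<bar>c\<bar> * (normal_density \<mu> \<sigma> x * \<bar>x - \<mu>\<bar> ^ 1))"
    using assms(2) by (intro Bochner_Integration.integrable_add integrable_mult_right 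
        integrable_normal_density integrable_normal_moment_abs) auto
  show "(\<lambda>x. h x * normal_density \<mu> \<sigma> x) \<in> borel_measurable lborel"
    using cvx_lip_measurable[OF assms(1)] by measurable
  show "AE x in lborel. norm (h x * normal_density \<mu> \<sigma> x)
      \<le> norm (\<bar>h \<mu>\<bar> * normal_density \<mu> \<sigma> x + \<bar>c\<bar> * (normal_density \<mu> \<sigma> x * \<bar>x - \<mu>\<bar> ^ 1))"
  proof (rule AE_I2)
    fix x
    have "\<bar>h x - h \<mu>\<bar> \<le> c * \<bar>x - \<mu>\<bar>" using assms(1) by (auto simp: cvx_lip_def)
    also have "\<dots> \<le> \<bar>c\<bar> * \<bar>x - \<mu>\<bar>" by (intro mult_right_mono) auto
    finally have "\<bar>h x\<bar> \<le> \<bar>h \<mu>\<bar> + \<bar>c\<bar> * \<bar>x - \<mu>\<bar>" by linarith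
    then have "\<bar>h x\<bar> * normal_density \<mu> \<sigma> x \<le> (\<bar>h \<mu>\<bar> + \<bar>c\<bar> * \<bar>x - \<mu>\<bar>) * normal_density \<mu> \<sigma> x"
      by (intro mult_right_mono) auto
    also have "\<dots> = \<bar>h \<mu>\<bar> * normal_density \<mu> \<sigma> x + \<bar>c\<bar> * (normal_density \<mu> \<sigma> x * \<bar>x - \<mu>\<bar> ^ 1)"
      by (simp add: algebra_simps)
    finally show "norm (h x * normal_density \<mu> \<sigma> x)
      \<le> norm (\<bar>h \<mu>\<bar> * normal_density \<mu> \<sigma> x + \<bar>c\<bar> * (normal_density \<mu> \<sigma> x * \<bar>x - \<mu>\<bar> ^ 1))"
      by (simp add: abs_mult)
  qed
qed

text \<open>An even density sees only the even part of a function, and the even part of a convex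
  function is monotone in the absolute value. This monotonicity is what a comparison by crossing
  densities requires.\<close>

definition even_part :: "(real \<Rightarrow> real) \<Rightarrow> real \<Rightarrow> real" where
  "even_part h x = (h x + h (- x)) / 2"

lemma cvx_lip_even_part:
  assumes "cvx_lip c h"
  shows "cvx_lip c (even_part h)"
  unfolding cvx_lip_def
proof (intro conjI allI)
  have h: "convex_on UNIV h" and l: "\<And>x y. \<bar>h x - h y\<bar> \<le> c * \<bar>x - y\<bar>" 
    using assms by (auto simp: cvx_lip_def)
  show "convex_on UNIV (even_part h)"
  proof (rule convex_onI)
    fix t x y :: real assume t: "0 < t" "t < 1"
    have "h ((1 - t) *\<^sub>R x + t *\<^sub>R y) \<le> (1 - t) * h x + t * h y"
      using convex_onD[OF h, of t x y] t by simp
    moreover have "h ((1 - t) *\<^sub>R (-x) + t *\<^sub>R (-y)) \<le> (1 - t) * h (-x) + t * h (-y)"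
      using convex_onD[OF h, of t "-x" "-y"] t by simp
    moreover have "(1 - t) *\<^sub>R (-x) + t *\<^sub>R (-y) = - ((1 - t) *\<^sub>R x + t *\<^sub>R y)" by simp
    ultimately show "even_part h ((1 - t) *\<^sub>R x + t *\<^sub>R y) \<le> (1 - t) * even_part h x + t * even_part h y"
      by (simp add: even_part_def field_simps)
  qed auto
  fix x y
  show "\<bar>even_part h x - even_part h y\<bar> \<le> c * \<bar>x - y\<bar>"
  proof -
    have "\<bar>h (-x) - h (-y)\<bar> \<le> c * \<bar>x - y\<bar>" using l[of "-x" "-y"] by (simp add: abs_minus_commute)
    moreover have "even_part h x - even_part h y = ((h x - h y) + (h (-x) - h (-y))) / 2"
      by (simp add: even_part_def field_simps)
    moreover have "\<bar>(a + b) / 2\<bar> \<le> r" if "\<bar>a\<bar> \<le> r" "\<bar>b\<bar> \<le> r" for a b r :: real using that by (auto simp: abs_le_iff)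
    ultimately show ?thesis using l[of x y] by simp
  qed
qed

text \<open>If \<open>\<bar>x\<bar> \<le> \<bar>y\<bar>\<close> then \<open>x\<close> is a convex
  combination of \<open>y\<close> and \<open>- y\<close>, where the even part takes the same
  value.\<close>

lemma even_part_mono:
  assumes "cvx_lip c h" "\<bar>x\<bar> \<le> \<bar>y\<bar>"
  shows "even_part h x \<le> even_part h y"
proof (cases "y = 0")
  case False
  have c: "convex_on UNIV (even_part h)" using cvx_lip_even_part[OF assms(1)] by (simp add: cvx_lip_def)
  define t where "t = (1 - x / y) / 2"
  have "\<bar>x / y\<bar> \<le> 1" using False assms(2) by (simp add: abs_divide)
  then have "x / y \<le> 1" "- 1 \<le> x / y" by linarith+
  then have t: "0 \<le> t" "t \<le> 1" by (auto simp: t_def)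
  have "x = (1 - t) *\<^sub>R y + t *\<^sub>R (- y)" using False by (simp add: t_def field_simps)
  then have "even_part h x \<le> (1 - t) * even_part h y + t * even_part h (- y)"
    using convex_onD[OF c, of t y "-y"] t by simp
  also have "even_part h (-y) = even_part h y" by (simp add: even_part_def)
  finally show ?thesis by (simp add: algebra_simps)
qed (use assms in auto)

lemma integral_even_part:
  fixes p :: "real \<Rightarrow> real"
  assumes p: "\<And>x. p (- x) = p x" and i: "integrable lborel (\<lambda>x. h x * p x)"
  shows "(\<integral>x. even_part h x * p x \<partial>lborel) = (\<integral>x. h x * p x \<partial>lborel)"
    and "integrable lborel (\<lambda>x. even_part h x * p x)"
proof -
  have i': "integrable lborel (\<lambda>x. h (-x) * p x)"
    using lborel_integrable_real_affine[OF i, of "-1" 0] p by simp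
  have e: "(\<integral>x. h (-x) * p x \<partial>lborel) = (\<integral>x. h x * p x \<partial>lborel)"
    using lborel_integral_real_affine[of "-1" "\<lambda>x. h x * p x" 0] p by simp
  have eq: "(\<lambda>x. even_part h x * p x) = (\<lambda>x. (h x * p x + h (-x) * p x) / 2)"
    by (auto simp: even_part_def field_simps)
  show "(\<integral>x. even_part h x * p x \<partial>lborel) = (\<integral>x. h x * p x \<partial>lborel)"
    "integrable lborel (\<lambda>x. even_part h x * p x)"
    unfolding eq using i i' e by simp_all
qed

text \<open>The quotient \<open>p / q\<close> decreases in the absolute value, so
  \<open>q - p\<close> changes sign once, from negative to positive, at some \<open>x0\<close>. Then
  \<open>(h x - h x0) * (q x - p x)\<close> is nonnegative everywhere, and the constant
  \<open>h x0\<close> integrates to zero because the masses agree.\<close>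

lemma single_crossing_le:
  fixes p q h :: "real \<Rightarrow> real"
  assumes h: "\<And>x y. \<bar>x\<bar> \<le> \<bar>y\<bar> \<Longrightarrow> h x \<le> h y"
    and p: "\<And>x. p (- x) = p x" "\<And>x. 0 < p x" and q: "\<And>x. q (- x) = q x" "\<And>x. 0 < q x"
    and ratio: "\<And>x y. 0 \<le> x \<Longrightarrow> x \<le> y \<Longrightarrow> p y * q x \<le> p x * q y"
    and i: "integrable lborel p" "integrable lborel q"
      "integrable lborel (\<lambda>x. h x * p x)" "integrable lborel (\<lambda>x. h x * q x)"
    and eq: "(\<integral>x. p x \<partial>lborel) = (\<integral>x. q x \<partial>lborel)"
  shows "(\<integral>x. h x * p x \<partial>lborel) \<le> (\<integral>x. h x * q x \<partial>lborel)"
proof -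
  define S where "S = {t. 0 \<le> t \<and> q t < p t}"
  have pa: "p \<bar>x\<bar> = p x" "q \<bar>x\<bar> = q x" for x using p q by (auto simp: abs_if)
  have down: "q x \<le> p x" if "y \<in> S" "\<bar>x\<bar> \<le> y" for x y
  proof -
    have "p y * q \<bar>x\<bar> \<le> p \<bar>x\<bar> * q y" using ratio[of "\<bar>x\<bar>" y] that by simp
    also have "\<dots> \<le> p \<bar>x\<bar> * p y" using that p(2)[of "\<bar>x\<bar>"] by (auto simp: S_def)
    finally show ?thesis using p(2)[of y] by (simp add: pa mult.commute)
  qed
  show ?thesis
  proof (cases "bdd_above S")
    \<comment> \<open>A crossing point at infinity: \<open>p\<close> dominates \<open>q\<close>
      everywhere and equal masses make them equal almost everywhere.\<close>
    case False
    then have "\<exists>y\<in>S. \<bar>x\<bar> \<le> y" for x unfolding bdd_above_def by (meson linear)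
    then have le: "q x \<le> p x" for x using down by blast
    have "AE x in lborel. p x - q x = 0"
      using integral_nonneg_eq_0_iff_AE[of lborel "\<lambda>x. p x - q x"] i eq le by auto
    then have "(\<integral>x. h x * p x \<partial>lborel) = (\<integral>x. h x * q x \<partial>lborel)"
      using i by (intro integral_cong_AE) auto
    then show ?thesis by simp
  next
    case True
    define x0 where "x0 = Sup (insert 0 S)"
    have bdd: "bdd_above (insert 0 S)" using True by simp
    have x0: "0 \<le> x0" unfolding x0_def using bdd by (intro cSup_upper) auto
    have nn: "0 \<le> (h x - h x0) * (q x - p x)" for x
    proof (cases "\<bar>x\<bar> < x0")
      case True
      then obtain y where "y \<in> insert 0 S" "\<bar>x\<bar> < y"
        unfolding x0_def by (meson less_cSupE insert_not_empty)
      then have "q x \<le> p x" using down[of y x] by auto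
      moreover have "h x \<le> h x0" using h[of x x0] True x0 by simp
      ultimately show ?thesis by (intro mult_nonpos_nonpos) auto
    next
      case False
      have "h x0 \<le> h x" using h[of x0 x] False x0 by simp
      \<comment> \<open>At the crossing point itself the order of the densities is open, but there
        the factor \<open>h x - h x0\<close> vanishes.\<close>
      moreover have "p x \<le> q x \<or> \<bar>x\<bar> = x0"
      proof (rule ccontr)
        assume "\<not> ?thesis"
        then have "\<bar>x\<bar> \<in> S" "\<bar>x\<bar> > x0" using False pa by (auto simp: S_def not_le)
        then show False using cSup_upper[OF _ bdd, of "\<bar>x\<bar>"] by (simp add: x0_def)
      qed
      moreover have "h x = h x0" if "\<bar>x\<bar> = x0" using h[of x x0] h[of x0 x] that x0 by auto
      ultimately show ?thesis by auto
    qed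
    have "0 \<le> (\<integral>x. (h x - h x0) * (q x - p x) \<partial>lborel)" using nn by (intro integral_nonneg_AE) auto
    also have "\<dots> = (\<integral>x. (h x * q x - h x * p x) - h x0 * (q x - p x) \<partial>lborel)"
      by (intro Bochner_Integration.integral_cong) (auto simp: algebra_simps)
    also have "\<dots> = (\<integral>x. h x * q x \<partial>lborel) - (\<integral>x. h x * p x \<partial>lborel)"
      using i eq by simp
    finally show ?thesis by simp
  qed
qed

text \<open>A Gaussian mixture has lighter tails than a Gaussian of almost the same variance, so the reverse comparison
  holds only up to the tail beyond \<open>X\<close>, which \<open>w\<close> pays for.\<close>

lemma truncated_crossing_le:
  fixes p q h :: "real \<Rightarrow> real"
  assumes h: "\<And>x y. \<bar>x\<bar> \<le> \<bar>y\<bar> \<Longrightarrow> h x \<le> h y" and lip: "\<And>x y. \<bar>h x - h y\<bar> \<le> c * \<bar>x - y\<bar>"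
    and p: "\<And>x. p (- x) = p x" "\<And>x. 0 < p x" and q: "\<And>x. q (- x) = q x" "\<And>x. 0 < q x"
    and X: "0 \<le> X"
    and ratio: "\<And>x y. 0 \<le> x \<Longrightarrow> x \<le> y \<Longrightarrow> y \<le> X \<Longrightarrow> p x * q y \<le> p y * q x"
    and i: "integrable lborel p" "integrable lborel q"
      "integrable lborel (\<lambda>x. h x * p x)" "integrable lborel (\<lambda>x. h x * q x)"
      "integrable lborel w" 
    and w: "\<And>x. 0 \<le> w x" "\<And>x. X < \<bar>x\<bar> \<Longrightarrow> c * \<bar>x\<bar> * q x \<le> w x"
    and eq: "(\<integral>x. p x \<partial>lborel) = (\<integral>x. q x \<partial>lborel)"
  shows "(\<integral>x. h x * q x \<partial>lborel) \<le> (\<integral>x. h x * p x \<partial>lborel) + (\<integral>x. w x \<partial>lborel)"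
proof -
  define S where "S = {t. 0 \<le> t \<and> t \<le> X \<and> p t < q t}"
  have pa: "p \<bar>x\<bar> = p x" "q \<bar>x\<bar> = q x" for x using p q by (auto simp: abs_if)
  have c: "0 \<le> c" using lip[of 1 0] by simp
  have down: "p x \<le> q x" if "y \<in> S" "\<bar>x\<bar> \<le> y" for x y
  proof -
    have "p \<bar>x\<bar> * q y \<le> p y * q \<bar>x\<bar>" using ratio[of "\<bar>x\<bar>" y] that by (simp add: S_def)
    also have "\<dots> \<le> q y * q \<bar>x\<bar>" using that q(2)[of "\<bar>x\<bar>"] by (auto simp: S_def)
    finally show ?thesis using q(2)[of y] by (simp add: pa mult.commute)
  qed
  define x0 where "x0 = Sup (insert 0 S)"
  have bdd: "bdd_above (insert 0 S)" by (auto simp: S_def intro!: bdd_aboveI[of _ "max 0 X"])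
  have x0: "0 \<le> x0" unfolding x0_def using bdd by (intro cSup_upper) auto
  have x0X: "x0 \<le> X" unfolding x0_def using X by (intro cSup_least) (auto simp: S_def)
  have nn: "(h x - h x0) * (q x - p x) \<le> w x" for x
  proof (cases "\<bar>x\<bar> < x0")
    case True
    then obtain y where "y \<in> insert 0 S" "\<bar>x\<bar> < y"
      unfolding x0_def by (meson less_cSupE insert_not_empty)
    then have "p x \<le> q x" using down[of y x] by auto
    moreover have "h x \<le> h x0" using h[of x x0] True x0 by simp
    ultimately have "(h x - h x0) * (q x - p x) \<le> 0" by (intro mult_nonpos_nonneg) auto
    then show ?thesis using w(1)[of x] by linarith
  next
    case False
    have le: "h x0 \<le> h x" using h[of x0 x] False x0 by simp
    show ?thesis
    proof (cases "\<bar>x\<bar> \<le> X")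
      case True
      have "q x \<le> p x \<or> \<bar>x\<bar> = x0"
      proof (rule ccontr)
        assume "\<not> ?thesis"
        then have "\<bar>x\<bar> \<in> S" "\<bar>x\<bar> > x0" using False True pa by (auto simp: S_def not_le)
        then show False using cSup_upper[OF _ bdd, of "\<bar>x\<bar>"] by (simp add: x0_def)
      qed
      moreover have "h x = h x0" if "\<bar>x\<bar> = x0" using h[of x x0] h[of x0 x] that x0 by auto
      ultimately have "(h x - h x0) * (q x - p x) \<le> 0" using le by (auto intro: mult_nonneg_nonpos)
      then show ?thesis using w(1)[of x] by linarith
    next
      case False
      have "h x - h x0 \<le> c * \<bar>x\<bar>"
      proof -
        have "h x = h \<bar>x\<bar>" using h[of x "\<bar>x\<bar>"] h[of "\<bar>x\<bar>" x] by simp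
        also have "\<dots> - h x0 \<le> c * \<bar>\<bar>x\<bar> - x0\<bar>" using lip[of "\<bar>x\<bar>" x0] by simp
        also have "\<dots> \<le> c * \<bar>x\<bar>" using c x0 x0X False by (intro mult_left_mono) auto
        finally show ?thesis by simp
      qed
      then have "(h x - h x0) * (q x - p x) \<le> c * \<bar>x\<bar> * q x"
      proof -
        assume a: "h x - h x0 \<le> c * \<bar>x\<bar>"
        have "(h x - h x0) * (q x - p x) \<le> (h x - h x0) * q x"
          using le p(2)[of x] by (intro mult_left_mono) auto
        also have "\<dots> \<le> c * \<bar>x\<bar> * q x" using a q(2)[of x] by (intro mult_right_mono) auto
        finally show ?thesis .
      qed
      then show ?thesis using w(2)[of x] False by simp
    qed
  qed
  have "(\<integral>x. h x * q x \<partial>lborel) - (\<integral>x. h x * p x \<partial>lborel)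
      = (\<integral>x. (h x * q x - h x * p x) - h x0 * (q x - p x) \<partial>lborel)" using i eq by simp
  also have "\<dots> = (\<integral>x. (h x - h x0) * (q x - p x) \<partial>lborel)"
    by (intro Bochner_Integration.integral_cong) (auto simp: algebra_simps)
  also have "\<dots> \<le> (\<integral>x. w x \<partial>lborel)"
  proof (intro integral_mono nn i)
    have "(\<lambda>x. (h x - h x0) * (q x - p x)) = (\<lambda>x. (h x * q x - h x * p x) - h x0 * (q x - p x))"
      by (auto simp: algebra_simps)
    then show "integrable lborel (\<lambda>x. (h x - h x0) * (q x - p x))" using i by simp
  qed
  finally show ?thesis by simp
qed

section \<open>Monotonicity of the quotient of a sign-Gaussian mixture and a Gaussian\<close>

lemma sinh_le_cosh: "0 \<le> y \<Longrightarrow> sinh y \<le> y * cosh (y::real)"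
proof -
  assume y: "0 \<le> y"
  have "(\<lambda>y. y * cosh y - sinh y) 0 \<le> (\<lambda>y. y * cosh y - sinh (y::real)) y"
    by (rule DERIV_nonneg_imp_nondecreasing[OF y])
      (auto intro!: exI derivative_eq_intros)
  then show ?thesis by simp
qed

text \<open>The Taylor bound \<open>tanh y \<ge> y - y^3 / 3\<close> without division; the
  derivative of the difference is controlled by the opposite bound
  \<open>tanh y \<le> y\<close>.\<close>

lemma sinh_ge_cosh: "0 \<le> y \<Longrightarrow> (y - y^3/3) * cosh (y::real) \<le> sinh y"
proof -
  assume y: "0 \<le> y"
  have "(\<lambda>y. sinh y - (y - y^3/3) * cosh y) 0 \<le> (\<lambda>y. sinh y - (y - y^3/3) * cosh (y::real)) y"
  proof (rule DERIV_nonneg_imp_nondecreasing[OF y], intro exI conjI)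
    fix x :: real assume x: "0 \<le> x" "x \<le> y"
    show "((\<lambda>y. sinh y - (y - y^3/3) * cosh y) has_real_derivative 
        (cosh x - ((1 - x\<^sup>2) * cosh x + (x - x^3/3) * sinh x))) (at x)"
      by (auto intro!: derivative_eq_intros simp: field_simps power2_eq_square)
    have "0 \<le> x * (x * cosh x - sinh x) + x^3/3 * sinh x" using x sinh_le_cosh[of x] by simp
    also have "\<dots> = cosh x - ((1 - x\<^sup>2) * cosh x + (x - x^3/3) * sinh x)"
      by (simp add: algebra_simps power2_eq_square)
    finally show "0 \<le> cosh x - ((1 - x\<^sup>2) * cosh x + (x - x^3/3) * sinh x)" .
  qed
  then show ?thesis by simp
qed

lemma cosh_gauss_deriv:
  "((\<lambda>x. cosh (a * x) * exp (- k * x\<^sup>2 / 2)) has_real_derivative 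
     (a * sinh (a * x) - k * x * cosh (a * x)) * exp (- k * x\<^sup>2 / 2)) (at x)"
  by (auto intro!: derivative_eq_intros simp: algebra_simps)

text \<open>The derivative has the sign of \<open>a * tanh (a * x) - k * x\<close>, so
  \<open>tanh y \<le> y\<close> makes \<open>a^2 \<le> k\<close> sufficient.\<close>

lemma cosh_gauss_antimono:
  fixes a k x y :: real
  assumes "0 \<le> a" "a\<^sup>2 \<le> k" "0 \<le> x" "x \<le> y"
  shows "cosh (a * y) * exp (- k * y\<^sup>2 / 2) \<le> cosh (a * x) * exp (- k * x\<^sup>2 / 2)"
proof (rule DERIV_nonpos_imp_nonincreasing[OF assms(4)], intro exI conjI)
  fix z assume z: "x \<le> z" "z \<le> y"
  show "((\<lambda>x. cosh (a * x) * exp (- k * x\<^sup>2 / 2)) has_real_derivative 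
     (a * sinh (a * z) - k * z * cosh (a * z)) * exp (- k * z\<^sup>2 / 2)) (at z)" by (rule cosh_gauss_deriv)
  have "a * sinh (a * z) \<le> a * ((a * z) * cosh (a * z))"
    using assms z sinh_le_cosh[of "a * z"] by (intro mult_left_mono) auto
  also have "\<dots> = a\<^sup>2 * (z * cosh (a * z))" by (simp add: power2_eq_square)
  also have "\<dots> \<le> k * (z * cosh (a * z))" using assms z by (intro mult_right_mono) (auto intro!: mult_nonneg_nonneg)
  finally show "(a * sinh (a * z) - k * z * cosh (a * z)) * exp (- k * z\<^sup>2 / 2) \<le> 0"
    by (intro mult_nonpos_nonneg) auto
qed

text \<open>Here the lower Taylor bound for tanh decides the sign of the derivative. Its cubic term
  is harmless only while \<open>a * y\<close> is small, hence monotonicity on a bounded range and a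
  slightly smaller \<open>k\<close>.\<close>

lemma cosh_gauss_mono:
  fixes a k x y :: real
  assumes "0 \<le> a" "k \<le> a\<^sup>2 * (1 - (a * y)\<^sup>2 / 3)" "0 \<le> x" "x \<le> y"
  shows "cosh (a * x) * exp (- k * x\<^sup>2 / 2) \<le> cosh (a * y) * exp (- k * y\<^sup>2 / 2)"
proof (rule DERIV_nonneg_imp_nondecreasing[OF assms(4)], intro exI conjI)
  fix z assume z: "x \<le> z" "z \<le> y"
  show "((\<lambda>x. cosh (a * x) * exp (- k * x\<^sup>2 / 2)) has_real_derivative 
     (a * sinh (a * z) - k * z * cosh (a * z)) * exp (- k * z\<^sup>2 / 2)) (at z)" by (rule cosh_gauss_deriv)
  have "(a * z)\<^sup>2 \<le> (a * y)\<^sup>2" using assms z by (intro power_mono mult_left_mono) auto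
  then have "a\<^sup>2 * (1 - (a * y)\<^sup>2 / 3) \<le> a\<^sup>2 * (1 - (a * z)\<^sup>2 / 3)" by (intro mult_left_mono) auto
  then have "k \<le> a\<^sup>2 * (1 - (a * z)\<^sup>2 / 3)" using assms by linarith
  then have "k * (z * cosh (a * z)) \<le> a\<^sup>2 * (1 - (a * z)\<^sup>2 / 3) * (z * cosh (a * z))"
    using assms z by (intro mult_right_mono) (auto intro!: mult_nonneg_nonneg)
  also have "\<dots> = a * ((a * z - (a * z)^3 / 3) * cosh (a * z))" 
    by (simp add: algebra_simps power2_eq_square power3_eq_cube)
  also have "\<dots> \<le> a * sinh (a * z)"
    using assms z sinh_ge_cosh[of "a * z"] by (intro mult_left_mono) auto
  finally show "0 \<le> (a * sinh (a * z) - k * z * cosh (a * z)) * exp (- k * z\<^sup>2 / 2)"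
    by (intro mult_nonneg_nonneg) (auto simp: mult.assoc)
qed

text \<open>The density of a centred Gaussian of standard deviation \<sigma> plus an independent
  random sign times \<open>b\<close>.\<close>

definition mixture :: "real \<Rightarrow> real \<Rightarrow> real \<Rightarrow> real" where
  "mixture b \<sigma> x = (normal_density b \<sigma> x + normal_density (- b) \<sigma> x) / 2"

lemma mixture_props:
  assumes "0 < \<sigma>"
  shows "mixture b \<sigma> (- x) = mixture b \<sigma> x" "0 < mixture b \<sigma> x"
    "integrable lborel (mixture b \<sigma>)" "(\<integral>x. mixture b \<sigma> x \<partial>lborel) = 1"
proof -
  show "mixture b \<sigma> (- x) = mixture b \<sigma> x" 
    by (simp add: mixture_def normal_density_def power2_eq_square algebra_simps)
  show "0 < mixture b \<sigma> x" using assms normal_density_pos[OF assms] by (simp add: mixture_def add_pos_pos)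
  have e: "mixture b \<sigma> = (\<lambda>x. (normal_density b \<sigma> x + normal_density (- b) \<sigma> x) / 2)"
    by (auto simp: mixture_def)
  show "integrable lborel (mixture b \<sigma>)" "(\<integral>x. mixture b \<sigma> x \<partial>lborel) = 1"
    unfolding e using assms by simp_all
qed

text \<open>Completing the square: up to a constant, the quotient with a centred Gaussian is the
  cosh-Gauss function studied above, so both crossing criteria reduce to its monotonicity.\<close>

lemma mixture_ratio:
  assumes s: "0 < \<sigma>" "0 < \<tau>"
  obtains A where "0 < A" "\<And>x. mixture b \<sigma> x = 
    A * (cosh (b / \<sigma>\<^sup>2 * x) * exp (- (1 / \<sigma>\<^sup>2 - 1 / \<tau>\<^sup>2) * x\<^sup>2 / 2)) * normal_density 0 \<tau> x"
proof
  let ?A = "exp (- b\<^sup>2 / (2 * \<sigma>\<^sup>2)) * sqrt (2 * pi * \<tau>\<^sup>2) / sqrt (2 * pi * \<sigma>\<^sup>2)"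
  show "0 < ?A" using s by simp
  fix x
  have 1: "exp (- (x - c)\<^sup>2 / (2 * \<sigma>\<^sup>2)) = exp (- c\<^sup>2 / (2 * \<sigma>\<^sup>2)) * exp (c / \<sigma>\<^sup>2 * x) * exp (- x\<^sup>2 / (2 * \<sigma>\<^sup>2))" for c
    using s by (simp add: power2_eq_square field_simps flip: exp_add)
  have 2: "exp (- x\<^sup>2 / (2 * \<sigma>\<^sup>2)) = exp (- (1 / \<sigma>\<^sup>2 - 1 / \<tau>\<^sup>2) * x\<^sup>2 / 2) * exp (- x\<^sup>2 / (2 * \<tau>\<^sup>2))"
    using s by (simp add: field_simps flip: exp_add)
  have "mixture b \<sigma> x = (1 / sqrt (2 * pi * \<sigma>\<^sup>2)) * (exp (- b\<^sup>2 / (2 * \<sigma>\<^sup>2)) * cosh (b / \<sigma>\<^sup>2 * x)) * exp (- x\<^sup>2 / (2 * \<sigma>\<^sup>2))"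
    unfolding mixture_def normal_density_def using 1[of b] 1[of "-b"]
    by (simp add: cosh_field_def add_divide_distrib distrib_left distrib_right)
  also have "\<dots> = ?A * (cosh (b / \<sigma>\<^sup>2 * x) * exp (- (1 / \<sigma>\<^sup>2 - 1 / \<tau>\<^sup>2) * x\<^sup>2 / 2)) * 
      (1 / sqrt (2 * pi * \<tau>\<^sup>2) * exp (- x\<^sup>2 / (2 * \<tau>\<^sup>2)))"
    unfolding 2 using s by simp
  finally show "mixture b \<sigma> x = ?A * (cosh (b / \<sigma>\<^sup>2 * x) * exp (- (1 / \<sigma>\<^sup>2 - 1 / \<tau>\<^sup>2) * x\<^sup>2 / 2)) * normal_density 0 \<tau> x"
    by (simp add: normal_density_def)
qed

lemma integral_mixture:
  assumes "cvx_lip c h" "0 < \<sigma>"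
  shows "(\<integral>x. h x * mixture b \<sigma> x \<partial>lborel) = (\<integral>x. (h (x + b) + h (x - b)) / 2 * normal_density 0 \<sigma> x \<partial>lborel)"
    and "integrable lborel (\<lambda>x. h x * mixture b \<sigma> x)"
proof -
  have i: "integrable lborel (\<lambda>x. h x * normal_density b \<sigma> x)" for b using cvx_lip_integrable[OF assms] .
  have e: "(\<integral>x. h x * normal_density b \<sigma> x \<partial>lborel) = (\<integral>x. h (x + b) * normal_density 0 \<sigma> x \<partial>lborel)" for b
    using lborel_integral_real_affine[of 1 "\<lambda>x. h x * normal_density b \<sigma> x" b]
    by (simp add: normal_density_def add.commute)
  have i2: "integrable lborel (\<lambda>x. h (x + b) * normal_density 0 \<sigma> x)" for b
    using lborel_integrable_real_affine[OF i, of 1 b b] by (simp add: normal_density_def add.commute)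
  have s: "(\<lambda>x. h x * mixture b \<sigma> x) = (\<lambda>x. (h x * normal_density b \<sigma> x + h x * normal_density (-b) \<sigma> x) / 2)"
    "(\<lambda>x. (h (x + b) + h (x - b)) / 2 * normal_density 0 \<sigma> x) = 
     (\<lambda>x. (h (x + b) * normal_density 0 \<sigma> x + h (x + (-b)) * normal_density 0 \<sigma> x) / 2)"
    by (auto simp: mixture_def field_simps)
  show "(\<integral>x. h x * mixture b \<sigma> x \<partial>lborel) = (\<integral>x. (h (x + b) + h (x - b)) / 2 * normal_density 0 \<sigma> x \<partial>lborel)"
    "integrable lborel (\<lambda>x. h x * mixture b \<sigma> x)"
    unfolding s using i i2[of b] i2[of "-b"] e[of b] e[of "-b"] by simp_all
qed

section \<open>Exchanging one random sign for Gaussian variance\<close>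

abbreviation gauss :: "real measure" where
  "gauss \<equiv> density lborel (\<lambda>x. ennreal (std_normal_density x))"

lemma gauss_integral_scale:
  assumes "h \<in> borel_measurable borel" "0 < \<sigma>"
  shows "(\<integral>t. h (\<sigma> * t) \<partial>gauss) = (\<integral>x. h x * normal_density 0 \<sigma> x \<partial>lborel)"
    and "integrable lborel (\<lambda>x. h x * normal_density 0 \<sigma> x) \<Longrightarrow> integrable gauss (\<lambda>t. h (\<sigma> * t))"
proof -
  have n: "\<sigma> * normal_density 0 \<sigma> (\<sigma> * t) = std_normal_density t" for t
    using assms(2) by (simp add: normal_density_def std_normal_density_def real_sqrt_mult power_mult_distrib)
  have m: "(\<lambda>t. h (\<sigma> * t)) \<in> borel_measurable lborel" using assms by measurable
  have "(\<integral>t. h (\<sigma> * t) \<partial>gauss) = (\<integral>t. std_normal_density t * h (\<sigma> * t) \<partial>lborel)"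
    using m by (subst integral_density) auto
  also have "\<dots> = \<sigma> * (\<integral>t. h (\<sigma> * t) * normal_density 0 \<sigma> (\<sigma> * t) \<partial>lborel)"
    by (subst integral_mult_right_zero[symmetric]) (simp add: n[symmetric] mult_ac)
  also have "\<dots> = (\<integral>x. h x * normal_density 0 \<sigma> x \<partial>lborel)"
    using lborel_integral_real_affine[of \<sigma> "\<lambda>x. h x * normal_density 0 \<sigma> x" 0] assms by simp
  finally show "(\<integral>t. h (\<sigma> * t) \<partial>gauss) = (\<integral>x. h x * normal_density 0 \<sigma> x \<partial>lborel)" .
  assume "integrable lborel (\<lambda>x. h x * normal_density 0 \<sigma> x)"
  from lborel_integrable_real_affine[OF this, of \<sigma> 0] assms
  have "integrable lborel (\<lambda>t. \<sigma> * (h (\<sigma> * t) * normal_density 0 \<sigma> (\<sigma> * t)))" by simp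
  also have "(\<lambda>t. \<sigma> * (h (\<sigma> * t) * normal_density 0 \<sigma> (\<sigma> * t))) = (\<lambda>t. std_normal_density t * h (\<sigma> * t))"
    by (auto simp: n[symmetric])
  finally show "integrable gauss (\<lambda>t. h (\<sigma> * t))" using m by (subst integrable_density) auto
qed

lemma gauss_prob: "prob_space gauss"
  by (rule prob_space_normal_density) simp

lemma gauss_abs_moment:
  assumes "0 < \<sigma>"
  shows "integrable lborel (\<lambda>x. \<bar>x\<bar> * normal_density 0 \<sigma> x)" "(\<integral>x. \<bar>x\<bar> * normal_density 0 \<sigma> x \<partial>lborel) \<le> \<sigma>"
proof -
  have i1: "integrable lborel (\<lambda>x. \<bar>x\<bar> * normal_density 0 \<sigma> x)"
    using integrable_normal_moment_abs[OF assms, of 0 1] by (simp add: mult.commute)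
  have i2: "integrable lborel (\<lambda>x. normal_density 0 \<sigma> x * x^2)"
    using integrable_normal_moment[OF assms, of 0 2] by simp
  have v: "(\<integral>x. normal_density 0 \<sigma> x * x^2 \<partial>lborel) = \<sigma>\<^sup>2"
    using integral_normal_moment_even[OF assms, of 0 1] by (simp add: fact_numeral)
  show "integrable lborel (\<lambda>x. \<bar>x\<bar> * normal_density 0 \<sigma> x)" by fact
  have "(\<integral>x. \<bar>x\<bar> * normal_density 0 \<sigma> x \<partial>lborel) 
      \<le> (\<integral>x. \<sigma> / 2 * normal_density 0 \<sigma> x + 1 / (2 * \<sigma>) * (normal_density 0 \<sigma> x * x^2) \<partial>lborel)"
  proof (intro integral_mono i1)
    show "integrable lborel (\<lambda>x. \<sigma> / 2 * normal_density 0 \<sigma> x + 1 / (2 * \<sigma>) * (normal_density 0 \<sigma> x * x^2))"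
      using i2 assms by simp
    fix x
    have "0 \<le> (\<bar>x\<bar> - \<sigma>)\<^sup>2" by simp
    then have "\<bar>x\<bar> \<le> \<sigma> / 2 + 1 / (2 * \<sigma>) * x^2" using assms by (simp add: power2_eq_square field_simps)
    from mult_right_mono[OF this, of "normal_density 0 \<sigma> x"]
    show "\<bar>x\<bar> * normal_density 0 \<sigma> x \<le> \<sigma> / 2 * normal_density 0 \<sigma> x + 1 / (2 * \<sigma>) * (normal_density 0 \<sigma> x * x^2)"
      by (simp add: algebra_simps)
  qed
  also have "\<dots> = \<sigma>" using assms i2 v by (simp add: power2_eq_square field_simps)
  finally show "(\<integral>x. \<bar>x\<bar> * normal_density 0 \<sigma> x \<partial>lborel) \<le> \<sigma>" .
qed

lemma gauss_integral_shift_scale: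
  assumes "cvx_lip c h" "0 < \<sigma>"
  shows "(\<integral>t. (h (\<sigma> * t + b) + h (\<sigma> * t - b)) / 2 \<partial>gauss) = (\<integral>x. h x * mixture b \<sigma> x \<partial>lborel)"
proof -
  have [measurable]: "h \<in> borel_measurable borel" using cvx_lip_measurable[OF assms(1)] .
  show ?thesis
    using gauss_integral_scale(1)[of "\<lambda>x. (h (x + b) + h (x - b)) / 2" \<sigma>] assms(2) integral_mixture(1)[OF assms, of b]
    by simp
qed

text \<open>The hypothesis is the one of \<open>cosh_gauss_antimono\<close> with
  \<open>a = b / \<sigma>^2\<close> and \<open>k = 1 / \<sigma>^2 - 1 / \<tau>^2\<close>: the
  quotient of the mixture by the Gaussian decreases on the whole half-line, so no error term
  appears.\<close>

lemma gauss_step_upper: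
  assumes h: "cvx_lip c h" and s: "0 < \<sigma>" "0 < \<tau>" and k: "(b / \<sigma>\<^sup>2)\<^sup>2 \<le> 1 / \<sigma>\<^sup>2 - 1 / \<tau>\<^sup>2"
  shows "(\<integral>t. (h (\<sigma> * t + b) + h (\<sigma> * t - b)) / 2 \<partial>gauss) \<le> (\<integral>t. h (\<tau> * t) \<partial>gauss)"
proof -
  have main: "(\<integral>t. (h (\<sigma> * t + b) + h (\<sigma> * t - b)) / 2 \<partial>gauss) \<le> (\<integral>t. h (\<tau> * t) \<partial>gauss)" if k: "(b / \<sigma>\<^sup>2)\<^sup>2 \<le> 1 / \<sigma>\<^sup>2 - 1 / \<tau>\<^sup>2" and b: "0 \<le> b" for b
  proof -
    obtain A where A: "0 < A" "\<And>x. mixture b \<sigma> x = 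
      A * (cosh (b / \<sigma>\<^sup>2 * x) * exp (- (1 / \<sigma>\<^sup>2 - 1 / \<tau>\<^sup>2) * x\<^sup>2 / 2)) * normal_density 0 \<tau> x"
      using mixture_ratio[OF s] by metis
    have he: "cvx_lip c (even_part h)" by (rule cvx_lip_even_part[OF h])
    have nd: "normal_density 0 \<tau> (- x) = normal_density 0 \<tau> x" for x by (simp add: normal_density_def)
    have "(\<integral>x. even_part h x * mixture b \<sigma> x \<partial>lborel) \<le> (\<integral>x. even_part h x * normal_density 0 \<tau> x \<partial>lborel)"
    proof (rule single_crossing_le)
      fix x y :: real assume xy: "0 \<le> x" "x \<le> y"
      have "cosh (b / \<sigma>\<^sup>2 * y) * exp (- (1 / \<sigma>\<^sup>2 - 1 / \<tau>\<^sup>2) * y\<^sup>2 / 2) 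
          \<le> cosh (b / \<sigma>\<^sup>2 * x) * exp (- (1 / \<sigma>\<^sup>2 - 1 / \<tau>\<^sup>2) * x\<^sup>2 / 2)"
        using k b xy by (intro cosh_gauss_antimono) auto
      from mult_left_mono[OF this, of "A * normal_density 0 \<tau> y * normal_density 0 \<tau> x"] A(1)
      show "mixture b \<sigma> y * normal_density 0 \<tau> x \<le> mixture b \<sigma> x * normal_density 0 \<tau> y"
        unfolding A(2) by (simp add: mult_ac)
    qed (use even_part_mono[OF h] mixture_props[OF s(1)] nd s integral_mixture(2)[OF he s(1)] 
        cvx_lip_integrable[OF he s(2)] in \<open>auto simp: normal_density_pos\<close>)
    then show ?thesis
      using integral_even_part(1)[OF mixture_props(1)[OF s(1)] integral_mixture(2)[OF h s(1)]]
        integral_even_part(1)[OF nd cvx_lip_integrable[OF h s(2)]] gauss_integral_shift_scale[OF h s(1)]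
        gauss_integral_scale(1)[OF cvx_lip_measurable[OF h] s(2)] by simp
  qed
  show ?thesis
  proof (cases "0 \<le> b")
    case False
    from main[of "- b"] False k show ?thesis by (simp add: add.commute)
  qed (use main k in auto)
qed

text \<open>Giving up a fraction \<delta> of the variance \<open>b^2\<close> makes the quotient
  increasing as long as \<open>(b * x / \<sigma>^2)^2 / 3 \<le> \<delta>\<close>, which
  \<open>bX\<close> guarantees up to \<open>X\<close>. The tail of the wider Gaussian beyond
  \<open>X\<close> is the error.\<close>

lemma gauss_step_lower:
  assumes h: "cvx_lip c h" and s: "0 < \<sigma>" "\<sigma> \<le> \<tau>" and X: "0 \<le> X" and d: "0 \<le> \<delta>"
    and \<tau>: "\<tau>\<^sup>2 \<le> \<sigma>\<^sup>2 + (1 - \<delta>) * b\<^sup>2" and bX: "(b * X)\<^sup>2 \<le> 3 * \<delta> * \<sigma>^4"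
  shows "(\<integral>t. h (\<tau> * t) \<partial>gauss) 
    \<le> (\<integral>t. (h (\<sigma> * t + b) + h (\<sigma> * t - b)) / 2 \<partial>gauss) + 2 * c * \<tau> * exp (- X\<^sup>2 / (4 * \<tau>\<^sup>2))"
proof -
  have t: "0 < \<tau>" using s by simp
  have c: "0 \<le> c" using h abs_ge_zero[of "h 1 - h 0"] unfolding cvx_lip_def 
    by (metis abs_1 diff_zero mult_cancel_left2 order_trans mult.right_neutral)
  have main: "(\<integral>t. h (\<tau> * t) \<partial>gauss) 
    \<le> (\<integral>t. (h (\<sigma> * t + b) + h (\<sigma> * t - b)) / 2 \<partial>gauss) + 2 * c * \<tau> * exp (- X\<^sup>2 / (4 * \<tau>\<^sup>2))" 
    if \<tau>: "\<tau>\<^sup>2 \<le> \<sigma>\<^sup>2 + (1 - \<delta>) * b\<^sup>2" and bX: "(b * X)\<^sup>2 \<le> 3 * \<delta> * \<sigma>^4" and b: "0 \<le> b" for b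
  proof -
    obtain A where A: "0 < A" "\<And>x. mixture b \<sigma> x = 
      A * (cosh (b / \<sigma>\<^sup>2 * x) * exp (- (1 / \<sigma>\<^sup>2 - 1 / \<tau>\<^sup>2) * x\<^sup>2 / 2)) * normal_density 0 \<tau> x"
      using mixture_ratio[OF s(1) t] by metis
    have he: "cvx_lip c (even_part h)" by (rule cvx_lip_even_part[OF h])
    have nd: "normal_density 0 \<tau> (- x) = normal_density 0 \<tau> x" for x by (simp add: normal_density_def)
    \<comment> \<open>Half of the Gaussian exponent supplies the factor
      \<open>exp (- X^2 / (4 * \<tau>^2))\<close>; the other half is a Gaussian of standard
      deviation \<open>sqrt 2 * \<tau>\<close>, whose first absolute moment is at most that. The two
      factors \<open>sqrt 2\<close> give the 2 in the error.\<close>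
    define w where "w = (\<lambda>x. c * sqrt 2 * exp (- X\<^sup>2 / (4 * \<tau>\<^sup>2)) * (\<bar>x\<bar> * normal_density 0 (sqrt 2 * \<tau>) x))"
    have t2: "0 < sqrt 2 * \<tau>" using t by simp
    have "(\<integral>x. even_part h x * normal_density 0 \<tau> x \<partial>lborel) \<le> 
        (\<integral>x. even_part h x * mixture b \<sigma> x \<partial>lborel) + (\<integral>x. w x \<partial>lborel)"
    proof (rule truncated_crossing_le[where c = c and X = X])
      fix x y :: real assume xy: "0 \<le> x" "x \<le> y" "y \<le> X"
      have "cosh (b / \<sigma>\<^sup>2 * x) * exp (- (1 / \<sigma>\<^sup>2 - 1 / \<tau>\<^sup>2) * x\<^sup>2 / 2)
          \<le> cosh (b / \<sigma>\<^sup>2 * y) * exp (- (1 / \<sigma>\<^sup>2 - 1 / \<tau>\<^sup>2) * y\<^sup>2 / 2)"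
      proof (rule cosh_gauss_mono)
        have "(b / \<sigma>\<^sup>2 * y)\<^sup>2 \<le> (b / \<sigma>\<^sup>2 * X)\<^sup>2" using xy b by (intro power_mono mult_left_mono) auto
        also have "\<dots> = (b * X)\<^sup>2 / \<sigma>^4" by (simp add: power_mult_distrib power_divide flip: power_mult)
        also have "\<dots> \<le> 3 * \<delta>" using bX s by (simp add: divide_le_eq)
        finally have y: "(b / \<sigma>\<^sup>2 * y)\<^sup>2 / 3 \<le> \<delta>" by simp
        have "1 / \<sigma>\<^sup>2 - 1 / \<tau>\<^sup>2 = (\<tau>\<^sup>2 - \<sigma>\<^sup>2) / (\<sigma>\<^sup>2 * \<tau>\<^sup>2)" using s t by (simp add: field_simps)
        also have "\<dots> \<le> (\<tau>\<^sup>2 - \<sigma>\<^sup>2) / (\<sigma>\<^sup>2 * \<sigma>\<^sup>2)" 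
          using s t by (intro divide_left_mono mult_left_mono power_mono) (auto intro!: mult_pos_pos)
        also have "\<dots> \<le> ((1 - \<delta>) * b\<^sup>2) / (\<sigma>\<^sup>2 * \<sigma>\<^sup>2)" using \<tau> by (intro divide_right_mono) auto
        also have "\<dots> = (b / \<sigma>\<^sup>2)\<^sup>2 * (1 - \<delta>)" by (simp add: power_divide power2_eq_square)
        also have "\<dots> \<le> (b / \<sigma>\<^sup>2)\<^sup>2 * (1 - (b / \<sigma>\<^sup>2 * y)\<^sup>2 / 3)" using y by (intro mult_left_mono) auto
        finally show "1 / \<sigma>\<^sup>2 - 1 / \<tau>\<^sup>2 \<le> (b / \<sigma>\<^sup>2)\<^sup>2 * (1 - (b / \<sigma>\<^sup>2 * y)\<^sup>2 / 3)" .
      qed (use b xy in auto)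
      from mult_left_mono[OF this, of "A * normal_density 0 \<tau> y * normal_density 0 \<tau> x"] A(1)
      show "mixture b \<sigma> x * normal_density 0 \<tau> y \<le> mixture b \<sigma> y * normal_density 0 \<tau> x"
        unfolding A(2) by (simp add: mult_ac)
    next
      fix x :: real assume x: "X < \<bar>x\<bar>"
      have "X\<^sup>2 \<le> \<bar>x\<bar>\<^sup>2" using x X by (intro power_mono) auto
      then have "- x\<^sup>2 / (2 * \<tau>\<^sup>2) \<le> - X\<^sup>2 / (4 * \<tau>\<^sup>2) + - x\<^sup>2 / (4 * \<tau>\<^sup>2)" using t by (simp add: field_simps)
      then have "exp (- x\<^sup>2 / (2 * \<tau>\<^sup>2)) \<le> exp (- X\<^sup>2 / (4 * \<tau>\<^sup>2)) * exp (- x\<^sup>2 / (4 * \<tau>\<^sup>2))"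
        by (simp flip: exp_add)
      then have "normal_density 0 \<tau> x \<le> 1 / sqrt (2 * pi * \<tau>\<^sup>2) * (exp (- X\<^sup>2 / (4 * \<tau>\<^sup>2)) * exp (- x\<^sup>2 / (4 * \<tau>\<^sup>2)))"
        unfolding normal_density_def by (intro mult_left_mono) auto
      also have "\<dots> = sqrt 2 * exp (- X\<^sup>2 / (4 * \<tau>\<^sup>2)) * normal_density 0 (sqrt 2 * \<tau>) x"
        using t by (simp add: normal_density_def power_mult_distrib real_sqrt_mult field_simps)
      finally show "c * \<bar>x\<bar> * normal_density 0 \<tau> x \<le> w x"
        using c by (auto simp: w_def mult_ac intro!: mult_left_mono)
    next
      show "integrable lborel w" unfolding w_def using gauss_abs_moment(1)[OF t2] by simp
      show "0 \<le> w x" for x using c by (simp add: w_def)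
    qed (use even_part_mono[OF h] he[unfolded cvx_lip_def] mixture_props[OF s(1)] nd s t X integral_mixture(2)[OF he s(1)] 
        cvx_lip_integrable[OF he t] in \<open>auto simp: normal_density_pos\<close>)
    moreover have "(\<integral>x. w x \<partial>lborel) \<le> 2 * c * \<tau> * exp (- X\<^sup>2 / (4 * \<tau>\<^sup>2))"
    proof -
      have "(\<integral>x. w x \<partial>lborel) \<le> c * sqrt 2 * exp (- X\<^sup>2 / (4 * \<tau>\<^sup>2)) * (sqrt 2 * \<tau>)"
        unfolding w_def using gauss_abs_moment[OF t2] c by (simp add: mult_left_mono)
      also have "\<dots> = 2 * c * \<tau> * exp (- X\<^sup>2 / (4 * \<tau>\<^sup>2))" by simp
      finally show ?thesis .
    qed
    ultimately show ?thesis
      using integral_even_part(1)[OF mixture_props(1)[OF s(1)] integral_mixture(2)[OF h s(1)]]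
        integral_even_part(1)[OF nd cvx_lip_integrable[OF h t]] gauss_integral_shift_scale[OF h s(1)]
        gauss_integral_scale(1)[OF cvx_lip_measurable[OF h] t] by simp
  qed
  show ?thesis
  proof (cases "0 \<le> b")
    case False
    from main[of "- b"] False \<tau> bX show ?thesis by (simp add: add.commute)
  qed (use main \<tau> bX in auto)
qed

text \<open>After passing to the even part the inequality is pointwise. The case
  \<open>\<sigma> = 0\<close> is included, so that a start without any Gaussian part can be compared
  with one that has some.\<close>

lemma gauss_scale_mono:
  assumes h: "cvx_lip c h" and s: "0 \<le> \<sigma>" "\<sigma> \<le> \<tau>"
  shows "(\<integral>t. h (\<sigma> * t) \<partial>gauss) \<le> (\<integral>t. h (\<tau> * t) \<partial>gauss)"
proof -
  interpret prob_space gauss by (rule gauss_prob)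
  have sym: "(\<integral>t. even_part h (\<sigma> * t) \<partial>gauss) = (\<integral>t. h (\<sigma> * t) \<partial>gauss) \<and> integrable gauss (\<lambda>t. even_part h (\<sigma> * t))"
    if "0 \<le> \<sigma>" for \<sigma>
  proof (cases "\<sigma> = 0")
    case True
    then show ?thesis using prob_space by (simp add: even_part_def)
  next
    case False
    then have s: "0 < \<sigma>" using that by simp
    have nd: "normal_density 0 \<sigma> (- x) = normal_density 0 \<sigma> x" for x by (simp add: normal_density_def)
    have he: "cvx_lip c (even_part h)" by (rule cvx_lip_even_part[OF h])
    show ?thesis
      using integral_even_part[OF nd cvx_lip_integrable[OF h s]] gauss_integral_scale[OF cvx_lip_measurable[OF h] s]
        gauss_integral_scale[OF cvx_lip_measurable[OF he] s] by simp
  qed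
  have "(\<integral>t. even_part h (\<sigma> * t) \<partial>gauss) \<le> (\<integral>t. even_part h (\<tau> * t) \<partial>gauss)"
    using s sym[of \<sigma>] sym[of \<tau>] 
    by (intro integral_mono even_part_mono[OF h]) (auto simp: abs_mult intro!: mult_right_mono)
  then show ?thesis using sym[of \<sigma>] sym[of \<tau>] s by simp
qed

subsection \<open>Comparison of sign averages with Gaussian averages\<close>

text \<open>Besides continuity this says that \<open>f\<close> ignores the coordinates outside
  \<open>I\<close>, so total functions and elements of the product space over \<open>I\<close> can
  be interchanged as arguments.\<close>

definition coord_lip :: "'i set \<Rightarrow> ('i \<Rightarrow> real) \<Rightarrow> (('i \<Rightarrow> real) \<Rightarrow> real) \<Rightarrow> bool" where
  "coord_lip I c f \<longleftrightarrow> (\<forall>x y. \<bar>f x - f y\<bar> \<le> (\<Sum>i\<in>I. c i * \<bar>x i - y i\<bar>))"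

text \<open>\<open>f\<close> is continuous for the product topology on all functions, whose Borel
  sets over a countable index type are the product sigma-algebra. Extension by zero carries the
  product over \<open>I\<close> there without changing the value of \<open>f\<close>.\<close>

lemma coord_lip_measurable:
  fixes f :: "('i::countable \<Rightarrow> real) \<Rightarrow> real"
  assumes I: "finite I" and f: "coord_lip I c f"
  shows "f \<in> borel_measurable (Pi\<^sub>M I (\<lambda>_. borel))"
proof -
  define ext where "ext = (\<lambda>(x::'i\<Rightarrow>real) i. if i \<in> I then x i else 0)"
  have c: "continuous_on UNIV f"
    unfolding continuous_on_def
  proof (intro ballI)
    fix a :: "'i \<Rightarrow> real"
    have "((\<lambda>x. \<Sum>i\<in>I. c i * \<bar>x i - a i\<bar>) \<longlongrightarrow> (\<Sum>i\<in>I. c i * \<bar>a i - a i\<bar>)) (at a within UNIV)"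
    proof (intro tendsto_intros)
      fix i
      have "continuous_on UNIV (\<lambda>x::'i\<Rightarrow>real. x i)" by (rule continuous_on_product_coordinates)
      then show "((\<lambda>x. x i) \<longlongrightarrow> a i) (at a within UNIV)" unfolding continuous_on_def by auto
    qed
    then have "((\<lambda>x. \<Sum>i\<in>I. c i * \<bar>x i - a i\<bar>) \<longlongrightarrow> 0) (at a within UNIV)" by simp
    then have "((\<lambda>x. f x - f a) \<longlongrightarrow> 0) (at a within UNIV)"
      by (rule Lim_null_comparison[rotated]) (use f in \<open>auto simp: coord_lip_def\<close>)
    then show "(f \<longlongrightarrow> f a) (at a within UNIV)" by (simp add: LIM_zero_iff)
  qed
  then have m: "f \<in> borel_measurable (Pi\<^sub>M UNIV (\<lambda>_. borel))"
    using borel_measurable_continuous_onI[OF c] 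
    by (simp add: measurable_cong_sets[OF sets_PiM_equal_borel refl])
  have e: "ext \<in> measurable (Pi\<^sub>M I (\<lambda>_. borel)) (Pi\<^sub>M UNIV (\<lambda>_. borel))"
  proof (rule measurable_PiM_single')
    fix i
    show "(\<lambda>x. ext x i) \<in> borel_measurable (Pi\<^sub>M I (\<lambda>_. borel))"
      by (cases "i \<in> I") (auto simp: ext_def)
  qed auto
  have "f (ext x) = f x" for x
  proof -
    have "\<bar>f (ext x) - f x\<bar> \<le> (\<Sum>i\<in>I. c i * \<bar>ext x i - x i\<bar>)" using f by (simp add: coord_lip_def)
    also have "\<dots> = 0" by (intro sum.neutral) (auto simp: ext_def)
    finally show ?thesis by simp
  qed
  then show ?thesis using measurable_compose[OF e m] by simp
qed

lemma gauss_sets: "sets gauss = sets borel" by simp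

lemma gauss_integrable_abs: "integrable gauss (\<lambda>t. \<bar>t\<bar>)"
  using gauss_integral_scale(2)[of "\<lambda>t. \<bar>t\<bar>" 1] gauss_abs_moment(1)[of 1] by simp

lemma cvx_lip_gauss_integrable:
  assumes "cvx_lip c h"
  shows "integrable gauss (\<lambda>t. h (\<sigma> * t))"
proof (rule Bochner_Integration.integrable_bound)
  interpret prob_space gauss by (rule gauss_prob)
  show "integrable gauss (\<lambda>t. \<bar>h 0\<bar> + \<bar>c\<bar> * (\<bar>\<sigma>\<bar> * \<bar>t\<bar>))"
    using gauss_integrable_abs by auto
  show "(\<lambda>t. h (\<sigma> * t)) \<in> borel_measurable gauss"
    using cvx_lip_measurable[OF assms] by simp
  show "AE t in gauss. norm (h (\<sigma> * t)) \<le> norm (\<bar>h 0\<bar> + \<bar>c\<bar> * (\<bar>\<sigma>\<bar> * \<bar>t\<bar>))"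
  proof (rule AE_I2)
    fix t
    have "\<bar>h (\<sigma> * t) - h 0\<bar> \<le> c * \<bar>\<sigma> * t - 0\<bar>" using assms unfolding cvx_lip_def by blast
    also have "\<dots> \<le> \<bar>c\<bar> * \<bar>\<sigma> * t - 0\<bar>" by (intro mult_right_mono) auto
    finally have "\<bar>h (\<sigma> * t) - h 0\<bar> \<le> \<bar>c\<bar> * (\<bar>\<sigma>\<bar> * \<bar>t\<bar>)" by (simp add: abs_mult)
    then show "norm (h (\<sigma> * t)) \<le> norm (\<bar>h 0\<bar> + \<bar>c\<bar> * (\<bar>\<sigma>\<bar> * \<bar>t\<bar>))" by simp
  qed
qed

lemma gauss_PiM_component_integrable:
  assumes "finite I" "i \<in> I"
  shows "integrable (Pi\<^sub>M I (\<lambda>_. gauss)) (\<lambda>g. \<bar>g i\<bar>)"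
proof -
  have "distr (Pi\<^sub>M I (\<lambda>_. gauss)) gauss (\<lambda>g. g i) = gauss"
    by (rule distr_PiM_component[OF gauss_prob assms(2)])
  then have "integrable (distr (Pi\<^sub>M I (\<lambda>_. gauss)) gauss (\<lambda>g. g i)) (\<lambda>t. \<bar>t\<bar>)"
    by (rule ssubst) (rule gauss_integrable_abs)
  with measurable_component_singleton[OF assms(2)] show ?thesis by (rule integrable_distr)
qed

lemma coord_lip_gauss_integrable:
  fixes f :: "('i::countable \<Rightarrow> real) \<Rightarrow> real"
  assumes I: "finite I" and f: "coord_lip I c f"
  shows "integrable (Pi\<^sub>M I (\<lambda>_. gauss)) (\<lambda>g. f (\<lambda>k. \<sigma> k * g k))"
proof (rule Bochner_Integration.integrable_bound)
  interpret P: prob_space "Pi\<^sub>M I (\<lambda>_. gauss)" by (rule prob_space_PiM) (rule gauss_prob)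
  show "integrable (Pi\<^sub>M I (\<lambda>_. gauss)) (\<lambda>g. \<bar>f (\<lambda>_. 0)\<bar> + (\<Sum>i\<in>I. \<bar>c i\<bar> * (\<bar>\<sigma> i\<bar> * \<bar>g i\<bar>)))"
    using gauss_PiM_component_integrable[OF I] by (intro Bochner_Integration.integrable_add
       Bochner_Integration.integrable_sum integrable_mult_right P.integrable_const) auto
  have "coord_lip I (\<lambda>i. c i * \<bar>\<sigma> i\<bar>) (\<lambda>g. f (\<lambda>k. \<sigma> k * g k))"
    unfolding coord_lip_def
  proof (intro allI)
    fix x y :: "'i \<Rightarrow> real"
    have "\<bar>f (\<lambda>k. \<sigma> k * x k) - f (\<lambda>k. \<sigma> k * y k)\<bar> \<le> (\<Sum>i\<in>I. c i * \<bar>\<sigma> i * x i - \<sigma> i * y i\<bar>)"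
      using f by (simp add: coord_lip_def)
    also have "\<dots> = (\<Sum>i\<in>I. c i * \<bar>\<sigma> i\<bar> * \<bar>x i - y i\<bar>)"
      by (intro sum.cong) (auto simp: mult.assoc simp flip: abs_mult right_diff_distrib)
    finally show "\<bar>f (\<lambda>k. \<sigma> k * x k) - f (\<lambda>k. \<sigma> k * y k)\<bar> \<le> (\<Sum>i\<in>I. c i * \<bar>\<sigma> i\<bar> * \<bar>x i - y i\<bar>)" .
  qed
  from coord_lip_measurable[OF I this]
  show "(\<lambda>g. f (\<lambda>k. \<sigma> k * g k)) \<in> borel_measurable (Pi\<^sub>M I (\<lambda>_. gauss))"
    by (simp add: measurable_cong_sets[OF sets_PiM_cong[OF refl gauss_sets] refl])
  show "AE g in Pi\<^sub>M I (\<lambda>_. gauss). norm (f (\<lambda>k. \<sigma> k * g k)) \<le> norm (\<bar>f (\<lambda>_. 0)\<bar> + (\<Sum>i\<in>I. \<bar>c i\<bar> * (\<bar>\<sigma> i\<bar> * \<bar>g i\<bar>)))"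
  proof (rule AE_I2)
    fix g
    have "\<bar>f (\<lambda>k. \<sigma> k * g k) - f (\<lambda>_. 0)\<bar> \<le> (\<Sum>i\<in>I. c i * \<bar>\<sigma> i * g i - 0\<bar>)"
      using f unfolding coord_lip_def by blast
    also have "\<dots> \<le> (\<Sum>i\<in>I. \<bar>c i\<bar> * (\<bar>\<sigma> i\<bar> * \<bar>g i\<bar>))"
      by (intro sum_mono) (auto simp: abs_mult intro!: mult_right_mono)
    finally show "norm (f (\<lambda>k. \<sigma> k * g k)) \<le> norm (\<bar>f (\<lambda>_. 0)\<bar> + (\<Sum>i\<in>I. \<bar>c i\<bar> * (\<bar>\<sigma> i\<bar> * \<bar>g i\<bar>)))"
      by simp
  qed
qed

text \<open>Convexity is asked for in each coordinate separately, because exchanges happen one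
  coordinate at a time and averaging over jumps preserves it in this form.\<close>

definition coord_cvx_lip :: "nat \<Rightarrow> (nat \<Rightarrow> real) \<Rightarrow> ((nat \<Rightarrow> real) \<Rightarrow> real) \<Rightarrow> bool" where
  "coord_cvx_lip n c \<Psi> \<longleftrightarrow>
     (\<forall>x. \<forall>j<n. convex_on UNIV (\<lambda>t. \<Psi> (x(j := t)))) \<and> coord_lip {..<n} c \<Psi>"

lemma coord_cvx_lipD:
  assumes "coord_cvx_lip n c \<Psi>" "j < n"
  shows "cvx_lip (c j) (\<lambda>t. \<Psi> (x(j := t)))"
proof -
  have "\<bar>\<Psi> (x(j := s)) - \<Psi> (x(j := t))\<bar> \<le> c j * \<bar>s - t\<bar>" for s t
  proof -
    have "\<bar>\<Psi> (x(j := s)) - \<Psi> (x(j := t))\<bar> \<le> (\<Sum>i<n. c i * \<bar>(x(j := s)) i - (x(j := t)) i\<bar>)"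
      using assms unfolding coord_cvx_lip_def coord_lip_def by blast
    also have "\<dots> = (\<Sum>i<n. if i = j then c j * \<bar>s - t\<bar> else 0)" by (intro sum.cong) auto
    finally show ?thesis using assms(2) by simp
  qed
  then show ?thesis using assms by (auto simp: cvx_lip_def coord_cvx_lip_def)
qed

text \<open>The expectation over one random jump \<open>\<plusminus>b\<close> in coordinate
  \<open>j\<close>. A sign average of the norm is a composition of such operators evaluated at the
  origin, and the exchange turns them into Gaussian variance one after the other.\<close>

definition rstep :: "nat \<Rightarrow> real \<Rightarrow> ((nat \<Rightarrow> real) \<Rightarrow> real) \<Rightarrow> (nat \<Rightarrow> real) \<Rightarrow> real" where
  "rstep j b \<Psi> x = (\<Psi> (x(j := x j + b)) + \<Psi> (x(j := x j - b))) / 2"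

fun rop :: "(nat \<times> real) list \<Rightarrow> ((nat \<Rightarrow> real) \<Rightarrow> real) \<Rightarrow> (nat \<Rightarrow> real) \<Rightarrow> real" where
  "rop [] \<Psi> = \<Psi>"
| "rop (p # l) \<Psi> = rstep (fst p) (snd p) (rop l \<Psi>)"

lemma convex_on_shift:
  fixes h :: "real \<Rightarrow> real"
  assumes "convex_on UNIV h"
  shows "convex_on UNIV (\<lambda>t. h (t + b))"
proof (rule convex_onI)
  fix t x y :: real assume t: "0 < t" "t < 1"
  have "(1 - t) *\<^sub>R x + t *\<^sub>R y + b = (1 - t) *\<^sub>R (x + b) + t *\<^sub>R (y + b)" by (simp add: algebra_simps)
  then show "h ((1 - t) *\<^sub>R x + t *\<^sub>R y + b) \<le> (1 - t) * h (x + b) + t * h (y + b)"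
    using convex_onD[OF assms, of t "x + b" "y + b"] t by simp
qed auto

lemma convex_on_average:
  assumes "convex_on UNIV h" "convex_on UNIV k"
  shows "convex_on UNIV (\<lambda>t. (h t + k t) / (2::real))"
proof -
  have "convex_on UNIV (\<lambda>t. (1 / 2) * (h t + k t))"
    using assms by (intro convex_on_cmul convex_on_add) auto
  then show ?thesis by simp
qed

lemma coord_cvx_lip_rstep:
  assumes "coord_cvx_lip n c \<Psi>" "j < n"
  shows "coord_cvx_lip n c (rstep j b \<Psi>)"
  unfolding coord_cvx_lip_def
proof (intro conjI allI impI)
  fix x k assume k: "k < n"
  have cv: "convex_on UNIV (\<lambda>t. \<Psi> (y(k := t)))" for y using assms k by (auto simp: coord_cvx_lip_def)
  show "convex_on UNIV (\<lambda>t. rstep j b \<Psi> (x(k := t)))"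
  proof (cases "k = j")
    case True
    have "convex_on UNIV (\<lambda>t. (\<Psi> (x(k := t + b)) + \<Psi> (x(k := t + (-b)))) / 2)"
      by (intro convex_on_average convex_on_shift[OF cv])
    then show ?thesis using True by (simp add: rstep_def)
  next
    case False
    have "convex_on UNIV (\<lambda>t. (\<Psi> ((x(j := x j + b))(k := t)) + \<Psi> ((x(j := x j - b))(k := t))) / 2)"
      by (intro convex_on_average cv)
    then show ?thesis using False by (simp add: rstep_def fun_upd_twist)
  qed
next
  show "coord_lip {..<n} c (rstep j b \<Psi>)"
    unfolding coord_lip_def
  proof (intro allI)
    fix x y
    have l: "\<bar>\<Psi> (x(j := x j + b)) - \<Psi> (y(j := y j + b))\<bar> \<le> (\<Sum>i<n. c i * \<bar>x i - y i\<bar>)" for b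
    proof -
      have "\<bar>\<Psi> (x(j := x j + b)) - \<Psi> (y(j := y j + b))\<bar> \<le> (\<Sum>i<n. c i * \<bar>(x(j := x j + b)) i - (y(j := y j + b)) i\<bar>)"
        using assms unfolding coord_cvx_lip_def coord_lip_def by blast
      also have "\<dots> = (\<Sum>i<n. c i * \<bar>x i - y i\<bar>)" by (intro sum.cong) auto
      finally show ?thesis .
    qed
    have avg: "\<bar>(a + b) / 2 - (a' + b') / 2\<bar> \<le> r" if "\<bar>a - a'\<bar> \<le> r" "\<bar>b - b'\<bar> \<le> r" for a b a' b' r :: real
      using that by (auto simp: abs_le_iff field_simps)
    show "\<bar>rstep j b \<Psi> x - rstep j b \<Psi> y\<bar> \<le> (\<Sum>i<n. c i * \<bar>x i - y i\<bar>)"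
      unfolding rstep_def using avg[OF l[of b] l[of "-b"]] by simp
  qed
qed

lemma coord_cvx_lip_rop:
  assumes "coord_cvx_lip n c \<Psi>" "\<And>p. p \<in> set l \<Longrightarrow> fst p < n"
  shows "coord_cvx_lip n c (rop l \<Psi>)"
  using assms(2) by (induction l) (auto intro: coord_cvx_lip_rstep assms(1))

lemma gauss_coordinate_integral:
  fixes \<sigma> :: "nat \<Rightarrow> real"
  assumes \<Psi>: "coord_cvx_lip n c \<Psi>" and j: "j < n"
  defines "F \<equiv> \<lambda>x. \<integral>t. \<Psi> (x(j := \<sigma> j * t)) \<partial>gauss"
  shows "(\<integral>g. \<Psi> (\<lambda>k. \<sigma> k * g k) \<partial>gaussian_law n) 
      = (\<integral>g. F (\<lambda>k. \<sigma> k * g k) \<partial>Pi\<^sub>M ({..<n} - {j}) (\<lambda>_. gauss))"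
    and "integrable (Pi\<^sub>M ({..<n} - {j}) (\<lambda>_. gauss)) (\<lambda>g. F (\<lambda>k. \<sigma> k * g k))"
proof -
  interpret product_prob_space "\<lambda>_. gauss" "{..<n}" by (intro product_prob_spaceI gauss_prob)
  interpret gp: prob_space gauss by (rule gauss_prob)
  have eq: "insert j ({..<n} - {j}) = {..<n}" using j by auto
  have lip: "coord_lip {..<n} c \<Psi>" using \<Psi> by (simp add: coord_cvx_lip_def)
  have "(\<integral>g. \<Psi> (\<lambda>k. \<sigma> k * g k) \<partial>gaussian_law n) 
      = (\<integral>g. (\<integral>t. \<Psi> (\<lambda>k. \<sigma> k * (g(j := t)) k) \<partial>gauss) \<partial>Pi\<^sub>M ({..<n} - {j}) (\<lambda>_. gauss))"
    using product_integral_insert[of "{..<n} - {j}" j "\<lambda>g. \<Psi> (\<lambda>k. \<sigma> k * g k)", unfolded eq]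
      coord_lip_gauss_integrable[OF finite_lessThan lip, of \<sigma>]
    unfolding gaussian_law_def by blast
  also have "\<dots> = (\<integral>g. F (\<lambda>k. \<sigma> k * g k) \<partial>Pi\<^sub>M ({..<n} - {j}) (\<lambda>_. gauss))"
  proof -
    have "(\<lambda>k. \<sigma> k * (g(j := t)) k) = (\<lambda>k. \<sigma> k * g k)(j := \<sigma> j * t)" for g t by auto
    then show ?thesis by (simp add: F_def)
  qed
  finally show "(\<integral>g. \<Psi> (\<lambda>k. \<sigma> k * g k) \<partial>gaussian_law n) 
      = (\<integral>g. F (\<lambda>k. \<sigma> k * g k) \<partial>Pi\<^sub>M ({..<n} - {j}) (\<lambda>_. gauss))" .
  have "coord_lip ({..<n} - {j}) c F"
    unfolding coord_lip_def
  proof (intro allI)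
    fix x y :: "nat \<Rightarrow> real"
    let ?S = "\<Sum>i\<in>{..<n} - {j}. c i * \<bar>x i - y i\<bar>"
    have i: "integrable gauss (\<lambda>t. \<Psi> (x(j := \<sigma> j * t)))" for x
      using cvx_lip_gauss_integrable[OF coord_cvx_lipD[OF \<Psi> j]] .
    have d: "\<bar>\<Psi> (x(j := t)) - \<Psi> (y(j := t))\<bar> \<le> ?S" for t
    proof -
      have "\<bar>\<Psi> (x(j := t)) - \<Psi> (y(j := t))\<bar> \<le> (\<Sum>i<n. c i * \<bar>(x(j := t)) i - (y(j := t)) i\<bar>)"
        using lip unfolding coord_lip_def by blast
      also have "\<dots> = ?S" using j by (subst sum.remove[of _ j]) (auto intro!: sum.cong)
      finally show ?thesis .
    qed
    have "F x - F y = (\<integral>t. \<Psi> (x(j := \<sigma> j * t)) - \<Psi> (y(j := \<sigma> j * t)) \<partial>gauss)"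
      unfolding F_def by (intro Bochner_Integration.integral_diff[symmetric] i)
    also have "\<bar>\<dots>\<bar> \<le> (\<integral>t. \<bar>\<Psi> (x(j := \<sigma> j * t)) - \<Psi> (y(j := \<sigma> j * t))\<bar> \<partial>gauss)"
      by (rule integral_abs_bound)
    also have "\<dots> \<le> (\<integral>t. ?S \<partial>gauss)"
      using d i by (intro integral_mono) auto
    also have "\<dots> = ?S" using prob_space.prob_space[OF gauss_prob] by simp
    finally show "\<bar>F x - F y\<bar> \<le> ?S" .
  qed
  then show "integrable (Pi\<^sub>M ({..<n} - {j}) (\<lambda>_. gauss)) (\<lambda>g. F (\<lambda>k. \<sigma> k * g k))"
    by (rule coord_lip_gauss_integrable[rotated]) auto
qed

text \<open>Fubini's theorem: a comparison in coordinate \<open>j\<close>, uniform in the remaining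
  coordinates, survives integration over these. The standard deviations may differ between
  coordinates, as they will during the exchange.\<close>

lemma gauss_coordinate_compare:
  assumes \<Psi>: "coord_cvx_lip n c \<Psi>" "coord_cvx_lip n c' \<Psi>'" and j: "j < n"
    and \<tau>: "\<And>k. k \<noteq> j \<Longrightarrow> \<tau> k = \<sigma> k"
    and le: "\<And>x. (\<integral>t. \<Psi> (x(j := \<sigma> j * t)) \<partial>gauss) \<le> (\<integral>t. \<Psi>' (x(j := \<tau> j * t)) \<partial>gauss) + e"
  shows "(\<integral>g. \<Psi> (\<lambda>k. \<sigma> k * g k) \<partial>gaussian_law n) \<le> (\<integral>g. \<Psi>' (\<lambda>k. \<tau> k * g k) \<partial>gaussian_law n) + e"
proof -
  let ?M = "Pi\<^sub>M ({..<n} - {j}) (\<lambda>_. gauss)"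
  interpret P: prob_space ?M by (rule prob_space_PiM) (rule gauss_prob)
  let ?F = "\<lambda>x. \<integral>t. \<Psi> (x(j := \<sigma> j * t)) \<partial>gauss" and ?G = "\<lambda>x. \<integral>t. \<Psi>' (x(j := \<tau> j * t)) \<partial>gauss"
  have G: "?G (\<lambda>k. \<tau> k * g k) = ?G (\<lambda>k. \<sigma> k * g k)" for g
  proof -
    have "(\<lambda>k. \<tau> k * g k)(j := t) = (\<lambda>k. \<sigma> k * g k)(j := t)" for t using \<tau> by auto
    then show ?thesis by simp
  qed
  have i: "integrable ?M (\<lambda>g. ?G (\<lambda>k. \<sigma> k * g k))" 
    using gauss_coordinate_integral(2)[OF \<Psi>(2) j, of \<tau>] by (simp add: G)
  have "(\<integral>g. \<Psi> (\<lambda>k. \<sigma> k * g k) \<partial>gaussian_law n) = (\<integral>g. ?F (\<lambda>k. \<sigma> k * g k) \<partial>?M)"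
    by (rule gauss_coordinate_integral(1)[OF \<Psi>(1) j])
  also have "\<dots> \<le> (\<integral>g. ?G (\<lambda>k. \<sigma> k * g k) + e \<partial>?M)"
    using gauss_coordinate_integral(2)[OF \<Psi>(1) j] i le by (intro integral_mono) auto
  also have "\<dots> = (\<integral>g. ?G (\<lambda>k. \<sigma> k * g k) \<partial>?M) + e" using i P.prob_space by simp
  also have "(\<integral>g. ?G (\<lambda>k. \<sigma> k * g k) \<partial>?M) = (\<integral>g. \<Psi>' (\<lambda>k. \<tau> k * g k) \<partial>gaussian_law n)"
    using gauss_coordinate_integral(1)[OF \<Psi>(2) j, of \<tau>] by (simp add: G)
  finally show ?thesis .
qed

lemma gauss_law_scale_mono:
  assumes \<Psi>: "coord_cvx_lip n c \<Psi>" and s: "\<And>j. j < n \<Longrightarrow> 0 \<le> \<sigma> j \<and> \<sigma> j \<le> \<tau> j"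
  shows "(\<integral>g. \<Psi> (\<lambda>k. \<sigma> k * g k) \<partial>gaussian_law n) \<le> (\<integral>g. \<Psi> (\<lambda>k. \<tau> k * g k) \<partial>gaussian_law n)"
proof -
  \<comment> \<open>Hybrid vectors: the first \<open>i\<close> standard deviations have already been
    enlarged.\<close>
  have "(\<integral>g. \<Psi> (\<lambda>k. \<sigma> k * g k) \<partial>gaussian_law n) 
      \<le> (\<integral>g. \<Psi> (\<lambda>k. (if k < i then \<tau> k else \<sigma> k) * g k) \<partial>gaussian_law n)" if "i \<le> n" for i
    using that
  proof (induction i)
    case (Suc i)
    have "(\<integral>g. \<Psi> (\<lambda>k. (if k < i then \<tau> k else \<sigma> k) * g k) \<partial>gaussian_law n)
        \<le> (\<integral>g. \<Psi> (\<lambda>k. (if k < Suc i then \<tau> k else \<sigma> k) * g k) \<partial>gaussian_law n) + 0"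
    proof (rule gauss_coordinate_compare[OF \<Psi> \<Psi>, of i])
      fix x
      show "(\<integral>t. \<Psi> (x(i := (if i < i then \<tau> i else \<sigma> i) * t)) \<partial>gauss)
        \<le> (\<integral>t. \<Psi> (x(i := (if i < Suc i then \<tau> i else \<sigma> i) * t)) \<partial>gauss) + 0"
        using gauss_scale_mono[OF coord_cvx_lipD[OF \<Psi>, of i x], of "\<sigma> i" "\<tau> i"] s[of i] Suc.prems by simp
    qed (use Suc in auto)
    then show ?case using Suc by simp
  qed simp
  from this[of n] have "(\<integral>g. \<Psi> (\<lambda>k. \<sigma> k * g k) \<partial>gaussian_law n) 
      \<le> (\<integral>g. \<Psi> (\<lambda>k. (if k < n then \<tau> k else \<sigma> k) * g k) \<partial>gaussian_law n)" by simp
  moreover have "(\<lambda>g. \<Psi> (\<lambda>k. (if k < n then \<tau> k else \<sigma> k) * g k)) = (\<lambda>g. \<Psi> (\<lambda>k. \<tau> k * g k))"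
  proof
    fix g :: "nat \<Rightarrow> real"
    have "\<bar>\<Psi> (\<lambda>k. (if k < n then \<tau> k else \<sigma> k) * g k) - \<Psi> (\<lambda>k. \<tau> k * g k)\<bar> 
      \<le> (\<Sum>i<n. c i * \<bar>(if i < n then \<tau> i else \<sigma> i) * g i - \<tau> i * g i\<bar>)"
      using \<Psi> unfolding coord_cvx_lip_def coord_lip_def by blast
    also have "\<dots> = 0" by (intro sum.neutral) auto
    finally show "\<Psi> (\<lambda>k. (if k < n then \<tau> k else \<sigma> k) * g k) = \<Psi> (\<lambda>k. \<tau> k * g k)" by linarith
  qed
  ultimately show ?thesis by metis
qed

text \<open>The variance that the jumps of the list contribute to coordinate
  \<open>j\<close>.\<close>

definition sqsum :: "(nat \<times> real) list \<Rightarrow> nat \<Rightarrow> real" where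
  "sqsum l j = sum_list (map (\<lambda>p. if fst p = j then (snd p)\<^sup>2 else 0) l)"

lemma rstep_gauss_integral:
  "(\<integral>t. rstep j b \<Psi> (x(j := s * t)) \<partial>gauss) = (\<integral>t. ((\<lambda>t. \<Psi> (x(j := t))) (s * t + b) + (\<lambda>t. \<Psi> (x(j := t))) (s * t - b)) / 2 \<partial>gauss)"
  by (simp add: rstep_def)

text \<open>The new variance \<open>w'\<close> is the solution of \<open>1 / w' = 1 / w - b\<^sup>2 / w\<^sup>2\<close>, the smallest one for which the densities cross
  once. The logarithmic term is the price of exchanging \<open>\<plusminus>b\<close> for a Gaussian, and it telescopes.\<close>

lemma potential_step:
  fixes \<beta> w b :: real
  assumes "0 < \<beta>" "\<bar>b\<bar> \<le> \<beta>" "2 * \<beta>\<^sup>2 \<le> w"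
  defines "w' \<equiv> w\<^sup>2 / (w - b\<^sup>2)"
  shows "w \<le> w'" "(b / w)\<^sup>2 \<le> 1 / w - 1 / w'" 
    "w' - 2 * \<beta>\<^sup>2 * ln w' \<le> w - 2 * \<beta>\<^sup>2 * ln w + b\<^sup>2"
proof -
  have b2: "b\<^sup>2 \<le> \<beta>\<^sup>2" using assms(2) power_mono[of "\<bar>b\<bar>" \<beta> 2] by simp
  have p: "0 < \<beta>\<^sup>2" using assms(1) by simp
  have w: "0 < w" "w / 2 \<le> w - b\<^sup>2" "0 < w - b\<^sup>2" using assms(3) b2 p by linarith+
  have w': "w' - w = b\<^sup>2 + b^4 / (w - b\<^sup>2)"
    using w by (simp add: w'_def field_simps power2_eq_square power4_eq_xxxx)
  show le: "w \<le> w'" 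
  proof -
    have "0 \<le> b^4 / (w - b\<^sup>2)" using w by (intro divide_nonneg_pos) auto
    then show ?thesis using w' zero_le_power2[of b] by linarith
  qed
  show "(b / w)\<^sup>2 \<le> 1 / w - 1 / w'"
    using w by (simp add: w'_def field_simps power2_eq_square)
  have "ln (w / w') \<le> w / w' - 1" using w le by (intro ln_le_minus_one) auto
  also have "w / w' - 1 = - (b\<^sup>2 / w)" using w by (simp add: w'_def field_simps power2_eq_square)
  finally have ln: "b\<^sup>2 / w \<le> ln w' - ln w" using w le by (simp add: ln_div)
  have "b^4 / (w - b\<^sup>2) \<le> b^4 / (w / 2)" using w by (intro divide_left_mono) auto
  also have "\<dots> = 2 * b\<^sup>2 * (b\<^sup>2 / w)" by (simp add: power2_eq_square power4_eq_xxxx)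
  also have "\<dots> \<le> 2 * \<beta>\<^sup>2 * (b\<^sup>2 / w)" using b2 w by (intro mult_right_mono) auto
  also have "\<dots> \<le> 2 * \<beta>\<^sup>2 * (ln w' - ln w)" using ln p by (intro mult_left_mono) auto
  finally show "w' - 2 * \<beta>\<^sup>2 * ln w' \<le> w - 2 * \<beta>\<^sup>2 * ln w + b\<^sup>2"
    using w' by (simp add: algebra_simps)
qed

text \<open>The variances \<open>w\<close> are not tracked exactly. Only
  \<open>w - 2 * \<beta>^2 * ln w\<close> accumulates, by at most \<open>b^2\<close> per jump; the
  condition \<open>2 * \<beta>^2 \<le> w\<close> needed by each step persists because variances only
  grow.\<close>

lemma rop_gauss_upper:
  assumes \<Phi>: "coord_cvx_lip n c \<Phi>" and \<beta>: "0 < \<beta>"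
    and l: "\<And>p. p \<in> set l \<Longrightarrow> fst p < n \<and> \<bar>snd p\<bar> \<le> \<beta>"
    and s: "\<And>j. j < n \<Longrightarrow> 0 \<le> \<sigma> j \<and> 2 * \<beta>\<^sup>2 \<le> (\<sigma> j)\<^sup>2"
  shows "\<exists>\<tau>. (\<forall>j<n. 0 \<le> \<tau> j \<and> 2 * \<beta>\<^sup>2 \<le> (\<tau> j)\<^sup>2 \<and>
      (\<tau> j)\<^sup>2 - 2 * \<beta>\<^sup>2 * ln ((\<tau> j)\<^sup>2) \<le> (\<sigma> j)\<^sup>2 - 2 * \<beta>\<^sup>2 * ln ((\<sigma> j)\<^sup>2) + sqsum l j) \<and>
    (\<integral>g. rop l \<Phi> (\<lambda>k. \<sigma> k * g k) \<partial>gaussian_law n) \<le> (\<integral>g. \<Phi> (\<lambda>k. \<tau> k * g k) \<partial>gaussian_law n)"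
  using l s
proof (induction l arbitrary: \<sigma>)
  case Nil
  then show ?case by (intro exI[of _ \<sigma>]) (auto simp: sqsum_def)
next
  case (Cons p l)
  obtain j b where p: "p = (j, b)" by force
  have j: "j < n" and b: "\<bar>b\<bar> \<le> \<beta>" using Cons.prems(1)[of p] p by auto
  have sj: "0 \<le> \<sigma> j" "2 * \<beta>\<^sup>2 \<le> (\<sigma> j)\<^sup>2" using Cons.prems(2)[OF j] by auto
  define w' where "w' = ((\<sigma> j)\<^sup>2)\<^sup>2 / ((\<sigma> j)\<^sup>2 - b\<^sup>2)"
  note w = potential_step[OF \<beta> b sj(2), folded w'_def]
  have pos: "0 < (\<sigma> j)\<^sup>2" "0 < w'" using sj(2) \<beta> w(1) zero_less_power[OF \<beta>, of 2] by linarith+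
  have sjp: "0 < \<sigma> j" using pos(1) sj by (metis less_eq_real_def power_zero_numeral less_irrefl)
  define \<sigma>' where "\<sigma>' = \<sigma>(j := sqrt w')"
  have rl: "coord_cvx_lip n c (rop l \<Phi>)" using Cons.prems(1) by (intro coord_cvx_lip_rop[OF \<Phi>]) auto
  have "\<exists>\<tau>. (\<forall>j<n. 0 \<le> \<tau> j \<and> 2 * \<beta>\<^sup>2 \<le> (\<tau> j)\<^sup>2 \<and>
      (\<tau> j)\<^sup>2 - 2 * \<beta>\<^sup>2 * ln ((\<tau> j)\<^sup>2) \<le> (\<sigma>' j)\<^sup>2 - 2 * \<beta>\<^sup>2 * ln ((\<sigma>' j)\<^sup>2) + sqsum l j) \<and>
    (\<integral>g. rop l \<Phi> (\<lambda>k. \<sigma>' k * g k) \<partial>gaussian_law n) \<le> (\<integral>g. \<Phi> (\<lambda>k. \<tau> k * g k) \<partial>gaussian_law n)"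
    using Cons.prems w(1) sj pos by (intro Cons.IH) (auto simp: \<sigma>'_def)
  then obtain \<tau> where \<tau>: "\<And>j. j < n \<Longrightarrow> 0 \<le> \<tau> j \<and> 2 * \<beta>\<^sup>2 \<le> (\<tau> j)\<^sup>2 \<and>
      (\<tau> j)\<^sup>2 - 2 * \<beta>\<^sup>2 * ln ((\<tau> j)\<^sup>2) \<le> (\<sigma>' j)\<^sup>2 - 2 * \<beta>\<^sup>2 * ln ((\<sigma>' j)\<^sup>2) + sqsum l j"
    and le: "(\<integral>g. rop l \<Phi> (\<lambda>k. \<sigma>' k * g k) \<partial>gaussian_law n) \<le> (\<integral>g. \<Phi> (\<lambda>k. \<tau> k * g k) \<partial>gaussian_law n)"
    by blast
  have "(\<integral>g. rstep j b (rop l \<Phi>) (\<lambda>k. \<sigma> k * g k) \<partial>gaussian_law n) 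
      \<le> (\<integral>g. rop l \<Phi> (\<lambda>k. \<sigma>' k * g k) \<partial>gaussian_law n) + 0"
  proof (rule gauss_coordinate_compare[OF coord_cvx_lip_rstep[OF rl j] rl j])
    fix x
    have "(\<integral>t. rstep j b (rop l \<Phi>) (x(j := \<sigma> j * t)) \<partial>gauss) \<le> (\<integral>t. (\<lambda>t. rop l \<Phi> (x(j := t))) (sqrt w' * t) \<partial>gauss)"
      unfolding rstep_gauss_integral using w(2) pos sjp
      by (intro gauss_step_upper[OF coord_cvx_lipD[OF rl j]]) auto
    then show "(\<integral>t. rstep j b (rop l \<Phi>) (x(j := \<sigma> j * t)) \<partial>gauss) \<le> (\<integral>t. rop l \<Phi> (x(j := \<sigma>' j * t)) \<partial>gauss) + 0"
      by (simp add: \<sigma>'_def)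
  qed (auto simp: \<sigma>'_def)
  then have fin: "(\<integral>g. rop (p # l) \<Phi> (\<lambda>k. \<sigma> k * g k) \<partial>gaussian_law n) \<le> (\<integral>g. \<Phi> (\<lambda>k. \<tau> k * g k) \<partial>gaussian_law n)"
    using le p by simp
  have "(\<sigma>' k)\<^sup>2 - 2 * \<beta>\<^sup>2 * ln ((\<sigma>' k)\<^sup>2) + sqsum l k 
      \<le> (\<sigma> k)\<^sup>2 - 2 * \<beta>\<^sup>2 * ln ((\<sigma> k)\<^sup>2) + sqsum (p # l) k" for k
    using w(3) pos p by (auto simp: \<sigma>'_def sqsum_def)
  moreover have "(\<tau> k)\<^sup>2 - 2 * \<beta>\<^sup>2 * ln ((\<tau> k)\<^sup>2) \<le> (\<sigma>' k)\<^sup>2 - 2 * \<beta>\<^sup>2 * ln ((\<sigma>' k)\<^sup>2) + sqsum l k" 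
    if "k < n" for k using \<tau>[OF that] by blast
  ultimately have "\<forall>j<n. 0 \<le> \<tau> j \<and> 2 * \<beta>\<^sup>2 \<le> (\<tau> j)\<^sup>2 \<and>
      (\<tau> j)\<^sup>2 - 2 * \<beta>\<^sup>2 * ln ((\<tau> j)\<^sup>2) \<le> (\<sigma> j)\<^sup>2 - 2 * \<beta>\<^sup>2 * ln ((\<sigma> j)\<^sup>2) + sqsum (p # l) j"
    using \<tau> by (meson order_trans)
  then show ?case using fin by blast
qed

text \<open>Here each jump adds exactly \<open>(1 - \<delta>) * b^2\<close> to the variance of its
  coordinate, and the errors add up over the list. The cap 4 on the total variance serves to bound
  every standard deviation by 2.\<close>

lemma rop_gauss_lower:
  assumes \<Phi>: "coord_cvx_lip n c \<Phi>" and \<beta>: "0 < \<beta>" "\<beta> \<le> \<sigma>\<^sub>0" and \<delta>: "0 \<le> \<delta>" "\<delta> \<le> 1" and c: "\<And>j. j < n \<Longrightarrow> 0 \<le> c j"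
    and l: "\<And>p. p \<in> set l \<Longrightarrow> fst p < n \<and> \<bar>snd p\<bar> \<le> \<beta>"
    and s: "\<And>j. j < n \<Longrightarrow> \<sigma>\<^sub>0 \<le> \<sigma> j \<and> (\<sigma> j)\<^sup>2 + sqsum l j \<le> 4"
  shows "\<exists>\<tau>. (\<forall>j<n. 0 \<le> \<tau> j \<and> (\<tau> j)\<^sup>2 = (\<sigma> j)\<^sup>2 + (1 - \<delta>) * sqsum l j) \<and>
    (\<integral>g. \<Phi> (\<lambda>k. \<tau> k * g k) \<partial>gaussian_law n) \<le> (\<integral>g. rop l \<Phi> (\<lambda>k. \<sigma> k * g k) \<partial>gaussian_law n)
      + sum_list (map (\<lambda>p. 4 * c (fst p)) l) * exp (- (3 * \<delta> * \<sigma>\<^sub>0\<^sup>2 / (8 * \<beta>\<^sup>2)))"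
  using l s
proof (induction l arbitrary: \<sigma>)
  case Nil
  have "0 \<le> \<sigma> j" if "j < n" for j using Nil(2)[OF that] \<beta> by linarith
  then show ?case by (intro exI[of _ \<sigma>]) (auto simp: sqsum_def)
next
  case (Cons p l)
  obtain j b where p: "p = (j, b)" by force
  have j: "j < n" and b: "\<bar>b\<bar> \<le> \<beta>" using Cons.prems(1)[of p] p by auto
  have sq0: "0 \<le> sqsum l k" for k unfolding sqsum_def by (intro sum_list_nonneg) auto
  have sj: "\<sigma>\<^sub>0 \<le> \<sigma> j" "(\<sigma> j)\<^sup>2 + b\<^sup>2 \<le> 4" using Cons.prems(2)[OF j] p sq0[of j] by (auto simp: sqsum_def)
  have s0: "0 < \<sigma>\<^sub>0" "0 < \<sigma> j" using \<beta> sj by auto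
  have bb: "b\<^sup>2 \<le> \<beta>\<^sup>2" using b power_mono[of "\<bar>b\<bar>" \<beta> 2] by simp
  have "\<beta>\<^sup>2 \<le> \<sigma>\<^sub>0\<^sup>2" "\<sigma>\<^sub>0\<^sup>2 \<le> (\<sigma> j)\<^sup>2" using \<beta> sj s0 by (auto intro!: power_mono)
  then have b2: "b\<^sup>2 \<le> (\<sigma> j)\<^sup>2" using bb by linarith
  define t where "t = sqrt ((\<sigma> j)\<^sup>2 + (1 - \<delta>) * b\<^sup>2)"
  have bd: "(1 - \<delta>) * b\<^sup>2 \<le> b\<^sup>2" "0 \<le> (1 - \<delta>) * b\<^sup>2" using \<delta> by (auto simp: mult_left_le_one_le)
  have t2: "t\<^sup>2 = (\<sigma> j)\<^sup>2 + (1 - \<delta>) * b\<^sup>2" unfolding t_def using bd by simp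
  have t: "\<sigma> j \<le> t" unfolding t_def using bd s0 by (intro real_le_rsqrt) auto
  have t_le: "t \<le> 2" using t2 sj bd by (intro power2_le_imp_le[of t 2]) auto
  define \<sigma>' where "\<sigma>' = \<sigma>(j := t)"
  let ?e = "exp (- (3 * \<delta> * \<sigma>\<^sub>0\<^sup>2 / (8 * \<beta>\<^sup>2)))"
  have rl: "coord_cvx_lip n c (rop l \<Phi>)" using Cons.prems(1) by (intro coord_cvx_lip_rop[OF \<Phi>]) auto
  have "\<exists>\<tau>. (\<forall>j<n. 0 \<le> \<tau> j \<and> (\<tau> j)\<^sup>2 = (\<sigma>' j)\<^sup>2 + (1 - \<delta>) * sqsum l j) \<and>
    (\<integral>g. \<Phi> (\<lambda>k. \<tau> k * g k) \<partial>gaussian_law n) \<le> (\<integral>g. rop l \<Phi> (\<lambda>k. \<sigma>' k * g k) \<partial>gaussian_law n)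
      + sum_list (map (\<lambda>p. 4 * c (fst p)) l) * ?e"
  proof (rule Cons.IH)
    fix k assume k: "k < n"
    show "\<sigma>\<^sub>0 \<le> \<sigma>' k \<and> (\<sigma>' k)\<^sup>2 + sqsum l k \<le> 4"
      using Cons.prems(2)[OF k] t2 t sj bd p by (auto simp: \<sigma>'_def sqsum_def split: if_splits)
  qed (use Cons.prems in auto)
  then obtain \<tau> where \<tau>: "\<And>j. j < n \<Longrightarrow> 0 \<le> \<tau> j \<and> (\<tau> j)\<^sup>2 = (\<sigma>' j)\<^sup>2 + (1 - \<delta>) * sqsum l j"
    and le: "(\<integral>g. \<Phi> (\<lambda>k. \<tau> k * g k) \<partial>gaussian_law n) \<le> (\<integral>g. rop l \<Phi> (\<lambda>k. \<sigma>' k * g k) \<partial>gaussian_law n)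
      + sum_list (map (\<lambda>p. 4 * c (fst p)) l) * ?e" by blast
  have "(\<integral>g. rop l \<Phi> (\<lambda>k. \<sigma>' k * g k) \<partial>gaussian_law n) 
      \<le> (\<integral>g. rstep j b (rop l \<Phi>) (\<lambda>k. \<sigma> k * g k) \<partial>gaussian_law n) + 4 * c j * ?e"
  proof (rule gauss_coordinate_compare[OF rl coord_cvx_lip_rstep[OF rl j] j])
    fix x
    \<comment> \<open>The largest cut-off that \<open>bX\<close> of the one-dimensional step allows
      simultaneously for all jumps of size at most \<beta>.\<close>
    define X where "X = sqrt (3 * \<delta>) * (\<sigma> j)\<^sup>2 / \<beta>"
    have X2: "X\<^sup>2 = 3 * \<delta> * (\<sigma> j)^4 / \<beta>\<^sup>2"
      using \<delta> by (simp add: X_def power_mult_distrib power_divide flip: power_mult)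
    have "(\<integral>s. (\<lambda>s. rop l \<Phi> (x(j := s))) (t * s) \<partial>gauss) \<le> 
        (\<integral>s. rstep j b (rop l \<Phi>) (x(j := \<sigma> j * s)) \<partial>gauss) + 2 * c j * t * exp (- X\<^sup>2 / (4 * t\<^sup>2))"
      unfolding rstep_gauss_integral
    proof (rule gauss_step_lower[OF coord_cvx_lipD[OF rl j] s0(2) t _ \<delta>(1)])
      show "0 \<le> X" using \<beta> \<delta> by (simp add: X_def)
      show "t\<^sup>2 \<le> (\<sigma> j)\<^sup>2 + (1 - \<delta>) * b\<^sup>2" using t2 by simp
      have "(b * X)\<^sup>2 = b\<^sup>2 / \<beta>\<^sup>2 * (3 * \<delta> * (\<sigma> j)^4)" by (simp add: power_mult_distrib X2)
      also have "\<dots> \<le> 1 * (3 * \<delta> * (\<sigma> j)^4)" using bb \<beta> \<delta> by (intro mult_right_mono) auto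
      finally show "(b * X)\<^sup>2 \<le> 3 * \<delta> * (\<sigma> j)^4" by simp
    qed
    \<comment> \<open>The cap gives \<open>t \<le> 2\<close>. Since
      \<open>b^2 \<le> \<beta>^2 \<le> (\<sigma> j)^2\<close> one has
      \<open>t^2 \<le> 2 * (\<sigma> j)^2\<close>, which turns \<open>X^2 / (4 * t^2)\<close> into
      the stated exponent.\<close>
    also have "2 * c j * t * exp (- X\<^sup>2 / (4 * t\<^sup>2)) \<le> 2 * c j * 2 * ?e"
    proof -
      have "3 * \<delta> * \<sigma>\<^sub>0\<^sup>2 / (8 * \<beta>\<^sup>2) \<le> 3 * \<delta> * (\<sigma> j)\<^sup>2 / (8 * \<beta>\<^sup>2)"
        using \<delta> sj s0 by (intro divide_right_mono mult_left_mono power_mono) auto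
      also have "\<dots> = X\<^sup>2 / (4 * (2 * (\<sigma> j)\<^sup>2))" 
        unfolding X2 using \<beta> s0 by (simp add: field_simps power2_eq_square power4_eq_xxxx)
      also have "\<dots> \<le> X\<^sup>2 / (4 * t\<^sup>2)" using t2 b2 bd s0 
        by (intro divide_left_mono mult_pos_pos) (auto intro: add_pos_nonneg)
      finally have "exp (- X\<^sup>2 / (4 * t\<^sup>2)) \<le> ?e" by simp
      then show ?thesis using t_le c[OF j] t s0 by (intro mult_mono) auto
    qed
    finally show "(\<integral>s. rop l \<Phi> (x(j := \<sigma>' j * s)) \<partial>gauss) \<le> 
        (\<integral>s. rstep j b (rop l \<Phi>) (x(j := \<sigma> j * s)) \<partial>gauss) + 4 * c j * ?e"
      by (simp add: \<sigma>'_def fun_upd_same del: fun_upd_apply)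
  qed (auto simp: \<sigma>'_def)
  then have "(\<integral>g. \<Phi> (\<lambda>k. \<tau> k * g k) \<partial>gaussian_law n) \<le> (\<integral>g. rop (p # l) \<Phi> (\<lambda>k. \<sigma> k * g k) \<partial>gaussian_law n)
     + sum_list (map (\<lambda>p. 4 * c (fst p)) (p # l)) * ?e"
    using le p by (simp add: algebra_simps)
  moreover have "(\<sigma>' k)\<^sup>2 + (1 - \<delta>) * sqsum l k = (\<sigma> k)\<^sup>2 + (1 - \<delta>) * sqsum (p # l) k" for k
    using t2 p by (auto simp: \<sigma>'_def sqsum_def algebra_simps)
  ultimately show ?case using \<tau> by (intro exI[of _ \<tau>]) simp
qed

text \<open>The exchange cannot start from variance zero. It starts from
  \<open>2 * \<beta>^2\<close>, the least variance the step accepts, which only increases the value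
  at the origin. The constant \<open>W\<close> is the variance reached at the end.\<close>

lemma rop_zero_upper:
  assumes \<Phi>: "coord_cvx_lip n c \<Phi>" and \<beta>: "0 < \<beta>" "2 * \<beta>\<^sup>2 < 1"
    and l: "\<And>p. p \<in> set l \<Longrightarrow> fst p < n \<and> \<bar>snd p\<bar> \<le> \<beta>" and v: "\<And>j. j < n \<Longrightarrow> sqsum l j \<le> v"
    and W: "v + 2 * \<beta>\<^sup>2 * ln (1 / (2 * \<beta>\<^sup>2)) \<le> W * (1 - 2 * \<beta>\<^sup>2)"
  shows "rop l \<Phi> (\<lambda>_. 0) \<le> (\<integral>g. \<Phi> (\<lambda>k. sqrt W * g k) \<partial>gaussian_law n)"
proof -
  interpret P: prob_space "gaussian_law n" unfolding gaussian_law_def by (rule prob_space_PiM) (rule gauss_prob)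
  have b: "0 < \<beta>\<^sup>2" using \<beta> by simp
  have rl: "coord_cvx_lip n c (rop l \<Phi>)" using l by (intro coord_cvx_lip_rop[OF \<Phi>]) auto
  have "\<exists>\<tau>. (\<forall>j<n. 0 \<le> \<tau> j \<and> 2 * \<beta>\<^sup>2 \<le> (\<tau> j)\<^sup>2 \<and>
      (\<tau> j)\<^sup>2 - 2 * \<beta>\<^sup>2 * ln ((\<tau> j)\<^sup>2) \<le> (sqrt (2 * \<beta>\<^sup>2))\<^sup>2 - 2 * \<beta>\<^sup>2 * ln ((sqrt (2 * \<beta>\<^sup>2))\<^sup>2) + sqsum l j) \<and>
    (\<integral>g. rop l \<Phi> (\<lambda>k. sqrt (2 * \<beta>\<^sup>2) * g k) \<partial>gaussian_law n) \<le> (\<integral>g. \<Phi> (\<lambda>k. \<tau> k * g k) \<partial>gaussian_law n)"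
    using l b by (intro rop_gauss_upper[OF \<Phi> \<beta>(1)]) auto
  then obtain \<tau> where \<tau>: "\<And>j. j < n \<Longrightarrow> 0 \<le> \<tau> j \<and> 2 * \<beta>\<^sup>2 \<le> (\<tau> j)\<^sup>2 \<and>
      (\<tau> j)\<^sup>2 - 2 * \<beta>\<^sup>2 * ln ((\<tau> j)\<^sup>2) \<le> 2 * \<beta>\<^sup>2 - 2 * \<beta>\<^sup>2 * ln (2 * \<beta>\<^sup>2) + sqsum l j"
    and le: "(\<integral>g. rop l \<Phi> (\<lambda>k. sqrt (2 * \<beta>\<^sup>2) * g k) \<partial>gaussian_law n) \<le> (\<integral>g. \<Phi> (\<lambda>k. \<tau> k * g k) \<partial>gaussian_law n)"
    using b by auto
  have "\<tau> j \<le> sqrt W" if j: "j < n" for j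
  proof -
    have pos: "0 < (\<tau> j)\<^sup>2" using \<tau>[OF j] b by linarith
    \<comment> \<open>The bound \<open>ln w \<le> w - 1\<close> solves the accumulated inequality
      for \<open>w\<close>; the starting variance cancels, and the logarithm of its inverse
      stays.\<close>
    have "2 * \<beta>\<^sup>2 * ln ((\<tau> j)\<^sup>2) \<le> 2 * \<beta>\<^sup>2 * ((\<tau> j)\<^sup>2 - 1)" 
      using b pos ln_le_minus_one[OF pos] by (intro mult_left_mono) auto
    then have "(\<tau> j)\<^sup>2 * (1 - 2 * \<beta>\<^sup>2) \<le> v + 2 * \<beta>\<^sup>2 * ln (1 / (2 * \<beta>\<^sup>2))"
      using \<tau>[OF j] v[OF j] b by (simp add: algebra_simps ln_div)
    then have "(\<tau> j)\<^sup>2 * (1 - 2 * \<beta>\<^sup>2) \<le> W * (1 - 2 * \<beta>\<^sup>2)" using W by linarith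
    then have "(\<tau> j)\<^sup>2 \<le> W" using \<beta> by simp
    then show ?thesis by (rule real_le_rsqrt)
  qed
  then have "(\<integral>g. \<Phi> (\<lambda>k. \<tau> k * g k) \<partial>gaussian_law n) \<le> (\<integral>g. \<Phi> (\<lambda>k. sqrt W * g k) \<partial>gaussian_law n)"
    using \<tau> by (intro gauss_law_scale_mono[OF \<Phi>]) auto
  moreover have "(\<integral>g. rop l \<Phi> (\<lambda>k. 0 * g k) \<partial>gaussian_law n) \<le> (\<integral>g. rop l \<Phi> (\<lambda>k. sqrt (2 * \<beta>\<^sup>2) * g k) \<partial>gaussian_law n)"
    by (rule gauss_law_scale_mono[OF rl, where \<sigma> = "\<lambda>_. 0" and \<tau> = "\<lambda>_. sqrt (2 * \<beta>\<^sup>2)"]) auto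
  ultimately show ?thesis using le P.prob_space by simp
qed

lemma rop_subadd:
  assumes "\<And>x y. \<Phi> (\<lambda>k. x k + y k) \<le> \<Phi> x + \<Phi> y"
  shows "rop l \<Phi> (\<lambda>k. x k + y k) \<le> rop l \<Phi> x + \<Phi> y"
proof (induction l arbitrary: x)
  case (Cons p l)
  have "rop l \<Phi> ((\<lambda>k. x k + y k)(fst p := x (fst p) + y (fst p) + b)) \<le> rop l \<Phi> (x(fst p := x (fst p) + b)) + \<Phi> y" for b
  proof -
    have "(\<lambda>k. x k + y k)(fst p := x (fst p) + y (fst p) + b) = (\<lambda>k. (x(fst p := x (fst p) + b)) k + y k)" by auto
    then show ?thesis using Cons.IH[of "x(fst p := x (fst p) + b)"] by (simp del: fun_upd_apply)
  qed
  from this[of "snd p"] this[of "- snd p"] show ?case by (simp add: rstep_def field_simps)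
qed (use assms in simp)

text \<open>The auxiliary starting noise of standard deviation \<open>\<sigma>\<^sub>0\<close> goes
  in the wrong direction here; subadditivity removes it at the price of its own Gaussian
  mean.\<close>

lemma rop_zero_lower:
  assumes \<Phi>: "coord_cvx_lip n c \<Phi>" and \<beta>: "0 < \<beta>" "\<beta> \<le> \<sigma>\<^sub>0" and \<delta>: "0 \<le> \<delta>" "\<delta> \<le> 1" and c: "\<And>j. j < n \<Longrightarrow> 0 \<le> c j"
    and sub: "\<And>x y. \<Phi> (\<lambda>k. x k + y k) \<le> \<Phi> x + \<Phi> y"
    and l: "\<And>p. p \<in> set l \<Longrightarrow> fst p < n \<and> \<bar>snd p\<bar> \<le> \<beta>"
    and s: "\<And>j. j < n \<Longrightarrow> \<sigma>\<^sub>0\<^sup>2 + sqsum l j \<le> 4"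
    and w: "0 \<le> w" "\<And>j. j < n \<Longrightarrow> w \<le> (1 - \<delta>) * sqsum l j"
  shows "(\<integral>g. \<Phi> (\<lambda>k. sqrt w * g k) \<partial>gaussian_law n) \<le> rop l \<Phi> (\<lambda>_. 0) + (\<integral>g. \<Phi> (\<lambda>k. \<sigma>\<^sub>0 * g k) \<partial>gaussian_law n)
      + sum_list (map (\<lambda>p. 4 * c (fst p)) l) * exp (- (3 * \<delta> * \<sigma>\<^sub>0\<^sup>2 / (8 * \<beta>\<^sup>2)))"
proof -
  interpret P: prob_space "gaussian_law n" unfolding gaussian_law_def by (rule prob_space_PiM) (rule gauss_prob)
  let ?e = "sum_list (map (\<lambda>p. 4 * c (fst p)) l) * exp (- (3 * \<delta> * \<sigma>\<^sub>0\<^sup>2 / (8 * \<beta>\<^sup>2)))"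
  have rl: "coord_cvx_lip n c (rop l \<Phi>)" using l by (intro coord_cvx_lip_rop[OF \<Phi>]) auto
  have "\<exists>\<tau>. (\<forall>j<n. 0 \<le> \<tau> j \<and> (\<tau> j)\<^sup>2 = \<sigma>\<^sub>0\<^sup>2 + (1 - \<delta>) * sqsum l j) \<and>
    (\<integral>g. \<Phi> (\<lambda>k. \<tau> k * g k) \<partial>gaussian_law n) \<le> (\<integral>g. rop l \<Phi> (\<lambda>k. \<sigma>\<^sub>0 * g k) \<partial>gaussian_law n) + ?e"
    using l s by (intro rop_gauss_lower[OF \<Phi> \<beta> \<delta> c, where \<sigma> = "\<lambda>_. \<sigma>\<^sub>0"]) auto
  then obtain \<tau> where \<tau>: "\<And>j. j < n \<Longrightarrow> 0 \<le> \<tau> j \<and> (\<tau> j)\<^sup>2 = \<sigma>\<^sub>0\<^sup>2 + (1 - \<delta>) * sqsum l j"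
    and le: "(\<integral>g. \<Phi> (\<lambda>k. \<tau> k * g k) \<partial>gaussian_law n) \<le> (\<integral>g. rop l \<Phi> (\<lambda>k. \<sigma>\<^sub>0 * g k) \<partial>gaussian_law n) + ?e" by blast
  have "sqrt w \<le> \<tau> j" if j: "j < n" for j
  proof (rule real_le_lsqrt)
    show "w \<le> (\<tau> j)\<^sup>2" using \<tau>[OF j] w(2)[OF j] zero_le_power2[of \<sigma>\<^sub>0] by linarith
  qed (use \<tau>[OF j] w in auto)
  then have 1: "(\<integral>g. \<Phi> (\<lambda>k. sqrt w * g k) \<partial>gaussian_law n) \<le> (\<integral>g. \<Phi> (\<lambda>k. \<tau> k * g k) \<partial>gaussian_law n)"
    using w(1) by (intro gauss_law_scale_mono[OF \<Phi>]) auto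
  have i: "integrable (gaussian_law n) (\<lambda>g. \<Phi> (\<lambda>k. \<sigma>\<^sub>0 * g k))"
    using coord_lip_gauss_integrable[of "{..<n}" c \<Phi> "\<lambda>_. \<sigma>\<^sub>0"] \<Phi> by (simp add: coord_cvx_lip_def gaussian_law_def)
  have "(\<integral>g. rop l \<Phi> (\<lambda>k. \<sigma>\<^sub>0 * g k) \<partial>gaussian_law n) \<le> (\<integral>g. rop l \<Phi> (\<lambda>_. 0) + \<Phi> (\<lambda>k. \<sigma>\<^sub>0 * g k) \<partial>gaussian_law n)"
  proof (rule integral_mono)
    show "integrable (gaussian_law n) (\<lambda>g. rop l \<Phi> (\<lambda>k. \<sigma>\<^sub>0 * g k))"
      using coord_lip_gauss_integrable[of "{..<n}" c "rop l \<Phi>" "\<lambda>_. \<sigma>\<^sub>0"] rl by (simp add: coord_cvx_lip_def gaussian_law_def)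
    show "rop l \<Phi> (\<lambda>k. \<sigma>\<^sub>0 * g k) \<le> rop l \<Phi> (\<lambda>_. 0) + \<Phi> (\<lambda>k. \<sigma>\<^sub>0 * g k)" for g
      using rop_subadd[of \<Phi> l "\<lambda>_. 0" "\<lambda>k. \<sigma>\<^sub>0 * g k", OF sub] by simp
  qed (use i in auto)
  also have "\<dots> = rop l \<Phi> (\<lambda>_. 0) + (\<integral>g. \<Phi> (\<lambda>k. \<sigma>\<^sub>0 * g k) \<partial>gaussian_law n)"
    using i P.prob_space by simp
  finally show ?thesis using 1 le by linarith
qed

text \<open>The contraction principle. As a function of the jump size, a symmetric two-point average
  of a convex function is an even part, hence monotone; the sizes are decreased one jump at a
  time.\<close>

lemma rop_contract:
  assumes \<Phi>: "coord_cvx_lip n c \<Phi>" and k: "\<And>k. k \<in> set ks \<Longrightarrow> p k < n \<and> \<bar>b' k\<bar> \<le> \<bar>b k\<bar>"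
  shows "rop (map (\<lambda>k. (p k, b' k)) ks) \<Phi> x \<le> rop (map (\<lambda>k. (p k, b k)) ks) \<Phi> x"
  using k
proof (induction ks arbitrary: x)
  case (Cons k ks)
  let ?R' = "rop (map (\<lambda>k. (p k, b' k)) ks) \<Phi>" and ?R = "rop (map (\<lambda>k. (p k, b k)) ks) \<Phi>"
  have rl: "coord_cvx_lip n c ?R" using Cons.prems by (intro coord_cvx_lip_rop[OF \<Phi>]) auto
  have pk: "p k < n" "\<bar>b' k\<bar> \<le> \<bar>b k\<bar>" using Cons.prems by auto
  define h where "h t = ?R (x(p k := t))" for t
  have "cvx_lip (c (p k)) h" unfolding h_def using coord_cvx_lipD[OF rl pk(1)] .
  then have "convex_on UNIV h" and lip: "\<And>s t. \<bar>h s - h t\<bar> \<le> c (p k) * \<bar>s - t\<bar>"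
    by (auto simp: cvx_lip_def)
  then have "cvx_lip (c (p k)) (\<lambda>t. h (t + x (p k)))"
    using convex_on_shift[of h "x (p k)"] lip[of "_ + x (p k)" "_ + x (p k)"] by (simp add: cvx_lip_def)
  from even_part_mono[OF this pk(2)]
  have "rstep (p k) (b' k) ?R x \<le> rstep (p k) (b k) ?R x"
    by (simp add: even_part_def rstep_def h_def add.commute)
  moreover have "rstep (p k) (b' k) ?R' x \<le> rstep (p k) (b' k) ?R x"
    unfolding rstep_def using Cons.prems by (intro divide_right_mono add_mono Cons.IH) auto
  ultimately show ?case by simp
qed simp

text \<open>Many signs act on the same coordinate: the map \<open>p\<close> sends a sign index to
  the coordinate it moves. The induction pushes the contribution of the first sign into the base
  point \<open>x\<close>.\<close>

lemma ravg_eq_rop: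
  assumes "distinct ks"
  shows "ravg ks (\<lambda>s. \<Psi> (\<lambda>j. x j + (\<Sum>k\<in>set ks. if p k = j then s k * b k else 0))) d
    = rop (map (\<lambda>k. (p k, b k)) ks) \<Psi> x"
  using assms
proof (induction ks arbitrary: d x)
  case (Cons k ks)
  have "ravg ks (\<lambda>s. \<Psi> (\<lambda>j. x j + (\<Sum>k\<in>set (k # ks). if p k = j then s k * b k else 0))) (d(k := v))
     = rop (map (\<lambda>k. (p k, b k)) ks) \<Psi> (x(p k := x (p k) + v * b k))" for v
  proof -
    have "ravg ks (\<lambda>s. \<Psi> (\<lambda>j. x j + (\<Sum>k\<in>set (k # ks). if p k = j then s k * b k else 0))) (d(k := v))
      = ravg ks (\<lambda>s. \<Psi> (\<lambda>j. (x(p k := x (p k) + v * b k)) j + (\<Sum>k\<in>set ks. if p k = j then s k * b k else 0))) (d(k := v))"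
    proof (rule ravg_cong)
      fix s assume "signs_on (set ks) (d(k := v)) s"
      then have sk: "s k = v" using Cons.prems by (auto simp: signs_on_def)
      have "(\<lambda>j. x j + (\<Sum>k\<in>set (k # ks). if p k = j then s k * b k else 0)) = 
        (\<lambda>j. (x(p k := x (p k) + v * b k)) j + (\<Sum>k\<in>set ks. if p k = j then s k * b k else 0))"
        using Cons.prems sk by (auto simp: fun_eq_iff)
      then show "\<Psi> (\<lambda>j. x j + (\<Sum>k\<in>set (k # ks). if p k = j then s k * b k else 0)) = 
        \<Psi> (\<lambda>j. (x(p k := x (p k) + v * b k)) j + (\<Sum>k\<in>set ks. if p k = j then s k * b k else 0))" by simp
    qed
    also have "\<dots> = rop (map (\<lambda>k. (p k, b k)) ks) \<Psi> (x(p k := x (p k) + v * b k))"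
      using Cons.prems by (intro Cons.IH) simp
    finally show ?thesis .
  qed
  from this[of 1] this[of "-1"] show ?case by (simp add: rstep_def del: fun_upd_apply)
qed simp

subsection \<open>The norm and its dual radius\<close>

text \<open>Makes the norm accept total functions, so that pointwise sums and multiples take the
  place of the extensional vector operations.\<close>

definition norm_fun :: "nat \<Rightarrow> ((nat \<Rightarrow> real) \<Rightarrow> real) \<Rightarrow> (nat \<Rightarrow> real) \<Rightarrow> real" where
  "norm_fun n N x = N (\<lambda>i\<in>{..<n}. x i)"

definition unit_vec :: "nat \<Rightarrow> nat \<Rightarrow> real" where
  "unit_vec j i = (if i = j then 1 else 0)"

lemma norm_fun_nonneg: "is_norm n N \<Longrightarrow> 0 \<le> norm_fun n N x"
  by (simp add: is_norm_def norm_fun_def)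

lemma norm_fun_add:
  assumes "is_norm n N"
  shows "norm_fun n N (\<lambda>i. x i + y i) \<le> norm_fun n N x + norm_fun n N y"
proof -
  have "(\<lambda>i\<in>{..<n}. x i + y i) = vadd n (\<lambda>i\<in>{..<n}. x i) (\<lambda>i\<in>{..<n}. y i)"
    by (auto simp: vadd_def restrict_def)
  moreover have "restrict x {..<n} \<in> Rn n" "restrict y {..<n} \<in> Rn n" by auto
  ultimately show ?thesis using assms unfolding is_norm_def norm_fun_def by metis
qed

lemma norm_fun_scale:
  assumes "is_norm n N"
  shows "norm_fun n N (\<lambda>i. a * x i) = \<bar>a\<bar> * norm_fun n N x"
proof -
  have "(\<lambda>i\<in>{..<n}. a * x i) = vscale n a (\<lambda>i\<in>{..<n}. x i)" by (auto simp: vscale_def restrict_def)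
  moreover have "restrict x {..<n} \<in> Rn n" by auto
  ultimately show ?thesis using assms unfolding is_norm_def norm_fun_def by metis
qed

lemma norm_fun_cong: "(\<And>i. i < n \<Longrightarrow> x i = y i) \<Longrightarrow> norm_fun n N x = norm_fun n N y"
  unfolding norm_fun_def by (metis lessThan_iff restrict_ext)

lemma norm_fun_zero: 
  assumes "is_norm n N"
  shows "norm_fun n N (\<lambda>_. 0) = 0"
  using norm_fun_scale[OF assms, of 0 "\<lambda>_. 0"] by simp

lemma norm_fun_sum_le:
  assumes "is_norm n N" "finite I"
  shows "norm_fun n N (\<lambda>i. \<Sum>j\<in>I. x j i) \<le> (\<Sum>j\<in>I. norm_fun n N (x j))"
  using assms(2)
proof (induction I rule: finite_induct)
  case (insert j I)
  then show ?case using norm_fun_add[OF assms(1), of "x j" "\<lambda>i. \<Sum>j\<in>I. x j i"] by simp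
qed (simp add: norm_fun_zero[OF assms(1)])

lemma norm_fun_le_coords:
  assumes "is_norm n N"
  shows "norm_fun n N x \<le> (\<Sum>j<n. norm_fun n N (unit_vec j) * \<bar>x j\<bar>)"
proof -
  have "norm_fun n N x = norm_fun n N (\<lambda>i. \<Sum>j<n. x j * unit_vec j i)"
    by (rule norm_fun_cong) (simp add: unit_vec_def if_distrib[of "\<lambda>t. _ * t"] cong: if_cong)
  also have "\<dots> \<le> (\<Sum>j<n. norm_fun n N (\<lambda>i. x j * unit_vec j i))"
    by (rule norm_fun_sum_le[OF assms]) simp
  also have "\<dots> = (\<Sum>j<n. norm_fun n N (unit_vec j) * \<bar>x j\<bar>)"
    by (simp add: norm_fun_scale[OF assms] mult.commute)
  finally show ?thesis .
qed

lemma norm_fun_diff_le: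
  assumes "is_norm n N"
  shows "\<bar>norm_fun n N x - norm_fun n N y\<bar> \<le> norm_fun n N (\<lambda>i. x i - y i)"
proof -
  have 1: "norm_fun n N x \<le> norm_fun n N y + norm_fun n N (\<lambda>i. x i - y i)" for x y
    using norm_fun_add[OF assms, of y "\<lambda>i. x i - y i"] by simp
  have "norm_fun n N (\<lambda>i. y i - x i) = norm_fun n N (\<lambda>i. x i - y i)"
    using norm_fun_scale[OF assms, of "-1" "\<lambda>i. x i - y i"] by simp
  then show ?thesis using 1[of x y] 1[of y x] by (simp add: abs_le_iff)
qed

lemma norm_fun_coord_cvx_lip:
  assumes "is_norm n N"
  shows "coord_cvx_lip n (\<lambda>j. norm_fun n N (unit_vec j)) (norm_fun n N)"
  unfolding coord_cvx_lip_def coord_lip_def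
proof (intro conjI allI impI)
  fix x j assume "j < n"
  show "convex_on UNIV (\<lambda>t. norm_fun n N (x(j := t)))"
  proof (rule convex_onI)
    fix t s r :: real assume t: "0 < t" "t < 1"
    have "norm_fun n N (x(j := (1 - t) *\<^sub>R s + t *\<^sub>R r)) 
      = norm_fun n N (\<lambda>i. (1 - t) * (x(j := s)) i + t * (x(j := r)) i)"
      by (rule norm_fun_cong) (auto simp: algebra_simps)
    also have "\<dots> \<le> norm_fun n N (\<lambda>i. (1 - t) * (x(j := s)) i) + norm_fun n N (\<lambda>i. t * (x(j := r)) i)"
      by (rule norm_fun_add[OF assms])
    finally show "norm_fun n N (x(j := (1 - t) *\<^sub>R s + t *\<^sub>R r)) 
        \<le> (1 - t) * norm_fun n N (x(j := s)) + t * norm_fun n N (x(j := r))"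
      using t unfolding norm_fun_scale[OF assms] by (simp del: fun_upd_apply)
  qed auto
next
  fix x y
  show "\<bar>norm_fun n N x - norm_fun n N y\<bar> \<le> (\<Sum>j<n. norm_fun n N (unit_vec j) * \<bar>x j - y j\<bar>)"
    using norm_fun_diff_le[OF assms, of x y] norm_fun_le_coords[OF assms, of "\<lambda>i. x i - y i"] by linarith
qed

lemma gaussian_mean_norm_fun: "gaussian_mean n N = (\<integral>g. norm_fun n N g \<partial>gaussian_law n)"
  unfolding gaussian_mean_def
proof (rule Bochner_Integration.integral_cong)
  fix g assume "g \<in> space (gaussian_law n)"
  then have "restrict g {..<n} = g" by (simp add: gaussian_law_def space_PiM PiE_restrict)
  then show "N g = norm_fun n N g" by (simp add: norm_fun_def)
qed simp

lemma gaussian_mean_scale: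
  assumes "is_norm n N"
  shows "(\<integral>g. norm_fun n N (\<lambda>k. a * g k) \<partial>gaussian_law n) = \<bar>a\<bar> * gaussian_mean n N"
  by (simp add: norm_fun_scale[OF assms] gaussian_mean_norm_fun)

lemma convex_body_bounded:
  assumes "convex_body n K"
  obtains M where "\<And>x. x \<in> K \<Longrightarrow> L2_set x {..<n} \<le> M"
proof -
  have "\<exists>B. \<forall>x\<in>K. \<bar>x i\<bar> \<le> B" if i: "i < n" for i
  proof -
    have "compactin (Rn_topology n) K" using assms by (simp add: convex_body_def)
    moreover have "continuous_map (Rn_topology n) euclideanreal (\<lambda>x. x i)"
      using i by (intro continuous_map_product_projection) auto
    ultimately have "compactin euclideanreal ((\<lambda>x. x i) ` K)" by (rule image_compactin)
    then have "bounded ((\<lambda>x. x i) ` K)" by (simp add: compact_imp_bounded)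
    then show ?thesis by (auto simp: bounded_iff)
  qed
  then obtain B where B: "\<And>i x. i < n \<Longrightarrow> x \<in> K \<Longrightarrow> \<bar>x i\<bar> \<le> B i" by metis
  show ?thesis
  proof
    fix x assume "x \<in> K"
    have "L2_set x {..<n} \<le> (\<Sum>i<n. \<bar>x i\<bar>)" by (rule L2_set_le_sum_abs)
    also have "\<dots> \<le> (\<Sum>i<n. B i)" using B[OF _ \<open>x \<in> K\<close>] by (intro sum_mono) auto
    finally show "L2_set x {..<n} \<le> (\<Sum>i<n. B i)" .
  qed
qed

lemma norm_unit_vec_pos:
  assumes "is_norm n N" "j < n"
  shows "0 < norm_fun n N (unit_vec j)"
proof -
  have "restrict (unit_vec j) {..<n} \<noteq> vzero n"
    using assms(2) by (auto simp: vzero_def unit_vec_def fun_eq_iff restrict_def)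
  moreover have "restrict (unit_vec j) {..<n} \<in> Rn n" by auto
  ultimately have "norm_fun n N (unit_vec j) \<noteq> 0" using assms(1) unfolding is_norm_def norm_fun_def by blast
  then show ?thesis using norm_fun_nonneg[OF assms(1), of "unit_vec j"] by linarith
qed

text \<open>Testing a polar vector against the normalised vectors
  \<open>\<plusminus>unit_vec j\<close> bounds its coordinates, so the supremum defining the dual
  radius is taken over a bounded nonempty set.\<close>

lemma polar_body_bdd:
  assumes N: "is_norm n N" 
  shows "bdd_above (vnorm2 n ` polar_body n (unit_ball_of n N))" 
    and "vzero n \<in> polar_body n (unit_ball_of n N)"
proof -
  show "vzero n \<in> polar_body n (unit_ball_of n N)"
    by (auto simp: polar_body_def vzero_def vinner_def)
  show "bdd_above (vnorm2 n ` polar_body n (unit_ball_of n N))"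
  proof (rule bdd_aboveI2)
    fix t assume t: "t \<in> polar_body n (unit_ball_of n N)"
    have "\<bar>t j\<bar> \<le> norm_fun n N (unit_vec j)" if j: "j < n" for j
    proof -
      have "s * t j \<le> norm_fun n N (unit_vec j)" if s: "\<bar>s\<bar> = 1" for s
      proof -
        let ?c = "norm_fun n N (unit_vec j)"
        have c: "0 < ?c" by (rule norm_unit_vec_pos[OF N j])
        define x where "x = (\<lambda>i\<in>{..<n}. s / ?c * unit_vec j i)"
        have "N x = norm_fun n N (\<lambda>i. s / ?c * unit_vec j i)" by (simp add: x_def norm_fun_def)
        also have "\<dots> = 1" 
          unfolding norm_fun_scale[OF N] using c s by (simp add: abs_divide)
        finally have "x \<in> unit_ball_of n N" by (simp add: unit_ball_of_def x_def)
        then have "vinner n x t \<le> 1" using t by (auto simp: polar_body_def)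
        also have "vinner n x t = (\<Sum>i<n. if i = j then s / ?c * t j else 0)"
          unfolding vinner_def by (intro sum.cong) (auto simp: x_def unit_vec_def)
        also have "\<dots> = s / ?c * t j" using j by simp
        finally show ?thesis using c by (simp add: field_simps)
      qed
      from this[of 1] this[of "-1"] show ?thesis by (simp add: abs_le_iff)
    qed
    then have "(\<Sum>i<n. \<bar>t i\<bar>) \<le> (\<Sum>i<n. norm_fun n N (unit_vec i))" by (intro sum_mono) auto
    then show "vnorm2 n t \<le> (\<Sum>i<n. norm_fun n N (unit_vec i))"
      using L2_set_le_sum_abs[of t "{..<n}"] by linarith
  qed
qed

definition dual_radius :: "nat \<Rightarrow> ((nat \<Rightarrow> real) \<Rightarrow> real) \<Rightarrow> real" where
  "dual_radius n N = (SUP t\<in>polar_body n (unit_ball_of n N). vnorm2 n t)"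

lemma dual_radius_upper:
  "is_norm n N \<Longrightarrow> t \<in> polar_body n (unit_ball_of n N) \<Longrightarrow> vnorm2 n t \<le> dual_radius n N"
  unfolding dual_radius_def by (rule cSUP_upper[OF _ polar_body_bdd(1)])

lemma dual_radius_nonneg: "is_norm n N \<Longrightarrow> 0 \<le> dual_radius n N"
  using dual_radius_upper[OF _ polar_body_bdd(2)] L2_set_nonneg order_trans by blast

lemma L2_set_scale: "L2_set (\<lambda>i. a * x i) A = \<bar>a\<bar> * L2_set x A"
  by (simp add: L2_set_def power_mult_distrib sum_distrib_left[symmetric] real_sqrt_mult)

text \<open>\<open>sqrt (1 + w) \<le> 1 + w / 2\<close>: a first-order expansion of the Euclidean
  norm at a unit vector with an explicit quadratic remainder.\<close>

lemma L2_set_sub_le: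
  fixes x y :: "nat \<Rightarrow> real"
  assumes "L2_set x {..<n} = 1"
  shows "L2_set (\<lambda>i. x i - s * y i) {..<n} \<le> 1 - s * (\<Sum>i<n. x i * y i) + s\<^sup>2 * (L2_set y {..<n})\<^sup>2 / 2"
proof -
  let ?p = "\<Sum>i<n. x i * y i" and ?q = "(L2_set y {..<n})\<^sup>2"
  have x: "(\<Sum>i<n. (x i)\<^sup>2) = 1" using assms by (simp add: L2_set_def)
  have q: "?q = (\<Sum>i<n. (y i)\<^sup>2)" by (simp add: L2_set_def sum_nonneg)
  have e: "(\<Sum>i<n. (x i - s * y i)\<^sup>2) = 1 + (s\<^sup>2 * ?q - 2 * s * ?p)"
  proof -
    have "(\<Sum>i<n. (x i - s * y i)\<^sup>2) = (\<Sum>i<n. (x i)\<^sup>2 - 2 * s * (x i * y i) + s\<^sup>2 * (y i)\<^sup>2)"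
      by (intro sum.cong) (auto simp: power2_eq_square algebra_simps)
    also have "\<dots> = (\<Sum>i<n. (x i)\<^sup>2) - 2 * s * ?p + s\<^sup>2 * (\<Sum>i<n. (y i)\<^sup>2)"
      by (simp add: sum.distrib sum_subtractf sum_distrib_left)
    finally show ?thesis by (simp add: x q)
  qed
  define w where "w = s\<^sup>2 * ?q - 2 * s * ?p"
  have w: "0 \<le> 1 + w" using e sum_nonneg[of "{..<n}" "\<lambda>i. (x i - s * y i)\<^sup>2"] by (simp add: w_def)
  have "L2_set (\<lambda>i. x i - s * y i) {..<n} = sqrt (1 + w)" by (simp add: L2_set_def e w_def)
  also have "\<dots> \<le> 1 + w / 2"
  proof (rule real_le_lsqrt)
    have "(1 + w / 2)\<^sup>2 = 1 + w + (w / 2)\<^sup>2" by (simp add: power2_eq_square algebra_simps)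
    then show "1 + w \<le> (1 + w / 2)\<^sup>2" by simp
  qed (use w in auto)
  finally show ?thesis by (simp add: w_def diff_divide_distrib)
qed

text \<open>A near-maximiser of the norm on the Euclidean sphere is, up to a factor, itself an element of the polar
  body (first-order condition), so no separation theorem is needed.\<close>

lemma norm_fun_le_dual_radius:
  assumes K: "convex_body n (unit_ball_of n N)" and N: "is_norm n N"
  shows "norm_fun n N x \<le> dual_radius n N * L2_set x {..<n}"
proof -
  let ?S = "norm_fun n N ` {x. L2_set x {..<n} = 1}"
  define r where "r = Sup ?S"
  obtain M where M: "\<And>x. x \<in> unit_ball_of n N \<Longrightarrow> L2_set x {..<n} \<le> M" using convex_body_bounded[OF K] by blast
  have bdd: "bdd_above ?S"
  proof (rule bdd_aboveI2)
    fix x assume "x \<in> {x. L2_set x {..<n} = 1}"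
    then have x: "L2_set x {..<n} = 1" by simp
    have "\<bar>x j\<bar> \<le> 1" if "j < n" for j
      using member_le_L2_set[of "{..<n}" j "\<lambda>j. \<bar>x j\<bar>"] that x by (simp add: L2_set_def)
    then have "(\<Sum>j<n. norm_fun n N (unit_vec j) * \<bar>x j\<bar>) \<le> (\<Sum>j<n. norm_fun n N (unit_vec j))"
      using norm_fun_nonneg[OF N] by (intro sum_mono) (simp add: mult_left_le)
    then show "norm_fun n N x \<le> (\<Sum>j<n. norm_fun n N (unit_vec j))"
      using norm_fun_le_coords[OF N, of x] by linarith
  qed
  have le_r: "norm_fun n N x \<le> r * L2_set x {..<n}" for x
  proof (cases "L2_set x {..<n} = 0")
    case True
    then have "norm_fun n N x = norm_fun n N (\<lambda>_. 0)"
      by (intro norm_fun_cong) (auto simp: L2_set_eq_0_iff)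
    then show ?thesis using True norm_fun_zero[OF N] by simp
  next
    case False
    then have p: "0 < L2_set x {..<n}" using L2_set_nonneg[of x "{..<n}"] by linarith
    define y where "y = (\<lambda>i. (1 / L2_set x {..<n}) * x i)"
    have "L2_set y {..<n} = \<bar>1 / L2_set x {..<n}\<bar> * L2_set x {..<n}"
      unfolding y_def by (rule L2_set_scale)
    then have "L2_set y {..<n} = 1" using p by simp
    then have "norm_fun n N y \<in> ?S" by (intro imageI CollectI)
    then have "norm_fun n N y \<le> r"
      unfolding r_def by (rule cSup_upper[OF _ bdd])
    moreover have "norm_fun n N y = \<bar>1 / L2_set x {..<n}\<bar> * norm_fun n N x"
      unfolding y_def by (rule norm_fun_scale[OF N])
    ultimately show ?thesis using p by (simp add: field_simps)
  qed
  \<comment> \<open>In dimension zero the sphere is empty and \<open>r\<close> is the supremum of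
    the empty set; that case is settled separately.\<close>
  have "r \<le> dual_radius n N" if n: "0 < n"
  proof -
    let ?R = "dual_radius n N"
    have u: "L2_set (unit_vec 0) {..<n} = 1" using n 
      by (simp add: L2_set_def unit_vec_def if_distrib[of "\<lambda>t. t\<^sup>2"] cong: if_cong)
    then have "norm_fun n N (unit_vec 0) \<in> ?S" by (intro imageI CollectI)
    then have ne: "?S \<noteq> {}" by (rule ex_in_conv[THEN iffD1, OF exI])
    have r0: "0 \<le> r" using le_r[of "unit_vec 0"] norm_fun_nonneg[OF N, of "unit_vec 0"] u by simp
    have R0: "0 \<le> ?R" by (rule dual_radius_nonneg[OF N])
    define C where "C = 1 + r * M\<^sup>2 / 2"
    have C: "0 < C" using r0 by (simp add: C_def add_pos_nonneg)
    \<comment> \<open>With a defect of only \<open>\<eta>^2\<close> from the maximum, a perturbation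
      of size \<eta> in any direction \<open>y\<close> of the unit ball can be divided by \<eta>,
      leaving the first-order condition up to \<open>\<eta> * C\<close>.\<close>
    have key: "r \<le> ?R * (1 + \<eta> * C)" if \<eta>: "0 < \<eta>" for \<eta>
    proof -
      have "r - \<eta>\<^sup>2 < Sup ?S" using \<eta> by (simp add: r_def)
      then obtain w where "w \<in> ?S" and w: "r - \<eta>\<^sup>2 < w" by (rule less_cSupE[OF _ ne])
      then obtain x0 where wx: "w = norm_fun n N x0" and "x0 \<in> {x. L2_set x {..<n} = 1}" by (elim imageE)
      then have x0: "L2_set x0 {..<n} = 1" "r - \<eta>\<^sup>2 < norm_fun n N x0" using w by simp_all
      have ip: "r * (\<Sum>i<n. y i * x0 i) \<le> 1 + \<eta> * C" if y: "y \<in> unit_ball_of n N" for y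
      proof -
        have "y \<in> Rn n" "N y \<le> 1" using y by (simp_all add: unit_ball_of_def)
        then have Ny: "norm_fun n N y \<le> 1" using PiE_restrict[of y "{..<n}" "\<lambda>_. UNIV"] by (simp add: norm_fun_def)
        define q p where "q = (L2_set y {..<n})\<^sup>2" and "p = (\<Sum>i<n. x0 i * y i)"
        have q: "q \<le> M\<^sup>2" unfolding q_def using M[OF y] by (intro power_mono) auto
        have "norm_fun n N x0 \<le> norm_fun n N (\<lambda>i. x0 i - \<eta> * y i) + norm_fun n N (\<lambda>i. \<eta> * y i)"
          using norm_fun_add[OF N, of "\<lambda>i. x0 i - \<eta> * y i" "\<lambda>i. \<eta> * y i"] by simp
        also have "\<dots> \<le> r * (1 - \<eta> * p + \<eta>\<^sup>2 * q / 2) + \<eta> * 1"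
        proof (rule add_mono)
          show "norm_fun n N (\<lambda>i. x0 i - \<eta> * y i) \<le> r * (1 - \<eta> * p + \<eta>\<^sup>2 * q / 2)"
            using le_r[of "\<lambda>i. x0 i - \<eta> * y i"] mult_left_mono[OF L2_set_sub_le[OF x0(1), of \<eta> y] r0]
            unfolding q_def p_def by linarith
          show "norm_fun n N (\<lambda>i. \<eta> * y i) \<le> \<eta> * 1"
            using norm_fun_scale[OF N, of \<eta> y] mult_left_mono[OF Ny, of \<eta>] \<eta> by simp
        qed
        finally have "\<eta> * (r * p) \<le> \<eta> * (\<eta> + \<eta> * (r * q / 2) + 1)"
          using x0(2) by (simp add: algebra_simps power2_eq_square)
        then have "r * p \<le> \<eta> + \<eta> * (r * q / 2) + 1" using \<eta> by simp
        also have "\<dots> \<le> \<eta> + \<eta> * (r * M\<^sup>2 / 2) + 1"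
          using mult_left_mono[OF q r0] \<eta> by simp
        also have "\<dots> = 1 + \<eta> * C" by (simp add: C_def algebra_simps)
        finally show ?thesis by (simp add: p_def mult.commute)
      qed
      have pos: "0 < 1 + \<eta> * C" using \<eta> C by (simp add: add_pos_pos)
      define t where "t = (\<lambda>i\<in>{..<n}. (r / (1 + \<eta> * C)) * x0 i)"
      have "t \<in> polar_body n (unit_ball_of n N)"
        unfolding polar_body_def
      proof (intro CollectI conjI ballI)
        fix y assume y: "y \<in> unit_ball_of n N"
        have "vinner n y t = (r * (\<Sum>i<n. y i * x0 i)) / (1 + \<eta> * C)"
          unfolding vinner_def t_def sum_distrib_left sum_divide_distrib by (intro sum.cong) auto
        also have "\<dots> \<le> 1" using ip[OF y] pos by simp
        finally show "vinner n y t \<le> 1" .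
      qed (auto simp: t_def)
      then have "vnorm2 n t \<le> ?R" by (rule dual_radius_upper[OF N])
      also have "vnorm2 n t = L2_set (\<lambda>i. (r / (1 + \<eta> * C)) * x0 i) {..<n}"
        by (rule L2_set_cong) (auto simp: t_def)
      also have "\<dots> = r / (1 + \<eta> * C)" using x0(1) r0 pos unfolding L2_set_scale by simp
      finally show ?thesis using pos by (simp add: field_simps)
    qed
    show ?thesis
    proof (rule field_le_epsilon)
      fix e :: real assume e: "0 < e"
      have p: "0 < ?R * C + 1" using R0 C by (simp add: add_nonneg_pos)
      have "r \<le> ?R * (1 + e / (?R * C + 1) * C)" using e p by (intro key) auto
      also have "\<dots> = ?R + e * (?R * C / (?R * C + 1))" by (simp add: algebra_simps)
      also have "\<dots> \<le> ?R + e * 1" using e p by (intro add_left_mono mult_left_mono) auto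
      finally show "r \<le> ?R + e" by simp
    qed
  qed
  moreover have "norm_fun n N x = 0" if "n = 0" using norm_fun_le_coords[OF N, of x] norm_fun_nonneg[OF N, of x] that by simp
  moreover have "r * L2_set x {..<n} \<le> dual_radius n N * L2_set x {..<n}" if "r \<le> dual_radius n N"
    using that by (intro mult_right_mono L2_set_nonneg)
  moreover have "0 \<le> dual_radius n N * L2_set x {..<n}"
    by (intro mult_nonneg_nonneg dual_radius_nonneg[OF N] L2_set_nonneg)
  ultimately show ?thesis using le_r[of x] by (cases "n = 0") linarith+
qed

lemma norm_unit_vec_le:
  assumes "convex_body n (unit_ball_of n N)" "is_norm n N" "j < n"
  shows "norm_fun n N (unit_vec j) \<le> dual_radius n N"
proof -
  have "L2_set (unit_vec j) {..<n} = 1" using assms(3)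
    by (simp add: L2_set_def unit_vec_def if_distrib[of "\<lambda>t. t\<^sup>2"] cong: if_cong)
  then show ?thesis using norm_fun_le_dual_radius[OF assms(1,2), of "unit_vec j"] by simp
qed

lemma critical_dim_eq: 
  assumes N: "is_norm n N" and pos: "0 < critical_dim n (unit_ball_of n N) N"
  shows "0 < dual_radius n N" "0 < gaussian_mean n N" 
    "gaussian_mean n N = dual_radius n N * sqrt (critical_dim n (unit_ball_of n N) N)"
proof -
  have c: "critical_dim n (unit_ball_of n N) N = (gaussian_mean n N / dual_radius n N)\<^sup>2"
    by (simp add: critical_dim_def dual_radius_def)
  have m: "0 \<le> gaussian_mean n N" unfolding gaussian_mean_norm_fun
    by (intro integral_nonneg_AE AE_I2 norm_fun_nonneg[OF N])
  have r: "0 \<le> dual_radius n N" by (rule dual_radius_nonneg[OF N])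
  \<comment> \<open>A vanishing radius would make the quotient 0 by the convention for division,
    against positivity of the critical dimension.\<close>
  have "gaussian_mean n N \<noteq> 0" "dual_radius n N \<noteq> 0" using pos c by auto
  then show p: "0 < dual_radius n N" "0 < gaussian_mean n N" using m r by auto
  then show "gaussian_mean n N = dual_radius n N * sqrt (critical_dim n (unit_ball_of n N) N)"
    unfolding c by simp
qed

subsection \<open>Moments, tails and symmetrization\<close>

text \<open>A single term of the exponential series at \<open>k\<close>.\<close>

lemma power_self_le_exp_fact: "real k ^ k \<le> exp (real k) * fact k"
proof -
  have s: "summable (\<lambda>n. real k ^ n /\<^sub>R fact n)" by (rule summable_exp_generic)
  have "(\<Sum>n\<in>{k}. real k ^ n /\<^sub>R fact n) \<le> (\<Sum>n. real k ^ n /\<^sub>R fact n)"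
    by (intro sum_le_suminf s) auto
  then have "real k ^ k /\<^sub>R fact k \<le> exp (real k)" by (simp add: exp_def)
  then show ?thesis by (simp add: field_simps)
qed

text \<open>Subgaussianity at the exponents \<open>p = 2 * k\<close> for a variable of variance one:
  the bound is \<open>(L * sqrt p)^p\<close>.\<close>

definition subgaussian_moments :: "real \<Rightarrow> 'a measure \<Rightarrow> ('a \<Rightarrow> real) \<Rightarrow> bool" where
  "subgaussian_moments L M f \<longleftrightarrow> f \<in> borel_measurable M \<and>
     (\<forall>k\<ge>1. integrable M (\<lambda>x. f x ^ (2 * k)) \<and> (\<integral>x. f x ^ (2 * k) \<partial>M) \<le> (2 * L\<^sup>2 * real k) ^ k) \<and>
     (\<integral>x. (f x)\<^sup>2 \<partial>M) = 1"

text \<open>The first-order coefficient \<open>t\<close> must be exact, because the variance is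
  needed up to \<epsilon> and not up to a constant. Only the terms from the second on are estimated,
  by a geometric series of ratio \<open>q\<close>, so the excess is quadratic in
  \<open>q\<close>.\<close>

lemma exp_square_moment:
  assumes M: "prob_space M" and f: "subgaussian_moments L M f" 
    and t: "0 \<le> t" "q = 6 * L\<^sup>2 * t" "q \<le> 1/2"
  shows "integrable M (\<lambda>x. exp (t * (f x)\<^sup>2))" "(\<integral>x. exp (t * (f x)\<^sup>2) \<partial>M) \<le> exp (t + 2 * q\<^sup>2)"
proof -
  interpret prob_space M by fact
  have fm[measurable]: "f \<in> borel_measurable M" using f by (simp add: subgaussian_moments_def)
  have q0: "0 \<le> q" using t by simp
  \<comment> \<open>Bounds for the terms of the series. In \<open>q = 6 * L^2 * t\<close> the factor
    2 comes from the exponents \<open>2 * k\<close> and the 3 from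
    \<open>k^k / fact k \<le> 3^k\<close>.\<close>
  define c where "c k = (if k = 0 then 1 else if k = 1 then t else q ^ k)" for k :: nat
  have gs: "(\<lambda>k. q ^ k) sums (1 / (1 - q))" using q0 t by (intro geometric_sums) auto
  have "(\<lambda>k. q ^ k + (if k = 1 then t - q else 0)) sums (1 / (1 - q) + (t - q))"
    using sums_single[of 1 "\<lambda>_. t - q"] by (intro sums_add gs) simp
  also have "(\<lambda>k. q ^ k + (if k = 1 then t - q else 0)) = c" by (auto simp: c_def fun_eq_iff)
  finally have cs: "c sums (1 / (1 - q) + (t - q))" .
  have cb: "1 / (1 - q) + (t - q) \<le> 1 + t + 2 * q\<^sup>2"
  proof -
    have "1 / (1 - q) \<le> 1 + q + 2 * q\<^sup>2"
    proof -
      have "(1 + q + 2 * q\<^sup>2) * (1 - q) - 1 = q\<^sup>2 * (1 - 2 * q)" by (simp add: algebra_simps power2_eq_square)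
      also have "\<dots> \<ge> 0" using t by simp
      finally show ?thesis using t by (simp add: divide_le_eq)
    qed
    then show ?thesis by simp
  qed
  have nn: "(\<integral>\<^sup>+ x. ennreal ((t * (f x)\<^sup>2) ^ k / fact k) \<partial>M) \<le> ennreal (c k)" for k
  proof (cases "k = 0")
    case True
    then show ?thesis by (simp add: c_def emeasure_space_1)
  next
    case False
    then have k: "k \<ge> 1" by simp
    have i: "integrable M (\<lambda>x. f x ^ (2 * k))" and b: "(\<integral>x. f x ^ (2 * k) \<partial>M) \<le> (2 * L\<^sup>2 * real k) ^ k"
      using f k by (auto simp: subgaussian_moments_def)
    have e: "(t * (f x)\<^sup>2) ^ k / fact k = t ^ k / fact k * f x ^ (2 * k)" for x
      by (simp add: power_mult_distrib power_mult)
    have "(\<integral>\<^sup>+ x. ennreal ((t * (f x)\<^sup>2) ^ k / fact k) \<partial>M) = ennreal (\<integral>x. t ^ k / fact k * f x ^ (2 * k) \<partial>M)"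
      unfolding e using i t by (intro nn_integral_eq_integral) auto
    also have "\<dots> \<le> ennreal (c k)"
    proof (rule ennreal_leI)
      show "(\<integral>x. t ^ k / fact k * f x ^ (2 * k) \<partial>M) \<le> c k"
      proof (cases "k = 1")
        case True
        then show ?thesis using f by (simp add: c_def subgaussian_moments_def)
      next
        case False
        have "(\<integral>x. t ^ k / fact k * f x ^ (2 * k) \<partial>M) = t ^ k / fact k * (\<integral>x. f x ^ (2 * k) \<partial>M)" by simp
        also have "\<dots> \<le> t ^ k / fact k * (2 * L\<^sup>2 * real k) ^ k" using b t by (intro mult_left_mono) auto
        also have "\<dots> = (2 * L\<^sup>2 * t) ^ k * (real k ^ k / fact k)" by (simp add: power_mult_distrib)
        also have "\<dots> \<le> (2 * L\<^sup>2 * t) ^ k * exp (real k)"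
          using power_self_le_exp_fact[of k] t by (intro mult_left_mono) (auto simp: field_simps)
        also have "exp (real k) = exp 1 ^ k" by (simp flip: exp_of_nat_mult)
        also have "(2 * L\<^sup>2 * t) ^ k * exp 1 ^ k \<le> (2 * L\<^sup>2 * t) ^ k * 3 ^ k"
          using exp_le t by (intro mult_left_mono power_mono) auto
        also have "\<dots> = (2 * L\<^sup>2 * t * 3) ^ k" by (simp only: power_mult_distrib)
        also have "\<dots> = c k" using False \<open>k \<noteq> 0\<close> t by (simp add: c_def algebra_simps)
        finally show ?thesis .
      qed
    qed
    finally show ?thesis .
  qed
  have expand: "ennreal (exp (t * (f x)\<^sup>2)) = (\<Sum>k. ennreal ((t * (f x)\<^sup>2) ^ k / fact k))" for x
  proof -
    have "(\<lambda>k. (t * (f x)\<^sup>2) ^ k / fact k) sums exp (t * (f x)\<^sup>2)"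
      using exp_converges[of "t * (f x)\<^sup>2"] by (simp add: divide_inverse mult.commute)
    then have "(\<lambda>k. ennreal ((t * (f x)\<^sup>2) ^ k / fact k)) sums ennreal (exp (t * (f x)\<^sup>2))"
      using t by (subst sums_ennreal) auto
    then show ?thesis by (simp add: sums_unique)
  qed
  have "(\<integral>\<^sup>+ x. ennreal (exp (t * (f x)\<^sup>2)) \<partial>M) = (\<Sum>k. \<integral>\<^sup>+ x. ennreal ((t * (f x)\<^sup>2) ^ k / fact k) \<partial>M)"
    unfolding expand by (rule nn_integral_suminf) measurable
  also have "\<dots> \<le> (\<Sum>k. ennreal (c k))" by (intro suminf_le nn) auto
  also have "\<dots> = ennreal (1 / (1 - q) + (t - q))"
    using cs q0 t by (subst suminf_ennreal2) (auto simp: c_def sums_iff)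
  also have "\<dots> \<le> ennreal (1 + t + 2 * q\<^sup>2)" by (rule ennreal_leI[OF cb])
  also have "\<dots> \<le> ennreal (exp (t + 2 * q\<^sup>2))"
    using exp_ge_add_one_self[of "t + 2 * q\<^sup>2"] by (intro ennreal_leI) (simp add: add.assoc)
  finally have le: "(\<integral>\<^sup>+ x. ennreal (exp (t * (f x)\<^sup>2)) \<partial>M) \<le> ennreal (exp (t + 2 * q\<^sup>2))" .
  show int: "integrable M (\<lambda>x. exp (t * (f x)\<^sup>2))"
    using le by (intro integrableI_bounded) (auto simp: le_less_trans[OF _ ennreal_less_top])
  show "(\<integral>x. exp (t * (f x)\<^sup>2) \<partial>M) \<le> exp (t + 2 * q\<^sup>2)"
  proof -
    have "ennreal (\<integral>x. exp (t * (f x)\<^sup>2) \<partial>M) = (\<integral>\<^sup>+ x. ennreal (exp (t * (f x)\<^sup>2)) \<partial>M)"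
      by (rule nn_integral_eq_integral[symmetric, OF int]) auto
    then have "ennreal (\<integral>x. exp (t * (f x)\<^sup>2) \<partial>M) \<le> ennreal (exp (t + 2 * q\<^sup>2))" using le by (simp only:)
    then show ?thesis by (simp only: ennreal_le_iff[OF less_imp_le[OF exp_gt_zero]])
  qed
qed

text \<open>Truncation at \<open>m\<close> removes at most \<open>f^4 / m\<close>, and
  \<open>16 * L^4\<close> bounds the fourth moment. The truncated form is needed since the lower
  comparison of the conditional mean works with truncated entries.\<close>

lemma exp_neg_truncated_square_moment:
  assumes M: "prob_space M" and f: "subgaussian_moments L M f" and t: "0 \<le> t" and m: "0 < m"
  shows "integrable M (\<lambda>x. exp (- t * min ((f x)\<^sup>2) m))" 
    "(\<integral>x. exp (- t * min ((f x)\<^sup>2) m) \<partial>M) \<le> exp (- t * (1 - 16 * L^4 / m) + 8 * L^4 * t\<^sup>2)"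
proof -
  interpret prob_space M by fact
  have fm[measurable]: "f \<in> borel_measurable M" using f by (simp add: subgaussian_moments_def)
  have i2: "integrable M (\<lambda>x. (f x)\<^sup>2)" and m2: "(\<integral>x. (f x)\<^sup>2 \<partial>M) = 1"
    using f by (auto simp: subgaussian_moments_def dest: spec[of _ 1])
  have i4: "integrable M (\<lambda>x. f x ^ 4)" and m4: "(\<integral>x. f x ^ 4 \<partial>M) \<le> 16 * L^4"
  proof -
    have "\<forall>k\<ge>1. integrable M (\<lambda>x. f x ^ (2 * k)) \<and> (\<integral>x. f x ^ (2 * k) \<partial>M) \<le> (2 * L\<^sup>2 * real k) ^ k"
      using f by (simp add: subgaussian_moments_def)
    from this[rule_format, of 2]
    have a: "integrable M (\<lambda>x. f x ^ (2 * 2)) \<and> (\<integral>x. f x ^ (2 * 2) \<partial>M) \<le> (2 * L\<^sup>2 * real 2) ^ 2" by simp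
    then show "integrable M (\<lambda>x. f x ^ 4)" by simp
    have "(2 * L\<^sup>2 * real 2) ^ 2 = 16 * L^4" by (simp add: power_mult_distrib flip: power_mult)
    then show "(\<integral>x. f x ^ 4 \<partial>M) \<le> 16 * L^4" using a by simp
  qed
  show i: "integrable M (\<lambda>x. exp (- t * min ((f x)\<^sup>2) m))"
    using t m by (intro integrable_const_bound[of _ 1]) auto
  have "(\<integral>x. exp (- t * min ((f x)\<^sup>2) m) \<partial>M) \<le> (\<integral>x. 1 - t * ((f x)\<^sup>2 - f x ^ 4 / m) + t\<^sup>2 / 2 * f x ^ 4 \<partial>M)"
  proof (intro integral_mono i)
    fix x
    let ?w = "min ((f x)\<^sup>2) m"
    have w0: "0 \<le> ?w" using m by auto
    have "exp (- (t * ?w)) \<le> 1 - t * ?w + (t * ?w)\<^sup>2 / 2" using w0 t by (intro exp_neg_le) auto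
    moreover have "(f x)\<^sup>2 - f x ^ 4 / m \<le> ?w"
    proof (cases "(f x)\<^sup>2 \<le> m")
      case False
      then have "(f x)\<^sup>2 * m \<le> (f x)\<^sup>2 * (f x)\<^sup>2" by (intro mult_left_mono) auto
      then have "(f x)\<^sup>2 \<le> f x ^ 4 / m" using m by (simp add: field_simps power2_eq_square power4_eq_xxxx)
      then show ?thesis using m by simp
    qed (use m in auto)
    then have "t * ((f x)\<^sup>2 - f x ^ 4 / m) \<le> t * ?w" using t by (intro mult_left_mono) auto
    moreover have "(t * ?w)\<^sup>2 \<le> t\<^sup>2 * f x ^ 4"
    proof -
      have "?w\<^sup>2 \<le> ((f x)\<^sup>2)\<^sup>2" using w0 by (intro power_mono) auto
      also have "\<dots> = f x ^ 4" by (simp flip: power_mult)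
      finally show ?thesis by (simp add: power_mult_distrib mult_left_mono)
    qed
    ultimately show "exp (- t * ?w) \<le> 1 - t * ((f x)\<^sup>2 - f x ^ 4 / m) + t\<^sup>2 / 2 * f x ^ 4" by simp
  qed (use i2 i4 in auto)
  also have "\<dots> = 1 - t * (1 - (\<integral>x. f x ^ 4 \<partial>M) / m) + t\<^sup>2 / 2 * (\<integral>x. f x ^ 4 \<partial>M)"
    using i2 i4 m2 prob_space by simp
  also have "\<dots> \<le> 1 - t * (1 - 16 * L^4 / m) + t\<^sup>2 / 2 * (16 * L^4)"
    using m4 t m by (intro add_mono diff_left_mono mult_left_mono divide_right_mono) auto
  also have "\<dots> \<le> exp (- t * (1 - 16 * L^4 / m) + 8 * L^4 * t\<^sup>2)"
    using exp_ge_add_one_self[of "- t * (1 - 16 * L^4 / m) + 8 * L^4 * t\<^sup>2"] by (simp add: algebra_simps)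
  finally show "(\<integral>x. exp (- t * min ((f x)\<^sup>2) m) \<partial>M) \<le> exp (- t * (1 - 16 * L^4 / m) + 8 * L^4 * t\<^sup>2)" .
qed

section \<open>Exponential tail bounds for weighted squares\<close>

lemma chernoff_iid:
  assumes M: "prob_space M" and X: "\<And>i. i < m \<Longrightarrow> X i \<in> borel_measurable M"
    "\<And>i. i < m \<Longrightarrow> integrable M (\<lambda>x. exp (X i x))" "\<And>i. i < m \<Longrightarrow> (\<integral>x. exp (X i x) \<partial>M) \<le> exp (b i)"
    and s: "(\<Sum>i<m. b i) + s \<le> r"
  shows "measure (iid_copies m M) {z \<in> space (iid_copies m M). (\<Sum>i<m. X i (z i)) \<ge> r} \<le> exp (- s)"
proof -
  interpret product_prob_space "\<lambda>_. M" "{..<m}" by (intro product_prob_spaceI M)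
  have int: "integrable (iid_copies m M) (\<lambda>z. \<Prod>i<m. exp (X i (z i)))"
    unfolding iid_copies_def using X by (intro product_integrable_prod) auto
  have "measure (iid_copies m M) {z \<in> space (iid_copies m M). (\<Sum>i<m. X i (z i)) \<ge> r}
    = measure (iid_copies m M) {z \<in> space (iid_copies m M). (\<Prod>i<m. exp (X i (z i))) \<ge> exp r}"
    by (simp flip: exp_sum)
  also have "\<dots> \<le> (\<integral>z. (\<Prod>i<m. exp (X i (z i))) \<partial>iid_copies m M) / exp r"
    by (rule integral_Markov_inequality_measure[OF int, of "{}"]) (auto intro!: AE_I2 prod_nonneg)
  also have "(\<integral>z. (\<Prod>i<m. exp (X i (z i))) \<partial>iid_copies m M) = (\<Prod>i<m. \<integral>x. exp (X i x) \<partial>M)"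
    unfolding iid_copies_def using X by (intro product_integral_prod) auto
  also have "\<dots> \<le> (\<Prod>i<m. exp (b i))"
    using X by (intro prod_mono) (auto intro: integral_nonneg_AE)
  also have "\<dots> = exp (\<Sum>i<m. b i)" by (simp flip: exp_sum)
  also have "exp (\<Sum>i<m. b i) / exp r \<le> exp (- s)" using s by (simp flip: exp_diff)
  finally show ?thesis by (simp add: divide_right_mono)
qed

text \<open>The quadratic excess of each factor is \<open>2 * (6 * L^2 * l * w i)^2\<close>, whence
  the 72. The second condition on \<open>l\<close> keeps every factor in the range of
  \<open>exp_square_moment\<close>.\<close>

lemma weighted_square_upper_tail:
  assumes M: "prob_space M" and f: "subgaussian_moments L M f" and w: "\<And>i. i < m \<Longrightarrow> 0 \<le> w i"
    and l: "0 < l" "\<And>i. i < m \<Longrightarrow> 6 * L\<^sup>2 * (l * w i) \<le> 1/2"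
    and s: "s \<le> l * e - 72 * L^4 * l\<^sup>2 * (\<Sum>i<m. (w i)\<^sup>2)"
  shows "measure (iid_copies m M) {z \<in> space (iid_copies m M). (\<Sum>i<m. w i * (f (z i))\<^sup>2) \<ge> (\<Sum>i<m. w i) + e} \<le> exp (- s)"
proof -
  have fm[measurable]: "f \<in> borel_measurable M" using f by (simp add: subgaussian_moments_def)
  have "measure (iid_copies m M) {z \<in> space (iid_copies m M). 
      (\<Sum>i<m. (l * w i) * (f (z i))\<^sup>2) \<ge> l * ((\<Sum>i<m. w i) + e)} \<le> exp (- s)"
  proof (rule chernoff_iid[OF M, where b = "\<lambda>i. l * w i + 2 * (6 * L\<^sup>2 * (l * w i))\<^sup>2"])
    fix i assume i: "i < m"
    show "(\<lambda>x. l * w i * (f x)\<^sup>2) \<in> borel_measurable M" by measurable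
    show "integrable M (\<lambda>x. exp (l * w i * (f x)\<^sup>2))" 
      "(\<integral>x. exp (l * w i * (f x)\<^sup>2) \<partial>M) \<le> exp (l * w i + 2 * (6 * L\<^sup>2 * (l * w i))\<^sup>2)"
      using w[OF i] l(1) l(2)[OF i] by (auto intro!: exp_square_moment[OF M f _ refl])
  next
    have "(\<Sum>i<m. l * w i + 2 * (6 * L\<^sup>2 * (l * w i))\<^sup>2) = l * (\<Sum>i<m. w i) + 72 * L^4 * l\<^sup>2 * (\<Sum>i<m. (w i)\<^sup>2)"
      by (simp add: sum.distrib sum_distrib_left power_mult_distrib algebra_simps flip: power_mult)
    then show "(\<Sum>i<m. l * w i + 2 * (6 * L\<^sup>2 * (l * w i))\<^sup>2) + s \<le> l * ((\<Sum>i<m. w i) + e)"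
      using s by (simp add: algebra_simps)
  qed
  also have "{z \<in> space (iid_copies m M). (\<Sum>i<m. (l * w i) * (f (z i))\<^sup>2) \<ge> l * ((\<Sum>i<m. w i) + e)}
    = {z \<in> space (iid_copies m M). (\<Sum>i<m. w i * (f (z i))\<^sup>2) \<ge> (\<Sum>i<m. w i) + e}"
    using l(1) by (simp add: mult.assoc flip: sum_distrib_left)
  finally show ?thesis .
qed

lemma weighted_truncated_square_lower_tail:
  assumes M: "prob_space M" and f: "subgaussian_moments L M f" and w: "\<And>i. i < m \<Longrightarrow> 0 \<le> w i"
    and l: "0 < l" and t: "0 < t"
    and s: "s \<le> l * e - 8 * L^4 * l\<^sup>2 * (\<Sum>i<m. (w i)\<^sup>2)"
  shows "measure (iid_copies m M) {z \<in> space (iid_copies m M). 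
    (\<Sum>i<m. w i * min ((f (z i))\<^sup>2) t) \<le> (1 - 16 * L^4 / t) * (\<Sum>i<m. w i) - e} \<le> exp (- s)"
proof -
  have fm[measurable]: "f \<in> borel_measurable M" using f by (simp add: subgaussian_moments_def)
  have "measure (iid_copies m M) {z \<in> space (iid_copies m M). 
      (\<Sum>i<m. - (l * w i) * min ((f (z i))\<^sup>2) t) \<ge> - l * ((1 - 16 * L^4 / t) * (\<Sum>i<m. w i) - e)} \<le> exp (- s)"
  proof (rule chernoff_iid[OF M, where b = "\<lambda>i. - (l * w i) * (1 - 16 * L^4 / t) + 8 * L^4 * (l * w i)\<^sup>2"])
    fix i assume i: "i < m"
    show "(\<lambda>x. - (l * w i) * min ((f x)\<^sup>2) t) \<in> borel_measurable M" by measurable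
    show "integrable M (\<lambda>x. exp (- (l * w i) * min ((f x)\<^sup>2) t))" 
      "(\<integral>x. exp (- (l * w i) * min ((f x)\<^sup>2) t) \<partial>M) \<le> exp (- (l * w i) * (1 - 16 * L^4 / t) + 8 * L^4 * (l * w i)\<^sup>2)"
      using exp_neg_truncated_square_moment[OF M f _ t, of "l * w i"] w[OF i] l(1) by auto
  next
    have "(\<Sum>i<m. - (l * w i) * (1 - 16 * L^4 / t) + 8 * L^4 * (l * w i)\<^sup>2) 
        = - l * ((1 - 16 * L^4 / t) * (\<Sum>i<m. w i)) + 8 * L^4 * l\<^sup>2 * (\<Sum>i<m. (w i)\<^sup>2)"
      unfolding sum.distrib by (simp add: sum_distrib_left sum_distrib_right sum_negf power_mult_distrib mult_ac)
    then show "(\<Sum>i<m. - (l * w i) * (1 - 16 * L^4 / t) + 8 * L^4 * (l * w i)\<^sup>2) + s 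
        \<le> - l * ((1 - 16 * L^4 / t) * (\<Sum>i<m. w i) - e)"
      using s by (simp add: algebra_simps)
  qed
  also have "{z \<in> space (iid_copies m M). 
      (\<Sum>i<m. - (l * w i) * min ((f (z i))\<^sup>2) t) \<ge> - l * ((1 - 16 * L^4 / t) * (\<Sum>i<m. w i) - e)} = 
    {z \<in> space (iid_copies m M). (\<Sum>i<m. w i * min ((f (z i))\<^sup>2) t) \<le> (1 - 16 * L^4 / t) * (\<Sum>i<m. w i) - e}"
  proof (intro Collect_cong conj_cong refl)
    fix z
    have "(\<Sum>i<m. - (l * w i) * min ((f (z i))\<^sup>2) t) = - l * (\<Sum>i<m. w i * min ((f (z i))\<^sup>2) t)"
      by (simp add: sum_distrib_left sum_negf mult.assoc)
    then show "((\<Sum>i<m. - (l * w i) * min ((f (z i))\<^sup>2) t) \<ge> - l * ((1 - 16 * L^4 / t) * (\<Sum>i<m. w i) - e)) = 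
      ((\<Sum>i<m. w i * min ((f (z i))\<^sup>2) t) \<le> (1 - 16 * L^4 / t) * (\<Sum>i<m. w i) - e)"
      using l by simp
  qed
  finally show ?thesis .
qed

text \<open>A weight concentrated at \<open>i\<close> reduces the sum to one variable. The value
  \<open>1 / (12 * L^2)\<close> is the largest parameter with \<open>q \<le> 1/2\<close>; there the
  exponential moment is at most \<open>exp (7/12) \<le> 2\<close>.\<close>

lemma square_tail:
  assumes M: "prob_space M" and f: "subgaussian_moments L M f" and L: "1 \<le> L" and i: "i < m"
  shows "measure (iid_copies m M) {z \<in> space (iid_copies m M). t \<le> (f (z i))\<^sup>2} \<le> 2 * exp (- t / (12 * L\<^sup>2))"
proof -
  let ?w = "\<lambda>k. if k = i then 1 / (12 * L\<^sup>2) else (0::real)"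
  have L2: "1 \<le> L\<^sup>2" using L by (simp add: one_le_power)
  have fm[measurable]: "f \<in> borel_measurable M" using f by (simp add: subgaussian_moments_def)
  interpret prob_space M by fact
  have "measure (iid_copies m M) {z \<in> space (iid_copies m M). (\<Sum>k<m. ?w k * (f (z k))\<^sup>2) \<ge> t / (12 * L\<^sup>2)} 
      \<le> exp (- (t / (12 * L\<^sup>2) - ln 2))"
  proof (rule chernoff_iid[OF M, where b = "\<lambda>k. if k = i then ln 2 else 0"])
    fix k assume k: "k < m"
    show "(\<lambda>x. ?w k * (f x)\<^sup>2) \<in> borel_measurable M" by measurable
    have q: "(1/2::real) = 6 * L\<^sup>2 * (1 / (12 * L\<^sup>2))" using L by simp
    note e = exp_square_moment[OF M f _ q]
    have "exp (1 / (12 * L\<^sup>2) + 2 * (1/2)\<^sup>2) \<le> exp (7/12::real)"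
      using L2 by (simp add: power2_eq_square divide_le_eq)
    also have "\<dots> \<le> 2" using exp_bound[of "7/12::real"] by (simp add: power2_eq_square)
    finally have ee: "exp (1 / (12 * L\<^sup>2) + 2 * (1/2)\<^sup>2) \<le> (2::real)" .
    show "integrable M (\<lambda>x. exp (?w k * (f x)\<^sup>2))" using e(1) by auto
    show "(\<integral>x. exp (?w k * (f x)\<^sup>2) \<partial>M) \<le> exp (if k = i then ln 2 else 0)"
      using e(2) ee prob_space by auto
  qed (use i in auto)
  moreover have "(\<Sum>k<m. ?w k * (f (z k))\<^sup>2) = (f (z i))\<^sup>2 / (12 * L\<^sup>2)" for z
  proof -
    have "(\<Sum>k<m. ?w k * (f (z k))\<^sup>2) = (\<Sum>k<m. if k = i then (f (z i))\<^sup>2 / (12 * L\<^sup>2) else 0)"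
      by (intro sum.cong) auto
    then show ?thesis using i by simp
  qed
  moreover have "{z \<in> space (iid_copies m M). t / (12 * L\<^sup>2) \<le> (f (z i))\<^sup>2 / (12 * L\<^sup>2)}
      = {z \<in> space (iid_copies m M). t \<le> (f (z i))\<^sup>2}" using L by (simp add: divide_le_cancel)
  moreover have "exp (- (t / (12 * L\<^sup>2) - ln 2)) = 2 * exp (- t / (12 * L\<^sup>2))"
    by (simp add: exp_diff exp_minus field_simps)
  ultimately show ?thesis by simp
qed

section \<open>Invariance of the law under sign flips of the entries\<close>

lemma PiM_distr_invariant:
  assumes I: "finite I" and M: "\<And>i. prob_space (M i)"
    and f: "\<And>i. i \<in> I \<Longrightarrow> f i \<in> measurable (M i) (M i)" "\<And>i. i \<in> I \<Longrightarrow> distr (M i) (M i) (f i) = M i"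
  shows "(\<lambda>x. \<lambda>i\<in>I. f i (x i)) \<in> measurable (Pi\<^sub>M I M) (Pi\<^sub>M I M)" 
    and "distr (Pi\<^sub>M I M) (Pi\<^sub>M I M) (\<lambda>x. \<lambda>i\<in>I. f i (x i)) = Pi\<^sub>M I M"
proof -
  interpret product_prob_space M I by (intro product_prob_spaceI M)
  show m: "(\<lambda>x. \<lambda>i\<in>I. f i (x i)) \<in> measurable (Pi\<^sub>M I M) (Pi\<^sub>M I M)"
    using f(1) by (intro measurable_restrict measurable_compose[OF measurable_component_singleton]) auto
  show "distr (Pi\<^sub>M I M) (Pi\<^sub>M I M) (\<lambda>x. \<lambda>i\<in>I. f i (x i)) = Pi\<^sub>M I M"
  proof (rule PiM_eqI[OF I])
    fix A assume A: "\<And>i. i \<in> I \<Longrightarrow> A i \<in> sets (M i)"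
    have "(\<lambda>x. \<lambda>i\<in>I. f i (x i)) -` Pi\<^sub>E I A \<inter> space (Pi\<^sub>M I M) = Pi\<^sub>E I (\<lambda>i. f i -` A i \<inter> space (M i))"
      by (auto simp: space_PiM PiE_iff)
    then have "emeasure (distr (Pi\<^sub>M I M) (Pi\<^sub>M I M) (\<lambda>x. \<lambda>i\<in>I. f i (x i))) (Pi\<^sub>E I A)
        = emeasure (Pi\<^sub>M I M) (Pi\<^sub>E I (\<lambda>i. f i -` A i \<inter> space (M i)))"
      using A I by (subst emeasure_distr[OF m]) (auto intro: sets_PiM_I_finite)
    also have "\<dots> = (\<Prod>i\<in>I. emeasure (M i) (f i -` A i \<inter> space (M i)))"
      using A f(1) by (intro emeasure_PiM I) (auto intro: measurable_sets)
    also have "\<dots> = (\<Prod>i\<in>I. emeasure (M i) (A i))"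
    proof (rule prod.cong)
      fix i assume i: "i \<in> I"
      have "emeasure (M i) (A i) = emeasure (distr (M i) (M i) (f i)) (A i)" using f(2)[OF i] by simp
      also have "\<dots> = emeasure (M i) (f i -` A i \<inter> space (M i))" 
        using A[OF i] f(1)[OF i] by (intro emeasure_distr) auto
      finally show "emeasure (M i) (f i -` A i \<inter> space (M i)) = emeasure (M i) (A i)" by simp
    qed simp
    finally show "emeasure (distr (Pi\<^sub>M I M) (Pi\<^sub>M I M) (\<lambda>x. \<lambda>i\<in>I. f i (x i))) (Pi\<^sub>E I A) = (\<Prod>i\<in>I. emeasure (M i) (A i))" .
  qed simp
qed

definition flip :: "nat \<Rightarrow> nat \<Rightarrow> (nat \<times> nat \<Rightarrow> real) \<Rightarrow> (nat \<Rightarrow> nat \<Rightarrow> real) \<Rightarrow> nat \<Rightarrow> nat \<Rightarrow> real" where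
  "flip m n s z = (\<lambda>i\<in>{..<m}. \<lambda>j\<in>{..<n}. s (i, j) * z i j)"

text \<open>Independence makes the law of the vector the product of its marginals. Symmetry of the
  vector passes to each marginal, so the signs of the coordinates may be flipped separately and not
  only all together.\<close>

lemma coordinate_flip_invariant:
  assumes rv: "random_vector n \<nu>" and sym: "symmetric_vector n \<nu>" and iid: "iid_coordinates n \<nu>" and n: "0 < n"
    and s: "\<And>j. s j = 1 \<or> s j = (-1::real)"
  shows "(\<lambda>z. \<lambda>j\<in>{..<n}. s j * z j) \<in> measurable \<nu> \<nu>" "distr \<nu> \<nu> (\<lambda>z. \<lambda>j\<in>{..<n}. s j * z j) = \<nu>"
proof -
  have P: "prob_space \<nu>" and sets: "sets \<nu> = sets (Rn_borel n)" using rv by (auto simp: random_vector_def)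
  interpret prob_space \<nu> by fact
  have sp: "space \<nu> = Rn n" using sets_eq_imp_space_eq[OF sets] by (simp add: space_PiM)
  have cm: "(\<lambda>z. z j) \<in> borel_measurable \<nu>" if "j < n" for j
    using that by (simp add: measurable_cong_sets[OF sets refl])
  \<comment> \<open>A point mass beyond \<open>n\<close> makes the family consist of probability
    measures at every index.\<close>
  define \<gamma> where "\<gamma> j = (if j < n then distr \<nu> borel (\<lambda>z. z j) else return borel 0)" for j
  have \<gamma>P: "prob_space (\<gamma> j)" for j
    using cm by (auto simp: \<gamma>_def intro!: prob_space_distr prob_space_return)
  have \<gamma>s[measurable_cong]: "sets (\<gamma> j) = sets borel" for j by (simp add: \<gamma>_def)
  have "distr \<nu> (Rn_borel n) (\<lambda>z. \<lambda>j\<in>{..<n}. z j) = Pi\<^sub>M {..<n} (\<lambda>j. distr \<nu> borel (\<lambda>z. z j))"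
    using iid n cm by (subst indep_vars_iff_distr_eq_PiM'[symmetric]) (auto simp: iid_coordinates_def)
  also have "distr \<nu> (Rn_borel n) (\<lambda>z. \<lambda>j\<in>{..<n}. z j) = distr \<nu> \<nu> (\<lambda>z. z)"
    using sets by (intro distr_cong) (auto simp: sp PiE_restrict)
  also have "\<dots> = \<nu>" by simp
  also have "Pi\<^sub>M {..<n} (\<lambda>j. distr \<nu> borel (\<lambda>z. z j)) = Pi\<^sub>M {..<n} \<gamma>"
    by (intro PiM_cong) (auto simp: \<gamma>_def)
  finally have \<nu>: "\<nu> = Pi\<^sub>M {..<n} \<gamma>" .
  have neg: "distr \<nu> borel (\<lambda>z. - z j) = distr \<nu> borel (\<lambda>z. z j)" if j: "j < n" for j
  proof -
    have vm: "vscale n (-1) \<in> measurable \<nu> (Rn_borel n)"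
      unfolding vscale_def using cm by (intro measurable_restrict) auto
    have "distr \<nu> borel (\<lambda>z. z j) = distr (distr \<nu> (Rn_borel n) (vscale n (-1))) borel (\<lambda>z. z j)"
      using sym by (simp add: symmetric_vector_def)
    also have "\<dots> = distr \<nu> borel ((\<lambda>z. z j) \<circ> vscale n (-1))"
      using j vm by (intro distr_distr) auto
    also have "(\<lambda>z. z j) \<circ> vscale n (-1) = (\<lambda>z. - z j)" using j by (auto simp: vscale_def)
    finally show ?thesis by simp
  qed
  have fl: "distr (\<gamma> j) (\<gamma> j) (\<lambda>t. s j * t) = \<gamma> j" if j: "j < n" for j
  proof -
    have "distr (\<gamma> j) (\<gamma> j) (\<lambda>t. s j * t) = distr (distr \<nu> borel (\<lambda>z. z j)) borel (\<lambda>t. s j * t)"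
      using j by (intro distr_cong) (auto simp: \<gamma>_def)
    also have "\<dots> = distr \<nu> borel ((\<lambda>t. s j * t) \<circ> (\<lambda>z. z j))" using cm[OF j] by (intro distr_distr) auto
    also have "\<dots> = distr \<nu> borel (\<lambda>z. z j)" using s[of j] neg[OF j] by (auto simp: comp_def)
    finally show ?thesis using j by (simp add: \<gamma>_def)
  qed
  have m: "(\<lambda>t. s j * t) \<in> measurable (\<gamma> j) (\<gamma> j)" for j by measurable
  show "(\<lambda>z. \<lambda>j\<in>{..<n}. s j * z j) \<in> measurable \<nu> \<nu>" "distr \<nu> \<nu> (\<lambda>z. \<lambda>j\<in>{..<n}. s j * z j) = \<nu>"
    unfolding \<nu> using PiM_distr_invariant[OF finite_lessThan \<gamma>P m fl, of n] by auto
qed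

lemma flip_invariant:
  assumes rv: "random_vector n \<nu>" and sym: "symmetric_vector n \<nu>" and iid: "iid_coordinates n \<nu>" and n: "0 < n"
    and s: "\<And>k. s k = 1 \<or> s k = (-1::real)"
  shows "flip m n s \<in> measurable (iid_copies m \<nu>) (iid_copies m \<nu>)" 
    "distr (iid_copies m \<nu>) (iid_copies m \<nu>) (flip m n s) = iid_copies m \<nu>"
proof -
  have P: "prob_space \<nu>" using rv by (auto simp: random_vector_def)
  have "flip m n s = (\<lambda>z. \<lambda>i\<in>{..<m}. (\<lambda>z. \<lambda>j\<in>{..<n}. s (i, j) * z j) (z i))" by (auto simp: flip_def)
  then show "flip m n s \<in> measurable (iid_copies m \<nu>) (iid_copies m \<nu>)" 
    "distr (iid_copies m \<nu>) (iid_copies m \<nu>) (flip m n s) = iid_copies m \<nu>"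
    unfolding iid_copies_def
    using PiM_distr_invariant[OF finite_lessThan P, of m "\<lambda>i z. \<lambda>j\<in>{..<n}. s (i, j) * z j"]
      coordinate_flip_invariant[OF rv sym iid n] s by auto
qed

lemma ravg_integral:
  assumes "\<And>s. (\<And>k. k \<notin> set ks \<Longrightarrow> s k = d k) \<Longrightarrow> (\<And>k. k \<in> set ks \<Longrightarrow> s k = 1 \<or> s k = -1) \<Longrightarrow> integrable M (F s)"
  shows "ravg ks (\<lambda>s. \<integral>z. F s z \<partial>M) d = (\<integral>z. ravg ks (\<lambda>s. F s z) d \<partial>M) \<and> integrable M (\<lambda>z. ravg ks (\<lambda>s. F s z) d)"
  using assms
proof (induction ks arbitrary: d)
  case (Cons k ks)
  have "ravg ks (\<lambda>s. \<integral>z. F s z \<partial>M) (d(k := v)) = (\<integral>z. ravg ks (\<lambda>s. F s z) (d(k := v)) \<partial>M) \<and> 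
      integrable M (\<lambda>z. ravg ks (\<lambda>s. F s z) (d(k := v)))" if v: "v = 1 \<or> v = -1" for v
  proof (rule Cons.IH)
    fix s assume s: "\<And>k'. k' \<notin> set ks \<Longrightarrow> s k' = (d(k := v)) k'" "\<And>k. k \<in> set ks \<Longrightarrow> s k = 1 \<or> s k = -1"
    have "s k = 1 \<or> s k = -1" using s(1)[of k] s(2)[of k] v by (cases "k \<in> set ks") auto
    moreover have "s k' = d k'" if "k' \<notin> set (k # ks)" for k' using s(1)[of k'] that by simp
    ultimately show "integrable M (F s)" using s(2) by (intro Cons.prems) auto
  qed
  from this[of 1] this[of "-1"] show ?case by simp
qed simp

text \<open>Each fixed flip preserves the law, so the probability of \<open>A \<inter> G\<close> is
  an average over flips; interchanging average and integral leaves, for each \<open>z\<close> in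
  \<open>G\<close>, a probability over the signs only. For \<open>z\<close> outside
  \<open>G\<close>, \<open>inv\<close> shows that no flip of \<open>z\<close> lies in
  \<open>G\<close>.\<close>

lemma symmetrized_tail:
  assumes rv: "random_vector n \<nu>" and sym: "symmetric_vector n \<nu>" and iid: "iid_coordinates n \<nu>" and n: "0 < n"
    and A: "A \<in> sets (iid_copies m \<nu>)" and G: "G \<in> sets (iid_copies m \<nu>)"
    and inv: "\<And>s z. (\<And>k. s k = 1 \<or> s k = (-1::real)) \<Longrightarrow> flip m n s z \<in> G \<Longrightarrow> z \<in> space (iid_copies m \<nu>) \<Longrightarrow> z \<in> G"
    and p: "\<And>z. z \<in> G \<Longrightarrow> ravg ks (\<lambda>s. of_bool (flip m n s z \<in> A)) (\<lambda>_. 1) \<le> p" and p0: "0 \<le> p"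
  shows "measure (iid_copies m \<nu>) A \<le> measure (iid_copies m \<nu>) (space (iid_copies m \<nu>) - G) + p"
proof -
  let ?M = "iid_copies m \<nu>"
  have "prob_space \<nu>" using rv by (auto simp: random_vector_def)
  then interpret P: prob_space ?M unfolding iid_copies_def by (intro prob_space_PiM)
  let ?F = "\<lambda>s z. indicator (A \<inter> G) (flip m n s z) :: real"
  have AG: "A \<inter> G \<in> sets ?M" using A G by auto
  have sg: "s k = 1 \<or> s k = (-1::real)" if "signs_on (set ks) (\<lambda>_. 1) s" for s k
    using that by (cases "k \<in> set ks"; cases k) (auto simp: signs_on_def)
  have F: "integrable ?M (?F s) \<and> (\<integral>z. ?F s z \<partial>?M) = measure ?M (A \<inter> G)" if s: "\<And>k. s k = 1 \<or> s k = (-1::real)" for s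
  proof -
    note fl = flip_invariant[OF rv sym iid n s, of m]
    have "integrable (distr ?M ?M (flip m n s)) (indicator (A \<inter> G) :: _ \<Rightarrow> real)"
      unfolding fl(2) using AG by (simp add: P.emeasure_eq_measure)
    then have 1: "integrable ?M (?F s)" by (rule integrable_distr[OF fl(1)])
    have "(\<integral>z. ?F s z \<partial>?M) = (\<integral>z. indicator (A \<inter> G) z \<partial>distr ?M ?M (flip m n s))"
      by (rule integral_distr[symmetric, OF fl(1)]) (use AG in auto)
    also have "\<dots> = measure ?M (A \<inter> G)" unfolding fl(2) using AG sets.sets_into_space[OF AG] by (simp add: Int_absorb2)
    finally show ?thesis using 1 by simp
  qed
  have "measure ?M (A \<inter> G) = ravg ks (\<lambda>s. measure ?M (A \<inter> G)) (\<lambda>_. 1)" by simp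
  also have "\<dots> = ravg ks (\<lambda>s. \<integral>z. ?F s z \<partial>?M) (\<lambda>_. 1)"
    using F sg by (intro ravg_cong) auto
  finally have meas: "measure ?M (A \<inter> G) = ravg ks (\<lambda>s. \<integral>z. ?F s z \<partial>?M) (\<lambda>_. 1)" .
  have swap: "ravg ks (\<lambda>s. \<integral>z. ?F s z \<partial>?M) (\<lambda>_. 1) = (\<integral>z. ravg ks (\<lambda>s. ?F s z) (\<lambda>_. 1) \<partial>?M) \<and> 
      integrable ?M (\<lambda>z. ravg ks (\<lambda>s. ?F s z) (\<lambda>_. 1))"
  proof (rule ravg_integral)
    fix s :: "nat \<times> nat \<Rightarrow> real"
    assume "\<And>k. k \<notin> set ks \<Longrightarrow> s k = 1" "\<And>k. k \<in> set ks \<Longrightarrow> s k = 1 \<or> s k = -1"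
    then have "\<And>k. s k = 1 \<or> s k = -1" by blast
    then show "integrable ?M (?F s)" using F by blast
  qed
  have "measure ?M (A \<inter> G) = (\<integral>z. ravg ks (\<lambda>s. ?F s z) (\<lambda>_. 1) \<partial>?M)" 
    using meas swap by simp
  also have "\<dots> \<le> (\<integral>z. p \<partial>?M)"
  proof (rule integral_mono[OF conjunct2[OF swap]])
    fix z assume z: "z \<in> space ?M"
    show "ravg ks (\<lambda>s. ?F s z) (\<lambda>_. 1) \<le> p"
    proof (cases "z \<in> G")
      case True
      have "ravg ks (\<lambda>s. ?F s z) (\<lambda>_. 1) \<le> ravg ks (\<lambda>s. of_bool (flip m n s z \<in> A)) (\<lambda>_. 1)"
        by (intro ravg_mono) (auto simp: indicator_def)
      then show ?thesis using p[OF True] by linarith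
    next
      case False
      have "ravg ks (\<lambda>s. ?F s z) (\<lambda>_. 1) \<le> ravg ks (\<lambda>s. 0) (\<lambda>_. 1)"
        using inv[OF _ _ z] False sg by (intro ravg_mono) (auto simp: indicator_def)
      then show ?thesis using p0 by simp
    qed
  qed simp
  also have "\<dots> = p" using P.prob_space by simp
  finally have 1: "measure ?M (A \<inter> G) \<le> p" .
  have "measure ?M A \<le> measure ?M ((space ?M - G) \<union> (A \<inter> G))"
    using A G sets.sets_into_space[OF A] by (intro P.finite_measure_mono) auto
  also have "\<dots> \<le> measure ?M (space ?M - G) + measure ?M (A \<inter> G)"
    using A G by (intro measure_Un_le) auto
  finally show ?thesis using 1 by linarith
qed

lemma subgaussian_coordinate_moments:
  assumes rv: "random_vector n \<nu>" and iso: "isotropic n \<nu>" and sub: "subgaussian n L \<nu>" and j: "j < n" and L: "1 \<le> L"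
  shows "subgaussian_moments L \<nu> (\<lambda>z. z j)"
proof -
  have P: "prob_space \<nu>" and sets: "sets \<nu> = sets (Rn_borel n)" using rv by (auto simp: random_vector_def)
  define x where "x = (\<lambda>i\<in>{..<n}. if i = j then 1 else (0::real))"
  have vx: "vinner n z x = z j" for z
  proof -
    have "vinner n z x = (\<Sum>i<n. if i = j then z j else 0)" unfolding vinner_def x_def by (intro sum.cong) auto
    then show ?thesis using j by simp
  qed
  have xR: "x \<in> Rn n" by (auto simp: x_def)
  have i2: "integrable \<nu> (\<lambda>z. (z j)\<^sup>2)" "(\<integral>z. (z j)\<^sup>2 \<partial>\<nu>) = 1"
    using iso j by (auto simp: isotropic_def power2_eq_square)
  have ab: "\<bar>t\<bar> powr (2 * real k) = t ^ (2 * k)" if "k \<ge> 1" for t :: real and k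
  proof (cases "t = 0")
    case False
    then have "\<bar>t\<bar> powr (2 * real k) = \<bar>t\<bar> powr (real (2 * k))" by simp
    also have "\<dots> = \<bar>t\<bar> ^ (2 * k)" using False by (intro powr_realpow) auto
    also have "\<dots> = t ^ (2 * k)" by (simp add: power_mult)
    finally show ?thesis .
  qed (use that in auto)
  have L2: "Lp_norm 2 \<nu> (\<lambda>z. z j) = 1"
    using i2 ab[of 1] by (simp add: Lp_norm_def)
  have "integrable \<nu> (\<lambda>z. z j ^ (2 * k)) \<and> (\<integral>z. z j ^ (2 * k) \<partial>\<nu>) \<le> (2 * L\<^sup>2 * real k) ^ k" if k: "k \<ge> 1" for k
  proof -
    let ?p = "2 * real k"
    have "Lp_norm ?p \<nu> (\<lambda>z. vinner n z x) \<le> ennreal (L * sqrt ?p) * Lp_norm 2 \<nu> (\<lambda>z. vinner n z x)"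
      using sub xR k by (auto simp: subgaussian_def)
    then have le: "Lp_norm ?p \<nu> (\<lambda>z. z j) \<le> ennreal (L * sqrt ?p)" by (simp add: vx L2)
    \<comment> \<open>A finite bound excludes the value infinity by which \<open>Lp_norm\<close>
      encodes a divergent moment.\<close>
    then have int: "integrable \<nu> (\<lambda>z. \<bar>z j\<bar> powr ?p)"
      by (auto simp: Lp_norm_def top_unique split: if_splits)
    then have "(\<integral>z. \<bar>z j\<bar> powr ?p \<partial>\<nu>) powr (1 / ?p) \<le> L * sqrt ?p"
      using le L by (simp add: Lp_norm_def ennreal_le_iff)
    then have "((\<integral>z. \<bar>z j\<bar> powr ?p \<partial>\<nu>) powr (1 / ?p)) powr ?p \<le> (L * sqrt ?p) powr ?p"
      by (intro powr_mono2) auto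
    also have "((\<integral>z. \<bar>z j\<bar> powr ?p \<partial>\<nu>) powr (1 / ?p)) powr ?p = (\<integral>z. \<bar>z j\<bar> powr ?p \<partial>\<nu>)"
      using k by (simp add: powr_powr integral_nonneg_AE)
    also have "(L * sqrt ?p) powr ?p = (L * sqrt ?p) ^ (2 * k)"
      using ab[OF k, of "L * sqrt ?p"] L k by simp
    also have "\<dots> = (2 * L\<^sup>2 * real k) ^ k"
    proof -
      have "(L * sqrt ?p)\<^sup>2 = 2 * L\<^sup>2 * real k" by (simp add: power_mult_distrib)
      then show ?thesis by (simp only: power_mult)
    qed
    finally show ?thesis using int by (simp add: ab[OF k])
  qed
  moreover have "(\<lambda>z. z j) \<in> borel_measurable \<nu>" using j by (simp add: measurable_cong_sets[OF sets refl])
  ultimately show ?thesis using i2 by (simp add: subgaussian_moments_def)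
qed

subsection \<open>Nets of the sphere\<close>

text \<open>Two one-sided geometric series, with \<open>1 - exp (- \<epsilon>) \<ge> \<epsilon> / (1
  + \<epsilon>) \<ge> 2 * \<epsilon> / 3\<close> in the allowed range.\<close>

lemma geometric_abs_sum_le:
  fixes \<epsilon> :: real
  assumes "0 < \<epsilon>" "\<epsilon> \<le> 1/2"
  shows "(\<Sum>k\<in>{-K..K::int}. exp (- \<epsilon> * real_of_int \<bar>k\<bar>)) \<le> 3 / \<epsilon>"
proof -
  let ?f = "\<lambda>(b, n). if b then int n else - int n" and ?P = "(UNIV :: bool set) \<times> {..nat K}"
  have q: "0 < exp (- \<epsilon>)" "exp (- \<epsilon>) < 1" using assms by auto
  have e: "exp (- \<epsilon> * real n) = exp (- \<epsilon>) ^ n" for n by (simp add: exp_of_nat_mult[symmetric] mult.commute)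
  have "{-K..K} \<subseteq> ?f ` ?P"
  proof
    fix k assume k: "k \<in> {-K..K}"
    show "k \<in> ?f ` ?P"
    proof (cases "0 \<le> k")
      case True
      then show ?thesis using k by (intro image_eqI[of _ _ "(True, nat k)"]) auto
    next
      case False
      then show ?thesis using k by (intro image_eqI[of _ _ "(False, nat (- k))"]) auto
    qed
  qed
  then have "(\<Sum>k\<in>{-K..K}. exp (- \<epsilon> * real_of_int \<bar>k\<bar>)) \<le> (\<Sum>k\<in>?f ` ?P. exp (- \<epsilon> * real_of_int \<bar>k\<bar>))"
    by (intro sum_mono2) auto
  also have "\<dots> \<le> (\<Sum>p\<in>?P. ((\<lambda>k. exp (- \<epsilon> * real_of_int \<bar>k\<bar>)) \<circ> ?f) p)"
    by (rule sum_image_le) auto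
  also have "\<dots> = (\<Sum>p\<in>?P. exp (- \<epsilon>) ^ snd p)"
    unfolding comp_def by (rule sum.cong) (auto simp: e[symmetric] split: if_splits)
  also have "\<dots> = (\<Sum>b\<in>(UNIV::bool set). \<Sum>n\<le>nat K. exp (- \<epsilon>) ^ n)"
    by (subst sum.cartesian_product) (simp add: case_prod_beta)
  also have "\<dots> = 2 * (\<Sum>n\<le>nat K. exp (- \<epsilon>) ^ n)" by simp
  also have "(\<Sum>n\<le>nat K. exp (- \<epsilon>) ^ n) \<le> 1 / (1 - exp (- \<epsilon>))"
  proof -
    have "(\<Sum>n\<in>{..nat K}. exp (- \<epsilon>) ^ n) \<le> (\<Sum>n. exp (- \<epsilon>) ^ n)"
      using q by (intro sum_le_suminf summable_geometric) auto
    also have "\<dots> = 1 / (1 - exp (- \<epsilon>))" using q by (intro suminf_geometric) auto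
    finally show ?thesis .
  qed
  also have "2 * (1 / (1 - exp (- \<epsilon>))) \<le> 3 / \<epsilon>"
  proof -
    have "exp (- \<epsilon>) \<le> 1 / (1 + \<epsilon>)"
      using exp_ge_add_one_self[of \<epsilon>] assms by (simp add: exp_minus inverse_eq_divide frac_le)
    then have "\<epsilon> / (1 + \<epsilon>) \<le> 1 - exp (- \<epsilon>)" using assms by (simp add: field_simps)
    moreover have "2 * \<epsilon> / 3 \<le> \<epsilon> / (1 + \<epsilon>)" using assms by (simp add: field_simps)
    ultimately have "2 * \<epsilon> / 3 \<le> 1 - exp (- \<epsilon>)" by linarith
    then have "2 / (1 - exp (- \<epsilon>)) \<le> 2 / (2 * \<epsilon> / 3)" using assms by (intro divide_left_mono mult_pos_pos) auto
    then show ?thesis by simp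
  qed
  finally show ?thesis by simp
qed

text \<open>Exponential weights count the integer points of an \<open>l\<^sub>1\<close> ball without volume arguments.\<close>

lemma card_l1_ball_le:
  assumes "0 < \<epsilon>" "\<epsilon> \<le> 1/2" and T: "T \<subseteq> {k \<in> {..<d} \<rightarrow>\<^sub>E {-K..K::int}. (\<Sum>i<d. \<bar>real_of_int (k i)\<bar>) \<le> real d / \<epsilon>}"
  shows "finite T" "real (card T) \<le> (9 / \<epsilon>) ^ d"
proof -
  let ?E = "{..<d} \<rightarrow>\<^sub>E {-K..K::int}"
  have fE: "finite ?E" by (intro finite_PiE) auto
  show "finite T" using T by (intro finite_subset[OF _ fE]) auto
  have "real (card T) = (\<Sum>k\<in>T. 1)" by simp
  also have "\<dots> \<le> (\<Sum>k\<in>T. exp (real d) * (\<Prod>i<d. exp (- \<epsilon> * real_of_int \<bar>k i\<bar>)))"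
  proof (rule sum_mono)
    fix k assume "k \<in> T"
    then have "(\<Sum>i<d. real_of_int \<bar>k i\<bar>) \<le> real d / \<epsilon>" using T by auto
    then have "\<epsilon> * (\<Sum>i<d. real_of_int \<bar>k i\<bar>) \<le> real d" using assms(1) by (simp add: field_simps)
    then have "1 \<le> exp (real d + (\<Sum>i<d. - \<epsilon> * real_of_int \<bar>k i\<bar>))"
      by (simp add: sum_distrib_left[symmetric] sum_negf)
    also have "\<dots> = exp (real d) * (\<Prod>i<d. exp (- \<epsilon> * real_of_int \<bar>k i\<bar>))" by (simp add: exp_add exp_sum)
    finally show "1 \<le> exp (real d) * (\<Prod>i<d. exp (- \<epsilon> * real_of_int \<bar>k i\<bar>))" .
  qed
  also have "\<dots> \<le> (\<Sum>k\<in>?E. exp (real d) * (\<Prod>i<d. exp (- \<epsilon> * real_of_int \<bar>k i\<bar>)))"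
    using T by (intro sum_mono2 fE) (auto intro!: mult_nonneg_nonneg prod_nonneg)
  also have "\<dots> = exp (real d) * (\<Prod>i<d. \<Sum>k\<in>{-K..K}. exp (- \<epsilon> * real_of_int \<bar>k\<bar>))"
    by (subst prod_sum_PiE) (auto simp: sum_distrib_left)
  also have "\<dots> \<le> 3 ^ d * (\<Prod>i<d. 3 / \<epsilon>)"
  proof (intro mult_mono prod_mono conjI)
    show "exp (real d) \<le> 3 ^ d"
      using power_mono[OF exp_le, of d] by (simp flip: exp_of_nat_mult)
    show "(\<Sum>k\<in>{-K..K}. exp (- \<epsilon> * real_of_int \<bar>k\<bar>)) \<le> 3 / \<epsilon>" by (rule geometric_abs_sum_le[OF assms(1,2)])
  qed (auto intro!: prod_nonneg sum_nonneg zero_le_power)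
  also have "\<dots> = (9 / \<epsilon>) ^ d" by (simp flip: power_mult_distrib)
  finally show "real (card T) \<le> (9 / \<epsilon>) ^ d" .
qed

lemma L2_set_diff_triangle: "\<bar>L2_set x A - L2_set y A\<bar> \<le> L2_set (\<lambda>i. x i - y i) A"
proof -
  have 1: "L2_set x A \<le> L2_set y A + L2_set (\<lambda>i. x i - y i) A" for x y
    using L2_set_triangle_ineq[of y "\<lambda>i. x i - y i" A] by simp
  have "L2_set (\<lambda>i. y i - x i) A = L2_set (\<lambda>i. x i - y i) A"
    using L2_set_scale[of "-1" "\<lambda>i. x i - y i" A] by simp
  then show ?thesis using 1[of x y] 1[of y x] by linarith
qed

lemma sum_abs_le_L2_set: "(\<Sum>i<d. \<bar>x i\<bar>) \<le> sqrt (real d) * L2_set x {..<d}"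
proof -
  have "(\<Sum>i<d. \<bar>1 * x i\<bar>) \<le> L2_set (\<lambda>_. 1) {..<d} * L2_set x {..<d}"
    using L2_set_mult_ineq[of "\<lambda>_. 1" x "{..<d}"] by simp
  then show ?thesis by (simp add: L2_set_constant L2_set_def)
qed

text \<open>The net consists of normalised integer points of an \<open>l1\<close> ball of radius
  \<open>d / \<epsilon>\<close>. Scaling by \<open>c = sqrt d / \<epsilon>\<close> and rounding
  moves a unit vector by at most \<epsilon>, and normalising costs another \<epsilon>. The count
  \<open>(9 / \<epsilon>)^d\<close> is at most \<open>\<epsilon>^(- 2 * d)\<close> because
  \<open>\<epsilon> \<le> 1/9\<close>.\<close>

lemma sphere_net:
  assumes e: "0 < \<epsilon>" "\<epsilon> \<le> 1/9" and d: "1 \<le> d"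
  obtains S where "finite S" "real (card S) \<le> exp (2 * real d * ln (1 / \<epsilon>))" "S \<subseteq> unit_sphere d"
    "\<And>u. u \<in> unit_sphere d \<Longrightarrow> \<exists>v\<in>S. L2_set (\<lambda>i. u i - v i) {..<d} \<le> 2 * \<epsilon>"
proof -
  define K where "K = \<lfloor>real d / \<epsilon>\<rfloor>"
  define T where "T = {k \<in> {..<d} \<rightarrow>\<^sub>E {-K..K}. (\<Sum>i<d. \<bar>real_of_int (k i)\<bar>) \<le> real d / \<epsilon>}"
  define nz where "nz k = (\<lambda>i\<in>{..<d}. real_of_int (k i) / L2_set (\<lambda>i. real_of_int (k i)) {..<d})" for k :: "nat \<Rightarrow> int"
  define S where "S = nz ` {k\<in>T. L2_set (\<lambda>i. real_of_int (k i)) {..<d} \<noteq> 0}"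
  have T: "finite T" "real (card T) \<le> (9 / \<epsilon>) ^ d"
    using card_l1_ball_le[of \<epsilon> T d K] e by (auto simp: T_def)
  have fS: "finite S" unfolding S_def using T by auto
  have "card S \<le> card {k\<in>T. L2_set (\<lambda>i. real_of_int (k i)) {..<d} \<noteq> 0}" unfolding S_def using T by (intro card_image_le) auto
  also have "\<dots> \<le> card T" using T by (intro card_mono) auto
  finally have "real (card S) \<le> (9 / \<epsilon>) ^ d" using T(2) by linarith
  also have "\<dots> \<le> ((1 / \<epsilon>)\<^sup>2) ^ d"
    using e by (intro power_mono) (auto simp: field_simps power2_eq_square)
  also have "\<dots> = exp (2 * real d * ln (1 / \<epsilon>))"
  proof -
    have "exp (2 * real d * ln (1 / \<epsilon>)) = exp (ln (1 / \<epsilon>)) ^ (2 * d)"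
      by (simp add: exp_of_nat_mult[symmetric])
    then show ?thesis using e by (simp add: power_mult)
  qed
  finally have cS: "real (card S) \<le> exp (2 * real d * ln (1 / \<epsilon>))" .
  have sS: "S \<subseteq> unit_sphere d"
  proof
    fix v assume "v \<in> S"
    then obtain k where v: "v = nz k" and k: "L2_set (\<lambda>i. real_of_int (k i)) {..<d} \<noteq> 0" unfolding S_def by auto
    have "vnorm2 d v = L2_set (\<lambda>i. (1 / L2_set (\<lambda>i. real_of_int (k i)) {..<d}) * real_of_int (k i)) {..<d}"
      by (rule L2_set_cong) (auto simp: v nz_def)
    also have "\<dots> = 1" using k L2_set_nonneg[of "\<lambda>i. real_of_int (k i)" "{..<d}"] by (subst L2_set_scale) simp
    finally show "v \<in> unit_sphere d" by (auto simp: unit_sphere_def v nz_def)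
  qed
  have net: "\<exists>v\<in>S. L2_set (\<lambda>i. u i - v i) {..<d} \<le> 2 * \<epsilon>" if u: "u \<in> unit_sphere d" for u
  proof -
    have u1: "L2_set u {..<d} = 1" using u by (simp add: unit_sphere_def)
    define c where "c = sqrt (real d) / \<epsilon>"
    have c: "0 < c" using e d by (simp add: c_def)
    \<comment> \<open>Rounding towards zero keeps the \<open>l1\<close> norm below that of the
      scaled vector, which is at most \<open>sqrt d * c = d / \<epsilon>\<close>.\<close>
    define k where "k = (\<lambda>i\<in>{..<d}. if 0 \<le> u i then \<lfloor>u i * c\<rfloor> else - \<lfloor>- u i * c\<rfloor>)"
    have fl: "0 \<le> \<lfloor>t\<rfloor> \<and> real_of_int \<lfloor>t\<rfloor> \<le> t \<and> t - real_of_int \<lfloor>t\<rfloor> \<le> 1" if "0 \<le> t" for t :: real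
      using that by linarith
    have k1: "\<bar>real_of_int (k i)\<bar> \<le> \<bar>u i\<bar> * c \<and> \<bar>u i * c - real_of_int (k i)\<bar> \<le> 1" if "i < d" for i
    proof (cases "0 \<le> u i")
      case True
      then show ?thesis using fl[of "u i * c"] c that by (simp add: k_def)
    next
      case False
      then have "0 \<le> - u i * c" using c by (intro mult_nonneg_nonneg) auto
      then have "0 \<le> \<lfloor>- u i * c\<rfloor> \<and> real_of_int \<lfloor>- u i * c\<rfloor> \<le> - u i * c \<and> - u i * c - real_of_int \<lfloor>- u i * c\<rfloor> \<le> 1"
        by (rule fl)
      moreover have "k i = - \<lfloor>- u i * c\<rfloor>" using that False by (simp add: k_def)
      moreover have "\<bar>u i\<bar> * c = - u i * c" using False by simp
      ultimately show ?thesis by (simp only: of_int_minus abs_minus_cancel) linarith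
    qed
    have sm: "(\<Sum>i<d. \<bar>real_of_int (k i)\<bar>) \<le> real d / \<epsilon>"
    proof -
      have "(\<Sum>i<d. \<bar>real_of_int (k i)\<bar>) \<le> (\<Sum>i<d. \<bar>u i\<bar> * c)" using k1 by (intro sum_mono) auto
      also have "\<dots> = (\<Sum>i<d. \<bar>u i\<bar>) * c" by (simp add: sum_distrib_right)
      also have "\<dots> \<le> (sqrt (real d) * 1) * c" using sum_abs_le_L2_set[of u d] u1 c by (intro mult_right_mono) auto
      also have "\<dots> = real d / \<epsilon>" by (simp add: c_def)
      finally show ?thesis .
    qed
    have kb: "\<bar>k i\<bar> \<le> K" if "i < d" for i
    proof -
      have "\<bar>real_of_int (k i)\<bar> \<le> (\<Sum>i<d. \<bar>real_of_int (k i)\<bar>)"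
        using that by (intro member_le_sum) auto
      then have "real_of_int \<bar>k i\<bar> \<le> real d / \<epsilon>" using sm by simp
      then show ?thesis unfolding K_def by (simp add: le_floor_iff)
    qed
    have "k i \<in> {-K..K}" if "i < d" for i using kb[OF that] by (auto simp: abs_le_iff)
    then have kT: "k \<in> T" using sm unfolding T_def by (auto simp: k_def)
    define w where "w = (\<lambda>i. (1 / c) * real_of_int (k i))"
    have "L2_set (\<lambda>i. u i - w i) {..<d} \<le> L2_set (\<lambda>i. 1 / c) {..<d}"
      unfolding L2_set_def
    proof (intro real_sqrt_le_mono sum_mono)
      fix i assume "i \<in> {..<d}"
      then have "\<bar>u i * c - real_of_int (k i)\<bar> / c \<le> 1 / c" using k1[of i] c by (intro divide_right_mono) auto
      moreover have "\<bar>u i * c - real_of_int (k i)\<bar> / c = \<bar>u i - w i\<bar>" 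

      proof -
        have "u i - w i = (u i * c - real_of_int (k i)) / c" using c by (simp add: w_def diff_divide_distrib)
        then show ?thesis using c by (simp add: abs_divide)
      qed
      ultimately have "\<bar>u i - w i\<bar> \<le> 1 / c" by simp
      then show "(u i - w i)\<^sup>2 \<le> (1 / c)\<^sup>2" using power_mono[of "\<bar>u i - w i\<bar>" "1 / c" 2] by simp
    qed
    also have "\<dots> = \<epsilon>" using c d e by (simp add: L2_set_def c_def real_sqrt_mult power_divide real_sqrt_divide)
    finally have uw: "L2_set (\<lambda>i. u i - w i) {..<d} \<le> \<epsilon>" .
    then have w1: "\<bar>1 - L2_set w {..<d}\<bar> \<le> \<epsilon>" using L2_set_diff_triangle[of u "{..<d}" w] u1 by simp
    have Lw: "L2_set w {..<d} = L2_set (\<lambda>i. real_of_int (k i)) {..<d} / c"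
      unfolding w_def L2_set_scale using c by simp
    have wp: "0 < L2_set w {..<d}" using w1 e by linarith
    then have kn: "L2_set (\<lambda>i. real_of_int (k i)) {..<d} \<noteq> 0" using Lw by auto
    have vS: "nz k \<in> S" unfolding S_def using kT kn by auto
    have "L2_set (\<lambda>i. w i - nz k i) {..<d} = L2_set (\<lambda>i. (1 - 1 / L2_set w {..<d}) * w i) {..<d}"
    proof (rule L2_set_cong[OF refl])
      fix i assume "i \<in> {..<d}"
      have inv: "1 / L2_set w {..<d} = c / L2_set (\<lambda>i. real_of_int (k i)) {..<d}" unfolding Lw by simp
      have "nz k i = (1 / L2_set w {..<d}) * w i"
        unfolding inv using c \<open>i \<in> {..<d}\<close> by (simp add: nz_def w_def)
      then show "w i - nz k i = (1 - 1 / L2_set w {..<d}) * w i" by (simp add: algebra_simps)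
    qed
    also have "\<dots> = \<bar>1 - 1 / L2_set w {..<d}\<bar> * L2_set w {..<d}" by (rule L2_set_scale)
    also have "\<dots> = \<bar>L2_set w {..<d} - 1\<bar>"
    proof -
      have "\<bar>1 - 1 / L2_set w {..<d}\<bar> * L2_set w {..<d} = \<bar>(1 - 1 / L2_set w {..<d}) * L2_set w {..<d}\<bar>"
        using wp by (simp add: abs_mult)
      also have "(1 - 1 / L2_set w {..<d}) * L2_set w {..<d} = L2_set w {..<d} - 1" using wp by (simp add: field_simps)
      finally show ?thesis .
    qed
    finally have "L2_set (\<lambda>i. w i - nz k i) {..<d} \<le> \<epsilon>" using w1 by simp
    moreover have "L2_set (\<lambda>i. u i - nz k i) {..<d} \<le> L2_set (\<lambda>i. u i - w i) {..<d} + L2_set (\<lambda>i. w i - nz k i) {..<d}"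
      using L2_set_triangle_ineq[of "\<lambda>i. u i - w i" "\<lambda>i. w i - nz k i" "{..<d}"] by simp
    ultimately show ?thesis using vS uw by (intro bexI[of _ "nz k"]) auto
  qed
  show ?thesis using that[OF fS cS sS net] .
qed

lemma unit_sphere_nonempty: "1 \<le> d \<Longrightarrow> (\<lambda>i\<in>{..<d}. if i = 0 then 1 else 0) \<in> unit_sphere d"
  by (auto simp: unit_sphere_def L2_set_def if_distrib[of "\<lambda>t. t\<^sup>2"] cong: if_cong)

text \<open>The supremum \<open>s\<close> over the sphere satisfies
  \<open>s \<le> (1 + \<tau>) * \<Lambda> + 2 * \<epsilon> * s\<close>. This can be solved for
  \<open>s\<close> because \<open>s\<close> is finite, which is the purpose of the crude bound
  \<open>C\<close>.\<close>

lemma seminorm_net_bound: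
  fixes A :: "(nat \<Rightarrow> real) \<Rightarrow> real"
  assumes add: "\<And>x y. A (\<lambda>i. x i + y i) \<le> A x + A y" and scale: "\<And>c x. A (\<lambda>i. c * x i) = \<bar>c\<bar> * A x"
    and cong: "\<And>x y. (\<And>i. i < d \<Longrightarrow> x i = y i) \<Longrightarrow> A x = A y"
    and bound: "\<And>u. u \<in> unit_sphere d \<Longrightarrow> A u \<le> C"
    and e: "0 < \<epsilon>" "\<epsilon> \<le> 1/8" and S: "S \<subseteq> unit_sphere d"
    and net: "\<And>u. u \<in> unit_sphere d \<Longrightarrow> \<exists>v\<in>S. L2_set (\<lambda>i. u i - v i) {..<d} \<le> 2 * \<epsilon>"
    and L: "0 < \<Lambda>" and t: "0 \<le> \<tau>" and AS: "\<And>v. v \<in> S \<Longrightarrow> \<bar>A v - \<Lambda>\<bar> \<le> \<tau> * \<Lambda>" and u: "u \<in> unit_sphere d"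
  shows "\<bar>A u / \<Lambda> - 1\<bar> \<le> \<tau> + 3 * \<epsilon> * (1 + \<tau>)"
proof -
  define s where "s = Sup (A ` unit_sphere d)"
  have ne: "A ` unit_sphere d \<noteq> {}" using u by auto
  have bdd: "bdd_above (A ` unit_sphere d)" using bound by (rule bdd_aboveI2)
  have le_s: "A u \<le> s" if "u \<in> unit_sphere d" for u unfolding s_def using that bdd by (intro cSup_upper) auto
  have A0: "0 \<le> A x" for x
  proof -
    have "A (\<lambda>i. x i + (-1) * x i) \<le> A x + A (\<lambda>i. (-1) * x i)" by (rule add)
    also have "\<dots> = 2 * A x" using scale[of "-1" x] by simp
    also have "A (\<lambda>i. x i + (-1) * x i) = A (\<lambda>i. 0 * x i)" by (rule cong) simp
    also have "\<dots> = 0" using scale[of 0 x] by simp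
    finally show ?thesis by simp
  qed
  have s0: "0 \<le> s" using le_s[OF u] A0[of u] by linarith
  have hom: "A x \<le> s * L2_set x {..<d}" for x
  proof (cases "L2_set x {..<d} = 0")
    case True
    then have "A x = A (\<lambda>i. 0 * x i)" by (intro cong) (auto simp: L2_set_eq_0_iff)
    then show ?thesis using True scale[of 0 x] by simp
  next
    case False
    then have p: "0 < L2_set x {..<d}" using L2_set_nonneg[of x "{..<d}"] by linarith
    define y where "y = (\<lambda>i. (1 / L2_set x {..<d}) * x i)"
    have y: "L2_set y {..<d} = 1" unfolding y_def L2_set_scale using p by simp
    have "A y = A (restrict y {..<d})" by (rule cong) simp
    also have "\<dots> \<le> s"
    proof (rule le_s)
      have "L2_set (restrict y {..<d}) {..<d} = 1" using y by (subst L2_set_cong[OF refl, of _ _ y]) auto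
      then show "restrict y {..<d} \<in> unit_sphere d" by (auto simp: unit_sphere_def)
    qed
    finally have "\<bar>1 / L2_set x {..<d}\<bar> * A x \<le> s" unfolding y_def scale .
    then show ?thesis using p by (simp add: field_simps)
  qed
  have near: "\<exists>v\<in>S. \<bar>A u - A v\<bar> \<le> 2 * \<epsilon> * s" if u: "u \<in> unit_sphere d" for u
  proof -
    obtain v where v: "v \<in> S" "L2_set (\<lambda>i. u i - v i) {..<d} \<le> 2 * \<epsilon>" using net[OF u] by blast
    have 1: "A u \<le> A v + A (\<lambda>i. u i - v i)" using add[of v "\<lambda>i. u i - v i"] by simp
    have 2: "A v \<le> A u + A (\<lambda>i. u i - v i)" using add[of u "\<lambda>i. v i - u i"] scale[of "-1" "\<lambda>i. u i - v i"] by simp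
    have "A (\<lambda>i. u i - v i) \<le> s * (2 * \<epsilon>)" using hom[of "\<lambda>i. u i - v i"] mult_left_mono[OF v(2) s0] by linarith
    then have "\<bar>A u - A v\<bar> \<le> 2 * \<epsilon> * s" using 1 2 by (simp add: abs_le_iff mult.commute)
    then show ?thesis using v(1) by blast
  qed
  have "s \<le> (1 + \<tau>) * \<Lambda> + 2 * \<epsilon> * s"
    unfolding s_def
  proof (rule cSup_least[OF ne])
    fix y assume "y \<in> A ` unit_sphere d"
    then obtain u where u: "u \<in> unit_sphere d" "y = A u" by auto
    then obtain v where "v \<in> S" "\<bar>A u - A v\<bar> \<le> 2 * \<epsilon> * s" using near by blast
    then show "y \<le> (1 + \<tau>) * \<Lambda> + 2 * \<epsilon> * Sup (A ` unit_sphere d)"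
      using AS[of v] u unfolding s_def by (simp add: algebra_simps abs_le_iff)
  qed
  moreover have "2 * \<epsilon> * s \<le> 1/4 * s" using e s0 by (intro mult_right_mono) auto
  ultimately have s: "3 * s \<le> 4 * ((1 + \<tau>) * \<Lambda>)" by linarith
  obtain v where v: "v \<in> S" "\<bar>A u - A v\<bar> \<le> 2 * \<epsilon> * s" using near[OF u] by blast
  have "\<bar>A u - \<Lambda>\<bar> \<le> 2 * \<epsilon> * s + \<tau> * \<Lambda>" using v AS[OF v(1)] by linarith
  also have "2 * \<epsilon> * s \<le> 3 * \<epsilon> * ((1 + \<tau>) * \<Lambda>)"
  proof -
    have "s \<le> 3/2 * ((1 + \<tau>) * \<Lambda>)" using s s0 by linarith
    from mult_left_mono[OF this, of "2 * \<epsilon>"] show ?thesis using e by (simp add: algebra_simps)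
  qed
  finally have "\<bar>A u - \<Lambda>\<bar> \<le> (\<tau> + 3 * \<epsilon> * (1 + \<tau>)) * \<Lambda>" by (simp add: algebra_simps)
  moreover have "A u / \<Lambda> - 1 = (A u - \<Lambda>) / \<Lambda>" using L by (simp add: field_simps)
  ultimately show ?thesis using L by (simp add: abs_divide pos_divide_le_eq)
qed

subsection \<open>A fixed direction\<close>

text \<open>The argument \<open>s\<close> ranges over all real arrays, as convex concentration
  requires; later the entries of \<open>z\<close> themselves are inserted for \<open>s\<close> when
  only measurability is at stake.\<close>

definition sign_norm :: "nat \<Rightarrow> nat \<Rightarrow> ((nat \<Rightarrow> real) \<Rightarrow> real) \<Rightarrow> (nat \<times> nat \<Rightarrow> real) \<Rightarrow> (nat \<times> nat \<Rightarrow> real) \<Rightarrow> real" where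
  "sign_norm m n N b s = norm_fun n N (\<lambda>j. \<Sum>i<m. s (i, j) * b (i, j))"

definition index_list :: "nat \<Rightarrow> nat \<Rightarrow> (nat \<times> nat) list" where
  "index_list m n = List.product [0..<m] [0..<n]"

lemma index_list_set [simp]: "set (index_list m n) = {..<m} \<times> {..<n}"
  by (auto simp: index_list_def)

lemma index_list_distinct [simp]: "distinct (index_list m n)"
  by (simp add: index_list_def distinct_product)

lemma sum_index_column:
  fixes g :: "nat \<times> nat \<Rightarrow> real"
  assumes "j < n"
  shows "(\<Sum>k\<in>{..<m} \<times> {..<n}. if snd k = j then g k else 0) = (\<Sum>i<m. g (i, j))"
  using assms by (simp add: sum.cartesian_product')

lemma Collect_union_cover:
  "{z \<in> S. (\<exists>i<m. \<exists>j<n. P i j z) \<or> (\<exists>j<n. Q j z) \<or> (\<exists>j<n. R j z)}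
    = (\<Union>k\<in>{..<m::nat} \<times> {..<n::nat}. {z \<in> S. P (fst k) (snd k) z}) \<union> ((\<Union>j<n. {z \<in> S. Q j z}) \<union> (\<Union>j<n. {z \<in> S. R j z}))"
  by force

lemma ravg_sign_norm:
  "ravg (index_list m n) (sign_norm m n N b) d = rop (map (\<lambda>k. (snd k, b k)) (index_list m n)) (norm_fun n N) (\<lambda>_. 0)"
proof -
  have "sign_norm m n N b s = norm_fun n N (\<lambda>j. 0 + (\<Sum>k\<in>set (index_list m n). if snd k = j then s k * b k else 0))" for s
    unfolding sign_norm_def by (rule norm_fun_cong) (simp add: sum_index_column)
  then have "sign_norm m n N b = (\<lambda>s. norm_fun n N (\<lambda>j. 0 + (\<Sum>k\<in>set (index_list m n). if snd k = j then s k * b k else 0)))" by auto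
  then show ?thesis using ravg_eq_rop[OF index_list_distinct, where \<Psi> = "norm_fun n N" and x = "\<lambda>_. 0" and p = snd and b = b] by simp
qed

lemma sqsum_index_list:
  assumes "j < n"
  shows "sqsum (map (\<lambda>k. (snd k, b k)) (index_list m n)) j = (\<Sum>i<m. (b (i, j))\<^sup>2)"
proof -
  have "sqsum (map (\<lambda>k. (snd k, b k)) (index_list m n)) j = sum_list (map (\<lambda>k. if snd k = j then (b k)\<^sup>2 else 0) (index_list m n))"
    by (simp add: sqsum_def comp_def cong: if_cong)
  also have "\<dots> = (\<Sum>k\<in>{..<m} \<times> {..<n}. if snd k = j then (b k)\<^sup>2 else 0)"
    by (subst sum_list_distinct_conv_sum_set) auto
  finally show ?thesis using assms by (simp add: sum_index_column)
qed

lemma ravg_sign_norm_upper: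
  assumes N: "is_norm n N" and \<beta>: "0 < \<beta>" "2 * \<beta>\<^sup>2 < 1"
    and b: "\<And>i j. i < m \<Longrightarrow> j < n \<Longrightarrow> \<bar>b (i, j)\<bar> \<le> \<beta>" and v: "\<And>j. j < n \<Longrightarrow> (\<Sum>i<m. (b (i, j))\<^sup>2) \<le> v"
    and W: "0 \<le> W" "v + 2 * \<beta>\<^sup>2 * ln (1 / (2 * \<beta>\<^sup>2)) \<le> W * (1 - 2 * \<beta>\<^sup>2)"
  shows "ravg (index_list m n) (sign_norm m n N b) d \<le> sqrt W * gaussian_mean n N"
proof -
  have "rop (map (\<lambda>k. (snd k, b k)) (index_list m n)) (norm_fun n N) (\<lambda>_. 0) \<le> (\<integral>g. norm_fun n N (\<lambda>k. sqrt W * g k) \<partial>gaussian_law n)"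
    using b v by (intro rop_zero_upper[OF norm_fun_coord_cvx_lip[OF N] \<beta> _ _ W(2)]) (auto simp: sqsum_index_list)
  then show ?thesis using W(1) by (simp add: ravg_sign_norm gaussian_mean_scale[OF N])
qed

text \<open>By contraction the smaller array \<open>b'\<close> may replace \<open>b\<close>, so that
  only small coefficients enter the exponential error. Each of the \<open>m * n\<close> exchanges
  costs at most \<open>4 * dual_radius n N\<close> times the exponential, since the norm of a
  coordinate vector is at most the dual radius.\<close>

lemma ravg_sign_norm_lower:
  assumes N: "is_norm n N" and K: "convex_body n (unit_ball_of n N)" 
    and \<beta>: "0 < \<beta>" "\<beta> \<le> \<sigma>\<^sub>0" and \<delta>: "0 \<le> \<delta>" "\<delta> \<le> 1"
    and b: "\<And>i j. i < m \<Longrightarrow> j < n \<Longrightarrow> \<bar>b' (i, j)\<bar> \<le> \<beta> \<and> \<bar>b' (i, j)\<bar> \<le> \<bar>b (i, j)\<bar>" 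
    and v: "\<And>j. j < n \<Longrightarrow> \<sigma>\<^sub>0\<^sup>2 + (\<Sum>i<m. (b' (i, j))\<^sup>2) \<le> 4"
    and w: "0 \<le> w" "\<And>j. j < n \<Longrightarrow> w \<le> (1 - \<delta>) * (\<Sum>i<m. (b' (i, j))\<^sup>2)"
  shows "sqrt w * gaussian_mean n N \<le> ravg (index_list m n) (sign_norm m n N b) d + \<sigma>\<^sub>0 * gaussian_mean n N
    + 4 * dual_radius n N * real (m * n) * exp (- (3 * \<delta> * \<sigma>\<^sub>0\<^sup>2 / (8 * \<beta>\<^sup>2)))"
proof -
  let ?l = "map (\<lambda>k. (snd k, b' k)) (index_list m n)" and ?e = "exp (- (3 * \<delta> * \<sigma>\<^sub>0\<^sup>2 / (8 * \<beta>\<^sup>2)))"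
  let ?c = "\<lambda>j. norm_fun n N (unit_vec j)"
  have 1: "(\<integral>g. norm_fun n N (\<lambda>k. sqrt w * g k) \<partial>gaussian_law n) \<le> rop ?l (norm_fun n N) (\<lambda>_. 0) 
      + (\<integral>g. norm_fun n N (\<lambda>k. \<sigma>\<^sub>0 * g k) \<partial>gaussian_law n) + sum_list (map (\<lambda>p. 4 * ?c (fst p)) ?l) * ?e"
    using b v w norm_fun_nonneg[OF N]
    by (intro rop_zero_lower[OF norm_fun_coord_cvx_lip[OF N] \<beta> \<delta> _ norm_fun_add[OF N]]) (auto simp: sqsum_index_list)
  have 2: "rop ?l (norm_fun n N) (\<lambda>_. 0) \<le> ravg (index_list m n) (sign_norm m n N b) d"
    unfolding ravg_sign_norm using b by (intro rop_contract[OF norm_fun_coord_cvx_lip[OF N]]) auto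
  have 3: "sum_list (map (\<lambda>p. 4 * ?c (fst p)) ?l) * ?e \<le> 4 * dual_radius n N * real (m * n) * ?e"
  proof (rule mult_right_mono)
    have "sum_list (map (\<lambda>p. 4 * ?c (fst p)) ?l) = (\<Sum>k\<in>{..<m} \<times> {..<n}. 4 * ?c (snd k))"
      by (simp add: comp_def sum_list_distinct_conv_sum_set)
    also have "\<dots> \<le> (\<Sum>k\<in>{..<m} \<times> {..<n}. 4 * dual_radius n N)"
      using norm_unit_vec_le[OF K N] by (intro sum_mono) auto
    finally show "sum_list (map (\<lambda>p. 4 * ?c (fst p)) ?l) \<le> 4 * dual_radius n N * real (m * n)"
      by (simp add: mult_ac)
  qed simp
  have 4: "(\<integral>g. norm_fun n N (\<lambda>k. sqrt w * g k) \<partial>gaussian_law n) = sqrt w * gaussian_mean n N"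
    "(\<integral>g. norm_fun n N (\<lambda>k. \<sigma>\<^sub>0 * g k) \<partial>gaussian_law n) = \<sigma>\<^sub>0 * gaussian_mean n N"
    using w(1) \<beta> by (simp_all add: gaussian_mean_scale[OF N])
  show ?thesis using 1 2 3 unfolding 4 by linarith
qed

lemma sign_norm_convex:
  assumes N: "is_norm n N"
  shows "convex_fun (sign_norm m n N b)"
  unfolding convex_fun_def
proof (intro allI impI)
  fix x y :: "nat \<times> nat \<Rightarrow> real" and t :: real assume t: "0 \<le> t" "t \<le> 1"
  have "sign_norm m n N b (\<lambda>k. (1 - t) * x k + t * y k) 
     = norm_fun n N (\<lambda>j. (1 - t) * (\<Sum>i<m. x (i, j) * b (i, j)) + t * (\<Sum>i<m. y (i, j) * b (i, j)))"
    unfolding sign_norm_def by (rule norm_fun_cong) (simp add: sum_distrib_left sum.distrib[symmetric] algebra_simps)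
  also have "\<dots> \<le> norm_fun n N (\<lambda>j. (1 - t) * (\<Sum>i<m. x (i, j) * b (i, j))) + norm_fun n N (\<lambda>j. t * (\<Sum>i<m. y (i, j) * b (i, j)))"
    by (rule norm_fun_add[OF N])
  also have "\<dots> = (1 - t) * sign_norm m n N b x + t * sign_norm m n N b y"
    unfolding norm_fun_scale[OF N] sign_norm_def using t by simp
  finally show "sign_norm m n N b (\<lambda>k. (1 - t) * x k + t * y k) \<le> (1 - t) * sign_norm m n N b x + t * sign_norm m n N b y" .
qed

text \<open>The columns of signs act on different coordinates, so Cauchy-Schwarz in each column
  shows that the linear map from signs to vectors has Euclidean norm at most the largest column norm
  \<open>sqrt v\<close>.\<close>

lemma sign_norm_lipschitz:
  assumes N: "is_norm n N" and K: "convex_body n (unit_ball_of n N)" 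
    and v: "0 \<le> v" "\<And>j. j < n \<Longrightarrow> (\<Sum>i<m. (b (i, j))\<^sup>2) \<le> v"
  shows "sign_norm m n N b x - sign_norm m n N b y \<le> dual_radius n N * sqrt v * sqrt (\<Sum>k\<in>{..<m} \<times> {..<n}. (x k - y k)\<^sup>2)"
proof -
  have "sign_norm m n N b x - sign_norm m n N b y \<le> norm_fun n N (\<lambda>j. (\<Sum>i<m. x (i, j) * b (i, j)) - (\<Sum>i<m. y (i, j) * b (i, j)))"
    unfolding sign_norm_def using norm_fun_diff_le[OF N] abs_le_D1 by blast
  also have "\<dots> \<le> dual_radius n N * L2_set (\<lambda>j. (\<Sum>i<m. x (i, j) * b (i, j)) - (\<Sum>i<m. y (i, j) * b (i, j))) {..<n}"
    by (rule norm_fun_le_dual_radius[OF K N])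
  also have "\<dots> \<le> dual_radius n N * sqrt (v * (\<Sum>k\<in>{..<m} \<times> {..<n}. (x k - y k)\<^sup>2))"
    unfolding L2_set_def
  proof (intro mult_left_mono real_sqrt_le_mono dual_radius_nonneg[OF N])
    have "(\<Sum>j<n. ((\<Sum>i<m. x (i, j) * b (i, j)) - (\<Sum>i<m. y (i, j) * b (i, j)))\<^sup>2) 
        \<le> (\<Sum>j<n. v * (\<Sum>i<m. (x (i, j) - y (i, j))\<^sup>2))"
    proof (rule sum_mono)
      fix j assume "j \<in> {..<n}"
      then have j: "j < n" by simp
      have "((\<Sum>i<m. x (i, j) * b (i, j)) - (\<Sum>i<m. y (i, j) * b (i, j)))\<^sup>2 = (\<Sum>i<m. b (i, j) * (x (i, j) - y (i, j)))\<^sup>2"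
        by (simp add: sum_subtractf[symmetric] algebra_simps)
      also have "\<dots> \<le> (\<Sum>i<m. (b (i, j))\<^sup>2) * (\<Sum>i<m. (x (i, j) - y (i, j))\<^sup>2)"
        by (rule Cauchy_Schwarz_ineq_sum)
      also have "\<dots> \<le> v * (\<Sum>i<m. (x (i, j) - y (i, j))\<^sup>2)"
        using v(2)[OF j] by (intro mult_right_mono sum_nonneg) auto
      finally show "((\<Sum>i<m. x (i, j) * b (i, j)) - (\<Sum>i<m. y (i, j) * b (i, j)))\<^sup>2 \<le> v * (\<Sum>i<m. (x (i, j) - y (i, j))\<^sup>2)" .
    qed
    also have "\<dots> = v * (\<Sum>i<m. \<Sum>j<n. (x (i, j) - y (i, j))\<^sup>2)"
      by (subst sum.swap) (simp add: sum_distrib_left)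
    finally show "(\<Sum>j<n. ((\<Sum>i<m. x (i, j) * b (i, j)) - (\<Sum>i<m. y (i, j) * b (i, j)))\<^sup>2) 
        \<le> v * (\<Sum>k\<in>{..<m} \<times> {..<n}. (x k - y k)\<^sup>2)"
      by (simp add: sum.cartesian_product case_prod_beta)
  qed
  finally show ?thesis by (simp add: real_sqrt_mult mult.assoc)
qed

text \<open>The hypotheses collected here are what the event on the \<open>X\<^sub>i\<close> provides about the coefficients
  \<open>a\<^sub>i = \<langle>X\<^sub>i, u\<rangle> / sqrt m\<close>: near-isotropy, the maximal squared coefficient \<open>A\<close>, the mass \<open>h\<close> of the large
  coefficients \<open>I\<close>, and the threshold \<open>\<theta>\<close> for the remaining ones.\<close>

locale small_coefficients =
  fixes L K D \<epsilon> A h \<theta> \<beta> :: real and m n :: nat and a :: "nat \<Rightarrow> real" and I :: "nat set"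
  assumes L: "1 \<le> L" and K: "2 \<le> K" and D: "0 < D" and eps: "0 < \<epsilon>" "\<epsilon> \<le> 1/9" and eD: "1 \<le> \<epsilon>\<^sup>2 * D"
    and nm: "0 < n" "0 < m" "real m \<le> exp D" "real n \<le> exp ((K - 2) * D)"
    and a_norm: "\<bar>(\<Sum>i<m. (a i)\<^sup>2) - 1\<bar> \<le> \<epsilon>"
    and a_max: "\<And>i. i < m \<Longrightarrow> (a i)\<^sup>2 \<le> A"
    and I: "I \<subseteq> {..<m}" "(\<Sum>i\<in>I. (a i)\<^sup>2) \<le> h" "\<And>i. i < m \<Longrightarrow> i \<notin> I \<Longrightarrow> (a i)\<^sup>2 \<le> \<theta>" and \<theta>: "0 < \<theta>" and h: "h \<le> \<epsilon>"
    and \<beta>: "0 < \<beta>" "12 * L\<^sup>2 * K * D * A \<le> \<beta>\<^sup>2" "2 * \<beta>\<^sup>2 \<le> \<epsilon>" "2 * \<beta>\<^sup>2 * ln (1 / (2 * \<beta>\<^sup>2)) \<le> \<epsilon>"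
    and fourth: "72 * L^4 * K\<^sup>2 * D * (A * h + 2 * \<theta>) \<le> \<epsilon>\<^sup>2"
    and small1: "16 * L^4 * \<theta> \<le> \<epsilon>^3" and small2: "K * D + 2 \<le> 3 * \<epsilon>^4 / (128 * L^4 * \<theta>)"
begin

text \<open>Chosen so that truncating the squares of the entries costs a fraction \<epsilon> of the
  variance.\<close>

definition trunc :: real where "trunc = 16 * L^4 / \<epsilon>"

text \<open>The first clause keeps all coefficients below \<beta> for the upper comparison. The
  second bounds the column variances, for the upper comparison and the Lipschitz constant. The third
  bounds from below what truncation and removal of \<open>I\<close> leave, for the lower comparison.
  Only squares of entries occur, so flips preserve the property.\<close>

definition good :: "(nat \<Rightarrow> nat \<Rightarrow> real) \<Rightarrow> bool" where
  "good z \<longleftrightarrow> (\<forall>i<m. \<forall>j<n. (z i j)\<^sup>2 < 12 * L\<^sup>2 * K * D) \<and>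
     (\<forall>j<n. (\<Sum>i<m. (a i)\<^sup>2 * (z i j)\<^sup>2) < (\<Sum>i<m. (a i)\<^sup>2) + \<epsilon>) \<and>
     (\<forall>j<n. (1 - 16 * L^4 / trunc) * (\<Sum>i<m. if i \<in> I then 0 else (a i)\<^sup>2) - \<epsilon> <
        (\<Sum>i<m. (if i \<in> I then 0 else (a i)\<^sup>2) * min ((z i j)\<^sup>2) trunc))"

lemma L4: "1 \<le> L^4" "1 \<le> L\<^sup>2" using L by (simp_all add: one_le_power)

lemma trunc_pos: "0 < trunc"
  unfolding trunc_def using L eps by (intro divide_pos_pos mult_pos_pos) auto

lemma trunc_eq: "16 * L^4 / trunc = \<epsilon>" using L eps by (simp add: trunc_def)

lemma A_nonneg: "0 \<le> A" using a_max[of 0] nm zero_le_power2[of "a 0"] by linarith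

lemma rest_mass: "1 - 2 * \<epsilon> \<le> (\<Sum>i<m. if i \<in> I then 0 else (a i)\<^sup>2)"
proof -
  have "(\<Sum>i<m. (a i)\<^sup>2) = (\<Sum>i<m. if i \<in> I then 0 else (a i)\<^sup>2) + (\<Sum>i<m. if i \<in> I then (a i)\<^sup>2 else 0)"
    by (simp add: sum.distrib[symmetric] if_distrib cong: if_cong)
  also have "(\<Sum>i<m. if i \<in> I then (a i)\<^sup>2 else 0) = (\<Sum>i\<in>I. (a i)\<^sup>2)"
    using I(1) by (simp add: sum.If_cases Int_absorb1)
  finally show ?thesis using a_norm I(2) h by linarith
qed

text \<open>The sum of squared weights in the Chernoff bounds. Splitting at \<open>I\<close> beats
  the plain bound by \<open>2 * A\<close>: the maximum \<open>A\<close> is charged only against the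
  small mass \<open>h\<close>.\<close>

lemma fourth_moment: "(\<Sum>i<m. ((a i)\<^sup>2)\<^sup>2) \<le> A * h + 2 * \<theta>"
proof -
  have "(\<Sum>i<m. ((a i)\<^sup>2)\<^sup>2) \<le> (\<Sum>i<m. (if i \<in> I then A * (a i)\<^sup>2 else 0) + \<theta> * (a i)\<^sup>2)"
  proof (rule sum_mono)
    fix i assume "i \<in> {..<m}"
    then have i: "i < m" by simp
    show "((a i)\<^sup>2)\<^sup>2 \<le> (if i \<in> I then A * (a i)\<^sup>2 else 0) + \<theta> * (a i)\<^sup>2"
    proof (cases "i \<in> I")
      case True
      have "((a i)\<^sup>2)\<^sup>2 \<le> A * (a i)\<^sup>2" using a_max[OF i] mult_right_mono[of "(a i)\<^sup>2" A "(a i)\<^sup>2"] by (simp add: power2_eq_square)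
      then show ?thesis using True \<theta> by (simp add: add_increasing2)
    next
      case False
      then show ?thesis using I(3)[OF i] mult_right_mono[of "(a i)\<^sup>2" \<theta> "(a i)\<^sup>2"] by (simp add: power2_eq_square)
    qed
  qed
  also have "\<dots> = A * (\<Sum>i\<in>I. (a i)\<^sup>2) + \<theta> * (\<Sum>i<m. (a i)\<^sup>2)"
    using I(1) by (simp add: sum.distrib sum.If_cases Int_absorb1 sum_distrib_left)
  also have "\<dots> \<le> A * h + \<theta> * 2" using A_nonneg \<theta> I(2) a_norm eps by (intro add_mono mult_left_mono) auto
  finally show ?thesis by simp
qed

text \<open>Upwards the variance costs \<open>5 * \<epsilon>\<close>. Downwards the variance costs
  \<open>5 * \<epsilon>\<close>, and the auxiliary noise and the accumulated exchange errors cost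
  \<epsilon> each.\<close>

lemma good_conditional_mean:
  assumes N: "is_norm n N" and C: "convex_body n (unit_ball_of n N)"
    and E: "gaussian_mean n N = dual_radius n N * sqrt D" and z: "good z"
  shows "\<bar>ravg (index_list m n) (sign_norm m n N (\<lambda>(i, j). a i * z i j)) d - gaussian_mean n N\<bar> \<le> 7 * \<epsilon> * gaussian_mean n N"
proof -
  let ?b = "\<lambda>(i, j). a i * z i j" and ?E = "gaussian_mean n N" and ?R = "dual_radius n N"
  let ?b' = "\<lambda>(i, j). if i \<in> I then 0 else a i * sqrt (min ((z i j)\<^sup>2) trunc)"
  have R0: "0 \<le> ?R" by (rule dual_radius_nonneg[OF N])
  have E0: "0 \<le> ?E" using E R0 D by simp
  have z1: "(z i j)\<^sup>2 \<le> 12 * L\<^sup>2 * K * D" if "i < m" "j < n" for i j using z that by (auto simp: good_def less_imp_le)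
  have bb: "(a i * z i j)\<^sup>2 \<le> \<beta>\<^sup>2" if "i < m" "j < n" for i j
  proof -
    have "(a i * z i j)\<^sup>2 \<le> A * (12 * L\<^sup>2 * K * D)"
      unfolding power_mult_distrib using a_max[OF that(1)] z1[OF that] A_nonneg by (intro mult_mono) auto
    also have "\<dots> \<le> \<beta>\<^sup>2" using \<beta>(2) by (simp add: mult_ac)
    finally show ?thesis .
  qed
  have v: "(\<Sum>i<m. (?b (i, j))\<^sup>2) \<le> 1 + 2 * \<epsilon>" if "j < n" for j
    using z that a_norm by (auto simp: good_def power_mult_distrib dest!: spec[of _ j])
  have b'b: "\<bar>?b' (i, j)\<bar> \<le> \<bar>?b (i, j)\<bar>" for i j
  proof -
    have "sqrt (min ((z i j)\<^sup>2) trunc) \<le> sqrt ((z i j)\<^sup>2)" by (intro real_sqrt_le_mono) auto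
    then show ?thesis using trunc_pos by (auto simp: abs_mult intro!: mult_left_mono)
  qed
  have up: "ravg (index_list m n) (sign_norm m n N ?b) d \<le> sqrt (1 + 5 * \<epsilon>) * ?E"
  proof (rule ravg_sign_norm_upper[OF N \<beta>(1)])
    show "2 * \<beta>\<^sup>2 < 1" using \<beta> eps by linarith
    show "\<bar>?b (i, j)\<bar> \<le> \<beta>" if "i < m" "j < n" for i j
      using bb[OF that] \<beta>(1) power2_le_imp_le[of "\<bar>a i * z i j\<bar>" \<beta>] by simp
    \<comment> \<open>The column variance is at most \<open>1 + 2 * \<epsilon>\<close> and the
      logarithmic price at most \<epsilon>; division by
      \<open>1 - 2 * \<beta>^2 \<ge> 1 - \<epsilon>\<close> leaves at most
      \<open>1 + 5 * \<epsilon>\<close>, as \<open>\<epsilon> \<le> 1/5\<close>.\<close>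
    have "(1 + 2 * \<epsilon>) + \<epsilon> \<le> (1 + 5 * \<epsilon>) * (1 - \<epsilon>)"
    proof -
      have "(1 + 5 * \<epsilon>) * (1 - \<epsilon>) - ((1 + 2 * \<epsilon>) + \<epsilon>) = \<epsilon> * (1 - 5 * \<epsilon>)" by (simp add: algebra_simps)
      moreover have "0 \<le> \<epsilon> * (1 - 5 * \<epsilon>)" using eps by (intro mult_nonneg_nonneg) auto
      ultimately show ?thesis by linarith
    qed
    also have "\<dots> \<le> (1 + 5 * \<epsilon>) * (1 - 2 * \<beta>\<^sup>2)" using \<beta>(3) eps by (intro mult_left_mono) auto
    finally show "(1 + 2 * \<epsilon>) + 2 * \<beta>\<^sup>2 * ln (1 / (2 * \<beta>\<^sup>2)) \<le> (1 + 5 * \<epsilon>) * (1 - 2 * \<beta>\<^sup>2)" using \<beta>(4) by linarith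
  qed (use v eps in auto)
  also have "sqrt (1 + 5 * \<epsilon>) * ?E \<le> (1 + 5 * \<epsilon>) * ?E"
  proof (rule mult_right_mono[OF real_le_lsqrt E0])
    show "1 + 5 * \<epsilon> \<le> (1 + 5 * \<epsilon>)\<^sup>2" using eps by (simp add: power2_eq_square)
  qed (use eps in auto)
  finally have up: "ravg (index_list m n) (sign_norm m n N ?b) d \<le> (1 + 5 * \<epsilon>) * ?E" .
  \<comment> \<open>The bound for the remaining coefficients after truncation, far below the \<beta>
    of the upper comparison.\<close>
  define \<beta>' where "\<beta>' = sqrt (\<theta> * trunc)"
  have b2: "\<beta>'\<^sup>2 = 16 * L^4 * \<theta> / \<epsilon>" 
  proof -
    have "\<beta>'\<^sup>2 = \<theta> * trunc" unfolding \<beta>'_def using \<theta> trunc_pos by (intro real_sqrt_pow2) simp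
    then show ?thesis by (simp add: trunc_def mult_ac)
  qed
  have b'2: "(?b' (i, j))\<^sup>2 = (if i \<in> I then 0 else (a i)\<^sup>2) * min ((z i j)\<^sup>2) trunc" for i j
    using trunc_pos by (auto simp: power_mult_distrib)
  \<comment> \<open>Both the fraction of variance given up and the auxiliary standard deviation are
    taken to be \<epsilon>.\<close>
  have low: "sqrt (1 - 5 * \<epsilon>) * ?E \<le> ravg (index_list m n) (sign_norm m n N ?b) d + \<epsilon> * ?E
    + 4 * ?R * real (m * n) * exp (- (3 * \<epsilon> * \<epsilon>\<^sup>2 / (8 * \<beta>'\<^sup>2)))"
  proof (rule ravg_sign_norm_lower[OF N C])
    show "0 < \<beta>'" using \<theta> trunc_pos by (simp add: \<beta>'_def)
    have "\<beta>'\<^sup>2 \<le> \<epsilon>\<^sup>2" unfolding b2 using small1 eps by (simp add: divide_le_eq power2_eq_square power3_eq_cube)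
    then show "\<beta>' \<le> \<epsilon>" using eps power2_le_imp_le by fastforce
    show "\<bar>?b' (i, j)\<bar> \<le> \<beta>' \<and> \<bar>?b' (i, j)\<bar> \<le> \<bar>?b (i, j)\<bar>" if ij: "i < m" "j < n" for i j
    proof (intro conjI b'b)
      have "(?b' (i, j))\<^sup>2 \<le> \<theta> * trunc"
        unfolding b'2 using I(3)[OF ij(1)] \<theta> trunc_pos by (auto intro!: mult_mono)
      then have "\<bar>?b' (i, j)\<bar>\<^sup>2 \<le> \<theta> * trunc" by (simp only: power2_abs)
      then show "\<bar>?b' (i, j)\<bar> \<le> \<beta>'" unfolding \<beta>'_def by (rule real_le_rsqrt)
    qed
    show "\<epsilon>\<^sup>2 + (\<Sum>i<m. (?b' (i, j))\<^sup>2) \<le> 4" if "j < n" for j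
    proof -
      have "(\<Sum>i<m. (?b' (i, j))\<^sup>2) \<le> (\<Sum>i<m. (?b (i, j))\<^sup>2)"
        using b'b by (intro sum_mono) (simp only: abs_le_square_iff)
      moreover have "\<epsilon>\<^sup>2 \<le> 1" using eps by (intro power_le_one) auto
      ultimately show ?thesis using v[OF that] eps by linarith
    qed
    show "1 - 5 * \<epsilon> \<le> (1 - \<epsilon>) * (\<Sum>i<m. (?b' (i, j))\<^sup>2)" if j: "j < n" for j
    proof -
      have "(1 - \<epsilon>) * (1 - 2 * \<epsilon>) \<le> (1 - \<epsilon>) * (\<Sum>i<m. if i \<in> I then 0 else (a i)\<^sup>2)"
        using rest_mass eps by (intro mult_left_mono) auto
      moreover have "(1 - \<epsilon>) * (\<Sum>i<m. if i \<in> I then 0 else (a i)\<^sup>2) - \<epsilon> < (\<Sum>i<m. (?b' (i, j))\<^sup>2)"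
        using z j unfolding b'2 good_def trunc_eq by blast
      moreover have q: "1 - 3 * \<epsilon> \<le> (1 - \<epsilon>) * (1 - 2 * \<epsilon>)" "1 - 5 * \<epsilon> \<le> (1 - \<epsilon>) * (1 - 4 * \<epsilon>)"
        using eps by (simp_all add: algebra_simps)
      ultimately have "1 - 4 * \<epsilon> \<le> (\<Sum>i<m. (?b' (i, j))\<^sup>2)" by linarith
      then have "(1 - \<epsilon>) * (1 - 4 * \<epsilon>) \<le> (1 - \<epsilon>) * (\<Sum>i<m. (?b' (i, j))\<^sup>2)"
        by (rule mult_left_mono) (use eps in simp)
      with q(2) show ?thesis by linarith
    qed
  qed (use eps in auto)
  have sq: "1 - 5 * \<epsilon> \<le> sqrt (1 - 5 * \<epsilon>)"
  proof (rule real_le_rsqrt)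
    show "(1 - 5 * \<epsilon>)\<^sup>2 \<le> 1 - 5 * \<epsilon>" using eps by (simp add: power2_eq_square mult_left_le)
  qed
  \<comment> \<open>The exponential beats \<open>4 * m * n\<close>, leaving \<open>R\<close>; and
    \<open>R \<le> \<epsilon> * E\<close> because \<open>E = R * sqrt D\<close> and
    \<open>\<epsilon>^2 * D \<ge> 1\<close>.\<close>
  have err: "4 * ?R * real (m * n) * exp (- (3 * \<epsilon> * \<epsilon>\<^sup>2 / (8 * \<beta>'\<^sup>2))) \<le> \<epsilon> * ?E"
  proof -
    have ex: "3 * \<epsilon> * \<epsilon>\<^sup>2 / (8 * \<beta>'\<^sup>2) = 3 * \<epsilon>^4 / (128 * L^4 * \<theta>)"
      unfolding b2 using eps \<theta> L4 by (simp add: field_simps power2_eq_square power4_eq_xxxx)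
    have "4 \<le> exp (2::real)"
    proof -
      have "(2::real)^2 \<le> exp 1 ^ 2" using exp_ge_add_one_self[of 1] by (intro power_mono) auto
      then show ?thesis by (simp flip: exp_of_nat_mult)
    qed
    then have "4 * real (m * n) \<le> exp 2 * (exp D * exp ((K - 2) * D))"
      unfolding of_nat_mult using nm by (intro mult_mono) auto
    also have "\<dots> = exp (2 + (K - 1) * D)" by (simp add: algebra_simps flip: exp_add)
    also have "\<dots> \<le> exp (K * D + 2)" using D by (simp add: algebra_simps)
    finally have "4 * real (m * n) * exp (- (3 * \<epsilon>^4 / (128 * L^4 * \<theta>))) \<le> exp (K * D + 2) * exp (- (3 * \<epsilon>^4 / (128 * L^4 * \<theta>)))"
      by (intro mult_right_mono) auto
    also have "\<dots> \<le> 1" using small2 by (simp flip: exp_add)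
    finally have 1: "4 * real (m * n) * exp (- (3 * \<epsilon>^4 / (128 * L^4 * \<theta>))) \<le> 1" .
    have "1 \<le> (\<epsilon> * sqrt D)\<^sup>2" using eD D by (simp add: power_mult_distrib)
    then have "1 \<le> \<epsilon> * sqrt D" using eps D power2_le_imp_le[of 1 "\<epsilon> * sqrt D"] by simp
    then have "?R * (4 * real (m * n) * exp (- (3 * \<epsilon>^4 / (128 * L^4 * \<theta>)))) \<le> ?R * (\<epsilon> * sqrt D)"
      using 1 by (intro mult_left_mono R0) auto
    then show ?thesis unfolding ex E by (simp add: mult_ac)
  qed
  have "(1 - 5 * \<epsilon>) * ?E \<le> sqrt (1 - 5 * \<epsilon>) * ?E" using sq E0 by (rule mult_right_mono)
  then have "(1 - 7 * \<epsilon>) * ?E \<le> ravg (index_list m n) (sign_norm m n N ?b) d"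
    using low err by (simp add: algebra_simps)
  moreover have "(1 + 5 * \<epsilon>) * ?E \<le> (1 + 7 * \<epsilon>) * ?E" using eps E0 by (intro mult_right_mono) auto
  ultimately show ?thesis using up by (simp add: abs_le_iff algebra_simps)
qed

text \<open>A deviation of \<open>8 * \<epsilon> * E\<close> from \<open>E\<close> leaves at least
  \<open>\<epsilon> * E\<close> from the conditional mean. With squared Lipschitz constant
  \<open>R^2 * (1 + 2 * \<epsilon>)\<close> and \<open>E^2 = R^2 * D\<close> the concentration
  exponent is at least \<open>\<epsilon>^2 * D / 32\<close>.\<close>

lemma good_conditional_tail:
  assumes N: "is_norm n N" and C: "convex_body n (unit_ball_of n N)"
    and E: "gaussian_mean n N = dual_radius n N * sqrt D" and R: "0 < dual_radius n N" and z: "good z"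
  shows "ravg (index_list m n) (\<lambda>s. of_bool (\<bar>sign_norm m n N (\<lambda>(i, j). a i * z i j) s - gaussian_mean n N\<bar> 
      > 8 * \<epsilon> * gaussian_mean n N)) d \<le> 2 * exp (- \<epsilon>\<^sup>2 * D / 32)"
proof -
  let ?b = "\<lambda>(i, j). a i * z i j" and ?E = "gaussian_mean n N" and ?R = "dual_radius n N"
  let ?f = "sign_norm m n N ?b"
  let ?v = "1 + 2 * \<epsilon>"
  have v: "(\<Sum>i<m. (?b (i, j))\<^sup>2) \<le> ?v" if "j < n" for j
    using z that a_norm by (auto simp: good_def power_mult_distrib dest!: spec[of _ j])
  have E0: "0 \<le> ?E" using E R D by simp
  have "ravg (index_list m n) (\<lambda>s. of_bool (\<bar>?f s - ?E\<bar> > 8 * \<epsilon> * ?E)) d 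
     \<le> ravg (index_list m n) (\<lambda>s. of_bool (\<bar>?f s - ravg (index_list m n) ?f d\<bar> > \<epsilon> * ?E)) d"
  proof (rule ravg_mono)
    fix s
    show "of_bool (\<bar>?f s - ?E\<bar> > 8 * \<epsilon> * ?E) \<le> (of_bool (\<bar>?f s - ravg (index_list m n) ?f d\<bar> > \<epsilon> * ?E) :: real)"
      using good_conditional_mean[OF N C E z, of d] by (auto simp: of_bool_def abs_if split: if_splits)
  qed
  also have "\<dots> \<le> 2 * exp (- (\<epsilon> * ?E)\<^sup>2 / (16 * (?R * sqrt ?v)\<^sup>2))"
  proof (rule ravg_concentration)
    show "0 \<le> ?f y" for y unfolding sign_norm_def by (rule norm_fun_nonneg[OF N])
    show "convex_fun ?f" by (rule sign_norm_convex[OF N])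
    show "0 < ?R * sqrt ?v" using R eps by simp
    show "?f x - ?f y \<le> ?R * sqrt ?v * sqrt (\<Sum>k\<in>set (index_list m n). (x k - y k)\<^sup>2)" for x y
      unfolding index_list_set using v eps by (intro sign_norm_lipschitz[OF N C]) auto
  qed (use eps E0 in auto)
  also have "(\<epsilon> * ?E)\<^sup>2 / (16 * (?R * sqrt ?v)\<^sup>2) = \<epsilon>\<^sup>2 * D / (16 * ?v)"
    unfolding E using R D eps by (simp add: power_mult_distrib)
  then have "- (\<epsilon> * ?E)\<^sup>2 / (16 * (?R * sqrt ?v)\<^sup>2) = - (\<epsilon>\<^sup>2 * D / (16 * ?v))" by simp
  also have "\<epsilon>\<^sup>2 * D / 32 \<le> \<epsilon>\<^sup>2 * D / (16 * ?v)" using eps D by (intro divide_left_mono) auto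
  then have "2 * exp (- (\<epsilon>\<^sup>2 * D / (16 * ?v))) \<le> 2 * exp (- \<epsilon>\<^sup>2 * D / 32)" by simp
  finally show ?thesis .
qed

text \<open>Union bounds. The \<open>m * n\<close> entries have tail
  \<open>2 * exp (- K * D)\<close> and the \<open>n\<close> columns
  \<open>exp (- (K - 1) * D)\<close>; the bounds \<open>exp D\<close> on \<open>m\<close> and
  \<open>exp ((K - 2) * D)\<close> on \<open>n\<close> leave a multiple of
  \<open>exp (- D)\<close>.\<close>

lemma good_probability:
  assumes M: "prob_space \<nu>" and mom: "\<And>j. j < n \<Longrightarrow> subgaussian_moments L \<nu> (\<lambda>z. z j)"
  shows "{z \<in> space (iid_copies m \<nu>). good z} \<in> sets (iid_copies m \<nu>)"
    and "measure (iid_copies m \<nu>) {z \<in> space (iid_copies m \<nu>). \<not> good z} \<le> 4 * exp (- D)"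
proof -
  let ?M = "iid_copies m \<nu>"
  interpret P: prob_space ?M unfolding iid_copies_def by (intro prob_space_PiM M)
  have zm[measurable]: "(\<lambda>z. z i j) \<in> borel_measurable ?M" if "i < m" "j < n" for i j
  proof -
    have "(\<lambda>z. z j) \<in> borel_measurable \<nu>" using mom[OF that(2)] by (simp add: subgaussian_moments_def)
    moreover have "(\<lambda>z. z i) \<in> measurable ?M \<nu>" unfolding iid_copies_def
      using that(1) by (intro measurable_component_singleton) auto
    ultimately show ?thesis by (rule measurable_compose[rotated])
  qed
  let ?w = "\<lambda>i. if i \<in> I then 0 else (a i)\<^sup>2"
  let ?B1 = "\<lambda>i j. {z \<in> space ?M. 12 * L\<^sup>2 * K * D \<le> (z i j)\<^sup>2}"
  let ?B2 = "\<lambda>j. {z \<in> space ?M. (\<Sum>i<m. (a i)\<^sup>2) + \<epsilon> \<le> (\<Sum>i<m. (a i)\<^sup>2 * (z i j)\<^sup>2)}"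
  let ?B3 = "\<lambda>j. {z \<in> space ?M. (\<Sum>i<m. ?w i * min ((z i j)\<^sup>2) trunc) \<le> (1 - 16 * L^4 / trunc) * (\<Sum>i<m. ?w i) - \<epsilon>}"
  have s1: "?B1 i j \<in> sets ?M" if "i < m" "j < n" for i j using zm[OF that] by measurable
  have s2: "?B2 j \<in> sets ?M" if "j < n" for j
  proof -
    have "(\<lambda>z. \<Sum>i<m. (a i)\<^sup>2 * (z i j)\<^sup>2) \<in> borel_measurable ?M"
      using zm that by (intro borel_measurable_sum borel_measurable_times borel_measurable_power borel_measurable_const) auto
    then show ?thesis by measurable
  qed
  have s3: "?B3 j \<in> sets ?M" if "j < n" for j
  proof -
    have "(\<lambda>z. \<Sum>i<m. ?w i * min ((z i j)\<^sup>2) trunc) \<in> borel_measurable ?M"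
      using zm that by (intro borel_measurable_sum borel_measurable_times borel_measurable_min borel_measurable_power borel_measurable_const) auto
    then show ?thesis by measurable
  qed
  let ?U = "(\<Union>k\<in>{..<m} \<times> {..<n}. ?B1 (fst k) (snd k)) \<union> ((\<Union>j<n. ?B2 j) \<union> (\<Union>j<n. ?B3 j))"
  have ng: "(\<not> good z) = ((\<exists>i<m. \<exists>j<n. 12 * L\<^sup>2 * K * D \<le> (z i j)\<^sup>2) \<or>
      (\<exists>j<n. (\<Sum>i<m. (a i)\<^sup>2) + \<epsilon> \<le> (\<Sum>i<m. (a i)\<^sup>2 * (z i j)\<^sup>2)) \<or>
      (\<exists>j<n. (\<Sum>i<m. ?w i * min ((z i j)\<^sup>2) trunc) \<le> (1 - 16 * L^4 / trunc) * (\<Sum>i<m. ?w i) - \<epsilon>))" for z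
    unfolding good_def de_Morgan_conj not_all not_imp not_less by (rule refl)
  have bad: "{z \<in> space ?M. \<not> good z} = ?U"
    unfolding ng by (rule Collect_union_cover)
  have U: "(\<Union>k\<in>{..<m} \<times> {..<n}. ?B1 (fst k) (snd k)) \<in> sets ?M" "(\<Union>j<n. ?B2 j) \<in> sets ?M" "(\<Union>j<n. ?B3 j) \<in> sets ?M"
  proof -
    show "(\<Union>k\<in>{..<m} \<times> {..<n}. ?B1 (fst k) (snd k)) \<in> sets ?M"
    proof (rule sets.finite_UN)
      fix k assume "k \<in> {..<m} \<times> {..<n}"
      then have "fst k < m" "snd k < n" by auto
      then show "?B1 (fst k) (snd k) \<in> sets ?M" by (rule s1)
    qed simp
    show "(\<Union>j<n. ?B2 j) \<in> sets ?M" by (rule sets.finite_UN) (simp, rule s2, simp)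
    show "(\<Union>j<n. ?B3 j) \<in> sets ?M" by (rule sets.finite_UN) (simp, rule s3, simp)
  qed
  have "{z \<in> space ?M. good z} = space ?M - {z \<in> space ?M. \<not> good z}" by auto
  then show "{z \<in> space ?M. good z} \<in> sets ?M"
    unfolding bad using sets.compl_sets[OF sets.Un[OF U(1) sets.Un[OF U(2,3)]]] by (rule ssubst)
  have KD: "real n * exp (- ((K - 1) * D)) \<le> exp (- D)"
  proof -
    have "real n * exp (- ((K - 1) * D)) \<le> exp ((K - 2) * D) * exp (- ((K - 1) * D))"
      using nm by (intro mult_right_mono) auto
    also have "\<dots> = exp (- D)" by (simp add: algebra_simps flip: exp_add)
    finally show ?thesis .
  qed
  \<comment> \<open>Makes the linear term of the Chernoff exponent equal to \<open>K * D\<close>;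
    the assumption \<open>fourth\<close> says that the quadratic term then takes away at most
    \<open>D\<close>.\<close>
  define l where "l = K * D / \<epsilon>"
  have l: "0 < l" "l * \<epsilon> = K * D" using K D eps by (auto simp: l_def)
  have KD1: "(K - 1) * D = K * D - D" by (simp add: left_diff_distrib)
  have l4: "72 * L^4 * l\<^sup>2 * S \<le> D" if "S \<le> A * h + 2 * \<theta>" for S
  proof -
    have "72 * L^4 * l\<^sup>2 * S \<le> 72 * L^4 * l\<^sup>2 * (A * h + 2 * \<theta>)" using that L4 by (intro mult_left_mono) auto
    also have "\<dots> = (72 * L^4 * K\<^sup>2 * D * (A * h + 2 * \<theta>)) * (D / \<epsilon>\<^sup>2)"
      using eps by (simp add: l_def power_divide power_mult_distrib power2_eq_square)
    also have "\<dots> \<le> \<epsilon>\<^sup>2 * (D / \<epsilon>\<^sup>2)" using fourth D eps by (intro mult_right_mono) auto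
    finally show ?thesis using eps by simp
  qed
  have m1: "measure ?M (\<Union>k\<in>{..<m} \<times> {..<n}. ?B1 (fst k) (snd k)) \<le> 2 * exp (- D)"
  proof -
    have "measure ?M (\<Union>k\<in>{..<m} \<times> {..<n}. ?B1 (fst k) (snd k)) \<le> (\<Sum>k\<in>{..<m} \<times> {..<n}. measure ?M (?B1 (fst k) (snd k)))"
      using s1 by (intro measure_UNION_le) auto
    also have "\<dots> \<le> (\<Sum>k\<in>{..<m} \<times> {..<n}. 2 * exp (- (K * D)))"
    proof (rule sum_mono)
      fix k assume "k \<in> {..<m} \<times> {..<n}"
      then have k: "fst k < m" "snd k < n" by auto
      have "- (12 * L\<^sup>2 * K * D) / (12 * L\<^sup>2) = - (K * D)" using L by simp
      then show "measure ?M (?B1 (fst k) (snd k)) \<le> 2 * exp (- (K * D))"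
        using square_tail[OF M mom[OF k(2)] L k(1), of "12 * L\<^sup>2 * K * D"] by simp
    qed
    also have "\<dots> = 2 * (real m * (real n * exp (- (K * D))))" by simp
    also have "\<dots> \<le> 2 * (exp D * (exp ((K - 2) * D) * exp (- (K * D))))"
      using nm by (intro mult_left_mono mult_mono) auto
    also have "\<dots> = 2 * exp (- D)" by (simp add: algebra_simps flip: exp_add)
    finally show ?thesis .
  qed
  have m2: "measure ?M (\<Union>j<n. ?B2 j) \<le> exp (- D)"
  proof -
    have "measure ?M (\<Union>j<n. ?B2 j) \<le> (\<Sum>j<n. measure ?M (?B2 j))"
      using s2 by (intro measure_UNION_le) auto
    also have "\<dots> \<le> (\<Sum>j<n. exp (- ((K - 1) * D)))"
    proof (rule sum_mono)
      fix j assume "j \<in> {..<n}"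
      then have j: "j < n" by simp
      show "measure ?M (?B2 j) \<le> exp (- ((K - 1) * D))"
      proof (rule weighted_square_upper_tail[OF M mom[OF j], where l = l])
        fix i assume i: "i < m"
        have "6 * L\<^sup>2 * (l * (a i)\<^sup>2) \<le> 6 * L\<^sup>2 * (l * A)"
          using a_max[OF i] l by (intro mult_left_mono) auto
        also have "\<dots> = 12 * L\<^sup>2 * K * D * A / (2 * \<epsilon>)" by (simp add: l_def)
        also have "\<dots> \<le> \<epsilon> / (2 * \<epsilon>)"
        proof -
          have "12 * L\<^sup>2 * K * D * A \<le> \<epsilon>" using \<beta>(2,3) zero_le_power2[of \<beta>] by linarith
          then show ?thesis using eps by (intro divide_right_mono) auto
        qed
        also have "\<dots> = 1/2" using eps by simp
        finally show "6 * L\<^sup>2 * (l * (a i)\<^sup>2) \<le> 1/2" .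
      next
        show "(K - 1) * D \<le> l * \<epsilon> - 72 * L^4 * l\<^sup>2 * (\<Sum>i<m. ((a i)\<^sup>2)\<^sup>2)"
          using l4[OF fourth_moment] l by (simp add: algebra_simps)
      qed (use l in auto)
    qed
    finally show ?thesis using KD by simp
  qed
  have m3: "measure ?M (\<Union>j<n. ?B3 j) \<le> exp (- D)"
  proof -
    have "measure ?M (\<Union>j<n. ?B3 j) \<le> (\<Sum>j<n. measure ?M (?B3 j))"
      using s3 by (intro measure_UNION_le) auto
    also have "\<dots> \<le> (\<Sum>j<n. exp (- ((K - 1) * D)))"
    proof (rule sum_mono)
      fix j assume "j \<in> {..<n}"
      then have j: "j < n" by simp
      show "measure ?M (?B3 j) \<le> exp (- ((K - 1) * D))"
      proof (rule weighted_truncated_square_lower_tail[OF M mom[OF j], where l = l])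
        have "(\<Sum>i<m. (?w i)\<^sup>2) \<le> (\<Sum>i<m. ((a i)\<^sup>2)\<^sup>2)" by (intro sum_mono) auto
        also have "\<dots> \<le> A * h + 2 * \<theta>" by (rule fourth_moment)
        finally have "72 * L^4 * l\<^sup>2 * (\<Sum>i<m. (?w i)\<^sup>2) \<le> D" by (rule l4)
        moreover have "8 * L^4 * l\<^sup>2 * (\<Sum>i<m. (?w i)\<^sup>2) \<le> 72 * L^4 * l\<^sup>2 * (\<Sum>i<m. (?w i)\<^sup>2)"
          using L4 by (intro mult_right_mono sum_nonneg) auto
        ultimately have "8 * L^4 * l\<^sup>2 * (\<Sum>i<m. (?w i)\<^sup>2) \<le> D" by linarith
        then show "(K - 1) * D \<le> l * \<epsilon> - 8 * L^4 * l\<^sup>2 * (\<Sum>i<m. (?w i)\<^sup>2)"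
          using l(2) KD1 by linarith
      qed (use l trunc_pos in auto)
    qed
    finally show ?thesis using KD by simp
  qed
  have "measure ?M ?U \<le> measure ?M (\<Union>k\<in>{..<m} \<times> {..<n}. ?B1 (fst k) (snd k)) + (measure ?M (\<Union>j<n. ?B2 j) + measure ?M (\<Union>j<n. ?B3 j))"
    using measure_Un_le[OF U(1) sets.Un[OF U(2,3)]] measure_Un_le[OF U(2,3)] by linarith
  then show "measure ?M {z \<in> space ?M. \<not> good z} \<le> 4 * exp (- D)"
    unfolding bad using m1 m2 m3 by linarith
qed

lemma good_flip:
  assumes s: "\<And>k. s k = 1 \<or> s k = (-1::real)" and g: "good (flip m n s z)"
  shows "good z"
proof -
  have "(flip m n s z i j)\<^sup>2 = (z i j)\<^sup>2" if "i < m" "j < n" for i j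
    using s[of "(i, j)"] that by (auto simp: flip_def power_mult_distrib)
  then show ?thesis using g unfolding good_def by simp
qed

lemma norm_tail:
  assumes N: "is_norm n N" and C: "convex_body n (unit_ball_of n N)"
    and E: "gaussian_mean n N = dual_radius n N * sqrt D" and R: "0 < dual_radius n N"
    and rv: "random_vector n \<nu>" and iso: "isotropic n \<nu>" and sym: "symmetric_vector n \<nu>" 
    and sub: "subgaussian n L \<nu>" and iid: "iid_coordinates n \<nu>"
    and meas: "(\<lambda>z. norm_fun n N (\<lambda>j. \<Sum>i<m. a i * z i j)) \<in> borel_measurable (iid_copies m \<nu>)"
  shows "measure (iid_copies m \<nu>) {z \<in> space (iid_copies m \<nu>). 
      \<bar>norm_fun n N (\<lambda>j. \<Sum>i<m. a i * z i j) - gaussian_mean n N\<bar> > 8 * \<epsilon> * gaussian_mean n N} 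
    \<le> 4 * exp (- D) + 2 * exp (- \<epsilon>\<^sup>2 * D / 32)"
proof -
  let ?M = "iid_copies m \<nu>" and ?E = "gaussian_mean n N"
  let ?A = "{z \<in> space ?M. \<bar>norm_fun n N (\<lambda>j. \<Sum>i<m. a i * z i j) - ?E\<bar> > 8 * \<epsilon> * ?E}"
  let ?G = "{z \<in> space ?M. good z}"
  have M: "prob_space \<nu>" using rv by (simp add: random_vector_def)
  note gp = good_probability[OF M subgaussian_coordinate_moments[OF rv iso sub _ L]]
  have "measure ?M ?A \<le> measure ?M (space ?M - ?G) + 2 * exp (- \<epsilon>\<^sup>2 * D / 32)"
  proof (rule symmetrized_tail[OF rv sym iid nm(1), where ks = "index_list m n"])
    show "?A \<in> sets ?M" using meas by measurable
    show "?G \<in> sets ?M" using gp(1) by simp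
    show "z \<in> ?G" if "\<And>k. s k = 1 \<or> s k = (-1::real)" "flip m n s z \<in> ?G" "z \<in> space ?M" for s z
      using good_flip[of s z] that by auto
    fix z assume "z \<in> ?G"
    then have z: "good z" by simp
    have "norm_fun n N (\<lambda>j. \<Sum>i<m. a i * flip m n s z i j) = sign_norm m n N (\<lambda>(i, j). a i * z i j) s" for s
      unfolding sign_norm_def by (rule norm_fun_cong) (auto simp: flip_def intro!: sum.cong)
    then have "ravg (index_list m n) (\<lambda>s. of_bool (flip m n s z \<in> ?A)) (\<lambda>_. 1) 
      \<le> ravg (index_list m n) (\<lambda>s. of_bool (\<bar>sign_norm m n N (\<lambda>(i, j). a i * z i j) s - ?E\<bar> > 8 * \<epsilon> * ?E)) (\<lambda>_. 1)"
      by (intro ravg_mono) auto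
    also have "\<dots> \<le> 2 * exp (- \<epsilon>\<^sup>2 * D / 32)" by (rule good_conditional_tail[OF N C E R z])
    finally show "ravg (index_list m n) (\<lambda>s. of_bool (flip m n s z \<in> ?A)) (\<lambda>_. 1) \<le> 2 * exp (- \<epsilon>\<^sup>2 * D / 32)" .
  qed simp
  moreover have "space ?M - ?G = {z \<in> space ?M. \<not> good z}" by auto
  ultimately show ?thesis using gp(2) by simp
qed

end

subsection \<open>Coefficients on the event\<close>

lemma sphere_coordinate_le:
  assumes "u \<in> unit_sphere d" "k < d"
  shows "\<bar>u k\<bar> \<le> 1"
  using member_le_L2_set[of "{..<d}" k "\<lambda>k. \<bar>u k\<bar>"] assms by (simp add: L2_set_def unit_sphere_def)

lemma vinner_sphere_le:
  assumes "u \<in> unit_sphere d"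
  shows "\<bar>vinner d x u\<bar> \<le> (\<Sum>k<d. \<bar>x k\<bar>)"
proof -
  have "\<bar>vinner d x u\<bar> \<le> (\<Sum>k<d. \<bar>x k * u k\<bar>)" unfolding vinner_def by (rule sum_abs)
  also have "\<dots> \<le> (\<Sum>k<d. \<bar>x k\<bar>)"
    using sphere_coordinate_le[OF assms] by (intro sum_mono) (auto simp: abs_mult mult_left_le)
  finally show ?thesis .
qed

lemma vinner_square_le:
  assumes "u \<in> unit_sphere d"
  shows "(vinner d x u)\<^sup>2 \<le> (\<Sum>k<d. \<bar>x k\<bar>)\<^sup>2"
  using power_mono[OF vinner_sphere_le[OF assms, of x], of 2] by simp

text \<open>The suprema are conditional, so boundedness over the sphere has to be checked; absolute
  sums of the entries of the \<open>x i\<close> provide it.\<close>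

lemma H_sup_upper:
  assumes u: "u \<in> unit_sphere d" and J: "J \<subseteq> {..<m}" "card J \<le> s"
  shows "sqrt (1 / real m * (\<Sum>i\<in>J. (vinner d (x i) u)\<^sup>2)) \<le> H_sup d s m x"
proof -
  let ?F = "\<lambda>u J. sqrt (1 / real m * (\<Sum>i\<in>J. (vinner d (x i) u)\<^sup>2))"
  let ?C = "{I. I \<subseteq> {..<m} \<and> card I \<le> s}"
  let ?B = "sqrt (1 / real m * (\<Sum>i<m. (\<Sum>k<d. \<bar>x i k\<bar>)\<^sup>2))"
  have fin: "finite ?C" by (rule finite_subset[of _ "Pow {..<m}"]) auto
  have le: "?F u J \<le> ?B" if "u \<in> unit_sphere d" "J \<in> ?C" for u J
  proof (intro real_sqrt_le_mono mult_left_mono)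
    have "(\<Sum>i\<in>J. (vinner d (x i) u)\<^sup>2) \<le> (\<Sum>i<m. (vinner d (x i) u)\<^sup>2)"
      using that by (intro sum_mono2) auto
    also have "\<dots> \<le> (\<Sum>i<m. (\<Sum>k<d. \<bar>x i k\<bar>)\<^sup>2)" by (intro sum_mono vinner_square_le that)
    finally show "(\<Sum>i\<in>J. (vinner d (x i) u)\<^sup>2) \<le> (\<Sum>i<m. (\<Sum>k<d. \<bar>x i k\<bar>)\<^sup>2)" .
  qed simp
  have "?F u J \<le> (SUP J\<in>?C. ?F u J)"
    using J fin by (intro cSUP_upper) (auto intro: bdd_above_finite)
  also have "\<dots> \<le> (SUP u\<in>unit_sphere d. SUP J\<in>?C. ?F u J)"
  proof (rule cSUP_upper[OF u])
    show "bdd_above ((\<lambda>u. SUP J\<in>?C. ?F u J) ` unit_sphere d)"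
    proof (rule bdd_aboveI2)
      fix u assume "u \<in> unit_sphere d"
      then show "(SUP J\<in>?C. ?F u J) \<le> ?B" using le by (intro cSUP_least) (auto intro: exI[of _ "{}"])
    qed
  qed
  finally show ?thesis by (simp add: H_sup_def)
qed

lemma rho_upper:
  assumes u: "u \<in> unit_sphere d"
  shows "\<bar>1 / real m * (\<Sum>i<m. (vinner d (x i) u)\<^sup>2) - 1\<bar> \<le> rho d m x"
  unfolding rho_def
proof (rule cSUP_upper[OF u])
  show "bdd_above ((\<lambda>u. \<bar>1 / real m * (\<Sum>i<m. (vinner d (x i) u)\<^sup>2) - 1\<bar>) ` unit_sphere d)"
  proof (rule bdd_aboveI2)
    fix u assume u: "u \<in> unit_sphere d"
    have 1: "1 / real m * (\<Sum>i<m. (vinner d (x i) u)\<^sup>2) \<le> 1 / real m * (\<Sum>i<m. (\<Sum>k<d. \<bar>x i k\<bar>)\<^sup>2)"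
      using vinner_square_le[OF u] by (intro mult_left_mono sum_mono) auto
    have 2: "0 \<le> 1 / real m * (\<Sum>i<m. (vinner d (x i) u)\<^sup>2)" by (intro mult_nonneg_nonneg sum_nonneg) auto
    show "\<bar>1 / real m * (\<Sum>i<m. (vinner d (x i) u)\<^sup>2) - 1\<bar> \<le> 1 / real m * (\<Sum>i<m. (\<Sum>k<d. \<bar>x i k\<bar>)\<^sup>2) + 1"
      using 1 2 by linarith
  qed
qed

lemma fourth_root: "0 < t \<Longrightarrow> (t ^ 4) powr (1 / 4) = (t::real)"
  by (simp add: powr_powr flip: powr_numeral)

text \<open>The eighth root \<open>y\<close> of \<open>D\<close> turns all exponents that occur into
  natural numbers, and one factor \<open>y\<close> is sacrificed for each logarithm.\<close>

lemma event_scales: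
  fixes y \<epsilon> \<alpha> D :: real and d m :: nat
  assumes y: "1 \<le> y" "D = y ^ 8" and eps: "0 < \<epsilon>" "\<epsilon> \<le> 1" and d: "1 \<le> d" "real d \<le> \<epsilon>\<^sup>2 * D"
    and \<alpha>: "4 \<le> \<alpha>" and m: "D powr \<alpha> \<le> real m" "real m \<le> D powr \<alpha> + 1"
  shows "(real d / real m) powr (1 / \<alpha>) \<le> sqrt \<epsilon> / y ^ 6" "ln (real m) \<le> (8 * \<alpha> + 1) * y" "y ^ 32 \<le> real m"
    "(real d / real m) powr (1 / \<alpha>) * ln (real m / real d) \<le> (8 * \<alpha> + 1) * sqrt \<epsilon> / y ^ 5"
proof -
  have D1: "1 \<le> D" using y by (simp add: one_le_power)
  have yp: "0 < y" using y by simp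
  have "y ^ 32 = D powr 4" using D1 y by (simp add: powr_numeral flip: power_mult)
  also have "\<dots> \<le> D powr \<alpha>" using \<alpha> D1 by (intro powr_mono) auto
  finally have DA: "y ^ 32 \<le> D powr \<alpha>" .
  then show m32: "y ^ 32 \<le> real m" using m by linarith
  have mp: "1 \<le> real m" using m32 one_le_power[OF y(1), of 32] by linarith
  have Da1: "1 \<le> D powr \<alpha>" using DA one_le_power[OF y(1), of 32] by linarith
  show a: "(real d / real m) powr (1 / \<alpha>) \<le> sqrt \<epsilon> / y ^ 6"
  proof -
    have "(real d / real m) powr (1 / \<alpha>) \<le> (real d / D powr \<alpha>) powr (1 / \<alpha>)"
      using m mp \<alpha> d Da1 by (intro powr_mono2 divide_left_mono mult_pos_pos) auto
    also have "\<dots> = real d powr (1 / \<alpha>) / D"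
      using \<alpha> d D1 by (simp add: powr_divide powr_powr)
    \<comment> \<open>As \<open>d \<ge> 1\<close> and \<open>\<alpha> \<ge> 4\<close>, the exponent
      may be raised to 1/4, after which \<alpha> disappears.\<close>
    also have "\<dots> \<le> real d powr (1 / 4) / D"
      using \<alpha> d D1 by (intro divide_right_mono powr_mono) (auto simp: field_simps)
    also have "\<dots> \<le> (sqrt \<epsilon> * y\<^sup>2) / D"
    proof (rule divide_right_mono)
      have "real d powr (1 / 4) \<le> (\<epsilon>\<^sup>2 * D) powr (1 / 4)" using d by (intro powr_mono2) auto
      also have "\<epsilon>\<^sup>2 * D = (sqrt \<epsilon> * y\<^sup>2) ^ 4"
      proof -
        have "sqrt \<epsilon> ^ 4 = (sqrt \<epsilon> ^ 2) ^ 2" by (simp flip: power_mult)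
        then show ?thesis using eps y(2) by (simp add: power_mult_distrib flip: power_mult)
      qed
      also have "\<dots> powr (1 / 4) = sqrt \<epsilon> * y\<^sup>2" using eps yp by (intro fourth_root) simp
      finally show "real d powr (1 / 4) \<le> sqrt \<epsilon> * y\<^sup>2" .
    qed (use D1 in auto)
    also have "\<dots> = sqrt \<epsilon> / y ^ 6" using yp by (simp add: y(2) field_simps flip: power_add)
    finally show ?thesis .
  qed
  show b: "ln (real m) \<le> (8 * \<alpha> + 1) * y"
  proof -
    have "ln (real m) \<le> ln (2 * D powr \<alpha>)" using m mp Da1 by (subst ln_le_cancel_iff) auto
    also have "\<dots> = ln 2 + \<alpha> * (8 * ln y)" using D1 yp by (simp add: ln_mult ln_powr y(2) ln_realpow)
    also have "\<dots> \<le> 1 * y + \<alpha> * (8 * y)"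
      using y(1) \<alpha> ln_le_minus_one[OF yp] ln_2_less_1 by (intro add_mono mult_left_mono) auto
    finally show ?thesis by (simp add: algebra_simps)
  qed
  have "(real d / real m) powr (1 / \<alpha>) * ln (real m / real d) \<le> (real d / real m) powr (1 / \<alpha>) * ((8 * \<alpha> + 1) * y)"
  proof (rule mult_left_mono)
    have "ln (real m / real d) \<le> ln (real m)" using d mp by (subst ln_le_cancel_iff) (auto simp: divide_le_eq mult_le_cancel_left1)
    then show "ln (real m / real d) \<le> (8 * \<alpha> + 1) * y" using b by linarith
  qed simp
  also have "\<dots> \<le> sqrt \<epsilon> / y ^ 6 * ((8 * \<alpha> + 1) * y)" using a \<alpha> yp by (intro mult_right_mono) auto
  also have "\<dots> = (8 * \<alpha> + 1) * sqrt \<epsilon> / y ^ 5" using yp by (simp add: field_simps eval_nat_numeral)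
  finally show "(real d / real m) powr (1 / \<alpha>) * ln (real m / real d) \<le> (8 * \<alpha> + 1) * sqrt \<epsilon> / y ^ 5" .
qed

text \<open>The bound on \<rho> gives near-isotropy, the bound on \<open>H\<close> with
  \<open>s = 1\<close> the largest coefficient, and with \<open>s\<close> about \<open>y^16\<close>
  the mass of the large ones. In \<open>C\<close> the \<open>8 * \<alpha> + 1\<close> stems from the
  logarithm, the additional 2 from the term in \<open>s\<close>, and the final \<open>+ 1\<close>
  makes an inequality strict.\<close>

lemma event_coefficients:
  fixes y \<epsilon> \<alpha> D \<kappa>\<^sub>3 B :: real and d m :: nat and x :: "nat \<Rightarrow> nat \<Rightarrow> real"
  assumes y: "2 \<le> y" "D = y ^ 8" and eps: "0 < \<epsilon>" "\<epsilon> \<le> 1" "1 \<le> \<epsilon>\<^sup>2 * D" and d: "1 \<le> d" "real d \<le> \<epsilon>\<^sup>2 * D"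
    and \<alpha>: "4 \<le> \<alpha>" and m: "D powr \<alpha> \<le> real m" "real m \<le> D powr \<alpha> + 1"
    and \<kappa>: "0 < \<kappa>\<^sub>3" and B: "0 \<le> B" "B \<le> y"
    and H: "H_bound \<kappa>\<^sub>3 \<alpha> d m x" and r: "rho_bound B \<alpha> d m x" and u: "u \<in> unit_sphere d"
  defines "C \<equiv> (\<kappa>\<^sub>3 * (8 * \<alpha> + 3))\<^sup>2 + 1" and "a \<equiv> \<lambda>i. 1 / sqrt (real m) * vinner d (x i) u"
  shows "\<bar>(\<Sum>i<m. (a i)\<^sup>2) - 1\<bar> \<le> \<epsilon>" "\<And>i. i < m \<Longrightarrow> (a i)\<^sup>2 \<le> C * \<epsilon> / y ^ 10"
    "(\<Sum>i | i < m \<and> C / y ^ 24 < (a i)\<^sup>2. (a i)\<^sup>2) \<le> C / y ^ 8"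
proof -
  have y1: "1 \<le> y" and yp: "0 < y" using y by auto
  note sc = event_scales[OF y1 y(2) eps(1,2) d \<alpha> m]
  have mp: "0 < real m" using sc(3) zero_less_power[OF yp, of 32] by linarith
  have sq: "(\<Sum>i\<in>J. (a i)\<^sup>2) = 1 / real m * (\<Sum>i\<in>J. (vinner d (x i) u)\<^sup>2)" for J
    using mp by (simp add: a_def power_divide power_mult_distrib sum_distrib_left)
  \<comment> \<open>A restatement of \<open>\<epsilon>^2 * D \<ge> 1\<close>, used to trade powers
    of \<epsilon> for powers of \<open>y\<close>.\<close>
  have e4: "1 / y ^ 4 \<le> \<epsilon>"
  proof -
    have "(1 / y ^ 4)\<^sup>2 \<le> \<epsilon>\<^sup>2" using eps(3) yp by (simp add: y(2) power_divide field_simps flip: power_mult)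
    then show ?thesis using eps(1) by (rule power2_le_imp_le[OF _ less_imp_le])
  qed
  have se: "1 / y\<^sup>2 \<le> sqrt \<epsilon>"
  proof (rule real_le_rsqrt)
    show "(1 / y\<^sup>2)\<^sup>2 \<le> \<epsilon>" using e4 by (simp add: power_divide flip: power_mult)
  qed
  have H': "H_sup d s m x \<le> \<kappa>\<^sub>3 * ((real s / real m) powr (1 / 4) + (8 * \<alpha> + 1) * sqrt \<epsilon> / y ^ 5)"
    if s: "1 \<le> s" "s \<le> m" for s
  proof -
    have "H_sup d s m x \<le> \<kappa>\<^sub>3 * ((real s / real m) powr (1 / 4) + (real d / real m) powr (1 / \<alpha>) * ln (real m / real d))"
      using H s by (auto simp: H_bound_def)
    also have "\<dots> \<le> \<kappa>\<^sub>3 * ((real s / real m) powr (1 / 4) + (8 * \<alpha> + 1) * sqrt \<epsilon> / y ^ 5)"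
      using sc(4) \<kappa> by (intro mult_left_mono add_left_mono) auto
    finally show ?thesis .
  qed
  have m1: "1 \<le> m" using mp by simp
  have C1: "(\<kappa>\<^sub>3 * (8 * \<alpha> + 3))\<^sup>2 \<le> C" by (simp add: C_def)
  have Cp: "0 < C" by (simp add: C_def add_nonneg_pos)
  show "(a i)\<^sup>2 \<le> C * \<epsilon> / y ^ 10" if i: "i < m" for i
  proof -
    have "(1 / real m) powr (1 / 4) \<le> (1 / y ^ 32) powr (1 / 4)"
      using sc(3) yp mp by (intro powr_mono2 divide_left_mono) auto
    also have "1 / y ^ 32 = (1 / y ^ 8) ^ 4" by (simp add: power_divide flip: power_mult)
    also have "\<dots> powr (1 / 4) = 1 / y ^ 8" using yp by (intro fourth_root) simp
    also have "1 / y ^ 8 = 1 / y\<^sup>2 * (1 / y ^ 6)" by (simp flip: power_add)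
    also have "\<dots> \<le> sqrt \<epsilon> * (1 / y ^ 5)"
      using se eps(1) yp y1 power_increasing[of 5 6 y] by (intro mult_mono divide_left_mono) auto
    finally have p: "(1 / real m) powr (1 / 4) \<le> sqrt \<epsilon> / y ^ 5" by simp
    have "\<bar>a i\<bar> = sqrt (\<Sum>i\<in>{i}. (a i)\<^sup>2)" by simp
    also have "\<dots> \<le> H_sup d 1 m x" unfolding sq using i by (intro H_sup_upper[OF u]) auto
    also have "\<dots> \<le> \<kappa>\<^sub>3 * ((1 / real m) powr (1 / 4) + (8 * \<alpha> + 1) * sqrt \<epsilon> / y ^ 5)"
      using H'[of 1] m1 by simp
    also have "\<dots> \<le> \<kappa>\<^sub>3 * (sqrt \<epsilon> / y ^ 5 + (8 * \<alpha> + 1) * sqrt \<epsilon> / y ^ 5)"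
      using p \<kappa> by (intro mult_left_mono add_right_mono) auto
    also have "\<dots> = \<kappa>\<^sub>3 * (8 * \<alpha> + 2) * (sqrt \<epsilon> / y ^ 5)" using yp by (simp add: field_simps)
    also have "\<dots> \<le> \<kappa>\<^sub>3 * (8 * \<alpha> + 3) * (sqrt \<epsilon> / y ^ 5)"
      using \<kappa> eps yp by (intro mult_right_mono mult_left_mono) auto
    finally have "\<bar>a i\<bar>\<^sup>2 \<le> (\<kappa>\<^sub>3 * (8 * \<alpha> + 3) * (sqrt \<epsilon> / y ^ 5))\<^sup>2" by (intro power_mono) auto
    also have "\<dots> = (\<kappa>\<^sub>3 * (8 * \<alpha> + 3))\<^sup>2 * (\<epsilon> / y ^ 10)"
      using eps by (simp add: power_mult_distrib power_divide flip: power_mult)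
    also have "\<dots> \<le> C * (\<epsilon> / y ^ 10)" using C1 eps yp by (intro mult_right_mono) auto
    finally show ?thesis by simp
  qed
  show "\<bar>(\<Sum>i<m. (a i)\<^sup>2) - 1\<bar> \<le> \<epsilon>"
  proof -
    have "\<bar>(\<Sum>i<m. (a i)\<^sup>2) - 1\<bar> \<le> B * (real d / real m) powr (2 / \<alpha>)"
      using rho_upper[OF u, of m x] r by (simp add: sq rho_bound_def)
    also have "(real d / real m) powr (2 / \<alpha>) = ((real d / real m) powr (1 / \<alpha>))\<^sup>2"
      using d mp by (simp add: powr_powr flip: powr_numeral)
    also have "B * \<dots> \<le> y * (sqrt \<epsilon> / y ^ 6)\<^sup>2"
      using sc(1) B by (intro mult_mono power_mono) auto
    also have "\<dots> = \<epsilon> / y ^ 11" using eps yp by (simp add: power_divide field_simps eval_nat_numeral)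
    also have "\<dots> \<le> \<epsilon> / 1" using eps(1) yp one_le_power[OF y1, of 11] by (intro divide_left_mono) auto
    also have "\<dots> = \<epsilon>" by simp
    finally show ?thesis .
  qed
  let ?I = "{i. i < m \<and> C / y ^ 24 < (a i)\<^sup>2}"
  \<comment> \<open>About \<open>D^2\<close>: then \<open>(s / m) powr (1/4)\<close> is at most
    \<open>2 / y^4\<close>, which matches the other term of the \<open>H\<close> bound.\<close>
  define s where "s = nat \<lceil>y ^ 16\<rceil>"
  have y16: "1 \<le> y ^ 16" using y1 by (rule one_le_power)
  have s: "y ^ 16 \<le> real s" "real s \<le> y ^ 16 + 1" using y16 unfolding s_def by linarith+
  have s1: "1 \<le> s" using s y16 by linarith
  have "real s \<le> 2 * y ^ 16" using s y16 by linarith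
  also have "\<dots> \<le> y ^ 16 * y ^ 16"
  proof -
    have "2 \<le> y ^ 16" using y(1) power_increasing[of 1 16 y] by simp
    then show ?thesis using yp by (intro mult_right_mono) auto
  qed
  also have "\<dots> = y ^ 32" by (simp flip: power_add)
  finally have sm: "s \<le> m" using sc(3) by linarith
  have mass: "(\<Sum>i\<in>J. (a i)\<^sup>2) \<le> (C - 1) / y ^ 8" if J: "J \<subseteq> {..<m}" "card J \<le> s" for J
  proof -
    have "(real s / real m) powr (1 / 4) \<le> (16 * y ^ 16 / y ^ 32) powr (1 / 4)"
      using sc(3) yp mp s y16 by (intro powr_mono2 frac_le) auto
    also have "16 * y ^ 16 / y ^ 32 = (2 / y ^ 4) ^ 4" using yp by (simp add: power_divide field_simps flip: power_mult power_add)
    also have "\<dots> powr (1 / 4) = 2 / y ^ 4" using yp by (intro fourth_root) simp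
    finally have p: "(real s / real m) powr (1 / 4) \<le> 2 / y ^ 4" .
    have q: "(8 * \<alpha> + 1) * sqrt \<epsilon> / y ^ 5 \<le> (8 * \<alpha> + 1) * 1 / y ^ 4"
      using eps \<alpha> yp y1 power_increasing[of 4 5 y] by (intro frac_le mult_left_mono) auto
    have "sqrt (\<Sum>i\<in>J. (a i)\<^sup>2) \<le> H_sup d s m x" unfolding sq by (rule H_sup_upper[OF u J])
    also have "\<dots> \<le> \<kappa>\<^sub>3 * ((real s / real m) powr (1 / 4) + (8 * \<alpha> + 1) * sqrt \<epsilon> / y ^ 5)" by (rule H'[OF s1 sm])
    also have "\<dots> \<le> \<kappa>\<^sub>3 * (2 / y ^ 4 + (8 * \<alpha> + 1) * 1 / y ^ 4)"
      using p q \<kappa> by (intro mult_left_mono add_mono) auto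
    also have "\<dots> = \<kappa>\<^sub>3 * (8 * \<alpha> + 3) / y ^ 4" using yp by (simp add: field_simps)
    finally have "(sqrt (\<Sum>i\<in>J. (a i)\<^sup>2))\<^sup>2 \<le> (\<kappa>\<^sub>3 * (8 * \<alpha> + 3) / y ^ 4)\<^sup>2"
      by (intro power_mono) (auto intro!: sum_nonneg)
    then show ?thesis by (simp add: C_def sum_nonneg power_divide flip: power_mult)
  qed
  \<comment> \<open>Otherwise \<open>s\<close> indices above the threshold \<open>C / y^24\<close>
    would carry mass at least \<open>C / y^8\<close>, while sets of at most \<open>s\<close> indices
    carry at most \<open>(C - 1) / y^8\<close>.\<close>
  have "card ?I \<le> s"
  proof (rule ccontr)
    assume "\<not> card ?I \<le> s"
    then have "s \<le> card ?I" by simp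
    then obtain J where J: "J \<subseteq> ?I" "card J = s" "finite J" by (rule obtain_subset_with_card_n)
    have "C / y ^ 8 = y ^ 16 * (C / y ^ 24)" using yp by (simp add: field_simps flip: power_add)
    also have "\<dots> \<le> real s * (C / y ^ 24)" using s Cp yp by (intro mult_right_mono) auto
    also have "\<dots> = (\<Sum>i\<in>J. C / y ^ 24)" using J by simp
    also have "\<dots> \<le> (\<Sum>i\<in>J. (a i)\<^sup>2)" using J by (intro sum_mono) auto
    also have "\<dots> \<le> (C - 1) / y ^ 8" using J by (intro mass) auto
    finally show False using yp by (simp add: divide_le_cancel)
  qed
  then have "(\<Sum>i\<in>?I. (a i)\<^sup>2) \<le> (C - 1) / y ^ 8" by (intro mass) auto
  also have "\<dots> \<le> C / y ^ 8" using yp by (intro divide_right_mono) auto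
  finally show "(\<Sum>i\<in>?I. (a i)\<^sup>2) \<le> C / y ^ 8" .
qed

text \<open>With \<open>A\<close> of order \<open>\<epsilon> / y^10\<close>, \<open>h\<close> of
  order \<open>1 / y^8\<close> and \<theta> of order \<open>1 / y^24\<close>, every requirement of
  the locale reduces to one of the two in \<open>big\<close>: \<open>y\<close> exceeds a constant,
  or \<open>\<epsilon>^2 * D\<close> does.\<close>

lemma event_small_coefficients:
  fixes y \<epsilon> \<alpha> D \<kappa>\<^sub>3 B L K :: real and d m n :: nat and x :: "nat \<Rightarrow> nat \<Rightarrow> real"
  defines "C \<equiv> (\<kappa>\<^sub>3 * (8 * \<alpha> + 3))\<^sup>2 + 1"
  assumes L: "1 \<le> L" and K: "2 \<le> K" and y: "2 \<le> y" "D = y ^ 8" and eps: "0 < \<epsilon>" "\<epsilon> \<le> 1/9" 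
    and d: "1 \<le> d" "real d \<le> \<epsilon>\<^sup>2 * D"
    and \<alpha>: "4 \<le> \<alpha>" and m: "D powr \<alpha> \<le> real m" "real m \<le> D powr \<alpha> + 1" and n: "0 < n" "ln (real n) \<le> (K - 2) * D"
    and \<kappa>: "0 < \<kappa>\<^sub>3" and B: "0 \<le> B" 
    and big: "432 * L^4 * K\<^sup>2 * C\<^sup>2 + 144 * L\<^sup>2 * K * C + (8 * \<alpha> + 1) + B \<le> y" "43 * L^4 * C * (K + 2) \<le> \<epsilon>\<^sup>2 * D"
    and H: "H_bound \<kappa>\<^sub>3 \<alpha> d m x" and r: "rho_bound B \<alpha> d m x" and u: "u \<in> unit_sphere d"
  shows "\<exists>A h \<theta> \<beta> I. small_coefficients L K D \<epsilon> A h \<theta> \<beta> m n (\<lambda>i. 1 / sqrt (real m) * vinner d (x i) u) I"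
proof -
  let ?a = "\<lambda>i. 1 / sqrt (real m) * vinner d (x i) u"
  have y1: "1 \<le> y" and yp: "0 < y" using y by auto
  have yn: "0 < y ^ k" for k using yp by simp
  have L4: "1 \<le> L^4" "1 \<le> L\<^sup>2" using L by (simp_all add: one_le_power)
  have C1: "1 \<le> C" by (simp add: C_def)
  have K2: "1 \<le> K\<^sup>2" using K by (simp add: one_le_power)
  have CC: "C \<le> C\<^sup>2" "1 \<le> C\<^sup>2" using power_increasing[of 1 2 C] C1 by simp_all
  have KC: "1 \<le> L\<^sup>2 * K * C"
  proof -
    have "1 * 1 * 1 \<le> L\<^sup>2 * K * C" using L4 K C1 by (intro mult_mono) auto
    then show ?thesis by simp
  qed
  have LKC: "1 \<le> L^4 * K\<^sup>2"
  proof -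
    have "1 * 1 \<le> L^4 * K\<^sup>2" using L4 K2 by (intro mult_mono) auto
    then show ?thesis by simp
  qed
  have L4C: "L^4 * C \<le> L^4 * K\<^sup>2 * C\<^sup>2" "C \<le> L^4 * K\<^sup>2 * C\<^sup>2"
  proof -
    have "L^4 * 1 * C \<le> L^4 * K\<^sup>2 * C\<^sup>2" using L4 K2 CC C1 by (intro mult_mono) auto
    then show "L^4 * C \<le> L^4 * K\<^sup>2 * C\<^sup>2" by simp
    have "1 * C \<le> (L^4 * K\<^sup>2) * C\<^sup>2" using LKC CC C1 by (intro mult_mono) auto
    then show "C \<le> L^4 * K\<^sup>2 * C\<^sup>2" by simp
  qed
  have pos: "0 \<le> L^4 * K\<^sup>2 * C\<^sup>2" "0 \<le> L\<^sup>2 * K * C" using L4C(2) C1 KC by linarith+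
  have y_a: "432 * (L^4 * K\<^sup>2 * C\<^sup>2) \<le> y" and y_b: "144 * (L\<^sup>2 * K * C) \<le> y" and y_c: "8 * \<alpha> + 1 \<le> y" and y_d: "B \<le> y"
  proof -
    have "432 * (L^4 * K\<^sup>2 * C\<^sup>2) + 144 * (L\<^sup>2 * K * C) + (8 * \<alpha> + 1) + B \<le> y"
      using big(1) by (simp only: mult.assoc)
    then show "432 * (L^4 * K\<^sup>2 * C\<^sup>2) \<le> y" "144 * (L\<^sup>2 * K * C) \<le> y" "8 * \<alpha> + 1 \<le> y" "B \<le> y"
      using pos \<alpha> B by linarith+
  qed
  have eD: "43 \<le> \<epsilon>\<^sup>2 * D"
  proof -
    have "43 * (1 * 1 * 1) \<le> 43 * (L^4 * C * (K + 2))" using L4 C1 K by (intro mult_left_mono mult_mono) auto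
    then show ?thesis using big(2) by (simp add: mult.assoc)
  qed
  have e4: "1 / y ^ 4 \<le> \<epsilon>"
  proof -
    have "(1 / y ^ 4)\<^sup>2 \<le> \<epsilon>\<^sup>2" using eD yn[of 8] by (simp add: y(2) power_divide field_simps flip: power_mult)
    then show ?thesis using eps(1) by (rule power2_le_imp_le[OF _ less_imp_le])
  qed
  have e4': "1 \<le> \<epsilon> * y ^ 4" using e4 yn[of 4] by (simp add: field_simps)
  have ev: "\<epsilon> \<le> 1" "1 \<le> \<epsilon>\<^sup>2 * D" using eps eD by auto
  note co = event_coefficients[OF y eps(1) ev d \<alpha> m \<kappa> B y_d H r u, folded C_def]
  have mp: "0 < m" using event_scales(3)[OF y1 y(2) eps(1) ev(1) d \<alpha> m] yn[of 32] by (cases m) auto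
  \<comment> \<open>Equality in \<open>12 * L^2 * K * D * A \<le> \<beta>^2\<close>. Its order
    \<open>\<epsilon> / y^2\<close> leaves a spare factor of \<open>y\<close> for the logarithm of
    \<open>1 / \<beta>^2\<close>.\<close>
  define \<beta> where "\<beta> = sqrt (12 * L\<^sup>2 * K * C * \<epsilon> / y\<^sup>2)"
  have G: "0 < 12 * L\<^sup>2 * K * C * \<epsilon> / y\<^sup>2" using KC eps yp K L C1 by (intro divide_pos_pos mult_pos_pos) auto
  have \<beta>2: "\<beta>\<^sup>2 = 12 * L\<^sup>2 * K * C * \<epsilon> / y\<^sup>2" unfolding \<beta>_def using G by (intro real_sqrt_pow2) auto
  have \<beta>y: "24 * (L\<^sup>2 * K * C) * \<epsilon> / y\<^sup>2 = 2 * \<beta>\<^sup>2" unfolding \<beta>2 by simp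
  have "small_coefficients L K D \<epsilon> (C * \<epsilon> / y ^ 10) (C / y ^ 8) (C / y ^ 24) \<beta> m n ?a {i. i < m \<and> C / y ^ 24 < (?a i)\<^sup>2}"
  proof
    show "0 < D" "1 \<le> \<epsilon>\<^sup>2 * D" "0 < n" "0 < m" using ev yn[of 8] n mp by (auto simp: y(2))
    have "ln (real m) \<le> (8 * \<alpha> + 1) * y" by (rule event_scales(2)[OF y1 y(2) eps(1) ev(1) d \<alpha> m])
    also have "\<dots> \<le> y * y" using y_c yp by (intro mult_right_mono) auto
    also have "\<dots> \<le> D" using power_increasing[of 2 8 y] y1 by (simp add: y(2) power2_eq_square)
    finally have "exp (ln (real m)) \<le> exp D" by (simp only: exp_le_cancel_iff)
    then show "real m \<le> exp D" using mp by simp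
    have "exp (ln (real n)) \<le> exp ((K - 2) * D)" using n(2) by (simp only: exp_le_cancel_iff)
    then show "real n \<le> exp ((K - 2) * D)" using n(1) by simp
    show "0 < C / y ^ 24" using C1 yp by simp
    show "C / y ^ 8 \<le> \<epsilon>"
    proof -
      have "C \<le> y" using L4C(2) pos y_a by linarith
      then have "C \<le> y ^ 4 * 1" using power_increasing[of 1 4 y] y1 by simp
      also have "\<dots> \<le> y ^ 4 * (\<epsilon> * y ^ 4)" using e4' yp by (intro mult_left_mono) auto
      also have "\<dots> = \<epsilon> * y ^ 8" by (simp flip: power_add)
      finally show ?thesis using yn[of 8] by (simp add: divide_le_eq)
    qed
    show "0 < \<beta>" unfolding \<beta>_def using G by simp
    show "12 * L\<^sup>2 * K * D * (C * \<epsilon> / y ^ 10) \<le> \<beta>\<^sup>2"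
    proof -
      have "y ^ 8 / y ^ 10 = 1 / y\<^sup>2" using yp by (simp add: field_simps flip: power_add)
      then have "12 * L\<^sup>2 * K * C * \<epsilon> * (y ^ 8 / y ^ 10) = \<beta>\<^sup>2" unfolding \<beta>2 by simp
      then show ?thesis by (simp add: y(2) mult_ac)
    qed
    have yy: "24 * (L\<^sup>2 * K * C) \<le> y\<^sup>2"
    proof -
      have "24 * (L\<^sup>2 * K * C) \<le> y" using y_b pos by linarith
      also have "\<dots> \<le> y\<^sup>2" using power_increasing[of 1 2 y] y1 by simp
      finally show ?thesis .
    qed
    show "2 * \<beta>\<^sup>2 \<le> \<epsilon>"
      unfolding \<beta>y[symmetric] using mult_right_mono[OF yy, of \<epsilon>] eps yn[of 2] by (simp add: divide_le_eq mult.commute)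
    show "2 * \<beta>\<^sup>2 * ln (1 / (2 * \<beta>\<^sup>2)) \<le> \<epsilon>"
    proof -
      have b0: "0 < 2 * \<beta>\<^sup>2" unfolding \<beta>2 using G by simp
      have "1 / (2 * \<beta>\<^sup>2) \<le> y ^ 6"
      proof -
        have "1 * 1 \<le> (24 * (L\<^sup>2 * K * C)) * (\<epsilon> * y ^ 4)" using KC e4' by (intro mult_mono) auto
        also have "\<dots> = 24 * (L\<^sup>2 * K * C) * \<epsilon> / y\<^sup>2 * y ^ 6" using yp by (simp add: field_simps flip: power_add)
        finally have "1 \<le> (2 * \<beta>\<^sup>2) * y ^ 6" unfolding \<beta>y by simp
        then show ?thesis using b0 by (simp add: divide_le_eq mult.commute)
      qed
      then have "ln (1 / (2 * \<beta>\<^sup>2)) \<le> ln (y ^ 6)" using b0 yp by (subst ln_le_cancel_iff) auto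
      also have "\<dots> = 6 * ln y" using yp by (simp add: ln_realpow)
      also have "\<dots> \<le> 6 * y" using ln_le_minus_one[OF yp] by simp
      finally have "2 * \<beta>\<^sup>2 * ln (1 / (2 * \<beta>\<^sup>2)) \<le> 2 * \<beta>\<^sup>2 * (6 * y)" using b0 by (intro mult_left_mono) auto
      also have "\<dots> = 144 * (L\<^sup>2 * K * C) * \<epsilon> / y" unfolding \<beta>2 using yp by (simp add: field_simps power2_eq_square)
      also have "\<dots> \<le> y * \<epsilon> / y" using y_b eps yp by (intro divide_right_mono mult_right_mono) auto
      also have "\<dots> = \<epsilon>" using yp by simp
      finally show ?thesis .
    qed
    show "72 * L^4 * K\<^sup>2 * D * (C * \<epsilon> / y ^ 10 * (C / y ^ 8) + 2 * (C / y ^ 24)) \<le> \<epsilon>\<^sup>2"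
    proof -
      have pd: "y ^ i / y ^ (i + j) = 1 / y ^ j" for i j using yp by (simp add: power_add)
      have pd1: "y ^ 6 / y ^ 24 = 1 / y ^ 18" "y ^ 8 / y ^ 18 = 1 / y ^ 10" "y / y ^ 10 = 1 / y ^ 9"
        using pd[of 6 18] pd[of 8 10] pd[of 1 9] by simp_all
      have r1: "1 / y ^ 24 \<le> \<epsilon> / y ^ 18"
      proof -
        have "\<epsilon> * y ^ 4 \<le> \<epsilon> * y ^ 6" using power_increasing[of 4 6 y] y1 eps by (intro mult_left_mono) auto
        then have "1 \<le> \<epsilon> * y ^ 6" using e4' by linarith
        then have "1 / y ^ 24 \<le> \<epsilon> * y ^ 6 / y ^ 24" using yn[of 24] by (intro divide_right_mono) auto
        also have "\<dots> = \<epsilon> / y ^ 18" 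
        proof -
          have "\<epsilon> * y ^ 6 / y ^ 24 = \<epsilon> * (y ^ 6 / y ^ 24)" by (rule times_divide_eq_right[symmetric])
          then show ?thesis unfolding pd1(1) by simp
        qed
        finally show ?thesis .
      qed
      have r2: "C * \<epsilon> / y ^ 10 * (C / y ^ 8) = C\<^sup>2 * (\<epsilon> / y ^ 18)"
        by (simp add: power2_eq_square)
      have three: "p + 2 * q \<le> 3 * p" if "q \<le> p" for p q :: real using that by simp
      have "C * (1 / y ^ 24) \<le> C\<^sup>2 * (\<epsilon> / y ^ 18)" using CC C1 r1 yn[of 24] by (intro mult_mono) auto
      then have "C / y ^ 24 \<le> C\<^sup>2 * (\<epsilon> / y ^ 18)" by simp
      then have r3: "C * \<epsilon> / y ^ 10 * (C / y ^ 8) + 2 * (C / y ^ 24) \<le> 3 * (C\<^sup>2 * (\<epsilon> / y ^ 18))"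
        unfolding r2 by (rule three)
      have "0 \<le> 72 * L^4 * K\<^sup>2 * D" using L4 K2 yn[of 8] unfolding y(2) by simp
      with r3 have r4: "72 * L^4 * K\<^sup>2 * D * (C * \<epsilon> / y ^ 10 * (C / y ^ 8) + 2 * (C / y ^ 24)) 
        \<le> 72 * L^4 * K\<^sup>2 * D * (3 * (C\<^sup>2 * (\<epsilon> / y ^ 18)))" by (rule mult_left_mono)
      have r5: "72 * L^4 * K\<^sup>2 * D * (3 * (C\<^sup>2 * (\<epsilon> / y ^ 18))) = 216 * (L^4 * K\<^sup>2 * C\<^sup>2) * \<epsilon> / y ^ 10"
      proof -
        have "72 * L^4 * K\<^sup>2 * D * (3 * (C\<^sup>2 * (\<epsilon> / y ^ 18))) = 216 * (L^4 * K\<^sup>2 * C\<^sup>2) * \<epsilon> * (y ^ 8 / y ^ 18)"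
          unfolding y(2) by simp
        then show ?thesis unfolding pd1(2) by simp
      qed
      have "216 * (L^4 * K\<^sup>2 * C\<^sup>2) * \<epsilon> \<le> y * \<epsilon>"
      proof (rule mult_right_mono)
        show "216 * (L^4 * K\<^sup>2 * C\<^sup>2) \<le> y" using y_a pos by linarith
      qed (use eps in simp)
      then have r6: "216 * (L^4 * K\<^sup>2 * C\<^sup>2) * \<epsilon> / y ^ 10 \<le> y * \<epsilon> / y ^ 10" using yn[of 10] by (intro divide_right_mono) auto
      have r7: "y * \<epsilon> / y ^ 10 = \<epsilon> * (1 / y ^ 9)" 
      proof -
        have "y * \<epsilon> / y ^ 10 = \<epsilon> * (y / y ^ 10)" by simp
        then show ?thesis unfolding pd1(3) .
      qed
      have "1 / y ^ 9 \<le> 1 / y ^ 4" using y1 yp power_increasing[of 4 9 y] by (intro divide_left_mono) auto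
      then have r8: "\<epsilon> * (1 / y ^ 9) \<le> \<epsilon> * \<epsilon>" using e4 eps by (intro mult_left_mono) auto
      show ?thesis using r4 r6 r8 unfolding r5 r7 power2_eq_square[of \<epsilon>] by linarith
    qed
    show "16 * L^4 * (C / y ^ 24) \<le> \<epsilon> ^ 3"
    proof -
      have "16 * (L^4 * C) \<le> y" using L4C(1) y_a pos by linarith
      also have "\<dots> \<le> y ^ 12" using power_increasing[of 1 12 y] y1 by simp
      finally have "16 * (L^4 * C) / y ^ 24 \<le> y ^ 12 / y ^ 24" using yn[of 24] by (intro divide_right_mono) auto
      also have "\<dots> = (1 / y ^ 4) ^ 3"
      proof -
        have "y ^ i / y ^ (i + j) = 1 / y ^ j" for i j using yp by (simp add: power_add)
        from this[of 12 12] have 1: "y ^ 12 / y ^ 24 = 1 / y ^ 12" by simp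
        have "(y ^ 4) ^ 3 = y ^ 12" by (simp flip: power_mult)
        then show ?thesis using 1 by (simp add: power_divide)
      qed
      also have "\<dots> \<le> \<epsilon> ^ 3" using e4 yp by (intro power_mono) auto
      finally show ?thesis by simp
    qed
    \<comment> \<open>The right side is
      \<open>3 * (\<epsilon>^2 * D)^2 * D / (128 * L^4 * C)\<close>: one factor
      \<open>\<epsilon>^2 * D\<close> absorbs the constants, the other is at least 1, and
      \<open>D\<close> remains.\<close>
    show "K * D + 2 \<le> 3 * \<epsilon> ^ 4 / (128 * L^4 * (C / y ^ 24))"
    proof -
      define P where "P = L^4 * C"
      have P: "0 < P" unfolding P_def using L C1 by (intro mult_pos_pos zero_less_power) auto
      have D1: "1 \<le> D" using y1 by (simp add: y(2) one_le_power)
      have "K * D + 2 \<le> (K + 2) * D" using D1 by (simp add: algebra_simps)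
      also have "\<dots> \<le> 3 * (\<epsilon>\<^sup>2 * D) / (128 * P) * D"
      proof (rule mult_right_mono)
        have "43 * (P * (K + 2)) \<le> \<epsilon>\<^sup>2 * D" using big(2) by (simp add: P_def mult.assoc)
        moreover have "0 \<le> P * (K + 2)" using P K by simp
        ultimately have "128 * (P * (K + 2)) \<le> 3 * (\<epsilon>\<^sup>2 * D)" by linarith
        then have "(K + 2) * (128 * P) \<le> 3 * (\<epsilon>\<^sup>2 * D)" by (simp only: mult_ac)
        then show "K + 2 \<le> 3 * (\<epsilon>\<^sup>2 * D) / (128 * P)" using P by (simp add: pos_le_divide_eq)
      qed (use D1 in simp)
      also have "\<dots> \<le> 3 * ((\<epsilon>\<^sup>2 * D) * (\<epsilon>\<^sup>2 * D)) / (128 * P) * D"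
      proof (intro mult_right_mono divide_right_mono mult_left_mono)
        show "\<epsilon>\<^sup>2 * D \<le> \<epsilon>\<^sup>2 * D * (\<epsilon>\<^sup>2 * D)" using ev(2) by (simp add: mult_le_cancel_left1)
      qed (use P D1 in auto)
      also have "\<dots> = 3 * \<epsilon> ^ 4 / (128 * L^4 * (C / y ^ 24))"
      proof -
        have "(\<epsilon>\<^sup>2 * D) * (\<epsilon>\<^sup>2 * D) * D = \<epsilon> ^ 4 * y ^ 24"
        proof -
          have "(\<epsilon>\<^sup>2 * D) * (\<epsilon>\<^sup>2 * D) * D = (\<epsilon>\<^sup>2 * \<epsilon>\<^sup>2) * (D * D * D)" by (simp only: mult_ac)
          also have "\<epsilon>\<^sup>2 * \<epsilon>\<^sup>2 = \<epsilon> ^ 4" by (simp flip: power_add)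
          also have "D * D * D = y ^ 24" unfolding y(2) by (simp flip: power_add)
          finally show ?thesis .
        qed
        then have "3 * ((\<epsilon>\<^sup>2 * D) * (\<epsilon>\<^sup>2 * D)) / (128 * P) * D = 3 * (\<epsilon> ^ 4 * y ^ 24) / (128 * P)" by simp
        then show ?thesis by (simp add: P_def mult_ac)
      qed
      finally show ?thesis .
    qed
    show "(\<Sum>i\<in>{i. i < m \<and> C / y ^ 24 < (?a i)\<^sup>2}. (?a i)\<^sup>2) \<le> C / y ^ 8" by (rule co(3))
    show "(?a i)\<^sup>2 \<le> C * \<epsilon> / y ^ 10" if "i < m" for i by (rule co(2)[OF that])
    show "\<bar>(\<Sum>i<m. (?a i)\<^sup>2) - 1\<bar> \<le> \<epsilon>" by (rule co(1))
  qed (use L K eps in auto)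
  then show ?thesis by blast
qed

subsection \<open>Uniform embedding\<close>

text \<open>For measurability of the supremum over the uncountable sphere: common Lipschitz
  coefficients survive a supremum, and a bound at the origin makes it finite everywhere.\<close>

lemma coord_lip_Sup:
  assumes I: "finite I" and U: "U \<noteq> {}" and g: "\<And>u. u \<in> U \<Longrightarrow> coord_lip I c (g u)" 
    and b: "\<And>u. u \<in> U \<Longrightarrow> g u (\<lambda>_. 0) \<le> C"
  shows "coord_lip I c (\<lambda>x. SUP u\<in>U. g u x)"
  unfolding coord_lip_def
proof (intro allI)
  fix x y
  have lip: "g u x \<le> g u y + (\<Sum>i\<in>I. c i * \<bar>x i - y i\<bar>)" if "u \<in> U" for u x y
  proof -
    have "\<bar>g u x - g u y\<bar> \<le> (\<Sum>i\<in>I. c i * \<bar>x i - y i\<bar>)" using g[OF that] by (simp add: coord_lip_def)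
    then show ?thesis by linarith
  qed
  have bdd: "bdd_above ((\<lambda>u. g u x) ` U)" for x
  proof (rule bdd_aboveI2)
    fix u assume "u \<in> U"
    then show "g u x \<le> C + (\<Sum>i\<in>I. c i * \<bar>x i - 0\<bar>)" using lip[of u x "\<lambda>_. 0"] b[of u] by simp
  qed
  have le: "(SUP u\<in>U. g u x) \<le> (SUP u\<in>U. g u y) + (\<Sum>i\<in>I. c i * \<bar>x i - y i\<bar>)" for x y
  proof (rule cSUP_least[OF U])
    fix u assume u: "u \<in> U"
    show "g u x \<le> (SUP u\<in>U. g u y) + (\<Sum>i\<in>I. c i * \<bar>x i - y i\<bar>)"
      using lip[OF u, of x y] cSUP_upper[OF u bdd, of y] by linarith
  qed
  have "(\<Sum>i\<in>I. c i * \<bar>y i - x i\<bar>) = (\<Sum>i\<in>I. c i * \<bar>x i - y i\<bar>)" by (simp add: abs_minus_commute)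
  then show "\<bar>(SUP u\<in>U. g u x) - (SUP u\<in>U. g u y)\<bar> \<le> (\<Sum>i\<in>I. c i * \<bar>x i - y i\<bar>)"
    using le[of x y] le[of y x] by (simp add: abs_le_iff)
qed

lemma sign_norm_coord_lip:
  assumes N: "is_norm n N" and b: "\<And>i j. i < m \<Longrightarrow> j < n \<Longrightarrow> \<bar>b (i, j)\<bar> \<le> B i"
  shows "coord_lip ({..<m} \<times> {..<n}) (\<lambda>k. norm_fun n N (unit_vec (snd k)) * B (fst k)) (sign_norm m n N b)"
  unfolding coord_lip_def
proof (intro allI)
  fix x y :: "nat \<times> nat \<Rightarrow> real"
  let ?c = "\<lambda>j. norm_fun n N (unit_vec j)"
  have "\<bar>sign_norm m n N b x - sign_norm m n N b y\<bar> 
    \<le> norm_fun n N (\<lambda>j. (\<Sum>i<m. x (i, j) * b (i, j)) - (\<Sum>i<m. y (i, j) * b (i, j)))"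
    unfolding sign_norm_def by (rule norm_fun_diff_le[OF N])
  also have "\<dots> \<le> (\<Sum>j<n. ?c j * \<bar>(\<Sum>i<m. x (i, j) * b (i, j)) - (\<Sum>i<m. y (i, j) * b (i, j))\<bar>)"
    by (rule norm_fun_le_coords[OF N])
  also have "\<dots> \<le> (\<Sum>j<n. ?c j * (\<Sum>i<m. B i * \<bar>x (i, j) - y (i, j)\<bar>))"
  proof (intro sum_mono mult_left_mono norm_fun_nonneg[OF N])
    fix j assume j: "j \<in> {..<n}"
    have "\<bar>(\<Sum>i<m. x (i, j) * b (i, j)) - (\<Sum>i<m. y (i, j) * b (i, j))\<bar> = \<bar>\<Sum>i<m. b (i, j) * (x (i, j) - y (i, j))\<bar>"
      by (simp add: sum_subtractf[symmetric] algebra_simps)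
    also have "\<dots> \<le> (\<Sum>i<m. \<bar>b (i, j) * (x (i, j) - y (i, j))\<bar>)" by (rule sum_abs)
    also have "\<dots> \<le> (\<Sum>i<m. B i * \<bar>x (i, j) - y (i, j)\<bar>)"
      using b j by (intro sum_mono) (auto simp: abs_mult intro!: mult_right_mono)
    finally show "\<bar>(\<Sum>i<m. x (i, j) * b (i, j)) - (\<Sum>i<m. y (i, j) * b (i, j))\<bar> \<le> (\<Sum>i<m. B i * \<bar>x (i, j) - y (i, j)\<bar>)" .
  qed
  also have "\<dots> = (\<Sum>j<n. \<Sum>i<m. ?c j * B i * \<bar>x (i, j) - y (i, j)\<bar>)"
    by (simp add: sum_distrib_left mult.assoc)
  also have "\<dots> = (\<Sum>i<m. \<Sum>j<n. ?c j * B i * \<bar>x (i, j) - y (i, j)\<bar>)" by (rule sum.swap)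
  also have "\<dots> = (\<Sum>k\<in>{..<m} \<times> {..<n}. ?c (snd k) * B (fst k) * \<bar>x k - y k\<bar>)"
    by (simp add: sum.cartesian_product')
  finally show "\<bar>sign_norm m n N b x - sign_norm m n N b y\<bar> \<le> (\<Sum>k\<in>{..<m} \<times> {..<n}. ?c (snd k) * B (fst k) * \<bar>x k - y k\<bar>)" .
qed

lemma coord_lip_iid_measurable:
  assumes rv: "random_vector n \<nu>" and f: "coord_lip ({..<m} \<times> {..<n}) c f"
  shows "(\<lambda>z. f (\<lambda>(i, j). z i j)) \<in> borel_measurable (iid_copies m \<nu>)"
proof -
  let ?I = "{..<m} \<times> {..<n}"
  have sets: "sets \<nu> = sets (Rn_borel n)" using rv by (simp add: random_vector_def)
  have zm: "(\<lambda>z. z i j) \<in> borel_measurable (iid_copies m \<nu>)" if "i < m" "j < n" for i j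
  proof -
    have "(\<lambda>z. z j) \<in> borel_measurable \<nu>" using that(2) by (simp add: measurable_cong_sets[OF sets refl])
    moreover have "(\<lambda>z. z i) \<in> measurable (iid_copies m \<nu>) \<nu>" unfolding iid_copies_def 
      using that(1) by (intro measurable_component_singleton) auto
    ultimately show ?thesis by (rule measurable_compose[rotated])
  qed
  have "(\<lambda>z. \<lambda>k\<in>?I. z (fst k) (snd k)) \<in> measurable (iid_copies m \<nu>) (Pi\<^sub>M ?I (\<lambda>_. borel))"
    using zm by (intro measurable_restrict) auto
  moreover have "f \<in> borel_measurable (Pi\<^sub>M ?I (\<lambda>_. borel))" by (rule coord_lip_measurable[OF _ f]) simp
  ultimately have "(\<lambda>z. f (\<lambda>k\<in>?I. z (fst k) (snd k))) \<in> borel_measurable (iid_copies m \<nu>)" by (rule measurable_compose)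
  moreover have "f (\<lambda>k\<in>?I. z (fst k) (snd k)) = f (\<lambda>(i, j). z i j)" for z :: "nat \<Rightarrow> nat \<Rightarrow> real"
  proof -
    have "\<bar>f (\<lambda>k\<in>?I. z (fst k) (snd k)) - f (\<lambda>(i, j). z i j)\<bar> 
        \<le> (\<Sum>k\<in>?I. c k * \<bar>(\<lambda>k\<in>?I. z (fst k) (snd k)) k - (\<lambda>(i, j). z i j) k\<bar>)"
      using f unfolding coord_lip_def by blast
    also have "\<dots> = 0" by (intro sum.neutral) auto
    finally show ?thesis by simp
  qed
  ultimately show ?thesis by simp
qed

text \<open>Here the entries of \<open>z\<close> stand in the place of the signs and the
  coefficients of the direction in the place of the array.\<close>

lemma N_D_Gamma:
  "N (D_op m n z (Gamma_op d m x u)) = sign_norm m n N (\<lambda>(i, j). 1 / sqrt (real m) * vinner d (x i) u) (\<lambda>(i, j). z i j)"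
proof -
  have "D_op m n z (Gamma_op d m x u) = (\<lambda>j\<in>{..<n}. \<Sum>i<m. z i j * (1 / sqrt (real m) * vinner d (x i) u))"
    unfolding D_op_def Gamma_op_def by (intro restrict_ext sum.cong) auto
  then show ?thesis by (simp add: sign_norm_def norm_fun_def)
qed

lemma vinner_add: "vinner d x (\<lambda>i. u i + v i) = vinner d x u + vinner d x v"
  by (simp add: vinner_def sum.distrib algebra_simps)

lemma vinner_scale: "vinner d x (\<lambda>i. c * u i) = c * vinner d x u"
  by (simp add: vinner_def sum_distrib_left mult_ac)

text \<open>The bound on \<open>d\<close> is what the net needs: its cardinality is at most
  \<open>exp (\<epsilon>^2 * D / 128)\<close>, a quarter of the exponent
  \<open>\<epsilon>^2 * D / 32\<close> of a single direction.\<close>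

lemma embedding_for_realization:
  fixes y \<epsilon> \<alpha> D \<kappa>\<^sub>3 B L K :: real and d m n :: nat and x :: "nat \<Rightarrow> nat \<Rightarrow> real"
  defines "C \<equiv> (\<kappa>\<^sub>3 * (8 * \<alpha> + 3))\<^sup>2 + 1"
  assumes L: "1 \<le> L" and K: "2 \<le> K" and y: "2 \<le> y" "D = y ^ 8" and eps: "0 < \<epsilon>" "\<epsilon> \<le> 1/9" 
    and d: "1 \<le> d" "real d * ln (1 / \<epsilon>) \<le> \<epsilon>\<^sup>2 * D / 256"
    and \<alpha>: "4 \<le> \<alpha>" and m: "D powr \<alpha> \<le> real m" "real m \<le> D powr \<alpha> + 1" and n: "0 < n" "ln (real n) \<le> (K - 2) * D"
    and \<kappa>: "0 < \<kappa>\<^sub>3" and B: "0 \<le> B" 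
    and big: "432 * L^4 * K\<^sup>2 * C\<^sup>2 + 144 * L\<^sup>2 * K * C + (8 * \<alpha> + 1) + B \<le> y" "43 * L^4 * C * (K + 2) \<le> \<epsilon>\<^sup>2 * D"
    and H: "H_bound \<kappa>\<^sub>3 \<alpha> d m x" and r: "rho_bound B \<alpha> d m x"
    and N: "is_norm n N" and Kb: "convex_body n (unit_ball_of n N)" and R: "0 < dual_radius n N"
    and E: "gaussian_mean n N = dual_radius n N * sqrt D"
    and rv: "random_vector n \<nu>" and iso: "isotropic n \<nu>" and sym: "symmetric_vector n \<nu>" 
    and sub: "subgaussian n L \<nu>" and iid: "iid_coordinates n \<nu>"
  shows "1 - 2 * exp (- (1 / 128) * \<epsilon>\<^sup>2 * D) \<le> measure (iid_copies m \<nu>)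
     {z \<in> space (iid_copies m \<nu>).
        (SUP u\<in>unit_sphere d. \<bar>N (D_op m n z (Gamma_op d m x u)) / gaussian_mean n N - 1\<bar>) \<le> 14 * \<epsilon>}"
proof -
  let ?M = "iid_copies m \<nu>" and ?E = "gaussian_mean n N"
  let ?a = "\<lambda>u i. 1 / sqrt (real m) * vinner d (x i) u"
  let ?A = "\<lambda>z u. norm_fun n N (\<lambda>j. \<Sum>i<m. ?a u i * z i j)"
  have pM: "prob_space \<nu>" using rv by (simp add: random_vector_def)
  interpret P: prob_space ?M unfolding iid_copies_def by (intro prob_space_PiM pM)
  have D0: "1 \<le> D" using y by (simp add: one_le_power)
  have E0: "0 < ?E" using E R D0 by simp
  have ln9: "1 \<le> ln (1 / \<epsilon>)"
  proof -
    have "3 \<le> 1 / \<epsilon>" using eps by (simp add: le_divide_eq)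
    then have "exp 1 \<le> 1 / \<epsilon>" using exp_le by linarith
    then show ?thesis using eps by (simp add: ln_ge_iff)
  qed
  have "real d * 1 \<le> real d * ln (1 / \<epsilon>)" using ln9 by (intro mult_left_mono) auto
  then have dd: "real d \<le> \<epsilon>\<^sup>2 * D / 256" using d(2) by linarith
  then have dD: "real d \<le> \<epsilon>\<^sup>2 * D" and eD: "256 \<le> \<epsilon>\<^sup>2 * D" using d(1) D0 by auto
  have alt: "?A z u = sign_norm m n N (\<lambda>(i, j). ?a u i) (\<lambda>(i, j). z i j)" for z u
    by (simp add: sign_norm_def mult.commute)
  have NA: "N (D_op m n z (Gamma_op d m x u)) = ?A z u" for z u unfolding alt by (rule N_D_Gamma)
  define Bd where "Bd i = 1 / sqrt (real m) * (\<Sum>k<d. \<bar>x i k\<bar>)" for i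
  have a_le: "\<bar>?a u i\<bar> \<le> Bd i" if "u \<in> unit_sphere d" for u i
    unfolding Bd_def abs_mult using vinner_sphere_le[OF that, of "x i"] by (simp add: divide_right_mono)
  have lipA: "coord_lip ({..<m} \<times> {..<n}) (\<lambda>k. norm_fun n N (unit_vec (snd k)) * Bd (fst k)) (sign_norm m n N (\<lambda>(i, j). ?a u i))"
    if "u \<in> unit_sphere d" for u
    using a_le[OF that] by (intro sign_norm_coord_lip[OF N]) auto
  have measA: "(\<lambda>z. ?A z u) \<in> borel_measurable ?M" if "u \<in> unit_sphere d" for u
    unfolding alt by (rule coord_lip_iid_measurable[OF rv lipA[OF that]])
  have ne: "unit_sphere d \<noteq> {}" using unit_sphere_nonempty[OF d(1)] by blast
  define cc where "cc k = norm_fun n N (unit_vec (snd k)) * Bd (fst k) / ?E" for k :: "nat \<times> nat"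
  have "coord_lip ({..<m} \<times> {..<n}) cc (\<lambda>z. SUP u\<in>unit_sphere d. \<bar>sign_norm m n N (\<lambda>(i, j). ?a u i) z / ?E - 1\<bar>)"
  proof (rule coord_lip_Sup[OF _ ne])
    fix u assume u: "u \<in> unit_sphere d"
    show "coord_lip ({..<m} \<times> {..<n}) cc (\<lambda>z. \<bar>sign_norm m n N (\<lambda>(i, j). ?a u i) z / ?E - 1\<bar>)"
      unfolding coord_lip_def
    proof (intro allI)
      fix z w :: "nat \<times> nat \<Rightarrow> real"
      let ?f = "sign_norm m n N (\<lambda>(i, j). ?a u i)"
      let ?S = "\<Sum>k\<in>{..<m} \<times> {..<n}. norm_fun n N (unit_vec (snd k)) * Bd (fst k) * \<bar>z k - w k\<bar>"
      have "\<bar>\<bar>?f z / ?E - 1\<bar> - \<bar>?f w / ?E - 1\<bar>\<bar> \<le> \<bar>(?f z / ?E - 1) - (?f w / ?E - 1)\<bar>" by (rule abs_triangle_ineq3)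
      also have "(?f z / ?E - 1) - (?f w / ?E - 1) = (?f z - ?f w) / ?E" by (simp add: diff_divide_distrib)
      also have "\<bar>(?f z - ?f w) / ?E\<bar> = \<bar>?f z - ?f w\<bar> / ?E" using E0 by (simp add: abs_divide)
      also have "\<dots> \<le> ?S / ?E"
        using lipA[OF u] E0 unfolding coord_lip_def by (intro divide_right_mono) auto
      also have "\<dots> = (\<Sum>k\<in>{..<m} \<times> {..<n}. cc k * \<bar>z k - w k\<bar>)"
        unfolding sum_divide_distrib cc_def by (intro sum.cong) auto
      finally show "\<bar>\<bar>?f z / ?E - 1\<bar> - \<bar>?f w / ?E - 1\<bar>\<bar> \<le> (\<Sum>k\<in>{..<m} \<times> {..<n}. cc k * \<bar>z k - w k\<bar>)" .
    qed
    show "\<bar>sign_norm m n N (\<lambda>(i, j). ?a u i) (\<lambda>_. 0) / ?E - 1\<bar> \<le> 1"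
      by (simp add: sign_norm_def norm_fun_zero[OF N])
  qed simp
  from coord_lip_iid_measurable[OF rv this]
  have measS: "(\<lambda>z. SUP u\<in>unit_sphere d. \<bar>?A z u / ?E - 1\<bar>) \<in> borel_measurable ?M" unfolding alt .
  obtain S where S: "finite S" "real (card S) \<le> exp (2 * real d * ln (1 / \<epsilon>))" "S \<subseteq> unit_sphere d"
    "\<And>u. u \<in> unit_sphere d \<Longrightarrow> \<exists>v\<in>S. L2_set (\<lambda>i. u i - v i) {..<d} \<le> 2 * \<epsilon>"
    using sphere_net[OF eps d(1)] by blast
  let ?Bad = "\<lambda>v. {z \<in> space ?M. \<bar>?A z v - ?E\<bar> > 8 * \<epsilon> * ?E}"
  let ?T = "{z \<in> space ?M. (SUP u\<in>unit_sphere d. \<bar>?A z u / ?E - 1\<bar>) \<le> 14 * \<epsilon>}"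
  have Ts: "?T \<in> sets ?M" using measS by measurable
  have Bs: "?Bad v \<in> sets ?M" if "v \<in> S" for v 
  proof -
    have [measurable]: "(\<lambda>z. ?A z v) \<in> borel_measurable ?M" using measA that S(3) by blast
    show ?thesis by measurable
  qed
  have bad: "measure ?M (?Bad v) \<le> 6 * exp (- \<epsilon>\<^sup>2 * D / 32)" if v: "v \<in> S" for v
  proof -
    have vs: "v \<in> unit_sphere d" using v S(3) by blast
    obtain A h \<theta> \<beta> I where sc: "small_coefficients L K D \<epsilon> A h \<theta> \<beta> m n (?a v) I"
      using event_small_coefficients[OF L K y eps d(1) dD \<alpha> m n \<kappa> B big(1)[unfolded C_def] big(2)[unfolded C_def] H r vs] by blast
    have "measure ?M (?Bad v) \<le> 4 * exp (- D) + 2 * exp (- \<epsilon>\<^sup>2 * D / 32)"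
      by (rule small_coefficients.norm_tail[OF sc N Kb E R rv iso sym sub iid measA[OF vs]])
    moreover have "exp (- D) \<le> exp (- \<epsilon>\<^sup>2 * D / 32)"
    proof -
      have "\<epsilon>\<^sup>2 * D \<le> 1 * D" using eps D0 by (intro mult_right_mono power_le_one) auto
      then show ?thesis using D0 by simp
    qed
    ultimately show ?thesis by linarith
  qed
  have sub: "space ?M - (\<Union>v\<in>S. ?Bad v) \<subseteq> ?T"
  proof
    fix z assume z: "z \<in> space ?M - (\<Union>v\<in>S. ?Bad v)"
    have "\<bar>?A z u / ?E - 1\<bar> \<le> 14 * \<epsilon>" if u: "u \<in> unit_sphere d" for u
    proof -
      have "\<bar>?A z u / ?E - 1\<bar> \<le> 8 * \<epsilon> + 3 * \<epsilon> * (1 + 8 * \<epsilon>)"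
      proof (rule seminorm_net_bound[where A = "?A z" and S = S and d = d])
        show "?A z (\<lambda>i. u i + v i) \<le> ?A z u + ?A z v" for u v
        proof -
          have "?A z (\<lambda>i. u i + v i) = norm_fun n N (\<lambda>j. (\<Sum>i<m. ?a u i * z i j) + (\<Sum>i<m. ?a v i * z i j))"
            by (simp add: vinner_add distrib_left distrib_right sum.distrib add_divide_distrib)
          also have "\<dots> \<le> ?A z u + ?A z v" by (rule norm_fun_add[OF N])
          finally show ?thesis .
        qed
        show "?A z (\<lambda>i. c * u i) = \<bar>c\<bar> * ?A z u" for c u
        proof -
          have "?A z (\<lambda>i. c * u i) = norm_fun n N (\<lambda>j. c * (\<Sum>i<m. ?a u i * z i j))"
            unfolding vinner_scale by (simp add: sum_distrib_left mult_ac)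
          also have "\<dots> = \<bar>c\<bar> * ?A z u" by (rule norm_fun_scale[OF N])
          finally show ?thesis .
        qed
        show "?A z u = ?A z v" if "\<And>i. i < d \<Longrightarrow> u i = v i" for u v
          using that by (simp add: vinner_def)
        show "?A z u \<le> (\<Sum>j<n. norm_fun n N (unit_vec j) * (\<Sum>i<m. Bd i * \<bar>z i j\<bar>))" if u: "u \<in> unit_sphere d" for u
        proof -
          have "?A z u \<le> (\<Sum>j<n. norm_fun n N (unit_vec j) * \<bar>\<Sum>i<m. ?a u i * z i j\<bar>)" by (rule norm_fun_le_coords[OF N])
          also have "\<dots> \<le> (\<Sum>j<n. norm_fun n N (unit_vec j) * (\<Sum>i<m. Bd i * \<bar>z i j\<bar>))"
          proof (intro sum_mono mult_left_mono norm_fun_nonneg[OF N])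
            fix j
            have "\<bar>\<Sum>i<m. ?a u i * z i j\<bar> \<le> (\<Sum>i<m. \<bar>?a u i * z i j\<bar>)" by (rule sum_abs)
            also have "\<dots> \<le> (\<Sum>i<m. Bd i * \<bar>z i j\<bar>)"
              unfolding abs_mult[of "?a u _"] using a_le[OF u] by (intro sum_mono mult_right_mono) auto
            finally show "\<bar>\<Sum>i<m. ?a u i * z i j\<bar> \<le> (\<Sum>i<m. Bd i * \<bar>z i j\<bar>)" .
          qed
          finally show ?thesis .
        qed
        show "\<bar>?A z v - ?E\<bar> \<le> 8 * \<epsilon> * ?E" if "v \<in> S" for v using z that by (force simp: not_less)
      qed (use S(3,4) eps E0 u in auto)
      \<comment> \<open>As \<open>\<epsilon> \<le> 1/9\<close>, the quadratic term
        \<open>24 * \<epsilon>^2\<close> is below \<open>3 * \<epsilon>\<close>.\<close>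
      also have "\<dots> \<le> 14 * \<epsilon>"
      proof -
        have "\<epsilon> * \<epsilon> \<le> \<epsilon> * (1/9)" using eps by (intro mult_left_mono) auto
        then show ?thesis using eps by (simp add: algebra_simps)
      qed
      finally show ?thesis .
    qed
    then have "(SUP u\<in>unit_sphere d. \<bar>?A z u / ?E - 1\<bar>) \<le> 14 * \<epsilon>" by (rule cSUP_least[OF ne])
    then show "z \<in> ?T" using z by simp
  qed
  have UB: "(\<Union>v\<in>S. ?Bad v) \<in> sets ?M" by (rule sets.finite_UN[OF S(1) Bs])
  have "measure ?M (\<Union>v\<in>S. ?Bad v) \<le> (\<Sum>v\<in>S. measure ?M (?Bad v))" by (rule measure_UNION_le[OF S(1) Bs])
  also have "\<dots> \<le> (\<Sum>v\<in>S. 6 * exp (- \<epsilon>\<^sup>2 * D / 32))" by (rule sum_mono[OF bad])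
  also have "\<dots> = real (card S) * (6 * exp (- \<epsilon>\<^sup>2 * D / 32))" by simp
  also have "\<dots> \<le> exp (\<epsilon>\<^sup>2 * D / 128) * (6 * exp (- \<epsilon>\<^sup>2 * D / 32))"
  proof (rule mult_right_mono)
    have "exp (2 * real d * ln (1 / \<epsilon>)) \<le> exp (\<epsilon>\<^sup>2 * D / 128)" using d(2) by simp
    then show "real (card S) \<le> exp (\<epsilon>\<^sup>2 * D / 128)" using S(2) by linarith
  qed simp
  also have "\<dots> = 6 * exp (- (3 / 128) * (\<epsilon>\<^sup>2 * D))" by (simp flip: exp_add)
  also have "\<dots> \<le> 2 * exp (- (1 / 128) * \<epsilon>\<^sup>2 * D)"
  proof -
    \<comment> \<open>The surplus exponent \<open>\<epsilon>^2 * D / 64\<close>, at least 4, turns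
      the prefactor 6 into 2.\<close>
    have "3 \<le> exp (\<epsilon>\<^sup>2 * D / 64)" using exp_ge_add_one_self[of "\<epsilon>\<^sup>2 * D / 64"] eD by linarith
    then have "3 * exp (- (3 / 128) * (\<epsilon>\<^sup>2 * D)) \<le> exp (\<epsilon>\<^sup>2 * D / 64) * exp (- (3 / 128) * (\<epsilon>\<^sup>2 * D))"
      by (intro mult_right_mono) auto
    also have "\<dots> = exp (- (1 / 128) * \<epsilon>\<^sup>2 * D)" by (simp flip: exp_add)
    finally show ?thesis by simp
  qed
  finally have mb: "measure ?M (\<Union>v\<in>S. ?Bad v) \<le> 2 * exp (- (1 / 128) * \<epsilon>\<^sup>2 * D)" .
  have "1 - measure ?M (\<Union>v\<in>S. ?Bad v) = measure ?M (space ?M - (\<Union>v\<in>S. ?Bad v))"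
    by (rule P.prob_compl[OF UB, symmetric])
  also have "\<dots> \<le> measure ?M ?T" by (rule P.finite_measure_mono[OF sub Ts])
  finally show ?thesis using mb unfolding NA by linarith
qed

theorem theorem1p5:
  fixes L B \<alpha> C\<^sub>0 \<kappa>\<^sub>1 \<kappa>\<^sub>2 \<kappa>\<^sub>3 :: real
  assumes "L \<ge> 1" and "B \<ge> 1" and "\<alpha> \<ge> 4" and "C\<^sub>0 > 0"
    and "admissible_kappas L B \<alpha> \<kappa>\<^sub>1 \<kappa>\<^sub>2 \<kappa>\<^sub>3"
  shows "\<exists>c\<^sub>1 c\<^sub>2 c\<^sub>3 c\<^sub>4 c\<^sub>5 c\<^sub>6 c\<^sub>7 c\<^sub>8 :: real.
    0 < c\<^sub>1 \<and> c\<^sub>1 \<le> 1 / 2 \<and> 0 < c\<^sub>2 \<and> 0 < c\<^sub>3 \<and> 0 < c\<^sub>4 \<and> 0 < c\<^sub>5 \<and> 0 < c\<^sub>6 \<and> 0 < c\<^sub>7 \<and> 0 < c\<^sub>8 \<and>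
    (\<forall>(n::nat) (K :: (nat \<Rightarrow> real) set) (N :: (nat \<Rightarrow> real) \<Rightarrow> real) (\<epsilon>::real) (m::nat) (d::nat)
       (\<eta>::real) (\<mu> :: (nat \<Rightarrow> real) measure) (\<nu> :: (nat \<Rightarrow> real) measure).
      convex_body n K \<longrightarrow> is_norm n N \<longrightarrow> K = unit_ball_of n N \<longrightarrow>
      critical_dim n K N \<ge> C\<^sub>0 * ln (real n) \<longrightarrow>
      0 < \<epsilon> \<longrightarrow> \<epsilon> \<le> c\<^sub>1 \<longrightarrow> real n \<ge> c\<^sub>2 \<longrightarrow>
      m = nat \<lceil>c\<^sub>3 * critical_dim n K N powr \<alpha>\<rceil> \<longrightarrow>
      1 \<le> d \<longrightarrow> real d \<le> c\<^sub>4 * (\<epsilon>\<^sup>2 / ln (1 / \<epsilon>)) * critical_dim n K N \<longrightarrow>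
      random_vector d \<mu> \<longrightarrow> isotropic d \<mu> \<longrightarrow> rotation_invariant d \<mu> \<longrightarrow> L4_L2_equiv d L \<mu> \<longrightarrow>
      0 \<le> \<eta> \<longrightarrow> \<eta> \<le> 1 \<longrightarrow> rho_bound_whp B \<alpha> \<eta> d m \<mu> \<longrightarrow>
      random_vector n \<nu> \<longrightarrow> isotropic n \<nu> \<longrightarrow> symmetric_vector n \<nu> \<longrightarrow> subgaussian n L \<nu> \<longrightarrow>
      iid_coordinates n \<nu> \<longrightarrow>
      (\<exists>\<Lambda> \<in> {c\<^sub>5 * gaussian_mean n N .. c\<^sub>6 * gaussian_mean n N}.
         \<forall>x \<in> Omega_event B \<alpha> \<kappa>\<^sub>2 \<kappa>\<^sub>3 d m \<mu>.
           measure (iid_copies m \<nu>)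
             {z \<in> space (iid_copies m \<nu>).
                (SUP u\<in>unit_sphere d. \<bar>N (D_op m n z (Gamma_op d m x u)) / \<Lambda> - 1\<bar>) \<le> c\<^sub>8 * \<epsilon>}
           \<ge> 1 - 2 * exp (- c\<^sub>7 * \<epsilon>\<^sup>2 * critical_dim n K N)))"
proof -
  \<comment> \<open>Makes \<open>(K\<^sub>0 - 2) * D = D / C\<^sub>0\<close>, which dominates
    \<open>ln n\<close> by the assumption on the critical dimension.\<close>
  define K\<^sub>0 where "K\<^sub>0 = 2 + 1 / C\<^sub>0"
  define C where "C = (\<kappa>\<^sub>3 * (8 * \<alpha> + 3))\<^sup>2 + 1"
  \<comment> \<open>The sum of all lower bounds that are imposed on \<open>y\<close> or on
    \<open>\<epsilon>^2 * D\<close>.\<close>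
  define y\<^sub>0 where "y\<^sub>0 = 432 * L^4 * K\<^sub>0\<^sup>2 * C\<^sup>2 + 144 * L\<^sup>2 * K\<^sub>0 * C + (8 * \<alpha> + 1) + B + 43 * L^4 * C * (K\<^sub>0 + 2)"
  \<comment> \<open>The inverse of the constant in the bound on \<open>d\<close>: the eighth power
    carries the requirement on \<open>y\<close> over to \<open>D\<close>, and 256 serves the entropy
    of the net.\<close>
  define q where "q = y\<^sub>0 ^ 8 + 256"
  have \<kappa>: "0 < \<kappa>\<^sub>3" using assms(5) by (simp add: admissible_kappas_def)
  have K0: "2 \<le> K\<^sub>0" using assms(4) by (simp add: K\<^sub>0_def)
  have C: "1 \<le> C" by (simp add: C_def)
  have parts: "0 \<le> 432 * L^4 * K\<^sub>0\<^sup>2 * C\<^sup>2" "0 \<le> 144 * L\<^sup>2 * K\<^sub>0 * C" "0 \<le> 43 * L^4 * C * (K\<^sub>0 + 2)"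
    using assms(1) K0 C by (auto intro!: mult_nonneg_nonneg)
  have y0: "33 \<le> y\<^sub>0" unfolding y\<^sub>0_def using parts assms(2,3) by linarith
  have q: "256 \<le> q" "y\<^sub>0 ^ 8 \<le> q" using y0 by (simp_all add: q_def)
  have y08: "y\<^sub>0 \<le> y\<^sub>0 ^ 8" using power_increasing[of 1 8 y\<^sub>0] y0 by simp
  show ?thesis
  \<comment> \<open>The two constants around \<Lambda> are both 1, as \<Lambda> is the Gaussian mean
    itself; 1/9 comes from the net, and 1/128 and 14 from the estimate for one realization.\<close>
  proof (rule exI[of _ "1/9"], rule exI[of _ 1], rule exI[of _ 1], rule exI[of _ "1 / q"], rule exI[of _ 1], rule exI[of _ 1],
      rule exI[of _ "1 / 128"], rule exI[of _ 14], intro conjI allI impI)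
    fix n :: nat and K :: "(nat \<Rightarrow> real) set" and N :: "(nat \<Rightarrow> real) \<Rightarrow> real" and \<epsilon> :: real and m d :: nat 
      and \<eta> :: real and \<mu> \<nu> :: "(nat \<Rightarrow> real) measure"
    assume Kb: "convex_body n K" and N: "is_norm n N" and KN: "K = unit_ball_of n N"
      and cd: "C\<^sub>0 * ln (real n) \<le> critical_dim n K N" and eps: "0 < \<epsilon>" "\<epsilon> \<le> 1/9" and n: "1 \<le> real n"
      and m: "m = nat \<lceil>1 * critical_dim n K N powr \<alpha>\<rceil>" 
      and d: "1 \<le> d" "real d \<le> 1 / q * (\<epsilon>\<^sup>2 / ln (1 / \<epsilon>)) * critical_dim n K N"
      and rv: "random_vector n \<nu>" and iso: "isotropic n \<nu>" and sym: "symmetric_vector n \<nu>" 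
      and sub: "subgaussian n L \<nu>" and iid: "iid_coordinates n \<nu>"
    define D where "D = critical_dim n K N"
    define y where "y = root 8 D"
    have ln9: "1 \<le> ln (1 / \<epsilon>)"
    proof -
      have "3 \<le> 1 / \<epsilon>" using eps by (simp add: le_divide_eq)
      then have "exp 1 \<le> 1 / \<epsilon>" using exp_le by linarith
      then show ?thesis using eps by (simp add: ln_ge_iff)
    qed
    have dl: "real d * ln (1 / \<epsilon>) \<le> \<epsilon>\<^sup>2 * D / q" 
    proof -
      have "real d * ln (1 / \<epsilon>) \<le> 1 / q * (\<epsilon>\<^sup>2 / ln (1 / \<epsilon>)) * D * ln (1 / \<epsilon>)"
        using d(2) ln9 unfolding D_def by (intro mult_right_mono) auto
      also have "\<dots> = \<epsilon>\<^sup>2 * D / q" using ln9 by simp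
      finally show ?thesis .
    qed
    moreover have "1 * 1 \<le> real d * ln (1 / \<epsilon>)" using d(1) ln9 by (intro mult_mono) auto
    \<comment> \<open>Since \<open>d \<ge> 1\<close> and \<open>ln (1 / \<epsilon>) \<ge> 1\<close>,
      the upper bound on \<open>d\<close> can hold only if \<open>\<epsilon>^2 * D \<ge> q\<close>.
      All largeness of \<open>D\<close> and \<open>y\<close> is drawn from this.\<close>
    ultimately have "1 \<le> \<epsilon>\<^sup>2 * D / q" by linarith
    then have qe: "q \<le> \<epsilon>\<^sup>2 * D" using q by (simp add: le_divide_eq)
    have D0: "0 < D"
    proof (rule ccontr)
      assume "\<not> 0 < D"
      then have "\<epsilon>\<^sup>2 * D \<le> 0" by (intro mult_nonneg_nonpos) auto
      then show False using qe q by linarith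
    qed
    have "\<epsilon>\<^sup>2 * D \<le> 1 * D" using eps D0 by (intro mult_right_mono power_le_one) auto
    then have qD: "q \<le> D" using qe by linarith
    have y: "D = y ^ 8" using D0 by (simp add: y_def)
    have "root 8 (y\<^sub>0 ^ 8) \<le> y" unfolding y_def using q qD by (intro real_root_le_mono) auto
    then have yy: "y\<^sub>0 \<le> y" using y0 by (simp add: real_root_power_cancel)
    have mm: "D powr \<alpha> \<le> real m" "real m \<le> D powr \<alpha> + 1"
      unfolding m D_def[symmetric] using powr_ge_zero[of D \<alpha>] by linarith+
    have big: "432 * L^4 * K\<^sub>0\<^sup>2 * C\<^sup>2 + 144 * L\<^sup>2 * K\<^sub>0 * C + (8 * \<alpha> + 1) + B \<le> y" "43 * L^4 * C * (K\<^sub>0 + 2) \<le> \<epsilon>\<^sup>2 * D"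
    proof -
      show "432 * L^4 * K\<^sub>0\<^sup>2 * C\<^sup>2 + 144 * L\<^sup>2 * K\<^sub>0 * C + (8 * \<alpha> + 1) + B \<le> y"
        using yy parts unfolding y\<^sub>0_def by linarith
      have "43 * L^4 * C * (K\<^sub>0 + 2) \<le> y\<^sub>0" using parts assms(2,3) unfolding y\<^sub>0_def by linarith
      then show "43 * L^4 * C * (K\<^sub>0 + 2) \<le> \<epsilon>\<^sup>2 * D" using y08 q(2) qe by linarith
    qed
    have lnn: "ln (real n) \<le> (K\<^sub>0 - 2) * D"
      using cd assms(4) unfolding D_def[symmetric] by (simp add: K\<^sub>0_def field_simps)
    have d256: "real d * ln (1 / \<epsilon>) \<le> \<epsilon>\<^sup>2 * D / 256"
    proof -
      have "\<epsilon>\<^sup>2 * D / q \<le> \<epsilon>\<^sup>2 * D / 256" using q D0 by (intro divide_left_mono) auto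
      then show ?thesis using dl by linarith
    qed
    note ce = critical_dim_eq[OF N D0[unfolded D_def KN]]
    show "\<exists>\<Lambda> \<in> {1 * gaussian_mean n N .. 1 * gaussian_mean n N}.
         \<forall>x \<in> Omega_event B \<alpha> \<kappa>\<^sub>2 \<kappa>\<^sub>3 d m \<mu>.
           measure (iid_copies m \<nu>)
             {z \<in> space (iid_copies m \<nu>).
                (SUP u\<in>unit_sphere d. \<bar>N (D_op m n z (Gamma_op d m x u)) / \<Lambda> - 1\<bar>) \<le> 14 * \<epsilon>}
           \<ge> 1 - 2 * exp (- (1 / 128) * \<epsilon>\<^sup>2 * critical_dim n K N)"
    proof (intro bexI[of _ "gaussian_mean n N"] ballI)
      fix x assume "x \<in> Omega_event B \<alpha> \<kappa>\<^sub>2 \<kappa>\<^sub>3 d m \<mu>"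
      then have x: "H_bound \<kappa>\<^sub>3 \<alpha> d m x" "rho_bound B \<alpha> d m x" by (simp_all add: Omega_event_def)
      show "1 - 2 * exp (- (1 / 128) * \<epsilon>\<^sup>2 * critical_dim n K N) \<le> measure (iid_copies m \<nu>)
             {z \<in> space (iid_copies m \<nu>).
                (SUP u\<in>unit_sphere d. \<bar>N (D_op m n z (Gamma_op d m x u)) / gaussian_mean n N - 1\<bar>) \<le> 14 * \<epsilon>}"
        unfolding D_def[symmetric]
      proof (rule embedding_for_realization[OF assms(1) K0 _ y eps d(1) d256 assms(3) mm _ lnn \<kappa> _ 
            big[unfolded C_def] x N Kb[unfolded KN] ce(1) _ rv iso sym sub iid])
        show "2 \<le> y" using yy y0 by linarith
        show "0 < n" using n by simp
        show "0 \<le> B" using assms(2) by simp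
        show "gaussian_mean n N = dual_radius n N * sqrt D" using ce(3) by (simp add: D_def KN)
      qed
    qed simp
  qed (use q in auto)
qed

end
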